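(* Let $p,q>0$. For every $\xi>0$, the vector of measures $(\nu_1^\xi,\nu_2^\xi)$ (defined in the context) is the unique minimizer of the energy functional $$\iint \log\frac{1}{|x-y|}\,d\nu_1(x)d\nu_1(y)+\iint \log\frac{1}{|x-y|}\,d\nu_2(x)d\nu_2(y)-\iint \log\frac{1}{|x-y|}\,d\nu_1(x)d\nu_2(y)+\frac1\xi\int V_1(x)\,d\nu_1(x)+\frac1\xi\int V_2(x)\,d\nu_2(x)$$ over all vectors of (positive) measures $(\nu_1,\nu_2)$ such that $\operatorname{supp}(\nu_1)\subset[0,\infty)$, $\int d\nu_1=1$, and $\operatorname{supp}(\nu_2)\subset(-\infty,0]$, $\int d\nu_2=1/2$, where $$V_1(x)=\int_0^\infty \log\left|\frac{z_1(x,s)}{z_2(x,s)}\right|ds,\qquad V_2(x)=\int_0^\infty \log\left|\frac{z_2(x,s)}{z_3(x,s)}\right|ds.$$ Moreover, the measures $\nu_1^\xi$ and $\nu_2^\xi$ are characterized by the following variational conditions: for some constant $\ell$, $$2\int\log|x-y|\,d\nu_1^\xi(y)-\int\log|x-y|\,d\nu_2^\xi(y)-\frac1\xi V_1(x)\ \begin{cases}=\ell, & x\in\operatorname{supp}(\nu_1^\xi),\\ \le \ell, & x\in[0,\infty),\end{cases}$$ and $$2\int\log|x-y|\,d\nu_2^\xi(y)-\int\log|x-y|\,d\nu_1^\xi(y)-\frac1\xi V_2(x)\ \begin{cases}=0, & x\in\operatorname{supp}(\nu_2^\xi),\\ \le 0, & x\in(-\infty,0].\end{cases}$$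
   Context: Fix $p,q>0$. For $s>0$ let $$A_s(z)=z+b(s)+c(s)z^{-1}+d(s)z^{-2}=\frac{(z+s(s+p))(z+s(s+p+q))(z+(s+p)(s+p+q))}{z^2},$$ where $b(s)=3s^2+4sp+2sq+p^2+pq$, $c(s)=s(s+p)(s+p+q)(3s+2p+q)$, $d(s)=s^2(s+p)^2(s+p+q)^2$. For $x\in\mathbb C$ let $z_1(x,s),z_2(x,s),z_3(x,s)$ be the three solutions (with multiplicity) of $A_s(z)=x$, ordered so that $|z_1(x,s)|\ge|z_2(x,s)|\ge|z_3(x,s)|>0$. Put $$\Gamma_1(s)=\{x\in\mathbb C:\ |z_1(x,s)|=|z_2(x,s)|\},\qquad \Gamma_2(s)=\{x\in\mathbb C:\ |z_2(x,s)|=|z_3(x,s)|\}.$$ These sets are real: $\Gamma_1(s)\subset(0,\infty)$ is a compact interval and $\Gamma_2(s)\subset(-\infty,0)$ is a closed half-line unbounded to the left. For $j=1,2$ let $\mu_j^s$ be the measure on $\Gamma_j(s)$ with $$d\mu_j^s(x)=\frac{1}{2\pi i}\left(\frac{z_{j-}'(x,s)}{z_{j-}(x,s)}-\frac{z_{j+}'(x,s)}{z_{j+}(x,s)}\right)dx,$$ where $'$ is the derivative with respect to $x$ and $z_{j\pm}(x,s)$ is the limit of $z_j(\tilde x,s)$ as $\tilde x\to x$ from the upper ($+$) or lower ($-$) half-plane. $\mu_1^s$ is a positive measure of total mass $1$, and $\mu_2^s$ is a positive measure of total mass $1/2$. For $\xi>0$ define $$\nu_j^\xi=\frac1\xi\int_0^\xi\mu_j^s\,ds,\qquad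 j=1,2.$$ *)

theory Defs
  imports "HOL-Analysis.Analysis" "HOL-Computational_Algebra.Fundamental_Theorem_Algebra"
begin

definition A_symbol :: "real \<Rightarrow> real \<Rightarrow> real \<Rightarrow> complex \<Rightarrow> complex" where
  "A_symbol p q s w =
     (w + of_real (s * (s + p))) * (w + of_real (s * (s + p + q)))
       * (w + of_real ((s + p) * (s + p + q))) / w\<^sup>2"

text \<open>
  \<open>z j x s\<close> (\<open>j = 1, 2, 3\<close>) are the solutions of \<open>A_symbol p q s w = x\<close>, listed with multiplicity
  (this is the factorization identity) and by decreasing modulus.  Ties in modulus may be broken
  arbitrarily; everything below uses \<open>z\<close> only through moduli and through its values off the real
  line, where the moduli are distinct.
\<close>
definition ordered_solutions ::
    "real \<Rightarrow> real \<Rightarrow> (nat \<Rightarrow> complex \<Rightarrow> real \<Rightarrow> complex) \<Rightarrow> bool" where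
  "ordered_solutions p q z \<longleftrightarrow> (\<forall>s>0. \<forall>x.
     (\<forall>w. w \<noteq> 0 \<longrightarrow> A_symbol p q s w - x = (w - z 1 x s) * (w - z 2 x s) * (w - z 3 x s) / w\<^sup>2) \<and>
     cmod (z 1 x s) \<ge> cmod (z 2 x s) \<and> cmod (z 2 x s) \<ge> cmod (z 3 x s) \<and> cmod (z 3 x s) > 0)"

lemma ordered_solutions_exists:
  assumes "p > 0" "q > 0"
  shows "\<exists>z. ordered_solutions p q z"
proof -
  have "\<exists>a b c. (\<forall>w. w \<noteq> 0 \<longrightarrow> A_symbol p q s w - x = (w - a) * (w - b) * (w - c) / w\<^sup>2) \<and>
          cmod a \<ge> cmod b \<and> cmod b \<ge> cmod c \<and> cmod c > 0" if "s > 0" for s x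
  proof -
    define u where "u = (of_real (s * (s + p)) :: complex)"
    define v where "v = (of_real (s * (s + p + q)) :: complex)"
    define t where "t = (of_real ((s + p) * (s + p + q)) :: complex)"
    have nz: "u \<noteq> 0" "v \<noteq> 0" "t \<noteq> 0"
      unfolding u_def v_def t_def of_real_eq_0_iff using assms that by auto
    define P where "P = [:u * v * t, u * v + u * t + v * t, u + v + t - x, 1:]"
    have degP: "degree P = 3" and lcP: "lead_coeff P = 1" and P0: "P \<noteq> 0"
      by (auto simp: P_def)
    have polyP: "poly P w = (w + u) * (w + v) * (w + t) - x * w\<^sup>2" for w
      by (simp add: P_def algebra_simps power2_eq_square)
    obtain M where M: "size M = degree P" "P = smult (lead_coeff P) (\<Prod>a\<in>#M. [:-a, 1:])"
      using alg_closed_imp_factorization[OF P0] by blast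
    define L where "L = sort_key cmod (SOME l. mset l = M)"
    have "mset (SOME l. mset l = M) = M" by (rule someI_ex) (rule ex_mset)
    hence L: "mset L = M" "sorted (map cmod L)" by (auto simp: L_def)
    have "length L = 3" using L(1) M(1) degP by (metis size_mset)
    then obtain c b a where abc: "L = [c, b, a]"
      by (metis (no_types, opaque_lifting) length_0_conv length_Suc_conv numeral_3_eq_3)
    have fac: "poly P w = (w - a) * (w - b) * (w - c)" for w
    proof -
      have "P = (\<Prod>a\<in>#M. [:-a, 1:])" using M(2) lcP by simp
      also have "\<dots> = [:-c, 1:] * [:-b, 1:] * [:-a, 1:]"
        unfolding L(1)[symmetric] abc by (simp only: mset.simps image_mset_add_mset image_mset_empty
            prod_mset.add_mset prod_mset.empty mult_1_right mult.assoc)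
      finally have "P = [:-c, 1:] * [:-b, 1:] * [:-a, 1:]" .
      hence "poly P w = poly ([:-c, 1:] * [:-b, 1:] * [:-a, 1:]) w" by simp
      thus ?thesis by (simp only: poly_mult) (simp add: algebra_simps)
    qed
    have "c \<noteq> 0"
    proof
      assume "c = 0"
      thus False using fac[of 0] polyP[of 0] nz by simp
    qed
    moreover have "A_symbol p q s w - x = (w - a) * (w - b) * (w - c) / w\<^sup>2" if "w \<noteq> 0" for w
      using that fac[of w] polyP[of w]
      by (simp add: A_symbol_def u_def v_def t_def field_simps)
    ultimately show ?thesis using L(2) abc by (intro exI[of _ a] exI[of _ b] exI[of _ c]) auto
  qed
  hence "\<forall>s x. \<exists>a b c. s > 0 \<longrightarrow>
          (\<forall>w. w \<noteq> 0 \<longrightarrow> A_symbol p q s w - x = (w - a) * (w - b) * (w - c) / w\<^sup>2) \<and>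
          cmod a \<ge> cmod b \<and> cmod b \<ge> cmod c \<and> cmod c > 0" by blast
  then obtain a b c where abc: "\<forall>s x. s > 0 \<longrightarrow>
          (\<forall>w. w \<noteq> 0 \<longrightarrow> A_symbol p q s w - x
             = (w - a s x) * (w - b s x) * (w - c s x) / w\<^sup>2) \<and>
          cmod (a s x) \<ge> cmod (b s x) \<and> cmod (b s x) \<ge> cmod (c s x) \<and> cmod (c s x) > 0"
    by metis
  show ?thesis unfolding ordered_solutions_def
    by (rule exI[of _ "\<lambda>j x s. if j = 1 then a s x else if j = 2 then b s x else c s x"])
       (use abc in auto)
qed

definition Gamma :: "(nat \<Rightarrow> complex \<Rightarrow> real \<Rightarrow> complex) \<Rightarrow> nat \<Rightarrow> real \<Rightarrow> complex set" where
  "Gamma z j s = {x. cmod (z j x s) = cmod (z (j + 1) x s)}"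

definition z_plus :: "(nat \<Rightarrow> complex \<Rightarrow> real \<Rightarrow> complex) \<Rightarrow> nat \<Rightarrow> real \<Rightarrow> real \<Rightarrow> complex" where
  "z_plus z j x s = Lim (at (of_real x) within {w. Im w > 0}) (\<lambda>w. z j w s)"

definition z_minus :: "(nat \<Rightarrow> complex \<Rightarrow> real \<Rightarrow> complex) \<Rightarrow> nat \<Rightarrow> real \<Rightarrow> real \<Rightarrow> complex" where
  "z_minus z j x s = Lim (at (of_real x) within {w. Im w < 0}) (\<lambda>w. z j w s)"

text \<open>
  For \<open>j = 1, 2\<close> the sets \<open>Gamma z j s\<close> are real, so all measures are Borel measures on the
  real line.  On \<open>Gamma z j s\<close> the expression under \<open>Re\<close> is real and nonnegative (Lebesgue-almost
  everywhere), so \<open>Re\<close> and \<open>ennreal\<close> only convert types.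
\<close>
definition mu :: "(nat \<Rightarrow> complex \<Rightarrow> real \<Rightarrow> complex) \<Rightarrow> nat \<Rightarrow> real \<Rightarrow> real measure" where
  "mu z j s = density lborel (\<lambda>x.
     ennreal (Re (1 / (2 * of_real pi * \<i>) *
       (vector_derivative (\<lambda>t. z_minus z j t s) (at x) / z_minus z j x s
        - vector_derivative (\<lambda>t. z_plus z j t s) (at x) / z_plus z j x s)))
     * indicator {x. complex_of_real x \<in> Gamma z j s} x)"

definition nu :: "(nat \<Rightarrow> complex \<Rightarrow> real \<Rightarrow> complex) \<Rightarrow> real \<Rightarrow> nat \<Rightarrow> real measure" where
  "nu z \<xi> j = measure_of UNIV (sets borel)
     (\<lambda>B. ennreal (1 / \<xi>) * (\<integral>\<^sup>+s\<in>{0<..\<xi>}. emeasure (mu z j s) B \<partial>lborel))"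

text \<open>
  The integrand is nonnegative because of the ordering.  The value \<open>\<infinity>\<close> is needed:
  \<open>potential_V z 1 0 = potential_V z 2 0 = \<infinity>\<close>.
\<close>
definition potential_V :: "(nat \<Rightarrow> complex \<Rightarrow> real \<Rightarrow> complex) \<Rightarrow> nat \<Rightarrow> real \<Rightarrow> ennreal" where
  "potential_V z j x = (\<integral>\<^sup>+s\<in>{0<..}.
     ennreal (ln (cmod (z j (of_real x) s / z (j + 1) (of_real x) s))) \<partial>lborel)"

text \<open>
  Extended-real integral.  In \<open>ereal\<close> one has \<open>\<infinity> - \<infinity> = \<infinity>\<close>; the value is the usual one whenever
  the positive or the negative part has finite integral.
\<close>
definition eintegral :: "'a measure \<Rightarrow> ('a \<Rightarrow> ereal) \<Rightarrow> ereal" where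
  "eintegral M f =
     enn2ereal (\<integral>\<^sup>+x. e2ennreal (f x) \<partial>M) - enn2ereal (\<integral>\<^sup>+x. e2ennreal (- f x) \<partial>M)"

definition log_dist :: "real \<Rightarrow> real \<Rightarrow> ereal" where
  "log_dist x y = (if x = y then -\<infinity> else ereal (ln \<bar>x - y\<bar>))"

definition log_energy :: "real measure \<Rightarrow> real measure \<Rightarrow> ereal" where
  "log_energy M N = eintegral (M \<Otimes>\<^sub>M N) (\<lambda>(x, y). - log_dist x y)"

definition log_potential :: "real measure \<Rightarrow> real \<Rightarrow> ereal" where
  "log_potential M x = eintegral M (\<lambda>y. log_dist x y)"

definition supp :: "real measure \<Rightarrow> real set" where
  "supp M = {x. \<forall>U. open U \<and> x \<in> U \<longrightarrow> emeasure M U > 0}"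

definition admissible :: "real measure \<times> real measure \<Rightarrow> bool" where
  "admissible = (\<lambda>(M, N).
     sets M = sets borel \<and> supp M \<subseteq> {0..} \<and> emeasure M UNIV = 1 \<and>
     sets N = sets borel \<and> supp N \<subseteq> {..0} \<and> emeasure N UNIV = ennreal (1 / 2))"

text \<open>
  The functional is defined on all admissible vectors: the sum has its usual value in
  \<open>[-\<infinity>, \<infinity>]\<close> whenever all five terms are defined and no \<open>\<infinity> - \<infinity>\<close> occurs between them.  In
  \<open>ereal\<close>, \<open>\<infinity>\<close> absorbs \<open>-\<infinity>\<close> in sums, so that a sum containing a term \<open>\<infinity>\<close> is \<open>\<infinity>\<close>.
\<close>
definition energy ::
    "(nat \<Rightarrow> complex \<Rightarrow> real \<Rightarrow> complex) \<Rightarrow> real \<Rightarrow> real measure \<times> real measure \<Rightarrow> ereal" where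
  "energy z \<xi> = (\<lambda>(M, N).
     log_energy M M + log_energy N N - log_energy M N
     + ereal (1 / \<xi>) * enn2ereal (\<integral>\<^sup>+x. potential_V z 1 x \<partial>M)
     + ereal (1 / \<xi>) * enn2ereal (\<integral>\<^sup>+x. potential_V z 2 x \<partial>N))"

definition variational_conditions ::
    "(nat \<Rightarrow> complex \<Rightarrow> real \<Rightarrow> complex) \<Rightarrow> real \<Rightarrow> real \<Rightarrow> real measure \<times> real measure \<Rightarrow> bool" where
  "variational_conditions z \<xi> l = (\<lambda>(M, N).
     (let F1 = (\<lambda>x. 2 * log_potential M x - log_potential N x
                     - ereal (1 / \<xi>) * enn2ereal (potential_V z 1 x));
          F2 = (\<lambda>x. 2 * log_potential N x - log_potential M x
                     - ereal (1 / \<xi>) * enn2ereal (potential_V z 2 x))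
      in (\<forall>x\<in>supp M. F1 x = ereal l) \<and> (\<forall>x\<ge>0. F1 x \<le> ereal l) \<and>
         (\<forall>x\<in>supp N. F2 x = 0) \<and> (\<forall>x\<le>0. F2 x \<le> 0)))"

end

theory Submission
  imports Defs "HOL-Probability.Probability" "HOL-Complex_Analysis.Complex_Analysis"
begin

text \<open>
  With the kernel regularised to \<open>ln ((x - y)\<^sup>2 + e\<^sup>2) / 2\<close>, the quadratic part of the energy becomes a
  Fourier integral of a positive definite form in the differences of the cosine and sine transforms.  This
  makes every admissible vector that satisfies the variational conditions the only minimizer, and the only
  such vector.

  To verify the conditions, put \<open>v = \<kappa> / w\<close> with \<open>\<kappa> = s (s + p) (s + p + q)\<close>; then \<open>A_s(w) = x\<close> becomes
  \<open>(v + s) (v + s + p) (v + s + p + q) = x v\<close>.  For real \<open>x \<noteq> 0\<close> one root \<open>- m\<close> is always real, and the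
  other two are conjugate exactly on the supports; their argument, divided by \<open>\<pi>\<close>, is up to sign and
  a constant the distribution function of \<open>mu z j s\<close>.  The logarithmic potentials of the two measures at parameter \<open>s\<close> are \<open>ln \<kappa> - ln \<bar>v_1\<bar>\<close> and
  \<open>ln \<bar>v_3\<bar>\<close>: composed with \<open>x = A(v)\<close>, the complex potential minus this logarithm is holomorphic on the
  range of \<open>v_1\<close> (or \<open>v_3\<close>) with imaginary part vanishing on the boundary.  Averaging over \<open>s \<le> \<xi>\<close> cancels
  the part of \<open>V_j\<close> with \<open>s \<le> \<xi>\<close> up to a constant and leaves minus the nonnegative integral over \<open>s > \<xi>\<close>.
  That integral vanishes on the support because the supports grow with \<open>s\<close>: in the variable \<open>v + s\<close>, raising
  \<open>s\<close> only adds a multiple of \<open>x\<close> to the cubic.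
\<close>

section \<open>The logarithmic energy as a Fourier integral\<close>

text \<open>A competitor comes with no moment and no finite energy, so finiteness has to be
  extracted first. For the minimum, \<open>energy z \<xi> (M, N) \<noteq> \<infinity>\<close> makes
  every term harmless; since the two measures lie on opposite sides of 0, the self-energies then
  control the singular part of the mixed term, and logarithmic moments follow. For the variational
  conditions, the inequalities at the common point 0 play that role: a missing moment, or a
  potential equal to minus infinity at 0, would make the left side infinite. Only then can the
  regularisation be removed. It is there because its kernel is \<open>ln e\<close> plus a
  nonnegative part: Tonelli transforms the latter, and equal masses cancel \<open>ln e\<close>.

  On the algebraic side, the functions \<open>z j\<close> are determined only up to ties in modulus.
  Continuity is therefore proved for moduli, and single roots are followed only off the real line,
  where \<open>Lf\<close> separates them. The masses 1 and 1/2 are total variations of the angle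
  divided by pi: it falls from pi to 0 on the positive axis, and on the negative axis it rises from
  its limit pi/2 at minus infinity to pi.\<close>

lemma nn_integral_exp_one_minus_cos:
  fixes u :: real
  assumes "e > 0"
  shows "(\<integral>\<^sup>+t. ennreal (exp (-e * t) * (1 - cos (u * t))) * indicator {0..} t \<partial>lborel)
           = ennreal (1 / e - e / (e\<^sup>2 + u\<^sup>2))"
proof -
  have pos: "e\<^sup>2 + u\<^sup>2 > 0" using assms by (simp add: add_pos_nonneg)
  \<comment> \<open>Antiderivative, obtained by integrating
    \<open>exp (-e * t) * cos (u * t)\<close> by parts twice; it vanishes at infinity, so the
    integral is \<open>- ?F 0\<close>.\<close>
  let ?F = "\<lambda>t. - exp (-e * t) / e - exp (-e * t) * (u * sin (u * t) - e * cos (u * t)) / (e\<^sup>2 + u\<^sup>2)"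
  have E: "((\<lambda>t. exp (-e * t)) \<longlongrightarrow> 0) at_top"
    using assms by real_asymp
  have B: "((\<lambda>t. exp (-e * t) * (u * sin (u * t) - e * cos (u * t))) \<longlongrightarrow> 0) at_top"
  proof (rule Lim_null_comparison)
    have "\<bar>u * sin (u * t) - e * cos (u * t)\<bar> \<le> \<bar>u\<bar> + \<bar>e\<bar>" for t
    proof -
      have "\<bar>u * sin (u * t)\<bar> \<le> \<bar>u\<bar>" "\<bar>e * cos (u * t)\<bar> \<le> \<bar>e\<bar>"
        by (simp_all add: abs_mult mult_left_le)
      thus ?thesis by linarith
    qed
    thus "\<forall>\<^sub>F t in at_top. norm (exp (-e * t) * (u * sin (u * t) - e * cos (u * t)))
           \<le> exp (-e * t) * (\<bar>u\<bar> + \<bar>e\<bar>)"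
      by (intro always_eventually allI) (simp add: abs_mult mult_left_mono)
    show "((\<lambda>t. exp (-e * t) * (\<bar>u\<bar> + \<bar>e\<bar>)) \<longlongrightarrow> 0) at_top"
      using tendsto_mult_right[OF E, of "\<bar>u\<bar> + \<bar>e\<bar>"] by simp
  qed
  have lim: "(?F \<longlongrightarrow> - 0 / e - 0 / (e\<^sup>2 + u\<^sup>2)) at_top"
    using assms pos by (intro tendsto_intros E B) auto
  have "(\<integral>\<^sup>+t. ennreal (exp (-e * t) * (1 - cos (u * t))) * indicator {0..} t \<partial>lborel) = (- 0 / e - 0 / (e\<^sup>2 + u\<^sup>2)) - ?F 0"
  proof (rule nn_integral_FTC_atLeast[OF _ _ _ lim])
    fix t :: real assume "0 \<le> t"
    show "DERIV ?F t :> exp (-e * t) * (1 - cos (u * t))"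
    proof -
      let ?w = "e\<^sup>2 + u\<^sup>2"
      have "DERIV (\<lambda>t. exp (-e * t) * (u * sin (u * t) - e * cos (u * t))) t :> exp (-e * t) * cos (u * t) * ?w"
        by (rule derivative_eq_intros refl)+ (simp add: algebra_simps power2_eq_square)
      from DERIV_cdivide[OF this, of ?w] have "DERIV (\<lambda>t. exp (-e * t) * (u * sin (u * t) - e * cos (u * t)) / ?w) t
          :> exp (-e * t) * cos (u * t)"
        using pos assms by simp
      moreover have "DERIV (\<lambda>t. - exp (-e * t) / e) t :> exp (-e * t)"
        by (rule derivative_eq_intros refl | use assms in simp)+
      ultimately show ?thesis by (auto intro: DERIV_cong[OF DERIV_diff] simp: right_diff_distrib)
    qed
  qed auto
  thus ?thesis using assms by simp
qed

lemma nn_integral_log_kernel_aux: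
  fixes u :: real
  assumes "e > 0"
  shows "(\<integral>\<^sup>+h. ennreal (1 / h - h / (h\<^sup>2 + u\<^sup>2)) * indicator {e..} h \<partial>lborel)
           = ennreal (ln (1 + (u / e)\<^sup>2) / 2)"
proof -
  let ?F = "\<lambda>h. ln h - ln (h\<^sup>2 + u\<^sup>2) / 2"
  have lim: "(?F \<longlongrightarrow> 0) at_top"
  proof -
    have "\<forall>\<^sub>F h in at_top. - ln (1 + (u / h)\<^sup>2) / 2 = ?F h"
      using eventually_gt_at_top[of 0]
    proof eventually_elim
      case (elim h)
      have "1 + (u / h)\<^sup>2 = (h\<^sup>2 + u\<^sup>2) / h\<^sup>2" using elim by (simp add: field_simps)
      moreover have "h\<^sup>2 + u\<^sup>2 > 0" using elim by (simp add: add_pos_nonneg)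
      ultimately show ?case using elim by (simp add: ln_div ln_realpow)
    qed
    moreover have "((\<lambda>h. - ln (1 + (u / h)\<^sup>2) / 2) \<longlongrightarrow> - ln (1 + 0\<^sup>2) / 2) at_top"
      by (intro tendsto_intros tendsto_divide_0[OF tendsto_const]
          filterlim_at_top_imp_at_infinity filterlim_ident) auto
    ultimately show ?thesis by (simp add: tendsto_cong)
  qed
  have "(\<integral>\<^sup>+h. ennreal (1 / h - h / (h\<^sup>2 + u\<^sup>2)) * indicator {e..} h \<partial>lborel) = 0 - ?F e"
  proof (rule nn_integral_FTC_atLeast[OF _ _ _ lim])
    fix h :: real assume "e \<le> h"
    hence h: "h > 0" using assms by simp
    hence p: "h\<^sup>2 + u\<^sup>2 > 0" by (simp add: add_pos_nonneg)
    show "DERIV ?F h :> 1 / h - h / (h\<^sup>2 + u\<^sup>2)"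
    proof -
      have "DERIV (\<lambda>h. ln (h\<^sup>2 + u\<^sup>2)) h :> 2 * h / (h\<^sup>2 + u\<^sup>2)"
        using p by (auto intro!: derivative_eq_intros)
      from DERIV_diff[OF DERIV_ln_divide[OF h] DERIV_cdivide[OF this, of 2]]
      have "DERIV ?F h :> 1 / h - 2 * h / (h\<^sup>2 + u\<^sup>2) / 2" .
      moreover have "2 * k / l / 2 = k / l" for k l :: real by simp
      ultimately show ?thesis by (simp only:)
    qed
    show "0 \<le> 1 / h - h / (h\<^sup>2 + u\<^sup>2)"
      using h p by (simp add: field_simps power2_eq_square)
  qed auto
  moreover have "0 - ?F e = ln (1 + (u / e)\<^sup>2) / 2"
  proof -
    have "1 + (u / e)\<^sup>2 = (e\<^sup>2 + u\<^sup>2) / e\<^sup>2" using assms by (simp add: field_simps)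
    moreover have "e\<^sup>2 + u\<^sup>2 > 0" using assms by (simp add: add_pos_nonneg)
    ultimately show ?thesis using assms by (simp add: ln_div ln_realpow)
  qed
  ultimately show ?thesis by (metis (no_types, lifting))
qed

lemma nn_integral_exp_atLeast:
  fixes t :: real
  assumes "t > 0"
  shows "(\<integral>\<^sup>+h. ennreal (exp (-h * t)) * indicator {e..} h \<partial>lborel) = ennreal (exp (-e * t) / t)"
proof -
  have E: "((\<lambda>h. - exp (-h * t) / t) \<longlongrightarrow> 0) at_top"
    using assms by real_asymp
  have "(\<integral>\<^sup>+h. ennreal (exp (-h * t)) * indicator {e..} h \<partial>lborel) = 0 - (- exp (-e * t) / t)"
  proof (rule nn_integral_FTC_atLeast[OF _ _ _ E])
    fix h show "DERIV (\<lambda>h. - exp (-h * t) / t) h :> exp (-h * t)"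
      by (rule derivative_eq_intros refl | use assms in force)+
  qed auto
  thus ?thesis by simp
qed

text \<open>A Frullani integral: \<open>exp (-e * t) / t\<close> is the integral of
  \<open>exp (-h * t)\<close> over \<open>h \<ge> e\<close>, so Tonelli leaves the Laplace transform
  of \<open>1 - cos\<close> to be integrated in \<open>h\<close>.\<close>

lemma nn_integral_log_kernel:
  fixes u :: real
  assumes "e > 0"
  shows "(\<integral>\<^sup>+t. ennreal (exp (-e * t) / t * (1 - cos (u * t))) * indicator {0..} t \<partial>lborel)
           = ennreal (ln (1 + (u / e)\<^sup>2) / 2)"
proof -
  have "(\<integral>\<^sup>+t. ennreal (exp (-e * t) / t * (1 - cos (u * t))) * indicator {0..} t \<partial>lborel)
     = (\<integral>\<^sup>+t. (\<integral>\<^sup>+h. ennreal (exp (-h * t) * (1 - cos (u * t))) * indicator {0..} t * indicator {e..} h \<partial>lborel) \<partial>lborel)"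
  proof (rule nn_integral_cong)
    fix t :: real
    show "ennreal (exp (-e * t) / t * (1 - cos (u * t))) * indicator {0..} t =
      (\<integral>\<^sup>+h. ennreal (exp (-h * t) * (1 - cos (u * t))) * indicator {0..} t * indicator {e..} h \<partial>lborel)"
    proof (cases "t > 0")
      case True
      have "(\<integral>\<^sup>+h. ennreal (exp (-h * t) * (1 - cos (u * t))) * indicator {0..} t * indicator {e..} h \<partial>lborel)
        = (\<integral>\<^sup>+h. ennreal (1 - cos (u * t)) * (ennreal (exp (-h * t)) * indicator {e..} h) \<partial>lborel)"
        using True by (intro nn_integral_cong) (simp add: ennreal_mult mult_ac split: split_indicator)
      also have "\<dots> = ennreal (1 - cos (u * t)) * ennreal (exp (-e * t) / t)"
        by (subst nn_integral_cmult) (simp_all only: nn_integral_exp_atLeast[OF True], measurable)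
      finally show ?thesis using True by (simp add: ennreal_mult[symmetric] mult_ac)
    next
      case False
      \<comment> \<open>At \<open>t = 0\<close> both sides vanish because
        \<open>1 - cos 0 = 0\<close>; the default value of the division by 0 does no harm.\<close>
      thus ?thesis by (cases "t = 0") (auto simp: indicator_def)
    qed
  qed
  also have "\<dots> = (\<integral>\<^sup>+h. (\<integral>\<^sup>+t. ennreal (exp (-h * t) * (1 - cos (u * t))) * indicator {0..} t * indicator {e..} h \<partial>lborel) \<partial>lborel)"
    by (rule lborel_pair.Fubini') measurable
  also have "\<dots> = (\<integral>\<^sup>+h. ennreal (1 / h - h / (h\<^sup>2 + u\<^sup>2)) * indicator {e..} h \<partial>lborel)"
  proof (rule nn_integral_cong)
    fix h :: real
    show "(\<integral>\<^sup>+t. ennreal (exp (-h * t) * (1 - cos (u * t))) * indicator {0..} t * indicator {e..} h \<partial>lborel)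
      = ennreal (1 / h - h / (h\<^sup>2 + u\<^sup>2)) * indicator {e..} h"
    proof (cases "e \<le> h")
      case True
      hence "h > 0" using assms by simp
      thus ?thesis using True nn_integral_exp_one_minus_cos[of h u] by simp
    qed auto
  qed
  also have "\<dots> = ennreal (ln (1 + (u / e)\<^sup>2) / 2)" by (rule nn_integral_log_kernel_aux[OF assms])
  finally show ?thesis .
qed

section \<open>Cosine and sine transforms of finite measures\<close>

definition cos_tr :: "real measure \<Rightarrow> real \<Rightarrow> real" where
  "cos_tr M t = (\<integral>x. cos (t * x) \<partial>M)"

definition sin_tr :: "real measure \<Rightarrow> real \<Rightarrow> real" where
  "sin_tr M t = (\<integral>x. sin (t * x) \<partial>M)"

context finite_borel_measure begin

declare M_is_borel [measurable_cong]

lemma space_M [simp]: "space M = UNIV"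
  using sets_eq_imp_space_eq[OF M_is_borel] by simp

lemma integrable_cos [simp]: "integrable M (\<lambda>x. cos (t * x))"
  by (rule integrable_const_bound[where B = 1]) auto

lemma integrable_sin [simp]: "integrable M (\<lambda>x. sin (t * x))"
  by (rule integrable_const_bound[where B = 1]) auto

text \<open>Links the two real transforms to \<open>char\<close>, for which Levy's uniqueness
  theorem is available.\<close>

lemma char_eq_cos_sin: "char M t = Complex (cos_tr M t) (sin_tr M t)"
proof -
  have "(\<lambda>x. cis (t * x)) \<in> borel_measurable M"
    by (subst measurable_cong_sets[OF M_is_borel refl]) (intro borel_measurable_continuous_onI continuous_intros)
  hence int: "integrable M (\<lambda>x. cis (t * x))"
    by (intro integrable_const_bound[where B = 1]) auto
  have "char M t = (\<integral>x. cis (t * x) \<partial>M)" by (simp add: char_def cis_conv_exp)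
  moreover have "Re (\<integral>x. cis (t * x) \<partial>M) = cos_tr M t" "Im (\<integral>x. cis (t * x) \<partial>M) = sin_tr M t"
    using int by (simp_all flip: integral_Re integral_Im add: cos_tr_def sin_tr_def)
  ultimately show ?thesis by (simp add: complex_eq_iff)
qed

end

lemma measurable_cos_tr [measurable]:
  assumes "finite_borel_measure M"
  shows "cos_tr M \<in> borel_measurable borel" "sin_tr M \<in> borel_measurable borel"
proof -
  interpret finite_borel_measure M by fact
  note [measurable_cong] = M_is_borel
  show "cos_tr M \<in> borel_measurable borel" "sin_tr M \<in> borel_measurable borel"
    unfolding cos_tr_def[abs_def] sin_tr_def[abs_def]
    by (rule borel_measurable_lebesgue_integral, measurable)+
qed

text \<open>The addition formula for the cosine separates \<open>x\<close> and \<open>y\<close>,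
  which turns the double integral into products of transforms.\<close>

lemma nn_integral_one_minus_cos_pair:
  assumes "finite_borel_measure M" "finite_borel_measure N"
  shows "(\<integral>\<^sup>+x. (\<integral>\<^sup>+y. ennreal (1 - cos ((x - y) * t)) \<partial>N) \<partial>M)
    = ennreal (measure M UNIV * measure N UNIV - cos_tr M t * cos_tr N t - sin_tr M t * sin_tr N t)"
proof -
  interpret M: finite_borel_measure M by fact
  interpret N: finite_borel_measure N by fact
  have eq: "cos ((x - y) * t) = cos (t * x) * cos (t * y) + sin (t * x) * sin (t * y)" for x y
    by (simp add: right_diff_distrib cos_diff mult.commute[of _ t])
  have in1: "integrable N (\<lambda>y. 1 - cos ((x - y) * t))" for x
    unfolding eq by auto
  have v1: "(\<integral>y. 1 - cos ((x - y) * t) \<partial>N) = measure N UNIV - cos (t * x) * cos_tr N t - sin (t * x) * sin_tr N t" for x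
    unfolding eq by (simp add: cos_tr_def sin_tr_def)
  have nn1: "0 \<le> measure N UNIV - cos (t * x) * cos_tr N t - sin (t * x) * sin_tr N t" for x
    unfolding v1[symmetric] by (rule integral_nonneg_AE) auto
  have "(\<integral>\<^sup>+x. (\<integral>\<^sup>+y. ennreal (1 - cos ((x - y) * t)) \<partial>N) \<partial>M) =
    (\<integral>\<^sup>+x. ennreal (measure N UNIV - cos (t * x) * cos_tr N t - sin (t * x) * sin_tr N t) \<partial>M)"
    by (intro nn_integral_cong) (subst nn_integral_eq_integral[OF in1], auto simp: v1)
  also have "\<dots> = ennreal (\<integral>x. measure N UNIV - cos (t * x) * cos_tr N t - sin (t * x) * sin_tr N t \<partial>M)"
    by (rule nn_integral_eq_integral) (use nn1 in auto)
  also have "(\<integral>x. measure N UNIV - cos (t * x) * cos_tr N t - sin (t * x) * sin_tr N t \<partial>M)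
    = measure M UNIV * measure N UNIV - cos_tr M t * cos_tr N t - sin_tr M t * sin_tr N t"
    by (simp add: cos_tr_def sin_tr_def)
  finally show ?thesis .
qed

text \<open>The expression is the double integral of the nonnegative function
  \<open>1 - cos ((x - y) * t)\<close>. Its sign keeps \<open>ennreal\<close> from truncating in the
  Fourier formulas.\<close>

lemma trig_pair_nonneg:
  assumes "finite_borel_measure M" "finite_borel_measure N"
  shows "0 \<le> measure M UNIV * measure N UNIV - cos_tr M t * cos_tr N t - sin_tr M t * sin_tr N t"
proof -
  interpret M: finite_borel_measure M by fact
  interpret N: finite_borel_measure N by fact
  have eq: "cos ((x - y) * t) = cos (t * x) * cos (t * y) + sin (t * x) * sin (t * y)" for x y
    by (simp add: right_diff_distrib cos_diff mult.commute[of _ t])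
  have v1: "(\<integral>y. 1 - cos ((x - y) * t) \<partial>N) = measure N UNIV - cos (t * x) * cos_tr N t - sin (t * x) * sin_tr N t" for x
    unfolding eq by (simp add: cos_tr_def sin_tr_def)
  have "0 \<le> (\<integral>x. (\<integral>y. 1 - cos ((x - y) * t) \<partial>N) \<partial>M)"
    by (intro integral_nonneg_AE AE_I2) auto
  also have "\<dots> = measure M UNIV * measure N UNIV - cos_tr M t * cos_tr N t - sin_tr M t * sin_tr N t"
    unfolding v1 by (simp add: cos_tr_def sin_tr_def)
  finally show ?thesis .
qed

text \<open>Integrates the Frullani formula over both measures and moves \<open>t\<close> outermost,
  where the inner double integral is known; nonnegativity permits this for all finite Borel
  measures.\<close>

lemma nn_integral_log_kernel_pair:
  assumes MN: "finite_borel_measure M" "finite_borel_measure N" and e: "e > 0"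
  shows "(\<integral>\<^sup>+x. (\<integral>\<^sup>+y. ennreal (ln (1 + ((x - y) / e)\<^sup>2) / 2) \<partial>N) \<partial>M)
    = (\<integral>\<^sup>+t. ennreal (exp (-e * t) / t * (measure M UNIV * measure N UNIV
         - cos_tr M t * cos_tr N t - sin_tr M t * sin_tr N t)) * indicator {0..} t \<partial>lborel)"
proof -
  interpret M: finite_borel_measure M by fact
  interpret N: finite_borel_measure N by fact
  interpret P1: pair_sigma_finite M "lborel::real measure" ..
  interpret P2: pair_sigma_finite N "lborel::real measure" ..
  note [measurable_cong] = M.M_is_borel N.M_is_borel
  define f where "f x y t = ennreal (exp (-e * t) / t * (1 - cos ((x - y) * t))) * indicator {0..} t" for x y t :: real
  have [measurable]: "(\<lambda>(x, y, t). f x y t) \<in> borel_measurable (borel \<Otimes>\<^sub>M borel \<Otimes>\<^sub>M borel)"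
    unfolding f_def by measurable
  have f2: "(\<lambda>(y, t). f x y t) \<in> borel_measurable (N \<Otimes>\<^sub>M lborel)" for x
    unfolding f_def by measurable
  have f3: "(\<lambda>(x, t). \<integral>\<^sup>+y. f x y t \<partial>N) \<in> borel_measurable (M \<Otimes>\<^sub>M lborel)"
    unfolding f_def case_prod_beta by measurable
  have "(\<integral>\<^sup>+x. (\<integral>\<^sup>+y. ennreal (ln (1 + ((x - y) / e)\<^sup>2) / 2) \<partial>N) \<partial>M)
      = (\<integral>\<^sup>+x. (\<integral>\<^sup>+y. (\<integral>\<^sup>+t. f x y t \<partial>lborel) \<partial>N) \<partial>M)"
    unfolding f_def nn_integral_log_kernel[OF e] ..
  also have "\<dots> = (\<integral>\<^sup>+x. (\<integral>\<^sup>+t. (\<integral>\<^sup>+y. f x y t \<partial>N) \<partial>lborel) \<partial>M)"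
    by (intro nn_integral_cong P2.Fubini'[symmetric] f2)
  also have "\<dots> = (\<integral>\<^sup>+t. (\<integral>\<^sup>+x. (\<integral>\<^sup>+y. f x y t \<partial>N) \<partial>M) \<partial>lborel)"
    by (intro P1.Fubini'[symmetric] f3)
  also have "\<dots> = (\<integral>\<^sup>+t. ennreal (exp (-e * t) / t * (measure M UNIV * measure N UNIV
         - cos_tr M t * cos_tr N t - sin_tr M t * sin_tr N t)) * indicator {0..} t \<partial>lborel)"
  proof (rule nn_integral_cong)
    fix t :: real
    show "(\<integral>\<^sup>+x. (\<integral>\<^sup>+y. f x y t \<partial>N) \<partial>M) = ennreal (exp (-e * t) / t * (measure M UNIV * measure N UNIV
         - cos_tr M t * cos_tr N t - sin_tr M t * sin_tr N t)) * indicator {0..} t"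
    proof (cases "t \<ge> 0")
      case True
      have "f x y t = ennreal (exp (-e * t) / t) * ennreal (1 - cos ((x - y) * t))" for x y
        using True by (simp add: f_def ennreal_mult[symmetric])
      hence "(\<integral>\<^sup>+x. (\<integral>\<^sup>+y. f x y t \<partial>N) \<partial>M) = (\<integral>\<^sup>+x. ennreal (exp (-e * t) / t) * (\<integral>\<^sup>+y. ennreal (1 - cos ((x - y) * t)) \<partial>N) \<partial>M)"
        by (simp add: nn_integral_cmult)
      also have "\<dots> = ennreal (exp (-e * t) / t) * (\<integral>\<^sup>+x. (\<integral>\<^sup>+y. ennreal (1 - cos ((x - y) * t)) \<partial>N) \<partial>M)"
        by (rule nn_integral_cmult) measurable
      finally show ?thesis using True trig_pair_nonneg[OF MN, of t]
        by (simp add: nn_integral_one_minus_cos_pair[OF MN] ennreal_mult[symmetric])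
    qed (simp add: f_def)
  qed
  finally show ?thesis .
qed

section \<open>Regularised mutual energies\<close>

definition log_int :: "real measure \<Rightarrow> bool" where
  "log_int M \<longleftrightarrow> integrable M (\<lambda>x. ln (1 + \<bar>x\<bar>))"

text \<open>Has the sign of the potential, opposite to that of the energy; \<open>e = 0\<close>
  gives the unregularised logarithm.\<close>

definition ker :: "real \<Rightarrow> real \<Rightarrow> real \<Rightarrow> real" where
  "ker e x y = ln ((x - y)\<^sup>2 + e\<^sup>2) / 2"

definition mutual :: "real \<Rightarrow> real measure \<Rightarrow> real measure \<Rightarrow> real" where
  "mutual e M N = (\<integral>z. ker e (fst z) (snd z) \<partial>(M \<Otimes>\<^sub>M N))"

text \<open>Because \<open>ln 0 = 0\<close>, integrability alone would overlook mass on the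
  diagonal, where the logarithm ought to be minus infinity; the second conjunct excludes such
  mass.\<close>

definition fin_pair :: "real measure \<Rightarrow> real measure \<Rightarrow> bool" where
  "fin_pair M N \<longleftrightarrow> integrable (M \<Otimes>\<^sub>M N) (\<lambda>z. ln \<bar>fst z - snd z\<bar>)
      \<and> (AE z in M \<Otimes>\<^sub>M N. fst z \<noteq> snd z)"

lemma ker_0: "ker 0 x y = ln \<bar>x - y\<bar>"
proof (cases "x = y")
  case False
  have "ln ((x - y)\<^sup>2) = ln (\<bar>x - y\<bar> ^ 2)" by simp
  also have "\<dots> = 2 * ln \<bar>x - y\<bar>" using False by (subst ln_realpow) auto
  finally show ?thesis by (simp add: ker_def)
qed (simp add: ker_def)

lemma ln_abs_diff_le:
  fixes x y :: real
  shows "ln (1 + \<bar>x - y\<bar>) \<le> ln (1 + \<bar>x\<bar>) + ln (1 + \<bar>y\<bar>)"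
proof -
  have "1 + \<bar>x - y\<bar> \<le> (1 + \<bar>x\<bar>) * (1 + \<bar>y\<bar>)" by (simp add: algebra_simps) (smt (verit) zero_le_mult_iff abs_ge_zero)
  hence "ln (1 + \<bar>x - y\<bar>) \<le> ln ((1 + \<bar>x\<bar>) * (1 + \<bar>y\<bar>))" by (subst ln_le_cancel_iff) (auto intro!: mult_pos_pos)
  also have "\<dots> = ln (1 + \<bar>x\<bar>) + ln (1 + \<bar>y\<bar>)" by (subst ln_mult) auto
  finally show ?thesis .
qed

lemma ker_le:
  assumes "0 < e" "e \<le> 1"
  shows "ker e x y \<le> ln (1 + \<bar>x\<bar>) + ln (1 + \<bar>y\<bar>)"
proof -
  have "(x - y)\<^sup>2 + e\<^sup>2 \<le> (x - y)\<^sup>2 + 1\<^sup>2" using assms by (intro add_left_mono power_mono) auto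
  also have "\<dots> \<le> (1 + \<bar>x - y\<bar>)\<^sup>2" by (simp add: power2_sum)
  finally have "ln ((x - y)\<^sup>2 + e\<^sup>2) \<le> ln ((1 + \<bar>x - y\<bar>)\<^sup>2)"
    using assms by (subst ln_le_cancel_iff) (auto intro!: add_nonneg_pos)
  also have "\<dots> = 2 * ln (1 + \<bar>x - y\<bar>)" by (subst ln_realpow) auto
  finally show ?thesis using ln_abs_diff_le[of x y] by (simp add: ker_def)
qed

lemma ker_mono:
  assumes "0 \<le> d" "d \<le> e" "x \<noteq> y"
  shows "ker d x y \<le> ker e x y"
proof -
  have "(x - y)\<^sup>2 + d\<^sup>2 \<le> (x - y)\<^sup>2 + e\<^sup>2" using assms by (intro add_left_mono power_mono) auto
  moreover have "0 < (x - y)\<^sup>2 + d\<^sup>2" using assms by (intro add_pos_nonneg) auto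
  ultimately show ?thesis by (simp add: ker_def)
qed

lemma ker_ge: "0 < e \<Longrightarrow> ln e \<le> ker e x y"
proof -
  assume e: "0 < e"
  have "2 * ln e = ln (e ^ 2)" using e by (subst ln_realpow) auto
  also have "\<dots> \<le> ln ((x - y)\<^sup>2 + e\<^sup>2)" using e by (subst ln_le_cancel_iff) (auto intro!: add_nonneg_pos)
  finally show ?thesis by (simp add: ker_def)
qed

lemma ker_abs_le:
  assumes "0 < e" "e \<le> 1"
  shows "\<bar>ker e x y\<bar> \<le> - ln e + (ln (1 + \<bar>x\<bar>) + ln (1 + \<bar>y\<bar>))"
  using ker_le[OF assms, of x y] ker_ge[OF assms(1), of x y] assms ln_ge_zero[of "1 + \<bar>x\<bar>"] ln_ge_zero[of "1 + \<bar>y\<bar>"]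
    ln_le_zero_iff[of e] by linarith

text \<open>Isolates the constant \<open>ln e\<close>, which cancels between measures of equal mass;
  the remainder is nonnegative and has a Fourier integral.\<close>

lemma ker_split:
  assumes "e > 0"
  shows "ker e x y = ln e + ln (1 + ((x - y) / e)\<^sup>2) / 2"
proof -
  have "(x - y)\<^sup>2 + e\<^sup>2 = e\<^sup>2 * (1 + ((x - y) / e)\<^sup>2)" using assms by (simp add: field_simps)
  hence "ln ((x - y)\<^sup>2 + e\<^sup>2) = ln (e\<^sup>2) + ln (1 + ((x - y) / e)\<^sup>2)"
    using assms by (simp only:) (subst ln_mult, auto intro!: add_pos_nonneg)
  thus ?thesis using assms by (simp add: ker_def ln_realpow)
qed

lemma measurable_ker [measurable]:
  "(\<lambda>z. ker e (fst z) (snd z)) \<in> borel_measurable (borel \<Otimes>\<^sub>M borel)"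
  unfolding ker_def by measurable

lemma integrable_pair_add:
  fixes g h :: "real \<Rightarrow> real"
  assumes "finite_borel_measure M" "finite_borel_measure N" "integrable M g" "integrable N h"
  shows "integrable (M \<Otimes>\<^sub>M N) (\<lambda>z. g (fst z) + h (snd z))"
proof -
  interpret M: finite_borel_measure M by fact
  interpret N: finite_borel_measure N by fact
  interpret pair_sigma_finite M N ..
  have [measurable]: "g \<in> borel_measurable M" "h \<in> borel_measurable N" using assms by auto
  have "integrable (M \<Otimes>\<^sub>M N) (\<lambda>z. g (fst z))"
  proof (rule Fubini_integrable)
    show "integrable M (\<lambda>x. LINT y|N. norm (g (fst (x, y))))"
      using integrable_abs[OF assms(3)] by simp
  qed auto
  moreover have "integrable (M \<Otimes>\<^sub>M N) (\<lambda>z. h (snd z))"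
    by (rule Fubini_integrable) (use assms(4) in auto)
  ultimately show ?thesis by (rule Bochner_Integration.integrable_add)
qed

lemma integrable_ker:
  assumes "finite_borel_measure M" "finite_borel_measure N" "log_int M" "log_int N" "0 < e" "e \<le> 1"
  shows "integrable (M \<Otimes>\<^sub>M N) (\<lambda>z. ker e (fst z) (snd z))"
proof -
  interpret M: finite_borel_measure M by fact
  interpret N: finite_borel_measure N by fact
  interpret pair_sigma_finite M N ..
  interpret P: finite_measure "M \<Otimes>\<^sub>M N"
    by (rule finite_measure_pair_measure) unfold_locales
  note [measurable_cong] = M.M_is_borel N.M_is_borel
  have "integrable (M \<Otimes>\<^sub>M N) (\<lambda>z. - ln e + (ln (1 + \<bar>fst z\<bar>) + ln (1 + \<bar>snd z\<bar>)))"
    using assms by (intro Bochner_Integration.integrable_add integrable_pair_add P.integrable_const)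
      (auto simp: log_int_def)
  thus ?thesis
  proof (rule Bochner_Integration.integrable_bound)
    show "AE z in M \<Otimes>\<^sub>M N. norm (ker e (fst z) (snd z)) \<le> norm (- ln e + (ln (1 + \<bar>fst z\<bar>) + ln (1 + \<bar>snd z\<bar>)))"
      unfolding real_norm_def using ker_abs_le[OF assms(5,6)] by (intro AE_I2) (rule order.trans[OF _ abs_ge_self])
  qed measurable
qed

text \<open>With \<open>ln e\<close> split off the kernel is nonnegative, so Tonelli gives the value
  in \<open>ennreal\<close>; the logarithmic moments make it finite. As a Bochner integral the
  formula may then be combined linearly with arbitrary signs.\<close>

lemma mutual_fourier:
  assumes M: "finite_borel_measure M" and N: "finite_borel_measure N"
    and "log_int M" "log_int N" and e: "0 < e" "e \<le> 1"
  shows "has_bochner_integral lborel (\<lambda>t. indicator {0..} t * (exp (-e * t) / t *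
      (measure M UNIV * measure N UNIV - cos_tr M t * cos_tr N t - sin_tr M t * sin_tr N t)))
     (mutual e M N - ln e * (measure M UNIV * measure N UNIV))"
proof -
  interpret M: finite_borel_measure M by fact
  interpret N: finite_borel_measure N by fact
  interpret pair_sigma_finite M N ..
  interpret P: finite_measure "M \<Otimes>\<^sub>M N"
    by (rule finite_measure_pair_measure) unfold_locales
  note [measurable_cong] = M.M_is_borel N.M_is_borel
  note [measurable] = measurable_cos_tr[OF M] measurable_cos_tr[OF N]
  let ?g = "\<lambda>z. ln (1 + ((fst z - snd z) / e)\<^sup>2) / 2"
  let ?h = "\<lambda>t. indicator {0..} t * (exp (-e * t) / t *
      (measure M UNIV * measure N UNIV - cos_tr M t * cos_tr N t - sin_tr M t * sin_tr N t))"
  have ik: "integrable (M \<Otimes>\<^sub>M N) (\<lambda>z. ker e (fst z) (snd z))" by (rule integrable_ker) fact+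
  have g_eq: "?g z = ker e (fst z) (snd z) - ln e" for z using ker_split[OF e(1)] by simp
  have ig: "integrable (M \<Otimes>\<^sub>M N) ?g"
    unfolding g_eq using ik by (intro Bochner_Integration.integrable_diff) auto
  have sp: "space (M \<Otimes>\<^sub>M N) = UNIV \<times> UNIV" by (simp add: space_pair_measure)
  have "emeasure (M \<Otimes>\<^sub>M N) (UNIV \<times> UNIV) = ennreal (measure M UNIV * measure N UNIV)"
    by (subst N.emeasure_pair_measure_Times) (auto simp: M.emeasure_eq_measure N.emeasure_eq_measure ennreal_mult)
  hence mp: "measure (M \<Otimes>\<^sub>M N) UNIV = measure M UNIV * measure N UNIV"
    by (simp add: Sigma_Algebra.measure_def[of "M \<Otimes>\<^sub>M N"])
  have int_g: "(\<integral>z. ?g z \<partial>(M \<Otimes>\<^sub>M N)) = mutual e M N - ln e * (measure M UNIV * measure N UNIV)"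
    unfolding g_eq using ik sp by (simp add: mutual_def mp)
  have gn: "0 \<le> ?g z" for z by (simp add: ln_ge_zero)
  have hn: "0 \<le> ?h t" for t using trig_pair_nonneg[OF M N, of t] by (auto simp: indicator_def)
  have "(\<integral>\<^sup>+t. ennreal (?h t) \<partial>lborel) = (\<integral>\<^sup>+t. ennreal (exp (-e * t) / t * (measure M UNIV * measure N UNIV
         - cos_tr M t * cos_tr N t - sin_tr M t * sin_tr N t)) * indicator {0..} t \<partial>lborel)"
    by (intro nn_integral_cong) (auto simp: indicator_def)
  also have "\<dots> = (\<integral>\<^sup>+x. (\<integral>\<^sup>+y. ennreal (ln (1 + ((x - y) / e)\<^sup>2) / 2) \<partial>N) \<partial>M)"
    by (rule nn_integral_log_kernel_pair[OF M N e(1), symmetric])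
  also have "\<dots> = (\<integral>\<^sup>+z. ennreal (?g z) \<partial>(M \<Otimes>\<^sub>M N))"
    by (subst N.nn_integral_fst[symmetric]) auto
  also have "\<dots> = ennreal (\<integral>z. ?g z \<partial>(M \<Otimes>\<^sub>M N))"
    by (rule nn_integral_eq_integral) (use ig gn in auto)
  finally have "(\<integral>\<^sup>+t. ennreal (?h t) \<partial>lborel) = ennreal (mutual e M N - ln e * (measure M UNIV * measure N UNIV))"
    unfolding int_g .
  moreover have "0 \<le> mutual e M N - ln e * (measure M UNIV * measure N UNIV)"
    unfolding int_g[symmetric] using gn by (intro integral_nonneg_AE) auto
  ultimately show ?thesis using hn by (intro has_bochner_integral_nn_integral) auto
qed

lemma mutual_tendsto:
  assumes "finite_borel_measure M" "finite_borel_measure N" "log_int M" "log_int N" "fin_pair M N"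
  shows "(\<lambda>n. mutual (1 / real (Suc n)) M N) \<longlonglongrightarrow> mutual 0 M N"
  unfolding mutual_def
proof (rule integral_dominated_convergence)
  interpret M: finite_borel_measure M by fact
  interpret N: finite_borel_measure N by fact
  note [measurable_cong] = M.M_is_borel N.M_is_borel
  \<comment> \<open>Off the diagonal \<open>ker e\<close> increases with \<open>e\<close>, so every
    member of the sequence lies between \<open>ker 0\<close> and \<open>ker 1\<close>.\<close>
  let ?w = "\<lambda>z. \<bar>ker 0 (fst z) (snd z)\<bar> + \<bar>ker 1 (fst z) (snd z)\<bar>"
  show "(\<lambda>z. ker 0 (fst z) (snd z)) \<in> borel_measurable (M \<Otimes>\<^sub>M N)" by measurable
  show "(\<lambda>z. ker (1 / real (Suc n)) (fst z) (snd z)) \<in> borel_measurable (M \<Otimes>\<^sub>M N)" for n by measurable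
  show "integrable (M \<Otimes>\<^sub>M N) ?w"
    using assms integrable_ker[of M N 1] by (intro Bochner_Integration.integrable_add integrable_abs)
      (auto simp: fin_pair_def ker_0)
  have ne: "AE z in M \<Otimes>\<^sub>M N. fst z \<noteq> snd z" using assms by (simp add: fin_pair_def)
  show "AE z in M \<Otimes>\<^sub>M N. norm (ker (1 / real (Suc n)) (fst z) (snd z)) \<le> ?w z" for n
    using ne
  proof eventually_elim
    case (elim z)
    show ?case using ker_mono[OF _ _ elim, of 0 "1 / real (Suc n)"] ker_mono[OF _ _ elim, of "1 / real (Suc n)" 1]
      by auto
  qed
  show "AE z in M \<Otimes>\<^sub>M N. (\<lambda>n. ker (1 / real (Suc n)) (fst z) (snd z)) \<longlonglongrightarrow> ker 0 (fst z) (snd z)"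
    using ne
  proof eventually_elim
    case (elim z)
    have "(\<lambda>n. 1 / real (Suc n)) \<longlonglongrightarrow> 0" using LIMSEQ_inverse_real_of_nat by (simp add: inverse_eq_divide)
    thus ?case unfolding ker_def using elim by (intro tendsto_intros) auto
  qed
qed

text \<open>After normalisation to mass 1, characteristic functions are continuous, and a nonempty
  open set is not a null set; so agreement almost everywhere is agreement at all
  \<open>t > 0\<close>, and by symmetry everywhere. Levy's theorem then applies.\<close>

lemma eq_of_transforms_AE:
  assumes M: "finite_borel_measure M" and N: "finite_borel_measure N"
    and mass: "measure M UNIV = c" "measure N UNIV = c" "c > 0"
    and ae: "AE t in lborel. t > 0 \<longrightarrow> cos_tr M t = cos_tr N t \<and> sin_tr M t = sin_tr N t"
  shows "M = N"
proof -
  interpret M: finite_borel_measure M by fact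
  interpret N: finite_borel_measure N by fact
  define sc where "sc K = density K (\<lambda>_::real. ennreal (1 / c))" for K :: "real measure"
  have rd: "real_distribution (sc K)" and ch: "char (sc K) t = of_real (1 / c) * char K t"
    if K: "finite_borel_measure K" "measure K UNIV = c" for K t
  proof -
    interpret K: finite_borel_measure K by fact
    have "emeasure (sc K) UNIV = ennreal (1 / c) * emeasure K UNIV"
      unfolding sc_def by (subst emeasure_density_const) auto
    hence "emeasure (sc K) UNIV = 1" using K(2) mass(3)
      by (simp add: K.emeasure_eq_measure ennreal_mult[symmetric])
    hence "prob_space (sc K)" by (intro prob_spaceI) (simp add: sc_def)
    thus "real_distribution (sc K)"
      by (simp add: real_distribution_def real_distribution_axioms_def sc_def K.M_is_borel)
    have "(\<lambda>x. cis (t * x)) \<in> borel_measurable K"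
      by (subst measurable_cong_sets[OF K.M_is_borel refl]) (intro borel_measurable_continuous_onI continuous_intros)
    thus "char (sc K) t = of_real (1 / c) * char K t"
      unfolding char_def sc_def cis_conv_exp using mass(3)
      by (subst integral_density) (auto simp: scaleR_conv_of_real)
  qed
  note rdM = rd[OF M mass(1)] and rdN = rd[OF N mass(2)]
  let ?d = "\<lambda>t. char (sc M) t - char (sc N) t"
  have cont: "continuous_on UNIV ?d"
    using real_distribution.isCont_char[OF rdM] real_distribution.isCont_char[OF rdN]
    by (intro continuous_on_diff continuous_at_imp_continuous_on) auto
  have pos: "?d t = 0" if "t > 0" for t
  proof (rule ccontr)
    assume "?d t \<noteq> 0"
    have "open {u. ?d u \<noteq> 0}" using cont by (intro open_Collect_neq) (auto intro: continuous_intros)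
    hence op: "open ({u. ?d u \<noteq> 0} \<inter> {0<..})" by auto
    have "AE u in lborel. u \<notin> {u. ?d u \<noteq> 0} \<inter> {0<..}"
      using ae by eventually_elim (auto simp: ch[OF M mass(1)] ch[OF N mass(2)] M.char_eq_cos_sin N.char_eq_cos_sin)
    hence "{u. ?d u \<noteq> 0} \<inter> {0<..} \<in> null_sets lborel"
      using op by (subst (asm) AE_iff_null_sets[symmetric]) auto
    hence "negligible ({u. ?d u \<noteq> 0} \<inter> {0<..})" using negligible_iff_null_sets null_sets_completionI by blast
    with op open_not_negligible[OF op] have "{u. ?d u \<noteq> 0} \<inter> {0<..} = {}" by blast
    with \<open>?d t \<noteq> 0\<close> that show False by auto
  qed
  have cs: "cos_tr M t = cos_tr N t \<and> sin_tr M t = sin_tr N t" if "t > 0" for t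
    using pos[OF that] mass(3)
    by (simp add: ch[OF M mass(1)] ch[OF N mass(2)] M.char_eq_cos_sin N.char_eq_cos_sin)
  have "char (sc M) t = char (sc N) t" for t
  proof (cases "t > 0 \<or> t = 0")
    case True
    thus ?thesis using pos[of t] real_distribution.char_zero[OF rdM] real_distribution.char_zero[OF rdN] by auto
  next
    case False
    have "cos_tr K t = cos_tr K (-t)" "sin_tr K t = - sin_tr K (-t)" for K
      by (simp_all add: cos_tr_def sin_tr_def)
    thus ?thesis using cs[of "-t"] False
      by (simp add: ch[OF M mass(1)] ch[OF N mass(2)] M.char_eq_cos_sin N.char_eq_cos_sin)
  qed
  hence "sc M = sc N" by (intro Levy_uniqueness rdM rdN) auto
  show ?thesis
  proof (rule measure_eqI)
    show "sets M = sets N" by (simp add: M.M_is_borel N.M_is_borel)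
    fix X assume X: "X \<in> sets M"
    have "ennreal (1 / c) * emeasure K X = emeasure (sc K) X" if "X \<in> sets K" for K
      unfolding sc_def using that by (subst emeasure_density_const) auto
    from this[of M] this[of N] \<open>sc M = sc N\<close> have "ennreal (1 / c) * emeasure M X = ennreal (1 / c) * emeasure N X"
      using X by (simp add: M.M_is_borel N.M_is_borel)
    hence "ennreal c * (ennreal (1 / c) * emeasure M X) = ennreal c * (ennreal (1 / c) * emeasure N X)" by simp
    thus "emeasure M X = emeasure N X" using mass(3)
      by (simp add: mult.assoc[symmetric] ennreal_mult[symmetric])
  qed
qed

text \<open>The quadratic part of the energy at the signed pair \<open>(M - A, N - B)\<close>,
  expanded bilinearly so that only positive measures occur.\<close>

definition energy_form :: "real \<Rightarrow> real measure \<Rightarrow> real measure \<Rightarrow> real measure \<Rightarrow> real measure \<Rightarrow> real" where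
  "energy_form e M A N B =
     - (mutual e M M - 2 * mutual e M A + mutual e A A)
     - (mutual e N N - 2 * mutual e N B + mutual e B B)
     + (mutual e M N - mutual e M B - mutual e A N + mutual e A B)"

text \<open>Equal masses remove the constants \<open>ln e\<close> and the products of masses,
  leaving the integral of a positive definite form \<open>Q\<close> in the differences of
  transforms. If it vanishes, all transforms agree almost everywhere.\<close>

lemma energy_form_pos:
  assumes fb: "finite_borel_measure M" "finite_borel_measure A" "finite_borel_measure N" "finite_borel_measure B"
    and li: "log_int M" "log_int A" "log_int N" "log_int B"
    and mass: "measure M UNIV = c" "measure A UNIV = c" "c > 0" "measure N UNIV = d" "measure B UNIV = d" "d > 0"
    and fp: "fin_pair M M" "fin_pair M A" "fin_pair A A" "fin_pair N N" "fin_pair N B" "fin_pair B B"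
      "fin_pair M N" "fin_pair M B" "fin_pair A N" "fin_pair A B"
  shows "energy_form 0 M A N B \<ge> 0" "energy_form 0 M A N B = 0 \<Longrightarrow> M = A \<and> N = B"
proof -
  define u where "u t = cos_tr M t - cos_tr A t" for t
  define u' where "u' t = sin_tr M t - sin_tr A t" for t
  define v where "v t = cos_tr N t - cos_tr B t" for t
  define v' where "v' t = sin_tr N t - sin_tr B t" for t
  define Q where "Q t = (u t)\<^sup>2 + (u' t)\<^sup>2 + (v t)\<^sup>2 + (v' t)\<^sup>2 - u t * v t - u' t * v' t" for t
  \<comment> \<open>From \<open>2 * u * v \<le> u\<^sup>2 + v\<^sup>2\<close>: the mixed coefficient
    1 of the functional stays below 2, which makes the form definite.\<close>
  have Q_ge: "Q t \<ge> ((u t)\<^sup>2 + (u' t)\<^sup>2 + (v t)\<^sup>2 + (v' t)\<^sup>2) / 2" for t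
    using zero_le_power2[of "u t - v t"] zero_le_power2[of "u' t - v' t"]
    unfolding Q_def by (simp add: power2_diff)
  have Q_nn: "Q t \<ge> 0" for t using Q_ge[of t] by (smt (verit) zero_le_power2 divide_nonneg_nonneg)
  define w where "w e t = indicator {0..} t * (exp (-e * t) / t)" for e t :: real
  have D: "has_bochner_integral lborel (\<lambda>t. w e t * Q t) (energy_form e M A N B)" if e: "0 < e" "e \<le> 1" for e
  proof -
    define H where "H K L t = indicator {0..} t * (exp (-e * t) / t *
      (measure K UNIV * measure L UNIV - cos_tr K t * cos_tr L t - sin_tr K t * sin_tr L t))" for K L t
    define g where "g K L = mutual e K L - ln e * (measure K UNIV * measure L UNIV)" for K L
    have H: "has_bochner_integral lborel (H K L) (g K L)"
      if "finite_borel_measure K" "finite_borel_measure L" "log_int K" "log_int L" for K L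
      unfolding H_def g_def by (rule mutual_fourier[OF that e])
    have "has_bochner_integral lborel (\<lambda>t. - (H M M t - 2 * H M A t + H A A t) - (H N N t - 2 * H N B t + H B B t)
        + (H M N t - H M B t - H A N t + H A B t))
        (- (g M M - 2 * g M A + g A A) - (g N N - 2 * g N B + g B B) + (g M N - g M B - g A N + g A B))"
      by (intro has_bochner_integral_add has_bochner_integral_diff has_bochner_integral_minus
          has_bochner_integral_mult_right H fb li)
    moreover have "- (H M M t - 2 * H M A t + H A A t) - (H N N t - 2 * H N B t + H B B t)
        + (H M N t - H M B t - H A N t + H A B t) = w e t * Q t" for t
      unfolding H_def w_def Q_def u_def u'_def v_def v'_def mass by (simp add: algebra_simps power2_eq_square)
    moreover have "- (g M M - 2 * g M A + g A A) - (g N N - 2 * g N B + g B B) + (g M N - g M B - g A N + g A B)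
       = energy_form e M A N B"
      unfolding g_def energy_form_def mass by (simp add: algebra_simps)
    ultimately show ?thesis by simp
  qed
  \<comment> \<open>The weight \<open>exp (-e * t) / t\<close> grows as \<open>e\<close> decreases.
    Hence the form at 0 dominates the one at 1, and its vanishing forces the integrand at
    \<open>e = 1\<close> to vanish.\<close>
  have ge1: "energy_form e M A N B \<ge> energy_form 1 M A N B" if "0 < e" "e \<le> 1" for e
    unfolding has_bochner_integral_integral_eq[OF D[OF that], symmetric]
      has_bochner_integral_integral_eq[OF D[of 1, simplified], symmetric]
  proof (rule integral_mono)
    show "integrable lborel (\<lambda>t. w 1 t * Q t)" "integrable lborel (\<lambda>t. w e t * Q t)"
      using D[of 1] D[OF that] by (auto simp: has_bochner_integral_iff)
    fix t :: real
    have "w 1 t \<le> w e t" using that unfolding w_def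
      by (auto simp: indicator_def mult_left_le_one_le intro!: divide_right_mono)
    thus "w 1 t * Q t \<le> w e t * Q t" using Q_nn by (rule mult_right_mono)
  qed
  have lim: "(\<lambda>n. energy_form (1 / real (Suc n)) M A N B) \<longlonglongrightarrow> energy_form 0 M A N B"
    unfolding energy_form_def by (intro tendsto_intros mutual_tendsto fb li fp)
  have ge: "energy_form 0 M A N B \<ge> energy_form 1 M A N B"
    by (rule LIMSEQ_le_const[OF lim]) (auto intro!: exI[of _ 0] ge1)
  have w_nn: "w 1 t \<ge> 0" for t by (auto simp: w_def indicator_def)
  have nn1: "energy_form 1 M A N B \<ge> 0"
    unfolding has_bochner_integral_integral_eq[OF D[of 1, simplified], symmetric]
    using w_nn Q_nn by (intro integral_nonneg_AE AE_I2) auto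
  show "energy_form 0 M A N B \<ge> 0" using ge nn1 by simp
  assume "energy_form 0 M A N B = 0"
  hence "(\<integral>t. w 1 t * Q t \<partial>lborel) = 0"
    unfolding has_bochner_integral_integral_eq[OF D[of 1, simplified]] using ge nn1 by simp
  moreover have "integrable lborel (\<lambda>t. w 1 t * Q t)" using D[of 1] by (auto simp: has_bochner_integral_iff)
  ultimately have ae: "AE t in lborel. w 1 t * Q t = 0"
    using w_nn Q_nn by (subst (asm) integral_nonneg_eq_0_iff_AE) auto
  have ae2: "AE t in lborel. t > 0 \<longrightarrow> u t = 0 \<and> u' t = 0 \<and> v t = 0 \<and> v' t = 0"
    using ae
  proof eventually_elim
    case (elim t)
    show ?case
    proof
      assume "t > 0"
      hence "Q t = 0" using elim by (simp add: w_def)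
      hence "(u t)\<^sup>2 + (u' t)\<^sup>2 + (v t)\<^sup>2 + (v' t)\<^sup>2 \<le> 0" using Q_ge[of t] by simp
      thus "u t = 0 \<and> u' t = 0 \<and> v t = 0 \<and> v' t = 0"
        by (smt (verit) zero_le_power2 power_eq_0_iff)
    qed
  qed
  have "M = A"
    by (rule eq_of_transforms_AE[OF fb(1,2) mass(1,2,3)]) (use ae2 in eventually_elim, auto simp: u_def u'_def)
  moreover have "N = B"
    by (rule eq_of_transforms_AE[OF fb(3,4) mass(4,5,6)]) (use ae2 in eventually_elim, auto simp: v_def v'_def)
  ultimately show "M = A \<and> N = B" ..
qed

section \<open>Uniqueness of the equilibrium vector\<close>

text \<open>By Lindelof the complement of the support is a countable union of open null
  sets.\<close>

lemma AE_supp: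
  assumes "sets M = sets borel"
  shows "AE x in M. x \<in> supp M"
proof -
  let ?F = "{U. open U \<and> emeasure M U = 0}"
  obtain G where G: "G \<subseteq> ?F" "countable G" "\<Union>G = \<Union>?F"
    using Lindelof[of ?F] by auto
  have "\<Union>G \<in> null_sets M"
  proof (rule null_sets_UN'[where N = id, simplified])
    show "countable G" by fact
    fix U assume "U \<in> G"
    thus "U \<in> null_sets M" using G(1) assms by (auto simp: null_sets_def)
  qed
  moreover have "{x \<in> space M. x \<notin> supp M} \<subseteq> \<Union>G"
    unfolding G(3) supp_def by (auto simp: zero_less_iff_neq_zero)
  ultimately show ?thesis by (rule AE_I')
qed

text \<open>The value is infinity as soon as the positive part has infinite integral, even if the
  negative part does too; this is the convention for an undefined difference. Only the last case is
  an ordinary integral.\<close>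

lemma eintegral_cases:
  assumes [measurable]: "f \<in> borel_measurable M"
  obtains (top) "(\<integral>\<^sup>+x. e2ennreal (f x) \<partial>M) = \<infinity>" "eintegral M f = \<infinity>"
  | (bot) "(\<integral>\<^sup>+x. e2ennreal (f x) \<partial>M) < \<infinity>" "(\<integral>\<^sup>+x. e2ennreal (- f x) \<partial>M) = \<infinity>" "eintegral M f = - \<infinity>"
  | (real) "(\<integral>\<^sup>+x. e2ennreal (f x) \<partial>M) < \<infinity>" "(\<integral>\<^sup>+x. e2ennreal (- f x) \<partial>M) < \<infinity>"
      "AE x in M. \<bar>f x\<bar> \<noteq> \<infinity>" "integrable M (\<lambda>x. real_of_ereal (f x))"
      "eintegral M f = ereal (\<integral>x. real_of_ereal (f x) \<partial>M)"
proof -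
  let ?P = "\<integral>\<^sup>+x. e2ennreal (f x) \<partial>M" and ?N = "\<integral>\<^sup>+x. e2ennreal (- f x) \<partial>M"
  show thesis
  proof (cases "?P = \<infinity>")
    case True
    thus ?thesis using top by (simp add: eintegral_def)
  next
    case P: False
    hence P': "?P < \<infinity>" by (simp add: top.not_eq_extremum)
    show ?thesis
    proof (cases "?N = \<infinity>")
      case True
      have "eintegral M f = - \<infinity>"
        using P' True unfolding eintegral_def by (cases ?P) auto
      thus ?thesis using bot P' True by simp
    next
      case N: False
      have a1: "AE x in M. e2ennreal (f x) \<noteq> \<infinity>" by (rule nn_integral_PInf_AE) (use P in auto)
      have a2: "AE x in M. e2ennreal (- f x) \<noteq> \<infinity>" by (rule nn_integral_PInf_AE) (use N in auto)
      have ae: "AE x in M. \<bar>f x\<bar> \<noteq> \<infinity>"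
        using a1 a2 by eventually_elim (auto simp: top_ereal_def)
      let ?g = "\<lambda>x. real_of_ereal (f x)"
      have p: "(\<integral>\<^sup>+x. ennreal (?g x) \<partial>M) = ?P"
        by (rule nn_integral_cong_AE) (use ae in eventually_elim, auto simp: ereal_real' e2ennreal_ereal[symmetric] simp del: e2ennreal_ereal)
      have n: "(\<integral>\<^sup>+x. ennreal (- ?g x) \<partial>M) = ?N"
        by (rule nn_integral_cong_AE) (use ae in eventually_elim, auto simp: ereal_real' e2ennreal_ereal[symmetric] uminus_ereal.simps(1)[symmetric] simp del: e2ennreal_ereal uminus_ereal.simps)
      have "integrable M ?g" using P N p n by (subst real_integrable_def) auto
      moreover have "eintegral M f = ereal (\<integral>x. ?g x \<partial>M)"
      proof -
        have "enn2ereal a = ereal (enn2real a)" if "a \<noteq> \<infinity>" for a using that by (cases a) auto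
        thus ?thesis unfolding eintegral_def real_lebesgue_integral_def[OF \<open>integrable M ?g\<close>] p n
          using P N by simp
      qed
      ultimately show ?thesis using real ae P' N by (simp add: top.not_eq_extremum)
    qed
  qed
qed

text \<open>Positive part of \<open>- log_dist\<close>, infinite on the diagonal. It carries the
  singularity, while the other part is governed by logarithmic moments.\<close>

definition kap :: "real \<Rightarrow> real \<Rightarrow> ennreal" where "kap x y = e2ennreal (- log_dist x y)"

lemma measurable_log_dist [measurable]:
  "(\<lambda>z. log_dist (fst z) (snd z)) \<in> borel_measurable (borel \<Otimes>\<^sub>M borel)"
  "(\<lambda>y. log_dist x y) \<in> borel_measurable borel"
  "(\<lambda>z. kap (fst z) (snd z)) \<in> borel_measurable (borel \<Otimes>\<^sub>M borel)"
  "(\<lambda>y. kap x y) \<in> borel_measurable borel"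
  unfolding log_dist_def kap_def by measurable

lemma real_log_dist: "real_of_ereal (log_dist x y) = ln \<bar>x - y\<bar>"
  by (simp add: log_dist_def)

lemma log_dist_finite_iff: "\<bar>log_dist x y\<bar> \<noteq> \<infinity> \<longleftrightarrow> x \<noteq> y"
  by (simp add: log_dist_def)

lemma ln_abs_le: "ln \<bar>x - y\<bar> \<le> ln (1 + \<bar>x\<bar>) + ln (1 + \<bar>y\<bar>)" for x y :: real
proof (cases "x = y")
  case False
  hence "ln \<bar>x - y\<bar> \<le> ln (1 + \<bar>x - y\<bar>)" by (subst ln_le_cancel_iff) auto
  thus ?thesis using ln_abs_diff_le[of x y] by linarith
qed (simp add: ln_ge_zero)

lemma pos_log_dist_le:
  "e2ennreal (log_dist x y) \<le> ennreal (ln (1 + \<bar>x\<bar>) + ln (1 + \<bar>y\<bar>))"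
proof (cases "x = y")
  case False
  thus ?thesis using ennreal_leI[OF ln_abs_le[of x y]] by (simp add: log_dist_def del: ennreal_plus)
qed (simp add: log_dist_def e2ennreal_neg)

lemma (in finite_borel_measure) pos_part_finite:
  assumes "log_int M"
  shows "(\<integral>\<^sup>+y. e2ennreal (log_dist x y) \<partial>M) < \<infinity>"
proof -
  have "(\<integral>\<^sup>+y. e2ennreal (log_dist x y) \<partial>M) \<le> (\<integral>\<^sup>+y. ennreal (ln (1 + \<bar>x\<bar>) + ln (1 + \<bar>y\<bar>)) \<partial>M)"
    by (intro nn_integral_mono pos_log_dist_le)
  also have "\<dots> < \<infinity>"
  proof -
    have "integrable M (\<lambda>y. ln (1 + \<bar>x\<bar>) + ln (1 + \<bar>y\<bar>))"
      using assms by (intro Bochner_Integration.integrable_add) (auto simp: log_int_def)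
    hence "(\<integral>\<^sup>+y. ennreal (norm (ln (1 + \<bar>x\<bar>) + ln (1 + \<bar>y\<bar>))) \<partial>M) < \<infinity>"
      by (simp only: integrable_iff_bounded)
    thus ?thesis by (simp add: ln_ge_zero)
  qed
  finally show ?thesis .
qed

text \<open>A logarithmic moment bounds the positive part of the integrand, so the potential can be
  infinite only downwards, through \<open>kap\<close>.\<close>

lemma (in finite_borel_measure) potential_cases:
  assumes "log_int M"
  obtains "log_potential M x = - \<infinity>" "(\<integral>\<^sup>+y. kap x y \<partial>M) = \<infinity>"
  | "(\<integral>\<^sup>+y. kap x y \<partial>M) < \<infinity>" "AE y in M. y \<noteq> x" "integrable M (\<lambda>y. ln \<bar>x - y\<bar>)"
    "log_potential M x = ereal (\<integral>y. ln \<bar>x - y\<bar> \<partial>M)"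
proof -
  have m: "log_dist x \<in> borel_measurable M" by measurable
  show thesis
  proof (cases rule: eintegral_cases[OF m])
    case 1
    thus ?thesis using pos_part_finite[OF assms, of x] by simp
  next
    case 2
    thus ?thesis using that by (simp add: log_potential_def kap_def)
  next
    case 3
    have "AE y in M. y \<noteq> x" using 3(3) by eventually_elim (auto simp: log_dist_finite_iff)
    thus ?thesis using 3 that(2) by (simp add: log_potential_def kap_def real_log_dist)
  qed
qed

text \<open>For \<open>|x - y| > 1\<close> one has \<open>1 + |y| \<le> (2 + |x|) * |x - y|\<close>,
  so the positive part of the logarithm inherits the divergence. Thus an upper bound for the
  potential at one single point already yields a logarithmic moment.\<close>

lemma (in finite_borel_measure) potential_not_log_int:
  assumes "\<not> log_int M"
  shows "log_potential M x = \<infinity>"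
proof -
  have "(\<lambda>y. ln (1 + \<bar>y\<bar>)) \<in> borel_measurable M" by measurable
  hence "(\<integral>\<^sup>+y. ennreal (norm (ln (1 + \<bar>y\<bar>))) \<partial>M) = \<infinity>"
    using assms unfolding log_int_def integrable_iff_bounded by (simp flip: top.not_eq_extremum)
  hence "\<infinity> = (\<integral>\<^sup>+y. ennreal (ln (1 + \<bar>y\<bar>)) \<partial>M)" by (simp add: ln_ge_zero)
  also have "\<dots> \<le> (\<integral>\<^sup>+y. ennreal (ln (2 + \<bar>x\<bar>)) + e2ennreal (log_dist x y) \<partial>M)"
  proof (rule nn_integral_mono)
    fix y :: real
    show "ennreal (ln (1 + \<bar>y\<bar>)) \<le> ennreal (ln (2 + \<bar>x\<bar>)) + e2ennreal (log_dist x y)"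
    proof (cases "\<bar>x - y\<bar> \<le> 1")
      case True
      hence "ln (1 + \<bar>y\<bar>) \<le> ln (2 + \<bar>x\<bar>)" by (subst ln_le_cancel_iff) auto
      thus ?thesis by (meson add_increasing2 ennreal_leI zero_le)
    next
      case False
      have "\<bar>y\<bar> \<le> \<bar>x\<bar> + \<bar>x - y\<bar>" by linarith
      moreover have "\<bar>x\<bar> \<le> \<bar>x\<bar> * \<bar>x - y\<bar>" using mult_left_mono[of 1 "\<bar>x - y\<bar>" "\<bar>x\<bar>"] False by simp
      ultimately have "1 + \<bar>y\<bar> \<le> (2 + \<bar>x\<bar>) * \<bar>x - y\<bar>"
        using False unfolding ring_distribs by linarith
      hence "ln (1 + \<bar>y\<bar>) \<le> ln ((2 + \<bar>x\<bar>) * \<bar>x - y\<bar>)" using False by (subst ln_le_cancel_iff) (auto intro!: mult_pos_pos)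
      also have "\<dots> = ln (2 + \<bar>x\<bar>) + ln \<bar>x - y\<bar>" using False by (subst ln_mult) auto
      finally have "ennreal (ln (1 + \<bar>y\<bar>)) \<le> ennreal (ln (2 + \<bar>x\<bar>) + ln \<bar>x - y\<bar>)" by (rule ennreal_leI)
      also have "\<dots> = ennreal (ln (2 + \<bar>x\<bar>)) + ennreal (ln \<bar>x - y\<bar>)"
        using False by (intro ennreal_plus) (auto intro!: ln_ge_zero)
      finally show ?thesis using False by (auto simp: log_dist_def)
    qed
  qed
  also have "\<dots> = ennreal (ln (2 + \<bar>x\<bar>)) * emeasure M (space M) + (\<integral>\<^sup>+y. e2ennreal (log_dist x y) \<partial>M)"
    by (subst nn_integral_add) auto
  finally have "(\<integral>\<^sup>+y. e2ennreal (log_dist x y) \<partial>M) = \<infinity>"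
    using emeasure_finite by (auto simp: top_unique ennreal_mult_eq_top_iff)
  moreover have "log_dist x \<in> borel_measurable M" by measurable
  ultimately show ?thesis by (simp add: log_potential_def eintegral_def)
qed

text \<open>The moments dispose of the positive part of the logarithm, so the \<open>kap\<close>
  integral is all that remains to be checked for a finite mutual energy.\<close>

lemma fin_pair_iff_kap:
  assumes "finite_borel_measure M" "finite_borel_measure N" "log_int M" "log_int N"
    and fin: "(\<integral>\<^sup>+z. kap (fst z) (snd z) \<partial>(M \<Otimes>\<^sub>M N)) < \<infinity>"
  shows "fin_pair M N" "log_energy M N = ereal (- mutual 0 M N)"
proof -
  interpret M: finite_borel_measure M by fact
  interpret N: finite_borel_measure N by fact
  interpret P: pair_sigma_finite M N ..
  note [measurable_cong] = M.M_is_borel N.M_is_borel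
  let ?f = "\<lambda>z. - log_dist (fst z) (snd z)"
  have m: "?f \<in> borel_measurable (M \<Otimes>\<^sub>M N)" by measurable
  have E: "log_energy M N = eintegral (M \<Otimes>\<^sub>M N) ?f" by (simp add: log_energy_def case_prod_unfold)
  have neg: "(\<integral>\<^sup>+z. e2ennreal (- ?f z) \<partial>(M \<Otimes>\<^sub>M N)) < \<infinity>"
  proof -
    have "(\<integral>\<^sup>+z. e2ennreal (- ?f z) \<partial>(M \<Otimes>\<^sub>M N)) \<le> (\<integral>\<^sup>+z. ennreal (norm (ln (1 + \<bar>fst z\<bar>) + ln (1 + \<bar>snd z\<bar>))) \<partial>(M \<Otimes>\<^sub>M N))"
      using pos_log_dist_le by (intro nn_integral_mono) (simp add: ln_ge_zero)
    also have "\<dots> < \<infinity>"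
      using integrable_pair_add[OF assms(1,2), of "\<lambda>x. ln (1 + \<bar>x\<bar>)" "\<lambda>x. ln (1 + \<bar>x\<bar>)"] assms(3,4)
      unfolding log_int_def integrable_iff_bounded by auto
    finally show ?thesis .
  qed
  have "fin_pair M N \<and> log_energy M N = ereal (- mutual 0 M N)"
  proof (cases rule: eintegral_cases[OF m])
    case 1
    with fin show ?thesis by (auto simp: kap_def)
  next
    case 2
    with neg show ?thesis by auto
  next
    case 3
    have "AE z in M \<Otimes>\<^sub>M N. fst z \<noteq> snd z" using 3(3) by eventually_elim (auto simp: log_dist_def)
    moreover have r: "real_of_ereal (?f z) = - ln \<bar>fst z - snd z\<bar>" for z by (simp add: real_log_dist)
    moreover have "integrable (M \<Otimes>\<^sub>M N) (\<lambda>z. ln \<bar>fst z - snd z\<bar>)"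
      using Bochner_Integration.integrable_minus[OF 3(4)] unfolding r by simp
    ultimately show ?thesis
      using 3(5) unfolding E r by (simp_all add: fin_pair_def mutual_def ker_0)
  qed
  thus "fin_pair M N" "log_energy M N = ereal (- mutual 0 M N)" by auto
qed

text \<open>Fubini: for almost every \<open>x\<close> the fibre avoids the diagonal, and there the
  extended-real potential is an ordinary integral.\<close>

lemma fin_pair_potential:
  assumes "finite_borel_measure M" "finite_borel_measure N" "log_int N" "fin_pair M N"
  shows "AE x in M. log_potential N x = ereal (real_of_ereal (log_potential N x))"
    and "has_bochner_integral M (\<lambda>x. real_of_ereal (log_potential N x)) (mutual 0 M N)"
proof -
  interpret M: finite_borel_measure M by fact
  interpret N: finite_borel_measure N by fact
  interpret P: pair_sigma_finite M N ..
  note [measurable_cong] = M.M_is_borel N.M_is_borel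
  have int: "integrable (M \<Otimes>\<^sub>M N) (\<lambda>(x, y). ln \<bar>x - y\<bar>)"
    and ne: "AE z in M \<Otimes>\<^sub>M N. fst z \<noteq> snd z"
    using assms(4) by (auto simp: fin_pair_def case_prod_unfold)
  have ae1: "AE x in M. integrable N (\<lambda>y. ln \<bar>x - y\<bar>)" using P.AE_integrable_fst[OF int] by simp
  have ae2: "AE x in M. AE y in N. x \<noteq> y" using P.AE_pair[OF ne] by simp
  have *: "AE x in M. log_potential N x = ereal (\<integral>y. ln \<bar>x - y\<bar> \<partial>N)"
    using ae1 ae2
  proof eventually_elim
    case (elim x)
    have "(\<integral>\<^sup>+y. kap x y \<partial>N) = (\<integral>\<^sup>+y. ennreal (- ln \<bar>x - y\<bar>) \<partial>N)"
      by (rule nn_integral_cong_AE) (use elim(2) in eventually_elim, simp add: kap_def log_dist_def)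
    also have "\<dots> < \<infinity>" using elim(1) by (simp add: real_integrable_def top.not_eq_extremum)
    finally show ?case by (cases rule: N.potential_cases[OF assms(3), of x]) auto
  qed
  show "AE x in M. log_potential N x = ereal (real_of_ereal (log_potential N x))"
    using * by eventually_elim simp
  have [measurable]: "(\<lambda>x. log_potential N x) \<in> borel_measurable M"
    unfolding log_potential_def eintegral_def by measurable
  have i: "integrable M (\<lambda>x. \<integral>y. ln \<bar>x - y\<bar> \<partial>N)" using P.integrable_fst[OF int] by simp
  have eq: "(\<integral>x. (\<integral>y. ln \<bar>x - y\<bar> \<partial>N) \<partial>M) = mutual 0 M N"
    using P.integral_fst[OF int] by (simp add: mutual_def ker_0 case_prod_unfold)
  have ae: "AE x in M. (\<integral>y. ln \<bar>x - y\<bar> \<partial>N) = real_of_ereal (log_potential N x)"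
    using * by eventually_elim simp
  have "has_bochner_integral M (\<lambda>x. \<integral>y. ln \<bar>x - y\<bar> \<partial>N) (mutual 0 M N)"
    using i eq by (simp add: has_bochner_integral_iff)
  thus "has_bochner_integral M (\<lambda>x. real_of_ereal (log_potential N x)) (mutual 0 M N)"
    by (subst has_bochner_integral_cong_AE[symmetric, OF _ _ ae]) auto
qed

lemma fin_pair_commute:
  assumes "finite_borel_measure M" "finite_borel_measure N" "fin_pair M N"
  shows "fin_pair N M" "mutual 0 N M = mutual 0 M N"
proof -
  interpret M: finite_borel_measure M by fact
  interpret N: finite_borel_measure N by fact
  interpret P: pair_sigma_finite M N ..
  interpret Q: pair_sigma_finite N M ..
  note [measurable_cong] = M.M_is_borel N.M_is_borel
  have int: "integrable (M \<Otimes>\<^sub>M N) (\<lambda>(x, y). ln \<bar>x - y\<bar>)"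
    and ne: "AE z in M \<Otimes>\<^sub>M N. fst z \<noteq> snd z"
    using assms(3) by (auto simp: fin_pair_def case_prod_unfold)
  have int': "integrable (N \<Otimes>\<^sub>M M) (\<lambda>z. ln \<bar>fst z - snd z\<bar>)"
    using P.integrable_product_swap[OF int] by (simp add: case_prod_unfold abs_minus_commute)
  have "AE z in N \<Otimes>\<^sub>M M. fst (case z of (x, y) \<Rightarrow> (y, x)) \<noteq> snd (case z of (x, y) \<Rightarrow> (y, x))"
    using ne by (subst (asm) P.distr_pair_swap) (subst (asm) AE_distr_iff, auto)
  hence "AE z in N \<Otimes>\<^sub>M M. fst z \<noteq> snd z" by eventually_elim auto
  with int' show "fin_pair N M" by (simp add: fin_pair_def)
  show "mutual 0 N M = mutual 0 M N"
    using P.integral_product_swap[of "\<lambda>(x, y). ln \<bar>x - y\<bar>"] int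
    by (simp add: mutual_def ker_0 case_prod_unfold abs_minus_commute borel_measurable_integrable)
qed

text \<open>\<open>kap x y\<close> is at most
  \<open>ln (1 + |x|) + ln (1 + |y|) - ln |x - y|\<close>, and a lower bound on the potential
  controls the integral of the last term. The bound grows only logarithmically in
  \<open>x\<close>.\<close>

lemma (in finite_borel_measure) kap_part_le:
  assumes "log_int M" "log_potential M x \<ge> ereal (- K)"
  shows "(\<integral>\<^sup>+y. kap x y \<partial>M) \<le> ennreal (measure M UNIV * ln (1 + \<bar>x\<bar>) + (\<integral>y. ln (1 + \<bar>y\<bar>) \<partial>M) + K)"
proof (cases rule: potential_cases[OF assms(1), of x])
  case 1
  thus ?thesis using assms(2) by simp
next
  case 2
  let ?u = "\<integral>y. ln \<bar>x - y\<bar> \<partial>M"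
  have K: "- K \<le> ?u" using assms(2) 2 by simp
  have li: "integrable M (\<lambda>y. ln (1 + \<bar>x\<bar>) + ln (1 + \<bar>y\<bar>) - ln \<bar>x - y\<bar>)"
    using assms(1) 2(3) by (intro Bochner_Integration.integrable_add Bochner_Integration.integrable_diff) (auto simp: log_int_def)
  have nn: "0 \<le> ln (1 + \<bar>x\<bar>) + ln (1 + \<bar>y\<bar>) - ln \<bar>x - y\<bar>" for y using ln_abs_le[of x y] by linarith
  have "(\<integral>\<^sup>+y. kap x y \<partial>M) \<le> (\<integral>\<^sup>+y. ennreal (ln (1 + \<bar>x\<bar>) + ln (1 + \<bar>y\<bar>) - ln \<bar>x - y\<bar>) \<partial>M)"
  proof (rule nn_integral_mono_AE)
    show "AE y in M. kap x y \<le> ennreal (ln (1 + \<bar>x\<bar>) + ln (1 + \<bar>y\<bar>) - ln \<bar>x - y\<bar>)"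
      using 2(2)
    proof eventually_elim
      case (elim y)
      hence "kap x y = ennreal (- ln \<bar>x - y\<bar>)" by (simp add: kap_def log_dist_def)
      also have "\<dots> \<le> ennreal (ln (1 + \<bar>x\<bar>) + ln (1 + \<bar>y\<bar>) - ln \<bar>x - y\<bar>)"
        using ln_ge_zero[of "1 + \<bar>x\<bar>"] ln_ge_zero[of "1 + \<bar>y\<bar>"] by (intro ennreal_leI) linarith
      finally show ?case .
    qed
  qed
  also have "\<dots> = ennreal (\<integral>y. ln (1 + \<bar>x\<bar>) + ln (1 + \<bar>y\<bar>) - ln \<bar>x - y\<bar> \<partial>M)"
    by (rule nn_integral_eq_integral[OF li]) (use nn in auto)
  also have "(\<integral>y. ln (1 + \<bar>x\<bar>) + ln (1 + \<bar>y\<bar>) - ln \<bar>x - y\<bar> \<partial>M) = measure M UNIV * ln (1 + \<bar>x\<bar>) + (\<integral>y. ln (1 + \<bar>y\<bar>) \<partial>M) - ?u"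
    using assms(1) 2(3) by (simp add: log_int_def)
  also have "ennreal \<dots> \<le> ennreal (measure M UNIV * ln (1 + \<bar>x\<bar>) + (\<integral>y. ln (1 + \<bar>y\<bar>) \<partial>M) + K)"
    using K by (intro ennreal_leI) linarith
  finally show ?thesis .
qed

text \<open>Integrates the previous bound against the logarithmic moment of \<open>M\<close>. A
  potential bounded below thus gives a finite mutual energy without further regularity of
  \<open>M\<close>.\<close>

lemma kap_pair_finite:
  assumes "finite_borel_measure M" "finite_borel_measure N" "log_int M" "log_int N"
    and "AE x in M. log_potential N x \<ge> ereal (- K)"
  shows "(\<integral>\<^sup>+z. kap (fst z) (snd z) \<partial>(M \<Otimes>\<^sub>M N)) < \<infinity>"
proof -
  interpret M: finite_borel_measure M by fact
  interpret N: finite_borel_measure N by fact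
  interpret P: pair_sigma_finite M N ..
  note [measurable_cong] = M.M_is_borel N.M_is_borel
  let ?c = "(\<integral>y. ln (1 + \<bar>y\<bar>) \<partial>N) + K"
  have "(\<integral>\<^sup>+z. kap (fst z) (snd z) \<partial>(M \<Otimes>\<^sub>M N)) = (\<integral>\<^sup>+x. (\<integral>\<^sup>+y. kap x y \<partial>N) \<partial>M)"
    by (subst N.nn_integral_fst[symmetric]) auto
  also have "\<dots> \<le> (\<integral>\<^sup>+x. ennreal (norm (measure N UNIV * ln (1 + \<bar>x\<bar>) + ?c)) \<partial>M)"
  proof (rule nn_integral_mono_AE)
    show "AE x in M. (\<integral>\<^sup>+y. kap x y \<partial>N) \<le> ennreal (norm (measure N UNIV * ln (1 + \<bar>x\<bar>) + ?c))"
      using assms(5)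
    proof eventually_elim
      case (elim x)
      show ?case using N.kap_part_le[OF assms(4) elim]
        by (rule order.trans) (auto intro!: ennreal_leI)
    qed
  qed
  also have "\<dots> < \<infinity>"
  proof -
    have "integrable M (\<lambda>x. measure N UNIV * ln (1 + \<bar>x\<bar>) + ?c)"
      using assms(3) by (intro Bochner_Integration.integrable_add) (auto simp: log_int_def)
    thus ?thesis by (simp only: integrable_iff_bounded)
  qed
  finally show ?thesis .
qed

text \<open>Across 0 the distance is at least \<open>|x|\<close> and at least \<open>|y|\<close>.
  With the reverse bound on one side of 0, this compares mixed energies with self-energies through
  the kernel \<open>min\<close>.\<close>

lemma kap_le_min:
  assumes "0 \<le> x" "y \<le> 0"
  shows "kap x y \<le> min (kap x 0) (kap y 0)"
proof (cases "x = y")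
  case False
  have "kap x y \<le> kap x 0"
    using assms False by (cases "x = 0") (auto simp: kap_def log_dist_def intro!: ennreal_leI)
  moreover have "kap x y \<le> kap y 0"
    using assms False by (cases "y = 0") (auto simp: kap_def log_dist_def intro!: ennreal_leI)
  ultimately show ?thesis by simp
qed (use assms in auto)

text \<open>On one side of 0 the distance is at most the larger of the two moduli.\<close>

lemma min_le_kap:
  assumes "0 \<le> x \<and> 0 \<le> y \<or> x \<le> 0 \<and> y \<le> 0"
  shows "min (kap x 0) (kap y 0) \<le> kap x y"
proof (cases "x = y")
  case True
  thus ?thesis by (simp add: kap_def log_dist_def)
next
  case False
  show ?thesis
  proof (cases "\<bar>x\<bar> \<le> \<bar>y\<bar>")
    case True
    hence "kap y 0 \<le> kap x y"
      using assms False by (cases "y = 0") (auto simp: kap_def log_dist_def intro!: ennreal_leI)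
    thus ?thesis by (simp add: min.coboundedI2)
  next
    case F: False
    hence "kap x 0 \<le> kap x y"
      using assms False by (cases "x = 0") (auto simp: kap_def log_dist_def intro!: ennreal_leI)
    thus ?thesis by (simp add: min.coboundedI1)
  qed
qed

lemma nn_integral_layer:
  "(\<integral>\<^sup>+t. indicator {t. 0 \<le> t \<and> ennreal t < a} t \<partial>lborel) = a"
proof (cases a)
  case (real r)
  hence "{t. 0 \<le> t \<and> ennreal t < a} = {0..<r}" by (auto simp: ennreal_less_iff)
  thus ?thesis using real by (simp add: emeasure_lborel_Ico)
next
  case top
  hence "{t. 0 \<le> t \<and> ennreal t < a} = {0..}" by (auto simp: ennreal_less_top)
  moreover have "emeasure lborel {0::real..} = \<infinity>"
  proof -
    have "\<infinity> = (SUP n::nat. ennreal (real n))" by (simp add: SUP_eqI ennreal_SUP_of_nat_eq_top[symmetric] flip: ennreal_of_nat_eq_real_of_nat)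
    also have "\<dots> \<le> emeasure lborel {0::real..}"
    proof (rule SUP_least)
      fix n :: nat
      have "ennreal (real n) = emeasure lborel {0..real n}" by simp
      also have "\<dots> \<le> emeasure lborel {0::real..}" by (rule emeasure_mono) auto
      finally show "ennreal (real n) \<le> emeasure lborel {0::real..}" .
    qed
    finally show ?thesis by (simp add: top_unique)
  qed
  ultimately show ?thesis using top by simp
qed

text \<open>Layer-cake form of \<open>min\<close>: under the integral in \<open>t\<close> the two
  variables separate, which exhibits \<open>min\<close> as a positive semidefinite kernel.\<close>

lemma min_kernel_pair:
  assumes "finite_borel_measure M" "finite_borel_measure N" and [measurable]: "u \<in> borel_measurable borel"
  shows "(\<integral>\<^sup>+x. (\<integral>\<^sup>+y. min (u x) (u y) \<partial>N) \<partial>M)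
    = (\<integral>\<^sup>+t. indicator {0..} t * (emeasure M {x. ennreal t < u x} * emeasure N {x. ennreal t < u x}) \<partial>lborel)"
proof -
  interpret M: finite_borel_measure M by fact
  interpret N: finite_borel_measure N by fact
  interpret P1: pair_sigma_finite M "lborel::real measure" ..
  interpret P2: pair_sigma_finite N "lborel::real measure" ..
  note [measurable_cong] = M.M_is_borel N.M_is_borel
  define f :: "real \<Rightarrow> real \<Rightarrow> real \<Rightarrow> ennreal" where
    "f x y t = indicator {0..} t * (indicator {x. ennreal t < u x} x * indicator {x. ennreal t < u x} y)" for x y t
  have f_alt: "f x y t = (if 0 \<le> t \<and> ennreal t < u x \<and> ennreal t < u y then 1 else 0)" for x y t
    by (auto simp: f_def)
  have f2: "(\<lambda>(y, t). f x y t) \<in> borel_measurable (N \<Otimes>\<^sub>M lborel)" for x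
    unfolding f_alt by measurable
  have f3: "(\<lambda>(x, t). \<integral>\<^sup>+y. f x y t \<partial>N) \<in> borel_measurable (M \<Otimes>\<^sub>M lborel)"
    unfolding f_alt case_prod_unfold by measurable
  have sl: "{x. ennreal t < u x} \<in> sets borel" for t by measurable
  have "(\<integral>\<^sup>+x. (\<integral>\<^sup>+y. min (u x) (u y) \<partial>N) \<partial>M) = (\<integral>\<^sup>+x. (\<integral>\<^sup>+y. (\<integral>\<^sup>+t. f x y t \<partial>lborel) \<partial>N) \<partial>M)"
  proof (intro nn_integral_cong)
    fix x y
    have "(\<integral>\<^sup>+t. f x y t \<partial>lborel) = (\<integral>\<^sup>+t. indicator {t. 0 \<le> t \<and> ennreal t < min (u x) (u y)} t \<partial>lborel)"
      by (intro nn_integral_cong) (auto simp: f_alt)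
    thus "min (u x) (u y) = (\<integral>\<^sup>+t. f x y t \<partial>lborel)" unfolding nn_integral_layer ..
  qed
  also have "\<dots> = (\<integral>\<^sup>+x. (\<integral>\<^sup>+t. (\<integral>\<^sup>+y. f x y t \<partial>N) \<partial>lborel) \<partial>M)"
    by (intro nn_integral_cong P2.Fubini'[symmetric] f2)
  also have "\<dots> = (\<integral>\<^sup>+t. (\<integral>\<^sup>+x. (\<integral>\<^sup>+y. f x y t \<partial>N) \<partial>M) \<partial>lborel)"
    by (intro P1.Fubini'[symmetric] f3)
  also have "\<dots> = (\<integral>\<^sup>+t. indicator {0..} t * (emeasure M {x. ennreal t < u x} * emeasure N {x. ennreal t < u x}) \<partial>lborel)"
    unfolding f_def using sl by (simp add: nn_integral_cmult nn_integral_multc M.M_is_borel N.M_is_borel mult_ac)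
  finally show ?thesis .
qed

text \<open>The kernel \<open>min (kap x 0) (kap y 0)\<close> lies above \<open>kap\<close> across 0
  and below it on either side. Level by level \<open>2 * a * b \<le> a * a + b * b\<close>, so the
  self-energies bound the mixed term.\<close>

lemma kap_pair_finite_of_diag:
  assumes "finite_borel_measure M" "finite_borel_measure N"
    and "AE x in M. 0 \<le> x" "AE x in N. x \<le> 0"
    and "(\<integral>\<^sup>+x. (\<integral>\<^sup>+y. kap x y \<partial>M) \<partial>M) < \<infinity>" "(\<integral>\<^sup>+x. (\<integral>\<^sup>+y. kap x y \<partial>N) \<partial>N) < \<infinity>"
  shows "(\<integral>\<^sup>+x. (\<integral>\<^sup>+y. kap x y \<partial>N) \<partial>M) < \<infinity>"
proof -
  interpret M: finite_borel_measure M by fact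
  interpret N: finite_borel_measure N by fact
  note [measurable_cong] = M.M_is_borel N.M_is_borel
  let ?u = "\<lambda>x. kap x 0"
  have um [measurable]: "?u \<in> borel_measurable borel" unfolding kap_def log_dist_def by measurable
  define m where "m K t = indicator {0..} t * (emeasure K {x. ennreal t < ?u x})" for K :: "real measure" and t :: real
  have mm: "(\<lambda>t. m K t) \<in> borel_measurable borel" if "finite_borel_measure K" for K
  proof -
    interpret K: finite_borel_measure K by fact
    note [measurable_cong] = K.M_is_borel
    have "(\<lambda>t. indicator {0..} t * (\<integral>\<^sup>+x. (if ennreal t < ?u x then 1 else 0) \<partial>K)) \<in> borel_measurable borel"
      by measurable
    moreover have "(\<integral>\<^sup>+x. (if ennreal t < ?u x then 1 else 0) \<partial>K) = emeasure K {x. ennreal t < ?u x}" for t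
    proof -
      have "{x. ennreal t < ?u x} \<in> sets K" by measurable
      moreover have "(\<integral>\<^sup>+x. (if ennreal t < ?u x then 1 else 0) \<partial>K) = (\<integral>\<^sup>+x. indicator {x. ennreal t < ?u x} x \<partial>K)"
        by (intro nn_integral_cong) auto
      ultimately show ?thesis by simp
    qed
    ultimately show ?thesis unfolding m_def by simp
  qed
  have int: "(\<integral>\<^sup>+x. (\<integral>\<^sup>+y. min (?u x) (?u y) \<partial>L) \<partial>K) = (\<integral>\<^sup>+t. m K t * m L t \<partial>lborel)"
    if "finite_borel_measure K" "finite_borel_measure L" for K L
    unfolding min_kernel_pair[OF that um] m_def by (intro nn_integral_cong) (auto simp: indicator_def)
  have le: "2 * (a * b) \<le> a * a + b * b" if ab: "a \<noteq> \<infinity>" "b \<noteq> \<infinity>" for a b :: ennreal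
  proof -
    obtain r s where rs: "a = ennreal r" "b = ennreal s" "0 \<le> r" "0 \<le> s" using ab by (cases a; cases b) auto
    have "2 * (r * s) \<le> r * r + s * s" using zero_le_power2[of "r - s"] by (simp add: power2_eq_square algebra_simps)
    hence "ennreal (2 * (r * s)) \<le> ennreal (r * r + s * s)" by (rule ennreal_leI)
    thus ?thesis using rs by (simp add: ennreal_mult)
  qed
  have fin: "m K t \<noteq> \<infinity>" if "finite_borel_measure K" for K t
  proof -
    interpret K: finite_borel_measure K by fact
    show ?thesis using K.emeasure_finite by (auto simp: m_def indicator_def)
  qed
  have "2 * (\<integral>\<^sup>+x. (\<integral>\<^sup>+y. kap x y \<partial>N) \<partial>M) \<le> 2 * (\<integral>\<^sup>+x. (\<integral>\<^sup>+y. min (?u x) (?u y) \<partial>N) \<partial>M)"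
  proof (intro mult_left_mono nn_integral_mono_AE)
    show "AE x in M. (\<integral>\<^sup>+y. kap x y \<partial>N) \<le> (\<integral>\<^sup>+y. min (?u x) (?u y) \<partial>N)"
      using assms(3)
    proof eventually_elim
      case (elim x)
      show ?case by (rule nn_integral_mono_AE, rule eventually_mono[OF assms(4)]) (use elim in \<open>intro kap_le_min; simp\<close>)
    qed
  qed auto
  also have "\<dots> = (\<integral>\<^sup>+t. 2 * (m M t * m N t) \<partial>lborel)"
    unfolding int[OF assms(1,2)] using mm assms(1,2) by (subst nn_integral_cmult) auto
  also have "\<dots> \<le> (\<integral>\<^sup>+t. m M t * m M t + m N t * m N t \<partial>lborel)"
    using fin assms(1,2) by (intro nn_integral_mono le) auto
  also have "\<dots> = (\<integral>\<^sup>+t. m M t * m M t \<partial>lborel) + (\<integral>\<^sup>+t. m N t * m N t \<partial>lborel)"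
    using mm assms(1,2) by (subst nn_integral_add) auto
  also have "\<dots> = (\<integral>\<^sup>+x. (\<integral>\<^sup>+y. min (?u x) (?u y) \<partial>M) \<partial>M) + (\<integral>\<^sup>+x. (\<integral>\<^sup>+y. min (?u x) (?u y) \<partial>N) \<partial>N)"
    by (simp only: int assms)
  also have "\<dots> \<le> (\<integral>\<^sup>+x. (\<integral>\<^sup>+y. kap x y \<partial>M) \<partial>M) + (\<integral>\<^sup>+x. (\<integral>\<^sup>+y. kap x y \<partial>N) \<partial>N)"
  proof (intro add_mono nn_integral_mono_AE)
    show "AE x in M. (\<integral>\<^sup>+y. min (?u x) (?u y) \<partial>M) \<le> (\<integral>\<^sup>+y. kap x y \<partial>M)"
      using assms(3)
    proof eventually_elim
      case (elim x)
      show ?case by (rule nn_integral_mono_AE, rule eventually_mono[OF assms(3)]) (use elim in \<open>intro min_le_kap; simp\<close>)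
    qed
    show "AE x in N. (\<integral>\<^sup>+y. min (?u x) (?u y) \<partial>N) \<le> (\<integral>\<^sup>+y. kap x y \<partial>N)"
      using assms(4)
    proof eventually_elim
      case (elim x)
      show ?case by (rule nn_integral_mono_AE, rule eventually_mono[OF assms(4)]) (use elim in \<open>intro min_le_kap; simp\<close>)
    qed
  qed
  also have "\<dots> < \<infinity>" using assms(5,6) by (simp add: less_top)
  finally have "2 * (\<integral>\<^sup>+x. (\<integral>\<^sup>+y. kap x y \<partial>N) \<partial>M) < \<infinity>" .
  thus ?thesis by (auto simp: ennreal_mult_less_top)
qed

text \<open>As \<open>|x| \<le> |x - y|\<close> almost surely, the positive part of the mixed
  logarithm dominates that of \<open>ln |x|\<close>, and \<open>ln (1 + |x|)\<close> exceeds the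
  latter by at most \<open>ln 2\<close>.\<close>

lemma log_int_of_pos_part:
  assumes M: "finite_borel_measure M" "finite_borel_measure N" and c: "measure N UNIV > 0"
    and fin: "(\<integral>\<^sup>+x. (\<integral>\<^sup>+y. e2ennreal (log_dist x y) \<partial>N) \<partial>M) < \<infinity>"
    and le: "AE x in M. AE y in N. \<bar>x\<bar> \<le> \<bar>x - y\<bar>"
  shows "log_int M"
proof -
  interpret M: finite_borel_measure M by fact
  interpret N: finite_borel_measure N by fact
  note [measurable_cong] = M.M_is_borel N.M_is_borel
  have "(\<integral>\<^sup>+x. ennreal (ln \<bar>x\<bar>) \<partial>M) * emeasure N UNIV = (\<integral>\<^sup>+x. (\<integral>\<^sup>+y. ennreal (ln \<bar>x\<bar>) \<partial>N) \<partial>M)"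
    by (simp add: nn_integral_multc)
  also have "\<dots> \<le> (\<integral>\<^sup>+x. (\<integral>\<^sup>+y. e2ennreal (log_dist x y) \<partial>N) \<partial>M)"
  proof (rule nn_integral_mono_AE)
    show "AE x in M. (\<integral>\<^sup>+y. ennreal (ln \<bar>x\<bar>) \<partial>N) \<le> (\<integral>\<^sup>+y. e2ennreal (log_dist x y) \<partial>N)"
      using le
    proof eventually_elim
      case (elim x)
      show ?case
      proof (rule nn_integral_mono_AE)
        show "AE y in N. ennreal (ln \<bar>x\<bar>) \<le> e2ennreal (log_dist x y)"
          using elim
        proof eventually_elim
          case (elim y)
          show ?case
          proof (cases "x = 0")
            case False
            hence "ln \<bar>x\<bar> \<le> ln \<bar>x - y\<bar>" "x \<noteq> y" using elim by auto
            thus ?thesis by (simp add: log_dist_def ennreal_leI)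
          qed simp
        qed
      qed
    qed
  qed
  finally have "(\<integral>\<^sup>+x. ennreal (ln \<bar>x\<bar>) \<partial>M) * emeasure N UNIV < \<infinity>" using fin by (rule order.strict_trans1)
  hence f1: "(\<integral>\<^sup>+x. ennreal (ln \<bar>x\<bar>) \<partial>M) < \<infinity>"
    using c by (auto simp: ennreal_mult_less_top N.emeasure_eq_measure)
  have "(\<integral>\<^sup>+x. ennreal (norm (ln (1 + \<bar>x\<bar>))) \<partial>M) \<le> (\<integral>\<^sup>+x. ennreal (ln 2) + ennreal (ln \<bar>x\<bar>) \<partial>M)"
  proof (rule nn_integral_mono)
    fix x :: real
    show "ennreal (norm (ln (1 + \<bar>x\<bar>))) \<le> ennreal (ln 2) + ennreal (ln \<bar>x\<bar>)"
    proof (cases "\<bar>x\<bar> \<le> 1")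
      case True
      hence "ln (1 + \<bar>x\<bar>) \<le> ln 2" by (subst ln_le_cancel_iff) auto
      hence "ennreal (norm (ln (1 + \<bar>x\<bar>))) \<le> ennreal (ln 2)" by (intro ennreal_leI) (simp add: ln_ge_zero)
      thus ?thesis by (rule order.trans) simp
    next
      case False
      hence "ln (1 + \<bar>x\<bar>) \<le> ln (2 * \<bar>x\<bar>)" by (subst ln_le_cancel_iff) auto
      also have "\<dots> = ln 2 + ln \<bar>x\<bar>" using False by (subst ln_mult) auto
      finally have "ennreal (norm (ln (1 + \<bar>x\<bar>))) \<le> ennreal (ln 2 + ln \<bar>x\<bar>)"
        by (intro ennreal_leI) (simp add: ln_ge_zero)
      also have "\<dots> = ennreal (ln 2) + ennreal (ln \<bar>x\<bar>)" using False by (intro ennreal_plus) auto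
      finally show ?thesis .
    qed
  qed
  also have "\<dots> < \<infinity>" using f1 M.emeasure_finite
    by (subst nn_integral_add) (auto simp: ennreal_mult_less_top M.emeasure_eq_measure)
  finally show ?thesis by (simp add: log_int_def integrable_iff_bounded)
qed

lemma admissibleD:
  assumes "admissible (M, N)"
  shows "finite_borel_measure M" "finite_borel_measure N" "measure M UNIV = 1" "measure N UNIV = 1/2"
    "AE x in M. x \<in> supp M \<and> 0 \<le> x" "AE x in N. x \<in> supp N \<and> x \<le> 0"
    "sets M = sets borel" "sets N = sets borel"
proof -
  have a: "sets M = sets borel" "supp M \<subseteq> {0..}" "emeasure M UNIV = 1"
     "sets N = sets borel" "supp N \<subseteq> {..0}" "emeasure N UNIV = ennreal (1 / 2)"
    using assms by (auto simp: admissible_def)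
  thus "sets M = sets borel" "sets N = sets borel" by auto
  have sp: "space M = UNIV" "space N = UNIV" using a by (auto dest: sets_eq_imp_space_eq)
  show "finite_borel_measure M" "finite_borel_measure N"
    using a sp by (auto simp: finite_borel_measure_def finite_borel_measure_axioms_def intro!: finite_measureI)
  show "measure M UNIV = 1" "measure N UNIV = 1/2" unfolding Sigma_Algebra.measure_def a(3) a(6) by (simp, subst enn2real_ennreal, auto)
  show "AE x in M. x \<in> supp M \<and> 0 \<le> x" "AE x in N. x \<in> supp N \<and> x \<le> 0"
    using AE_supp[OF a(1)] AE_supp[OF a(4)] a(2,5) by (auto elim!: eventually_mono)
qed

lemma ereal_plus_neq_PInfty: "a + b \<noteq> \<infinity> \<Longrightarrow> a \<noteq> \<infinity> \<and> b \<noteq> (\<infinity>::ereal)"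
  by (cases a; cases b) auto

lemma ereal_minus_neq_PInfty: "a - b \<noteq> \<infinity> \<Longrightarrow> a \<noteq> \<infinity> \<and> b \<noteq> (- \<infinity>::ereal)"
  by (cases a; cases b) auto

text \<open>In \<open>ereal\<close> a sum is infinite as soon as one summand is, whatever the others
  are, so a value other than infinity excludes this for every summand. Everything else follows from
  the separation of the supports by 0.\<close>

lemma energy_finiteD:
  assumes adm: "admissible (M, N)" and fin: "energy z \<xi> (M, N) \<noteq> \<infinity>" and xi: "\<xi> > 0"
  shows "log_int M" "log_int N" "fin_pair M M" "fin_pair N N" "fin_pair M N"
    "log_energy M M = ereal (- mutual 0 M M)" "log_energy N N = ereal (- mutual 0 N N)" "log_energy M N = ereal (- mutual 0 M N)"
    "(\<integral>\<^sup>+x. potential_V z 1 x \<partial>M) < \<infinity>" "(\<integral>\<^sup>+x. potential_V z 2 x \<partial>N) < \<infinity>"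
proof -
  note A = admissibleD[OF adm]
  interpret M: finite_borel_measure M by fact
  interpret N: finite_borel_measure N by fact
  note [measurable_cong] = M.M_is_borel N.M_is_borel
  let ?a = "log_energy M M" and ?b = "log_energy N N" and ?c = "log_energy M N"
  let ?d = "ereal (1 / \<xi>) * enn2ereal (\<integral>\<^sup>+x. potential_V z 1 x \<partial>M)"
  let ?e = "ereal (1 / \<xi>) * enn2ereal (\<integral>\<^sup>+x. potential_V z 2 x \<partial>N)"
  have ne: "?a \<noteq> \<infinity>" "?b \<noteq> \<infinity>" "?c \<noteq> - \<infinity>" "?d \<noteq> \<infinity>" "?e \<noteq> \<infinity>"
    using fin unfolding energy_def by (auto dest!: ereal_plus_neq_PInfty ereal_minus_neq_PInfty)
  have m: "(\<lambda>z. - log_dist (fst z) (snd z)) \<in> borel_measurable (K \<Otimes>\<^sub>M L)"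
    if "finite_borel_measure K" "finite_borel_measure L" for K L
  proof -
    note [measurable_cong] = finite_borel_measure.M_is_borel[OF that(1)] finite_borel_measure.M_is_borel[OF that(2)]
    show ?thesis by measurable
  qed
  have it: "(\<integral>\<^sup>+z. f (fst z) (snd z) \<partial>(K \<Otimes>\<^sub>M L)) = (\<integral>\<^sup>+x. (\<integral>\<^sup>+y. f x y \<partial>L) \<partial>K)"
    if "finite_borel_measure K" "finite_borel_measure L" "(\<lambda>z. f (fst z) (snd z)) \<in> borel_measurable (borel \<Otimes>\<^sub>M borel)"
    for f :: "real \<Rightarrow> real \<Rightarrow> ennreal" and K L
  proof -
    interpret L: finite_borel_measure L by fact
    note [measurable_cong] = finite_borel_measure.M_is_borel[OF that(1)] finite_borel_measure.M_is_borel[OF that(2)]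
    note that(3)[measurable]
    show ?thesis by (subst L.nn_integral_fst[symmetric]) auto
  qed
  have E: "log_energy K L = eintegral (K \<Otimes>\<^sub>M L) (\<lambda>z. - log_dist (fst z) (snd z))" for K L
    by (simp add: log_energy_def case_prod_unfold)
  have k: "(\<integral>\<^sup>+z. kap (fst z) (snd z) \<partial>(K \<Otimes>\<^sub>M K)) < \<infinity>" if "finite_borel_measure K" "log_energy K K \<noteq> \<infinity>" for K
    by (cases rule: eintegral_cases[OF m[OF that(1,1)]]) (use that(2) in \<open>auto simp: E kap_def\<close>)
  have kMM: "(\<integral>\<^sup>+z. kap (fst z) (snd z) \<partial>(M \<Otimes>\<^sub>M M)) < \<infinity>" and kNN: "(\<integral>\<^sup>+z. kap (fst z) (snd z) \<partial>(N \<Otimes>\<^sub>M N)) < \<infinity>"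
    using k A ne by auto
  \<comment> \<open>The mixed term enters with a minus sign, so finiteness of the sum says nothing
    about its singular part; the self-energies have to control it.\<close>
  have kMN: "(\<integral>\<^sup>+z. kap (fst z) (snd z) \<partial>(M \<Otimes>\<^sub>M N)) < \<infinity>"
    unfolding it[OF A(1,2) measurable_log_dist(3)]
  proof (rule kap_pair_finite_of_diag)
    show "AE x in M. 0 \<le> x" "AE x in N. x \<le> 0" using A(5,6) by auto
    show "(\<integral>\<^sup>+x. (\<integral>\<^sup>+y. kap x y \<partial>M) \<partial>M) < \<infinity>" "(\<integral>\<^sup>+x. (\<integral>\<^sup>+y. kap x y \<partial>N) \<partial>N) < \<infinity>"
      using kMM kNN it[OF A(1,1) measurable_log_dist(3)] it[OF A(2,2) measurable_log_dist(3)] by auto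
  qed fact+
  have lm: "(\<lambda>z. e2ennreal (log_dist (fst z) (snd z))) \<in> borel_measurable (borel \<Otimes>\<^sub>M borel)" by measurable
  \<comment> \<open>With the \<open>kap\<close> part finite, a mixed energy above minus infinity has
    a finite part from large distances, and the separation by 0 turns that into moments of both
    measures.\<close>
  have "(\<integral>\<^sup>+z. e2ennreal (- (- log_dist (fst z) (snd z))) \<partial>(M \<Otimes>\<^sub>M N)) < \<infinity>"
    by (cases rule: eintegral_cases[OF m[OF A(1,2)]]) (use kMN ne(3) in \<open>auto simp: E kap_def\<close>)
  hence pf: "(\<integral>\<^sup>+z. e2ennreal (log_dist (fst z) (snd z)) \<partial>(M \<Otimes>\<^sub>M N)) < \<infinity>" by simp
  hence p1: "(\<integral>\<^sup>+x. (\<integral>\<^sup>+y. e2ennreal (log_dist x y) \<partial>N) \<partial>M) < \<infinity>"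
    using it[OF A(1,2) lm] by simp
  have [measurable]: "(\<lambda>z. e2ennreal (log_dist (fst z) (snd z))) \<in> borel_measurable (M \<Otimes>\<^sub>M N)" by measurable
  interpret P: pair_sigma_finite M N ..
  have p2: "(\<integral>\<^sup>+y. (\<integral>\<^sup>+x. e2ennreal (log_dist y x) \<partial>M) \<partial>N) < \<infinity>"
  proof -
    have sym: "log_dist x y = log_dist y x" for x y by (auto simp: log_dist_def abs_minus_commute)
    have "(\<integral>\<^sup>+y. (\<integral>\<^sup>+x. e2ennreal (log_dist x y) \<partial>M) \<partial>N) = (\<integral>\<^sup>+x. (\<integral>\<^sup>+y. e2ennreal (log_dist x y) \<partial>N) \<partial>M)"
      by (rule P.Fubini') (simp add: case_prod_unfold)
    thus ?thesis using p1 by (simp add: sym)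
  qed
  have ae: "AE x in M. AE y in N. \<bar>x\<bar> \<le> \<bar>x - y\<bar>"
    using A(5)
  proof eventually_elim
    case (elim x)
    show ?case using A(6) by eventually_elim (use elim in auto)
  qed
  have ae': "AE y in N. AE x in M. \<bar>y\<bar> \<le> \<bar>y - x\<bar>"
    using A(6)
  proof eventually_elim
    case (elim x)
    show ?case using A(5) by eventually_elim (use elim in auto)
  qed
  show li: "log_int M" "log_int N"
    using log_int_of_pos_part[OF A(1,2) _ p1 ae] log_int_of_pos_part[OF A(2,1) _ p2 ae'] A by auto
  show "fin_pair M M" "fin_pair N N" "fin_pair M N"
    "log_energy M M = ereal (- mutual 0 M M)" "log_energy N N = ereal (- mutual 0 N N)" "log_energy M N = ereal (- mutual 0 M N)"
    using fin_pair_iff_kap kMM kNN kMN A li by auto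
  show "(\<integral>\<^sup>+x. potential_V z 1 x \<partial>M) < \<infinity>" "(\<integral>\<^sup>+x. potential_V z 2 x \<partial>N) < \<infinity>"
    using ne(4,5) xi by (auto simp: less_top)
qed

section \<open>Variational conditions integrated against measures\<close>

lemma ereal_combination:
  assumes "v \<noteq> \<infinity>"
  shows "2 * ereal a - ereal b - ereal c * enn2ereal v = ereal (2 * a - b - c * enn2real v)"
  using assms by (cases v) auto

lemma has_bochner_integral_mono_AE:
  fixes f g :: "'a \<Rightarrow> real"
  assumes "has_bochner_integral M f a" "has_bochner_integral M g b" "AE x in M. f x \<le> g x"
  shows "a \<le> b"
  using assms integral_mono_AE[of M f g] by (simp add: has_bochner_integral_iff)

lemma side_le:
  assumes fb: "finite_borel_measure K" "finite_borel_measure M" "finite_borel_measure N"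
    and li: "log_int M" "log_int N" and fp: "fin_pair K M" "fin_pair K N"
    and V: "V \<in> borel_measurable borel" "(\<integral>\<^sup>+x. V x \<partial>K) < \<infinity>"
    and ae: "AE x in K. 2 * log_potential M x - log_potential N x - ereal c * enn2ereal (V x) \<le> ereal l"
  shows "2 * mutual 0 K M - mutual 0 K N - c * (\<integral>x. enn2real (V x) \<partial>K) \<le> l * measure K UNIV"
    "has_bochner_integral K (\<lambda>x. enn2real (V x)) (\<integral>x. enn2real (V x) \<partial>K)"
    "(\<integral>\<^sup>+x. V x \<partial>K) = ennreal (\<integral>x. enn2real (V x) \<partial>K)"
proof -
  interpret K: finite_borel_measure K by fact
  have [measurable]: "V \<in> borel_measurable K" using V(1) K.M_is_borel by (simp cong: measurable_cong_sets)
  have Vf: "AE x in K. V x \<noteq> \<infinity>" by (rule nn_integral_PInf_AE) (use V in auto)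
  have eq: "(\<integral>\<^sup>+x. ennreal (enn2real (V x)) \<partial>K) = (\<integral>\<^sup>+x. V x \<partial>K)"
    by (rule nn_integral_cong_AE) (use Vf in eventually_elim, auto simp: less_top)
  have iV: "integrable K (\<lambda>x. enn2real (V x))"
    by (rule integrableI_bounded) (use eq V in auto)
  thus hb: "has_bochner_integral K (\<lambda>x. enn2real (V x)) (\<integral>x. enn2real (V x) \<partial>K)" by (rule has_bochner_integral_integrable)
  show "(\<integral>\<^sup>+x. V x \<partial>K) = ennreal (\<integral>x. enn2real (V x) \<partial>K)"
    unfolding eq[symmetric] by (rule nn_integral_eq_integral[OF iV]) auto
  note pM = fin_pair_potential[OF fb(1,2) li(1) fp(1)] and pN = fin_pair_potential[OF fb(1,3) li(2) fp(2)]
  have h1: "has_bochner_integral K (\<lambda>x. 2 * real_of_ereal (log_potential M x) - real_of_ereal (log_potential N x) - c * enn2real (V x))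
     (2 * mutual 0 K M - mutual 0 K N - c * (\<integral>x. enn2real (V x) \<partial>K))"
    by (intro has_bochner_integral_diff has_bochner_integral_mult_right pM pN hb)
  have h2: "AE x in K. 2 * real_of_ereal (log_potential M x) - real_of_ereal (log_potential N x) - c * enn2real (V x) \<le> l"
    using ae pM(1) pN(1) Vf
  proof eventually_elim
    case (elim x)
    from elim(1) show ?case unfolding elim(2)[symmetric] elim(3)[symmetric]
      by (subst (asm) elim(2), subst (asm) elim(3), subst (asm) ereal_combination[OF elim(4)]) simp
  qed
  have h3: "has_bochner_integral K (\<lambda>x. l) (l * measure K UNIV)"
    using has_bochner_integral_integrable[OF K.integrable_const[of l]] by (simp add: mult.commute)
  show "2 * mutual 0 K M - mutual 0 K N - c * (\<integral>x. enn2real (V x) \<partial>K) \<le> l * measure K UNIV"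
    by (rule has_bochner_integral_mono_AE[OF h1 h3 h2])
qed

text \<open>Both potentials are \<open>M\<close>-integrable, so the equality expresses
  \<open>V\<close> through them almost everywhere; its finiteness and integrability come out as a
  result.\<close>

lemma side_eq:
  assumes fb: "finite_borel_measure M" "finite_borel_measure N"
    and li: "log_int M" "log_int N" and fp: "fin_pair M M" "fin_pair M N"
    and V: "V \<in> borel_measurable borel" and c: "c > 0"
    and ae: "AE x in M. 2 * log_potential M x - log_potential N x - ereal c * enn2ereal (V x) = ereal l"
  shows "(\<integral>\<^sup>+x. V x \<partial>M) < \<infinity>"
    "2 * mutual 0 M M - mutual 0 M N - c * (\<integral>x. enn2real (V x) \<partial>M) = l * measure M UNIV"
proof -
  interpret M: finite_borel_measure M by fact
  have [measurable]: "V \<in> borel_measurable M" using V M.M_is_borel by (simp cong: measurable_cong_sets)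
  note pM = fin_pair_potential[OF fb(1,1) li(1) fp(1)] and pN = fin_pair_potential[OF fb(1,2) li(2) fp(2)]
  have Vf: "AE x in M. V x \<noteq> \<infinity>"
    using ae pM(1) pN(1)
  proof eventually_elim
    case (elim x)
    show ?case
    proof
      assume "V x = \<infinity>"
      hence "ereal c * enn2ereal (V x) = \<infinity>" using c by simp
      hence "2 * log_potential M x - log_potential N x - \<infinity> = ereal l" using elim(1) by simp
      thus False by (subst (asm) elim(2), subst (asm) elim(3)) simp
    qed
  qed
  let ?g = "\<lambda>x. (2 * real_of_ereal (log_potential M x) - real_of_ereal (log_potential N x) - l) / c"
  have hl: "has_bochner_integral M (\<lambda>x. l) (l * measure M UNIV)"
    using has_bochner_integral_integrable[OF M.integrable_const[of l]] by (simp add: mult.commute)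
  have hg: "has_bochner_integral M ?g ((2 * mutual 0 M M - mutual 0 M N - l * measure M UNIV) / c)"
    by (intro has_bochner_integral_divide_zero has_bochner_integral_diff has_bochner_integral_mult_right pM pN hl)
  have eq: "AE x in M. ?g x = enn2real (V x)"
    using ae pM(1) pN(1) Vf
  proof eventually_elim
    case (elim x)
    have "2 * real_of_ereal (log_potential M x) - real_of_ereal (log_potential N x) - c * enn2real (V x) = l"
      using elim(1) by (subst (asm) elim(2), subst (asm) elim(3), subst (asm) ereal_combination[OF elim(4)]) simp
    thus ?case using c by (simp add: field_simps)
  qed
  have hv: "has_bochner_integral M (\<lambda>x. enn2real (V x)) ((2 * mutual 0 M M - mutual 0 M N - l * measure M UNIV) / c)"
    by (subst has_bochner_integral_cong_AE[OF _ _ eq, symmetric]) (use hg in \<open>auto simp: has_bochner_integral_iff\<close>)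
  have "(\<integral>\<^sup>+x. V x \<partial>M) = (\<integral>\<^sup>+x. ennreal (enn2real (V x)) \<partial>M)"
    by (rule nn_integral_cong_AE) (use Vf in eventually_elim, auto simp: less_top)
  also have "\<dots> < \<infinity>"
    using hv by (subst nn_integral_eq_integral) (auto simp: has_bochner_integral_iff)
  finally show "(\<integral>\<^sup>+x. V x \<partial>M) < \<infinity>" .
  show "2 * mutual 0 M M - mutual 0 M N - c * (\<integral>x. enn2real (V x) \<partial>M) = l * measure M UNIV"
    using hv c by (simp add: has_bochner_integral_iff)
qed

text \<open>For a point on the other side of 0 the logarithm increases when 0 is replaced by
  \<open>x\<close>. One finite value at 0 therefore bounds the potential below on the whole opposite
  half-line.\<close>

lemma potential_ge_at_0:
  assumes "finite_borel_measure N" "log_int N" "log_potential N 0 \<noteq> - \<infinity>" "AE y in N. \<bar>y\<bar> \<le> \<bar>x - y\<bar>"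
  shows "log_potential N x \<ge> log_potential N 0" "\<bar>log_potential N 0\<bar> \<noteq> \<infinity>" "log_potential N x \<noteq> \<infinity>"
proof -
  interpret N: finite_borel_measure N by fact
  have c0: "(\<integral>\<^sup>+y. kap 0 y \<partial>N) < \<infinity>" "AE y in N. y \<noteq> 0" "integrable N (\<lambda>y. ln \<bar>0 - y\<bar>)"
    "log_potential N 0 = ereal (\<integral>y. ln \<bar>0 - y\<bar> \<partial>N)"
    by (cases rule: N.potential_cases[OF assms(2), of 0]; use assms(3) in simp)+
  show "\<bar>log_potential N 0\<bar> \<noteq> \<infinity>" using c0(4) by simp
  have "(\<integral>\<^sup>+y. kap x y \<partial>N) \<le> (\<integral>\<^sup>+y. kap 0 y \<partial>N)"
  proof (rule nn_integral_mono_AE)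
    show "AE y in N. kap x y \<le> kap 0 y"
      using assms(4) c0(2)
    proof eventually_elim
      case (elim y)
      thus ?case by (auto simp: kap_def log_dist_def intro!: ennreal_leI)
    qed
  qed
  hence "(\<integral>\<^sup>+y. kap x y \<partial>N) < \<infinity>" using c0(1) by (rule order.strict_trans1)
  hence cx: "integrable N (\<lambda>y. ln \<bar>x - y\<bar>)" "log_potential N x = ereal (\<integral>y. ln \<bar>x - y\<bar> \<partial>N)"
    by (cases rule: N.potential_cases[OF assms(2), of x]; simp)+
  show "log_potential N x \<noteq> \<infinity>" using cx by simp
  have "AE y in N. ln \<bar>0 - y\<bar> \<le> ln \<bar>x - y\<bar>"
    using assms(4) c0(2)
  proof eventually_elim
    case (elim y)
    hence "0 < \<bar>0 - y\<bar>" "\<bar>0 - y\<bar> \<le> \<bar>x - y\<bar>" by auto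
    thus ?case by (subst ln_le_cancel_iff) auto
  qed
  thus "log_potential N x \<ge> log_potential N 0"
    unfolding c0(4) cx(2) ereal_less_eq by (intro integral_mono_AE c0 cx)
qed

text \<open>\<open>c V\<close> is nonnegative, so the equality gives
  \<open>2 * a \<ge> l + b\<close>: a lower bound on the other potential becomes one on
  \<open>a\<close>.\<close>

lemma ereal_combination_ge:
  assumes "2 * a - b - ereal c * enn2ereal v = ereal l" "b \<ge> ereal u" "b \<noteq> \<infinity>" "c > 0"
  shows "a \<ge> ereal ((l + u) / 2)"
proof -
  obtain r where r: "b = ereal r" "r \<ge> u" using assms(2,3) by (cases b) auto
  show ?thesis
  proof (cases v)
    case top
    thus ?thesis using assms r by (cases a) auto
  next
    case (real w)
    have "c * w \<ge> 0" using real assms(4) by simp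
    hence "u - c * w \<le> r" using r(2) by linarith
    thus ?thesis using assms r real by (cases a) auto
  qed
qed

text \<open>Without a moment the potential is infinite, and infinity absorbs the other terms. This
  remains decisive where \<open>V\<close> is infinite, as at 0.\<close>

lemma side_log_int:
  assumes "finite_borel_measure M"
    and "2 * log_potential M 0 - b - ereal c * enn2ereal v \<le> ereal l" "c > 0"
  shows "log_int M"
proof (rule ccontr)
  assume "\<not> log_int M"
  hence "log_potential M 0 = \<infinity>" by (rule finite_borel_measure.potential_not_log_int[OF assms(1)])
  thus False using assms(2,3) by (cases b; cases v) auto
qed

lemma side_neq_minus_infty:
  assumes "2 * a - b - ereal c * enn2ereal v \<le> ereal l" "a \<noteq> \<infinity>" "c > 0"
  shows "b \<noteq> - \<infinity>"
  using assms by (cases a; cases b; cases v) auto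

lemma log_potential_neq_infty:
  assumes "finite_borel_measure M" "log_int M"
  shows "log_potential M x \<noteq> \<infinity>"
proof -
  interpret finite_borel_measure M by fact
  show ?thesis by (cases rule: potential_cases[OF assms(2), of x]) auto
qed

text \<open>The value of the potential of \<open>N\<close> at 0 bounds it below on the other side;
  the equality then bounds the potential of \<open>M\<close> below almost everywhere. Both bounds
  give finite mutual energies.\<close>

lemma side_fin_pairs:
  assumes fb: "finite_borel_measure M" "finite_borel_measure N"
    and li: "log_int M" "log_int N" and n0: "log_potential N 0 \<noteq> - \<infinity>" and c: "c > 0"
    and sgn: "AE x in M. AE y in N. \<bar>y\<bar> \<le> \<bar>x - y\<bar>"
    and ae: "AE x in M. 2 * log_potential M x - log_potential N x - ereal c * enn2ereal (V x) = ereal l"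
  shows "fin_pair M N" "fin_pair M M"
proof -
  obtain u where u: "log_potential N 0 = ereal u"
    using n0 log_potential_neq_infty[OF fb(2) li(2), of 0] by (cases "log_potential N 0") auto
  have ge: "AE x in M. log_potential N x \<ge> ereal u"
    using sgn by eventually_elim (use potential_ge_at_0[OF fb(2) li(2) n0] u in auto)
  have "AE x in M. log_potential N x \<ge> ereal (- (- u))" using ge by simp
  from kap_pair_finite[OF fb li this] show "fin_pair M N" by (rule fin_pair_iff_kap[OF fb li])
  have "AE x in M. log_potential M x \<ge> ereal (- (- ((l + u) / 2)))"
    using ae ge
  proof eventually_elim
    case (elim x)
    show ?case using ereal_combination_ge[OF elim(1,2) log_potential_neq_infty[OF fb(2) li(2)] c] by simp
  qed
  from kap_pair_finite[OF fb(1,1) li(1,1) this] show "fin_pair M M" by (rule fin_pair_iff_kap[OF fb(1,1) li(1,1)])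
qed

text \<open>Convexity without differentiation: comparisons with \<open>(A, B)\<close> are written as
  \<open>energy_form\<close> plus integrated variational conditions. The uniform lower bounds on the
  potentials make all mutual energies with \<open>A\<close> and \<open>B\<close> finite.\<close>

theorem equilibrium_unique:
  assumes xi: "\<xi> > 0"
    and Vm: "potential_V z 1 \<in> borel_measurable borel" "potential_V z 2 \<in> borel_measurable borel"
    and adm: "admissible (A, B)" and liA: "log_int A" and liB: "log_int B"
    and pA: "\<And>x. log_potential A x \<ge> ereal (- K)" and pB: "\<And>x. log_potential B x \<ge> ereal (- K)"
    and vc: "variational_conditions z \<xi> l (A, B)"
  shows "is_arg_min (energy z \<xi>) admissible \<nu> \<longleftrightarrow> \<nu> = (A, B)" (is ?P)
    and "admissible \<nu> \<Longrightarrow> (\<exists>l. variational_conditions z \<xi> l \<nu>) \<longleftrightarrow> \<nu> = (A, B)"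
proof -
  note D = admissibleD[OF adm]
  have c: "1 / \<xi> > 0" using xi by simp
  \<comment> \<open>The lower bound \<open>- K\<close> holds at every point, so \<open>M\<close> may
    be any finite Borel measure with a logarithmic moment, in particular \<open>A\<close> or
    \<open>B\<close> itself.\<close>
  have fpA: "fin_pair M A" and fpB: "fin_pair M B" if "finite_borel_measure M" "log_int M" for M
  proof -
    show "fin_pair M A"
      by (rule fin_pair_iff_kap[OF that(1) D(1) that(2) liA], rule kap_pair_finite[OF that(1) D(1) that(2) liA])
        (use pA in auto)
    show "fin_pair M B"
      by (rule fin_pair_iff_kap[OF that(1) D(2) that(2) liB], rule kap_pair_finite[OF that(1) D(2) that(2) liB])
        (use pB in auto)
  qed
  define I1 where "I1 M = (1 / \<xi>) * (\<integral>x. enn2real (potential_V z 1 x) \<partial>M)" for M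
  define I2 where "I2 M = (1 / \<xi>) * (\<integral>x. enn2real (potential_V z 2 x) \<partial>M)" for M
  define E where "E M N = - mutual 0 M M - mutual 0 N N + mutual 0 M N + I1 M + I2 N" for M N
  have vcA1: "AE x in A. 2 * log_potential A x - log_potential B x - ereal (1 / \<xi>) * enn2ereal (potential_V z 1 x) = ereal l"
    and vcB1: "AE x in B. 2 * log_potential B x - log_potential A x - ereal (1 / \<xi>) * enn2ereal (potential_V z 2 x) = ereal 0"
    using D(5,6) vc by (auto simp: variational_conditions_def Let_def zero_ereal_def elim!: eventually_mono)
  note eqA = side_eq[OF D(1,2) liA liB fpA[OF D(1) liA] fpB[OF D(1) liA] Vm(1) c vcA1]
  note eqB = side_eq[OF D(2,1) liB liA fpB[OF D(2) liB] fpA[OF D(2) liB] Vm(2) c vcB1]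
  have en: "energy z \<xi> (M, N) = ereal (E M N)"
    if MN: "finite_borel_measure M" "finite_borel_measure N" "log_energy M M = ereal (- mutual 0 M M)"
      "log_energy N N = ereal (- mutual 0 N N)" "log_energy M N = ereal (- mutual 0 M N)"
    and V: "(\<integral>\<^sup>+x. potential_V z 1 x \<partial>M) < \<infinity>" "(\<integral>\<^sup>+x. potential_V z 2 x \<partial>N) < \<infinity>" for M N
  proof -
    have nn: "(\<integral>\<^sup>+x. V x \<partial>K) = ennreal (\<integral>x. enn2real (V x) \<partial>K)"
      if "finite_borel_measure K" "V \<in> borel_measurable borel" "(\<integral>\<^sup>+x. V x \<partial>K) < \<infinity>" for K V
    proof -
      interpret K: finite_borel_measure K by fact
      have [measurable]: "V \<in> borel_measurable K" using that(2) K.M_is_borel by (simp cong: measurable_cong_sets)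
      have Vf: "AE x in K. V x \<noteq> \<infinity>" by (rule nn_integral_PInf_AE) (use that in auto)
      have eq: "(\<integral>\<^sup>+x. ennreal (enn2real (V x)) \<partial>K) = (\<integral>\<^sup>+x. V x \<partial>K)"
        by (rule nn_integral_cong_AE) (use Vf in eventually_elim, auto simp: less_top)
      have iV: "integrable K (\<lambda>x. enn2real (V x))"
        by (rule integrableI_bounded) (use eq that in auto)
      show ?thesis unfolding eq[symmetric] by (rule nn_integral_eq_integral[OF iV]) auto
    qed
    have nng: "0 \<le> (\<integral>x. enn2real (V x) \<partial>K)" for V and K :: "real measure" by (rule integral_nonneg_AE) auto
    have m: "ereal (1 / \<xi>) * enn2ereal (ennreal r) = ereal (1 / \<xi> * r)" if "0 \<le> r" for r
      using that xi by (simp add: enn2ereal_ennreal)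
    show ?thesis
      unfolding energy_def prod.case E_def I1_def I2_def MN(3-5) nn[OF MN(1) Vm(1) V(1)] nn[OF MN(2) Vm(2) V(2)]
        m[OF nng] by simp
  qed
  have energyAB: "energy z \<xi> (A, B) = ereal (E A B)"
  proof (rule en)
    show "log_energy A A = ereal (- mutual 0 A A)"
      by (rule fin_pair_iff_kap[OF D(1,1) liA liA], rule kap_pair_finite[OF D(1,1) liA liA]) (use pA in auto)
    show "log_energy B B = ereal (- mutual 0 B B)"
      by (rule fin_pair_iff_kap[OF D(2,2) liB liB], rule kap_pair_finite[OF D(2,2) liB liB]) (use pB in auto)
    show "log_energy A B = ereal (- mutual 0 A B)"
      by (rule fin_pair_iff_kap[OF D(1,2) liA liB], rule kap_pair_finite[OF D(1,2) liA liB]) (use pB in auto)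
  qed (use D eqA eqB in auto)
  have main: "energy_form 0 M A N B \<ge> 0" "energy_form 0 M A N B = 0 \<Longrightarrow> (M, N) = (A, B)"
    if "admissible (M, N)" "log_int M" "log_int N" "fin_pair M M" "fin_pair N N" "fin_pair M N" for M N
  proof -
    note F = admissibleD[OF that(1)]
    have fAN: "fin_pair A N" by (rule fin_pair_commute[OF F(2) D(1) fpA[OF F(2) that(3)]])
    note ep = energy_form_pos[OF F(1) D(1) F(2) D(2) that(2) liA that(3) liB F(3) D(3) zero_less_one F(4) D(4) _
        that(4) fpA[OF F(1) that(2)] fpA[OF D(1) liA] that(5) fpB[OF F(2) that(3)] fpB[OF D(2) liB]
        that(6) fpB[OF F(1) that(2)] fAN fpB[OF D(1) liA]]
    show "energy_form 0 M A N B \<ge> 0" "energy_form 0 M A N B = 0 \<Longrightarrow> (M, N) = (A, B)" using ep by auto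
  qed
  have sym: "mutual 0 A N = mutual 0 N A" "mutual 0 B M = mutual 0 M B"
    if "finite_borel_measure M" "finite_borel_measure N" "log_int M" "log_int N" for M N
    using fin_pair_commute(2)[OF that(2) D(1) fpA[OF that(2,4)]] fin_pair_commute(2)[OF that(1) D(2) fpB[OF that(1,3)]] by auto
  \<comment> \<open>The inequalities for \<open>(A, B)\<close>, integrated against a competitor of
    the same masses; the integral of \<open>l\<close> is \<open>l\<close> since \<open>M\<close> has
    mass 1.\<close>
  have test: "2 * mutual 0 M A - mutual 0 M B - I1 M \<le> l" "2 * mutual 0 N B - mutual 0 N A - I2 N \<le> 0"
    if "admissible (M, N)" "log_int M" "log_int N"
      "(\<integral>\<^sup>+x. potential_V z 1 x \<partial>M) < \<infinity>" "(\<integral>\<^sup>+x. potential_V z 2 x \<partial>N) < \<infinity>" for M N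
  proof -
    note F = admissibleD[OF that(1)]
    have 1: "AE x in M. 2 * log_potential A x - log_potential B x - ereal (1 / \<xi>) * enn2ereal (potential_V z 1 x) \<le> ereal l"
      by (rule eventually_mono[OF F(5)]) (use vc in \<open>auto simp: variational_conditions_def Let_def\<close>)
    have 2: "AE x in N. 2 * log_potential B x - log_potential A x - ereal (1 / \<xi>) * enn2ereal (potential_V z 2 x) \<le> ereal 0"
      by (rule eventually_mono[OF F(6)]) (use vc in \<open>auto simp: variational_conditions_def Let_def zero_ereal_def\<close>)
    from side_le(1)[OF F(1) D(1,2) liA liB fpA[OF F(1) that(2)] fpB[OF F(1) that(2)] Vm(1) that(4) 1]
    show "2 * mutual 0 M A - mutual 0 M B - I1 M \<le> l" by (simp add: I1_def F(3))
    from side_le(1)[OF F(2) D(2,1) liB liA fpB[OF F(2) that(3)] fpA[OF F(2) that(3)] Vm(2) that(5) 2]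
    show "2 * mutual 0 N B - mutual 0 N A - I2 N \<le> 0" by (simp add: I2_def F(4))
  qed
  have eA: "2 * mutual 0 A A - mutual 0 A B - I1 A = l" using eqA(2) by (simp add: I1_def D(3))
  have eB: "2 * mutual 0 B B - mutual 0 B A - I2 B = 0" using eqB(2) by (simp add: I2_def D(4))
  have sAB: "mutual 0 B A = mutual 0 A B" using sym(2)[OF D(1,2) liA liB] .
  \<comment> \<open>The energy difference is \<open>energy_form 0 M A N B\<close> plus the terms of
    \<open>eA\<close>, \<open>eB\<close> minus those of \<open>test\<close>, and the latter
    difference is nonnegative.\<close>
  have strict: "energy z \<xi> (A, B) < energy z \<xi> (M, N)" if adm': "admissible (M, N)" and ne: "(M, N) \<noteq> (A, B)" for M N
  proof (cases "energy z \<xi> (M, N) = \<infinity>")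
    case True
    thus ?thesis using energyAB by simp
  next
    case False
    note F = admissibleD[OF adm']
    note G = energy_finiteD[OF adm' False xi]
    have e: "energy z \<xi> (M, N) = ereal (E M N)" by (rule en) (use F G in auto)
    have pos: "energy_form 0 M A N B > 0" using main[OF adm' G(1-5)] ne by force
    show ?thesis
      unfolding e energyAB using pos test[OF adm' G(1,2,9,10)] eA eB sAB sym[OF F(1,2) G(1,2)]
      unfolding E_def energy_form_def by simp
  qed
  show ?P
  proof
    assume a: "is_arg_min (energy z \<xi>) admissible \<nu>"
    obtain M N where MN: "\<nu> = (M, N)" by (cases \<nu>)
    show "\<nu> = (A, B)"
    proof (rule ccontr)
      assume "\<nu> \<noteq> (A, B)"
      hence "energy z \<xi> (A, B) < energy z \<xi> \<nu>" using strict[of M N] a MN by (simp add: is_arg_min_def)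
      thus False using a adm by (auto simp: is_arg_min_def)
    qed
  next
    assume eq: "\<nu> = (A, B)"
    have "\<not> energy z \<xi> y < energy z \<xi> (A, B)" if "admissible y" for y
    proof (cases "y = (A, B)")
      case False
      obtain M N where MN: "y = (M, N)" by (cases y)
      show ?thesis using strict[of M N] that False MN by auto
    qed auto
    thus "is_arg_min (energy z \<xi>) admissible \<nu>" using adm eq by (auto simp: is_arg_min_def)
  qed
  assume adm\<nu>: "admissible \<nu>"
  show "(\<exists>l. variational_conditions z \<xi> l \<nu>) \<longleftrightarrow> \<nu> = (A, B)"
  proof
    assume "\<exists>l. variational_conditions z \<xi> l \<nu>"
    then obtain l' where vc': "variational_conditions z \<xi> l' \<nu>" ..
    obtain M N where MN: "\<nu> = (M, N)" by (cases \<nu>)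
    note adm' = adm\<nu>[unfolded MN] and vc' = vc'[unfolded MN]
    note F = admissibleD[OF adm']
    let ?F1 = "\<lambda>x. 2 * log_potential M x - log_potential N x - ereal (1 / \<xi>) * enn2ereal (potential_V z 1 x)"
    let ?F2 = "\<lambda>x. 2 * log_potential N x - log_potential M x - ereal (1 / \<xi>) * enn2ereal (potential_V z 2 x)"
    have v: "x \<in> supp M \<Longrightarrow> ?F1 x = ereal l'" "0 \<le> x \<Longrightarrow> ?F1 x \<le> ereal l'"
      "x \<in> supp N \<Longrightarrow> ?F2 x = ereal 0" "x \<le> 0 \<Longrightarrow> ?F2 x \<le> ereal 0" for x
      using vc' by (auto simp: variational_conditions_def Let_def zero_ereal_def)
    \<comment> \<open>The point 0 belongs to both half-lines, so both inequalities are available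
      there for an unknown vector; they exclude missing moments and potentials equal to minus
      infinity.\<close>
    have liM: "log_int M" by (rule side_log_int[OF F(1) v(2)[of 0] c]) simp
    have liN: "log_int N" by (rule side_log_int[OF F(2) v(4)[of 0] c]) simp
    have n0: "log_potential N 0 \<noteq> - \<infinity>"
      by (rule side_neq_minus_infty[OF v(2)[of 0] log_potential_neq_infty[OF F(1) liM] c]) simp
    have m0: "log_potential M 0 \<noteq> - \<infinity>"
      by (rule side_neq_minus_infty[OF v(4)[of 0] log_potential_neq_infty[OF F(2) liN] c]) simp
    have ae1: "AE x in M. ?F1 x = ereal l'" and ae2: "AE x in N. ?F2 x = ereal 0"
      using F(5,6) v by (auto elim!: eventually_mono)
    have s1: "AE x in M. AE y in N. \<bar>y\<bar> \<le> \<bar>x - y\<bar>"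
      using F(5)
    proof eventually_elim
      case (elim x) show ?case using F(6) by (rule eventually_mono) (use elim in auto)
    qed
    have s2: "AE y in N. AE x in M. \<bar>x\<bar> \<le> \<bar>y - x\<bar>"
      using F(6)
    proof eventually_elim
      case (elim y) show ?case using F(5) by (rule eventually_mono) (use elim in auto)
    qed
    note fp1 = side_fin_pairs[OF F(1,2) liM liN n0 c s1 ae1]
    note fp2 = side_fin_pairs[OF F(2,1) liN liM m0 c s2 ae2]
    note e1 = side_eq[OF F(1,2) liM liN fp1(2,1) Vm(1) c ae1]
    note e2 = side_eq[OF F(2,1) liN liM fp2(2,1) Vm(2) c ae2]
    have fAM: "fin_pair A M" "mutual 0 A M = mutual 0 M A" using fin_pair_commute[OF F(1) D(1) fpA[OF F(1) liM]] .
    have fAN: "fin_pair A N" "mutual 0 A N = mutual 0 N A" using fin_pair_commute[OF F(2) D(1) fpA[OF F(2) liN]] .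
    have fBM: "fin_pair B M" "mutual 0 B M = mutual 0 M B" using fin_pair_commute[OF F(1) D(2) fpB[OF F(1) liM]] .
    have fBN: "fin_pair B N" "mutual 0 B N = mutual 0 N B" using fin_pair_commute[OF F(2) D(2) fpB[OF F(2) liN]] .
    have ae3: "AE x in A. ?F1 x \<le> ereal l'" and ae4: "AE x in B. ?F2 x \<le> ereal 0"
      by (rule eventually_mono[OF D(5)], use v in auto) (rule eventually_mono[OF D(6)], use v in auto)
    have t1: "2 * mutual 0 A M - mutual 0 A N - I1 A \<le> l'"
      using side_le(1)[OF D(1) F(1,2) liM liN fAM(1) fAN(1) Vm(1) eqA(1) ae3] by (simp add: I1_def D(3))
    have t2: "2 * mutual 0 B N - mutual 0 B M - I2 B \<le> 0"
      using side_le(1)[OF D(2) F(2,1) liN liM fBN(1) fBM(1) Vm(2) eqB(1) ae4] by (simp add: I2_def D(4))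
    have t3: "2 * mutual 0 M M - mutual 0 M N - I1 M = l'" using e1(2) by (simp add: I1_def F(3))
    have t4: "2 * mutual 0 N N - mutual 0 N M - I2 N = 0" using e2(2) by (simp add: I2_def F(4))
    have sMN: "mutual 0 N M = mutual 0 M N" by (rule fin_pair_commute(2)[OF F(1,2) fp1(1)])
    \<comment> \<open>Each solution is tested against the other and against itself: the four mixed
      inequalities minus the four equalities add up to twice the form.\<close>
    have "energy_form 0 M A N B \<le> 0"
      using test[OF adm' liM liN e1(1) e2(1)] eA eB sAB t1 t2 t3 t4 sMN fAM fAN fBM fBN
      unfolding energy_form_def by linarith
    with main[OF adm' liM liN fp1(2) fp2(2) fp1(1)] show "\<nu> = (A, B)" unfolding MN by force
  qed (use vc in auto)
qed

section \<open>The cubic equation\<close>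

text \<open>Symmetric functions record the roots with multiplicity, so double roots need no separate
  treatment and the relations pass to limits.\<close>

definition cubic_roots :: "complex \<Rightarrow> complex \<Rightarrow> complex \<Rightarrow> complex \<Rightarrow> complex \<Rightarrow> complex \<Rightarrow> bool" where
  "cubic_roots e1 e2 e3 u1 u2 u3 \<longleftrightarrow> u1 + u2 + u3 = e1 \<and> u1 * u2 + u1 * u3 + u2 * u3 = e2 \<and> u1 * u2 * u3 = e3
     \<and> cmod u1 \<le> cmod u2 \<and> cmod u2 \<le> cmod u3"

lemma cubic_factor:
  fixes X :: complex
  assumes "u1 + u2 + u3 = e1" "u1 * u2 + u1 * u3 + u2 * u3 = e2" "u1 * u2 * u3 = e3"
  shows "(X - u1) * (X - u2) * (X - u3) = X ^ 3 - e1 * X\<^sup>2 + e2 * X - e3"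
  unfolding assms[symmetric] by (simp add: algebra_simps power2_eq_square power3_eq_cube)

lemma pair_unique:
  fixes u v :: complex
  assumes "u + v = u' + v'" "u * v = u' * v'"
  shows "u = u' \<and> v = v' \<or> u = v' \<and> v = u'"
proof -
  have "(u - u') * (u - v') = u * u - u * (u' + v') + u' * v'" by (simp add: algebra_simps)
  also have "\<dots> = 0" unfolding assms[symmetric] by (simp add: algebra_simps)
  finally have "u = u' \<or> u = v'" by simp
  thus ?thesis using assms(1) by auto
qed

text \<open>The symmetric functions fix the roots up to order, and the ordering fixes them up to
  ties; so the moduli are what is determined.\<close>

lemma cubic_roots_unique:
  assumes "cubic_roots e1 e2 e3 u1 u2 u3" "cubic_roots e1 e2 e3 w1 w2 w3"
  shows "cmod u1 = cmod w1" "cmod u2 = cmod w2" "cmod u3 = cmod w3"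
proof -
  note U = assms(1)[unfolded cubic_roots_def] and W = assms(2)[unfolded cubic_roots_def]
  have "(u1 - w1) * (u1 - w2) * (u1 - w3) = (u1 - u1) * (u1 - u2) * (u1 - u3)"
    using cubic_factor[of u1 u2 u3 e1 e2 e3 u1] cubic_factor[of w1 w2 w3 e1 e2 e3 u1] U W by simp
  hence "u1 = w1 \<or> u1 = w2 \<or> u1 = w3" by simp
  moreover have split: "u2 = y \<and> u3 = w \<or> u2 = w \<and> u3 = y"
    if "u1 = t" "t + y + w = e1" "t * y + t * w + y * w = e2" for t y w
  proof (rule pair_unique)
    show s: "u2 + u3 = y + w" using U that by (metis add.assoc add_left_cancel)
    have "u1 * (u2 + u3) + u2 * u3 = t * (y + w) + y * w" using U that by (simp add: algebra_simps)
    thus "u2 * u3 = y * w" using s that by simp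
  qed
  moreover have "w2 + w1 + w3 = e1" "w2 * w1 + w2 * w3 + w1 * w3 = e2" "w3 + w1 + w2 = e1" "w3 * w1 + w3 * w2 + w1 * w2 = e2"
    using W by (auto simp: algebra_simps)
  ultimately have c: "u1 = w1 \<Longrightarrow> u2 = w2 \<and> u3 = w3 \<or> u2 = w3 \<and> u3 = w2" "u1 = w2 \<Longrightarrow> u2 = w1 \<and> u3 = w3 \<or> u2 = w3 \<and> u3 = w1"
    "u1 = w3 \<Longrightarrow> u2 = w1 \<and> u3 = w2 \<or> u2 = w2 \<and> u3 = w1" and d: "u1 = w1 \<or> u1 = w2 \<or> u1 = w3"
    using split[of w1 w2 w3] split[of w2 w1 w3] split[of w3 w1 w2] W by simp_all
  have "cmod u1 = cmod w1 \<and> cmod u2 = cmod w2 \<and> cmod u3 = cmod w3"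
    using d
  proof (elim disjE)
    assume "u1 = w1" from c(1)[OF this] this U W show ?thesis by auto
  next
    assume "u1 = w2" from c(2)[OF this] this U W show ?thesis by auto
  next
    assume "u1 = w3" from c(3)[OF this] this U W show ?thesis by auto
  qed
  thus "cmod u1 = cmod w1" "cmod u2 = cmod w2" "cmod u3 = cmod w3" by auto
qed

lemma cubic_root_bound:
  fixes u :: complex
  assumes "u ^ 3 - e1 * u\<^sup>2 + e2 * u - e3 = 0"
  shows "cmod u \<le> 1 + cmod e1 + cmod e2 + cmod e3"
proof (cases "cmod u \<le> 1")
  case False
  have "u ^ 3 = e1 * u\<^sup>2 - e2 * u + e3" using assms by (simp add: algebra_simps)
  hence "cmod (u ^ 3) \<le> cmod (e1 * u\<^sup>2) + cmod (e2 * u) + cmod e3"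
    using norm_triangle_ineq[of "e1 * u\<^sup>2 - e2 * u" e3] norm_triangle_ineq4[of "e1 * u\<^sup>2" "e2 * u"] by simp
  also have "\<dots> \<le> cmod e1 * (cmod u)\<^sup>2 + cmod e2 * (cmod u)\<^sup>2 + cmod e3 * (cmod u)\<^sup>2"
  proof -
    have "cmod u * 1 \<le> (cmod u)\<^sup>2" unfolding power2_eq_square using False by (intro mult_left_mono) auto
    moreover have "1 \<le> (cmod u)\<^sup>2" using False by simp
    ultimately show ?thesis by (intro add_mono) (auto simp: norm_mult norm_power mult_left_mono mult_le_cancel_left1)
  qed
  finally have "(cmod u)\<^sup>2 * cmod u \<le> (cmod u)\<^sup>2 * (cmod e1 + cmod e2 + cmod e3)"
    by (simp add: norm_power norm_mult power2_eq_square power3_eq_cube algebra_simps)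
  moreover have "0 < (cmod u)\<^sup>2" using False by (intro zero_less_power) linarith
  ultimately have "cmod u \<le> cmod e1 + cmod e2 + cmod e3" by (simp only: mult_le_cancel_left_pos)
  thus ?thesis by simp
next
  case True
  thus ?thesis using norm_ge_zero[of e1] norm_ge_zero[of e2] norm_ge_zero[of e3] by linarith
qed

lemma cubic_roots_bound:
  assumes "cubic_roots e1 e2 e3 u1 u2 u3"
  shows "cmod u1 \<le> 1 + cmod e1 + cmod e2 + cmod e3" "cmod u2 \<le> 1 + cmod e1 + cmod e2 + cmod e3"
    "cmod u3 \<le> 1 + cmod e1 + cmod e2 + cmod e3"
proof -
  note U = assms[unfolded cubic_roots_def]
  have f: "(X - u1) * (X - u2) * (X - u3) = X ^ 3 - e1 * X\<^sup>2 + e2 * X - e3" for X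
    using U by (intro cubic_factor) auto
  show "cmod u1 \<le> 1 + cmod e1 + cmod e2 + cmod e3" "cmod u2 \<le> 1 + cmod e1 + cmod e2 + cmod e3"
    "cmod u3 \<le> 1 + cmod e1 + cmod e2 + cmod e3"
    by (rule cubic_root_bound, subst f[symmetric], simp)+
qed

lemma tendsto_subseq_subseq:
  fixes X :: "nat \<Rightarrow> 'a::metric_space"
  assumes "\<And>r :: nat \<Rightarrow> nat. strict_mono r \<Longrightarrow> \<exists>r' :: nat \<Rightarrow> nat. strict_mono r' \<and> (X \<circ> r \<circ> r') \<longlonglongrightarrow> L"
  shows "X \<longlonglongrightarrow> L"
proof (rule ccontr)
  assume "\<not> X \<longlonglongrightarrow> L"
  then obtain e where e: "e > 0" "\<And>N. \<exists>n\<ge>N. dist (X n) L \<ge> e"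
    unfolding lim_sequentially by (meson not_less)
  hence "\<exists>\<^sub>F n in sequentially. dist (X n) L \<ge> e" by (auto simp: frequently_sequentially)
  hence "infinite {n. dist (X n) L \<ge> e}" by (simp add: cofinite_eq_sequentially[symmetric] frequently_cofinite)
  from infinite_enumerate[OF this] obtain r :: "nat \<Rightarrow> nat" where r: "strict_mono r" "\<And>n. r n \<in> {n. dist (X n) L \<ge> e}"
    by metis
  obtain r' where r': "(X \<circ> r \<circ> r') \<longlonglongrightarrow> L" using assms[OF r(1)] by blast
  then obtain n where "dist ((X \<circ> r \<circ> r') n) L < e" using e(1) unfolding lim_sequentially by blast
  thus False using r(2)[of "r' n"] by simp
qed

text \<open>Compactness: bounded coefficients bound the roots, and every convergent subsequence ends
  at ordered roots of the limit cubic. Single roots may swap within a tie, hence the restriction to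
  moduli.\<close>

lemma cubic_roots_tendsto:
  assumes e: "e1 \<longlonglongrightarrow> f1" "e2 \<longlonglongrightarrow> f2" "e3 \<longlonglongrightarrow> f3"
    and R: "\<And>n. cubic_roots (e1 n) (e2 n) (e3 n) (u1 n) (u2 n) (u3 n)" and S: "cubic_roots f1 f2 f3 w1 w2 w3"
  shows "(\<lambda>n. cmod (u1 n)) \<longlonglongrightarrow> cmod w1" "(\<lambda>n. cmod (u2 n)) \<longlonglongrightarrow> cmod w2" "(\<lambda>n. cmod (u3 n)) \<longlonglongrightarrow> cmod w3"
proof -
  let ?X = "\<lambda>n. (cmod (u1 n), cmod (u2 n), cmod (u3 n))"
  have "?X \<longlonglongrightarrow> (cmod w1, cmod w2, cmod w3)"
  proof (rule tendsto_subseq_subseq)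
    fix r :: "nat \<Rightarrow> nat" assume r: "strict_mono r"
    have "(\<lambda>n. 1 + cmod (e1 n) + cmod (e2 n) + cmod (e3 n)) \<longlonglongrightarrow> 1 + cmod f1 + cmod f2 + cmod f3"
      by (intro tendsto_intros e)
    hence "Bseq (\<lambda>n. 1 + cmod (e1 n) + cmod (e2 n) + cmod (e3 n))"
      by (intro convergent_imp_Bseq convergentI)
    then obtain B where B: "\<And>n. norm (1 + cmod (e1 n) + cmod (e2 n) + cmod (e3 n)) \<le> B" by (auto simp: Bseq_def)
    have Bn: "cmod (u1 n) \<le> B" "cmod (u2 n) \<le> B" "cmod (u3 n) \<le> B" for n
      using cubic_roots_bound[OF R[of n]] B[of n] by auto
    have bd: "bounded (range (\<lambda>n. (u1 (r n), u2 (r n), u3 (r n))))"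
    proof (rule bounded_subset[of "cball 0 B \<times> cball 0 B \<times> cball 0 B"])
      show "bounded (cball (0::complex) B \<times> cball (0::complex) B \<times> cball (0::complex) B)" by (intro bounded_Times bounded_cball)
      show "range (\<lambda>n. (u1 (r n), u2 (r n), u3 (r n))) \<subseteq> cball 0 B \<times> cball 0 B \<times> cball 0 B" using Bn by auto
    qed
    obtain l q where q: "strict_mono q" "((\<lambda>n. (u1 (r n), u2 (r n), u3 (r n))) \<circ> q) \<longlonglongrightarrow> l"
      using bounded_imp_convergent_subsequence[OF bd] by auto
    obtain l1 l2 l3 where l: "l = (l1, l2, l3)" by (cases l)
    have L: "(\<lambda>n. u1 (r (q n))) \<longlonglongrightarrow> l1" "(\<lambda>n. u2 (r (q n))) \<longlonglongrightarrow> l2" "(\<lambda>n. u3 (r (q n))) \<longlonglongrightarrow> l3"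
      using tendsto_fst[OF q(2)] tendsto_fst[OF tendsto_snd[OF q(2)]] tendsto_snd[OF tendsto_snd[OF q(2)]]
      by (simp_all add: l o_def)
    have rq: "strict_mono (\<lambda>n. r (q n))" using r q(1) by (simp add: strict_mono_def)
    have E: "(\<lambda>n. e1 (r (q n))) \<longlonglongrightarrow> f1" "(\<lambda>n. e2 (r (q n))) \<longlonglongrightarrow> f2" "(\<lambda>n. e3 (r (q n))) \<longlonglongrightarrow> f3"
      using e[THEN LIMSEQ_subseq_LIMSEQ, OF rq] by (simp_all add: o_def)
    have Rn: "u1 (r (q n)) + u2 (r (q n)) + u3 (r (q n)) = e1 (r (q n))"
       "u1 (r (q n)) * u2 (r (q n)) + u1 (r (q n)) * u3 (r (q n)) + u2 (r (q n)) * u3 (r (q n)) = e2 (r (q n))"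
       "u1 (r (q n)) * u2 (r (q n)) * u3 (r (q n)) = e3 (r (q n))"
       "cmod (u1 (r (q n))) \<le> cmod (u2 (r (q n)))" "cmod (u2 (r (q n))) \<le> cmod (u3 (r (q n)))" for n
      using R[of "r (q n)"] by (auto simp: cubic_roots_def)
    have "cubic_roots f1 f2 f3 l1 l2 l3"
      unfolding cubic_roots_def
    proof (intro conjI)
      show "l1 + l2 + l3 = f1"
        by (rule LIMSEQ_unique[OF _ E(1)], subst Rn(1)[symmetric]) (intro tendsto_intros L)
      show "l1 * l2 + l1 * l3 + l2 * l3 = f2"
        by (rule LIMSEQ_unique[OF _ E(2)], subst Rn(2)[symmetric]) (intro tendsto_intros L)
      show "l1 * l2 * l3 = f3"
        by (rule LIMSEQ_unique[OF _ E(3)], subst Rn(3)[symmetric]) (intro tendsto_intros L)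
      show "cmod l1 \<le> cmod l2" by (rule LIMSEQ_le[OF tendsto_norm[OF L(1)] tendsto_norm[OF L(2)]]) (use Rn in auto)
      show "cmod l2 \<le> cmod l3" by (rule LIMSEQ_le[OF tendsto_norm[OF L(2)] tendsto_norm[OF L(3)]]) (use Rn in auto)
    qed
    from cubic_roots_unique[OF this S] have W: "cmod l1 = cmod w1" "cmod l2 = cmod w2" "cmod l3 = cmod w3" .
    have "(?X \<circ> r \<circ> q) \<longlonglongrightarrow> (cmod w1, cmod w2, cmod w3)"
      unfolding o_def W[symmetric] by (intro tendsto_Pair tendsto_norm L)
    thus "\<exists>r'. strict_mono r' \<and> (?X \<circ> r \<circ> r') \<longlonglongrightarrow> (cmod w1, cmod w2, cmod w3)" using q(1) by blast
  qed
  from tendsto_fst[OF this] tendsto_fst[OF tendsto_snd[OF this]] tendsto_snd[OF tendsto_snd[OF this]]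
  show "(\<lambda>n. cmod (u1 n)) \<longlonglongrightarrow> cmod w1" "(\<lambda>n. cmod (u2 n)) \<longlonglongrightarrow> cmod w2" "(\<lambda>n. cmod (u3 n)) \<longlonglongrightarrow> cmod w3" by auto
qed

section \<open>Principal arguments as arc cosines\<close>

lemma cos_Im_Ln: "w \<noteq> 0 \<Longrightarrow> cos (Im (Ln w)) = Re w / cmod w"
proof -
  assume w: "w \<noteq> 0"
  have "Re w = exp (Re (Ln w)) * cos (Im (Ln w))" using w by (metis Re_exp exp_Ln)
  thus ?thesis using w by simp
qed

text \<open>The arc cosine is continuous up to the negative axis approached from above, where
  \<open>Ln\<close> itself has its cut.\<close>

lemma Im_Ln_upper: "w \<noteq> 0 \<Longrightarrow> 0 \<le> Im w \<Longrightarrow> Im (Ln w) = arccos (Re w / cmod w)"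
  using Im_Ln_pos_le[of w] by (subst cos_Im_Ln[symmetric]) (auto simp: arccos_cos)

lemma Im_Ln_lower: "Im w < 0 \<Longrightarrow> Im (Ln w) = - arccos (Re w / cmod w)"
proof -
  assume w: "Im w < 0"
  hence nz: "w \<noteq> 0" by auto
  have "\<not> (0 \<le> Im (Ln w) \<and> Im (Ln w) \<le> pi)" using Im_Ln_pos_le[OF nz] w by simp
  hence "- Im (Ln w) \<ge> 0" "- Im (Ln w) \<le> pi" using Im_Ln_le_pi[OF nz] mpi_less_Im_Ln[OF nz] by auto
  hence "arccos (cos (- Im (Ln w))) = - Im (Ln w)" by (intro arccos_cos)
  thus ?thesis using cos_Im_Ln[OF nz] by simp
qed

section \<open>The logarithm of the rational function and the ordering of the three roots\<close>

locale three_shifts =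
  fixes a b c :: real
  assumes a_pos: "0 < a" and ab: "a < b" and bc: "b < c"
begin

text \<open>At parameter \<open>s\<close> the shifts are \<open>s\<close>, \<open>s + p\<close> and
  \<open>s + p + q\<close>. Up to sign, \<open>sg\<close> and \<open>kp\<close> are the sum and the
  product of the roots of the cubic in \<open>v\<close>, for every \<open>x\<close>.\<close>

definition "sg = a + b + c"
definition "kp = a * b * c"

definition Af :: "complex \<Rightarrow> complex" where
  "Af v = (v + of_real a) * (v + of_real b) * (v + of_real c) / v"

text \<open>A logarithm of \<open>Af\<close>, injective on the upper half-plane; the three roots of \<open>Af v = x\<close> (or their
  conjugates) are distinguished by the branch of \<open>Ln x\<close> that \<open>Lf\<close> takes there.\<close>

definition Lf :: "complex \<Rightarrow> complex" where
  "Lf v = Ln (v + of_real a) + Ln (v + of_real b) + Ln (v + of_real c) - Ln v"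

lemma pos: "0 < a" "0 < b" "0 < c" "0 < kp" "0 < sg"
  using a_pos ab bc by (auto simp: kp_def sg_def)

lemma exp_Lf: "Im v > 0 \<Longrightarrow> exp (Lf v) = Af v"
proof -
  assume v: "Im v > 0"
  have "v \<noteq> 0" "v + of_real t \<noteq> 0" for t using v by (auto simp: complex_eq_iff)
  thus ?thesis by (simp add: Lf_def Af_def exp_add exp_diff)
qed

lemma has_field_derivative_Lf:
  "Im v > 0 \<Longrightarrow> (Lf has_field_derivative (1 / (v + of_real a) + 1 / (v + of_real b) + 1 / (v + of_real c) - 1 / v)) (at v)"
proof -
  assume v: "Im v > 0"
  have "v \<notin> \<real>\<^sub>\<le>\<^sub>0" "v + of_real t \<notin> \<real>\<^sub>\<le>\<^sub>0" for t using v by (auto simp: complex_nonpos_Reals_iff)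
  thus ?thesis unfolding Lf_def[abs_def]
    by (auto intro!: derivative_eq_intros simp: inverse_eq_divide)
qed

lemma Im_quot: "Im (v / (v + of_real t)) = t * Im v / (cmod (v + of_real t))\<^sup>2"
  by (simp add: Im_divide cmod_power2 algebra_simps)

text \<open>This is the derivative of \<open>Lf\<close> with respect to \<open>Ln v\<close>, a sum
  of terms \<open>v / (v + t)\<close> minus 1, and each term has positive imaginary part.\<close>

lemma Im_v_dLf_pos:
  assumes "Im v > 0"
  shows "Im (v * (1 / (v + of_real a) + 1 / (v + of_real b) + 1 / (v + of_real c) - 1 / v)) > 0"
proof -
  have nz: "v \<noteq> 0" "v + of_real t \<noteq> 0" for t using assms by (auto simp: complex_eq_iff)
  have "v * (1 / (v + of_real a) + 1 / (v + of_real b) + 1 / (v + of_real c) - 1 / v)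
     = v / (v + of_real a) + v / (v + of_real b) + v / (v + of_real c) - 1"
    using nz by (simp add: algebra_simps)
  moreover have "Im (v / (v + of_real t)) > 0" if "t > 0" for t
    unfolding Im_quot using that assms nz(2)[of t] by (intro divide_pos_pos mult_pos_pos) auto
  ultimately show ?thesis using pos by (simp add: add_pos_pos)
qed

lemma Im_Ln_strip: "Im v > 0 \<Longrightarrow> 0 < Im (Ln v) \<and> Im (Ln v) < pi"
  using Im_Ln_pos_lt[of v] by force

text \<open>The Noshiro-Warschawski argument: in the coordinate \<open>Ln v\<close> the upper
  half-plane is the convex strip between 0 and pi, and a derivative confined to a half-plane
  confines the difference quotients along segments.\<close>

lemma Lf_segment:
  assumes v: "Im v > 0" "Im w > 0" "v \<noteq> w"
  shows "Re ((Lf w - Lf v) * (- \<i>) / (Ln w - Ln v)) > 0"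
proof -
  have nz: "v \<noteq> 0" "w \<noteq> 0" using v by auto
  define d where "d = Ln w - Ln v"
  have d: "d \<noteq> 0" using v(3) nz unfolding d_def by (metis exp_Ln right_minus_eq)
  define g where "g t = exp (Ln v + t * d)" for t :: complex
  define psi where "psi t = Re (Lf (g (of_real t)) * (- \<i>) / d)" for t :: real
  have gpos: "Im (g (of_real t)) > 0" if "0 \<le> t" "t \<le> 1" for t
  proof -
    have "Im (Ln v + of_real t * d) = (1 - t) * Im (Ln v) + t * Im (Ln w)" by (simp add: d_def algebra_simps)
    moreover have "0 < (1 - t) * Im (Ln v) + t * Im (Ln w)"
      using that Im_Ln_strip[OF v(1)] Im_Ln_strip[OF v(2)]
      by (cases "t = 0") (auto intro!: add_nonneg_pos)
    moreover have "(1 - t) * Im (Ln v) + t * Im (Ln w) < pi"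
      using that Im_Ln_strip[OF v(1)] Im_Ln_strip[OF v(2)] by (intro convex_bound_lt) auto
    ultimately have "sin (Im (Ln v + of_real t * d)) > 0" by (intro sin_gt_zero) auto
    thus ?thesis by (simp add: g_def Im_exp)
  qed
  have "psi 0 < psi 1"
  proof (rule DERIV_pos_imp_increasing[of 0 1 psi])
    fix t :: real assume t: "0 \<le> t" "t \<le> 1"
    let ?v = "g (of_real t)"
    let ?D = "1 / (?v + of_real a) + 1 / (?v + of_real b) + 1 / (?v + of_real c) - 1 / ?v"
    have dg: "(g has_field_derivative ?v * d) (at (of_real t))"
      unfolding g_def by (auto intro!: derivative_eq_intros)
    have "((\<lambda>u. Lf (g u) * (- \<i>) / d) has_field_derivative (?D * (?v * d)) * (- \<i>) / d) (at (of_real t))"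
      by (intro DERIV_cdivide DERIV_cmult_right DERIV_chain2[OF has_field_derivative_Lf dg] gpos t)
    hence "((\<lambda>u. Lf (g (of_real u)) * (- \<i>) / d) has_vector_derivative (?D * (?v * d)) * (- \<i>) / d) (at t)"
      by (rule has_vector_derivative_real_field)
    hence "(psi has_vector_derivative Re ((?D * (?v * d)) * (- \<i>) / d)) (at t)"
      unfolding psi_def[abs_def] by (rule bounded_linear.has_vector_derivative[OF bounded_linear_Re])
    moreover have "(?D * (?v * d)) * (- \<i>) / d = - \<i> * (?v * ?D)" using d by (simp add: mult_ac)
    hence "Re ((?D * (?v * d)) * (- \<i>) / d) = Im (?v * ?D)" by simp
    ultimately have "DERIV psi t :> Im (?v * ?D)" by (simp add: has_real_derivative_iff_has_vector_derivative)
    thus "\<exists>y. DERIV psi t :> y \<and> y > 0" using Im_v_dLf_pos[OF gpos[OF t]] by blast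
  qed simp
  moreover have "g 0 = v" "g 1 = w" using nz by (simp_all add: g_def d_def)
  ultimately show ?thesis unfolding psi_def d_def[symmetric]
    by (simp add: diff_divide_distrib left_diff_distrib)
qed

lemma Lf_inj: "Im v > 0 \<Longrightarrow> Im w > 0 \<Longrightarrow> Lf v = Lf w \<Longrightarrow> v = w"
  using Lf_segment[of v w] by auto

text \<open>If the values of \<open>Lf\<close> differ by a purely imaginary number, the bound on the
  difference quotient decides the sign of the difference of \<open>Re (Ln v)\<close>. This orders
  the roots by their branch.\<close>

lemma Lf_cmod_less:
  assumes v: "Im v > 0" "Im w > 0" and L: "Re (Lf v) = Re (Lf w)" "Im (Lf v) < Im (Lf w)"
  shows "cmod v < cmod w"
proof -
  have nz: "v \<noteq> 0" "w \<noteq> 0" "v \<noteq> w" using v L by auto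
  let ?t = "Im (Lf w) - Im (Lf v)"
  have "(Lf w - Lf v) * (- \<i>) = of_real ?t" using L by (simp add: complex_eq_iff)
  hence "Re (of_real ?t / (Ln w - Ln v)) > 0" using Lf_segment[OF v nz(3)] by simp
  hence "?t * Re (Ln w - Ln v) / (cmod (Ln w - Ln v))\<^sup>2 > 0" by (simp add: Re_divide cmod_power2)
  hence "Re (Ln v) < Re (Ln w)" using L by (simp add: zero_less_divide_iff zero_less_mult_iff)
  thus ?thesis using nz by simp
qed

text \<open>The same bound for a real difference of \<open>Ln\<close>. It shows that the regions cut
  out by \<open>Im (Lf v)\<close> are stable under scaling, towards 0 or towards infinity.\<close>

lemma Im_Lf_scale:
  assumes v: "Im v > 0" and t: "0 < t" "t < 1"
  shows "Im (Lf (of_real t * v)) < Im (Lf v)"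
proof -
  have nz: "v \<noteq> 0" using v by auto
  have L: "Ln (of_real t * v) = of_real (ln t) + Ln v" using Ln_times_of_real[OF t(1) nz] t by (simp add: Ln_of_real)
  have "Im (of_real t * v) > 0" "of_real t * v \<noteq> v" using v t nz by auto
  from Lf_segment[OF this(1) v this(2)] have "Re ((Lf v - Lf (of_real t * v)) * (- \<i>) / of_real (- ln t)) > 0"
    unfolding L by simp
  hence "Re ((Lf v - Lf (of_real t * v)) * (- \<i>)) / (- ln t) > 0" by (simp only: Re_divide_of_real)
  moreover have "- ln t > 0" using t by simp
  ultimately have "Re ((Lf v - Lf (of_real t * v)) * (- \<i>)) > 0" by (simp only: zero_less_divide_iff) auto
  thus ?thesis by simp
qed

lemma Im_Ln_shift_less:
  assumes "Im v > 0" "t > 0"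
  shows "Im (Ln (v + of_real t)) < Im (Ln v)"
proof -
  have "Im (Ln (v + of_real t)) < Im (Ln (v + of_real 0))"
  proof (rule DERIV_neg_imp_decreasing[of 0 t "\<lambda>u. Im (Ln (v + of_real u))"])
    fix u :: real assume "0 \<le> u" "u \<le> t"
    have np: "v + of_real u \<notin> \<real>\<^sub>\<le>\<^sub>0" using assms by (auto simp: complex_nonpos_Reals_iff)
    have "((\<lambda>z. Ln (v + z)) has_field_derivative 1 / (v + of_real u)) (at (of_real u))"
      using np by (auto intro!: derivative_eq_intros simp: inverse_eq_divide)
    from has_vector_derivative_real_field[OF this]
    have "((\<lambda>u. Im (Ln (v + of_real u))) has_vector_derivative Im (1 / (v + of_real u))) (at u)"
      by (rule bounded_linear.has_vector_derivative[OF bounded_linear_Im])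
    moreover have "Im (1 / (v + of_real u)) < 0"
      using assms by (simp add: Im_divide) (intro divide_pos_pos add_nonneg_pos, auto)
    ultimately show "\<exists>y. DERIV (\<lambda>u. Im (Ln (v + of_real u))) u :> y \<and> y < 0"
      by (auto simp: has_real_derivative_iff_has_vector_derivative)
  qed fact
  thus ?thesis by simp
qed

text \<open>The arguments of \<open>v + a\<close>, \<open>v + b\<close>, \<open>v + c\<close> are
  positive and smaller than that of \<open>v\<close>, which is subtracted once.\<close>

lemma Im_Lf_range:
  assumes "Im v > 0"
  shows "- pi < Im (Lf v)" "Im (Lf v) < 2 * Im (Ln v)" "Im (Lf v) < 2 * pi"
proof -
  have "Im (v + of_real t) > 0" for t using assms by simp
  from Im_Ln_strip[OF this] have p: "0 < Im (Ln (v + of_real t))" for t by blast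
  have "0 < Im (Ln v)" "Im (Ln v) < pi" using Im_Ln_strip[OF assms] by auto
  thus "- pi < Im (Lf v)" "Im (Lf v) < 2 * Im (Ln v)" "Im (Lf v) < 2 * pi"
    using p[of a] p[of b] p[of c] Im_Ln_shift_less[OF assms pos(1)] Im_Ln_shift_less[OF assms pos(2)]
      Im_Ln_shift_less[OF assms pos(3)] unfolding Lf_def by auto
qed

definition roots :: "complex \<Rightarrow> complex \<Rightarrow> complex \<Rightarrow> complex \<Rightarrow> bool" where
  "roots x u1 u2 u3 \<longleftrightarrow> cubic_roots (- of_real sg) (of_real (a * b + a * c + b * c) - x) (- of_real kp) u1 u2 u3"

lemma roots_factor:
  assumes "roots x u1 u2 u3"
  shows "(X + of_real a) * (X + of_real b) * (X + of_real c) - x * X = (X - u1) * (X - u2) * (X - u3)"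
proof -
  note R = assms[unfolded roots_def cubic_roots_def]
  show ?thesis using cubic_factor[of u1 u2 u3 _ _ _ X, OF R[THEN conjunct1] R[THEN conjunct2, THEN conjunct1]
      R[THEN conjunct2, THEN conjunct2, THEN conjunct1]]
    by (simp add: sg_def kp_def algebra_simps power2_eq_square power3_eq_cube)
qed

lemma roots_prod: "roots x u1 u2 u3 \<Longrightarrow> u1 * u2 * u3 = - of_real kp"
  and roots_sum: "roots x u1 u2 u3 \<Longrightarrow> u1 + u2 + u3 = - of_real sg"
  and roots_le: "roots x u1 u2 u3 \<Longrightarrow> cmod u1 \<le> cmod u2 \<and> cmod u2 \<le> cmod u3"
  by (auto simp: roots_def cubic_roots_def)

lemma roots_cmod_prod: "roots x u1 u2 u3 \<Longrightarrow> cmod u1 * cmod u2 * cmod u3 = kp"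
  using arg_cong[OF roots_prod, of x u1 u2 u3 cmod] pos by (simp add: norm_mult)

lemma roots_nonzero: "roots x u1 u2 u3 \<Longrightarrow> u1 \<noteq> 0 \<and> u2 \<noteq> 0 \<and> u3 \<noteq> 0"
  using roots_prod[of x u1 u2 u3] pos by auto

lemma roots_Af_iff:
  assumes "roots x u1 u2 u3" "v \<noteq> 0"
  shows "Af v = x \<longleftrightarrow> v = u1 \<or> v = u2 \<or> v = u3"
proof -
  have "Af v = x \<longleftrightarrow> (v + of_real a) * (v + of_real b) * (v + of_real c) - x * v = 0"
    using assms(2) by (simp add: Af_def field_simps)
  thus ?thesis unfolding roots_factor[OF assms(1)] by simp
qed

lemma Af_cnj: "Af (cnj v) = cnj (Af v)" by (simp add: Af_def)

lemma roots_cnj: "roots x u1 u2 u3 \<Longrightarrow> roots (cnj x) (cnj u1) (cnj u2) (cnj u3)"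
proof -
  assume "roots x u1 u2 u3"
  hence R: "u1 + u2 + u3 = - of_real sg" "u1 * u2 + u1 * u3 + u2 * u3 = of_real (a * b + a * c + b * c) - x"
    "u1 * u2 * u3 = - of_real kp" "cmod u1 \<le> cmod u2" "cmod u2 \<le> cmod u3"
    by (auto simp: roots_def cubic_roots_def)
  show ?thesis
    using R(1-3)[THEN arg_cong[where f = cnj]] R(4,5) unfolding roots_def cubic_roots_def
    by simp
qed

text \<open>At a double root the terms \<open>u / (u + t)\<close> add up to 1, while their imaginary
  parts all have the sign of \<open>Im u\<close>.\<close>

lemma double_root_real:
  assumes "u + u + w = - of_real sg" "u * u + u * w + u * w = of_real (a * b + a * c + b * c) - x" "u * u * w = - of_real kp"
  shows "Im u = 0"
proof (rule ccontr)
  assume Im: "Im u \<noteq> 0"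
  have nz: "u \<noteq> 0" "u + of_real t \<noteq> 0" for t using Im by (auto simp: complex_eq_iff)
  have w: "w = - of_real sg - u - u" using assms(1) by (simp add: algebra_simps)
  have "x = of_real (a * b + a * c + b * c) - (u * u + u * w + u * w)" using assms(2) by simp
  hence x: "x = (u + of_real b) * (u + of_real c) + (u + of_real a) * (u + of_real c) + (u + of_real a) * (u + of_real b)"
    unfolding w sg_def by (simp add: algebra_simps)
  have "(u + of_real a) * (u + of_real b) * (u + of_real c) = u ^ 3 + of_real sg * u\<^sup>2 + of_real (a * b + a * c + b * c) * u + of_real kp"
    by (simp add: sg_def kp_def algebra_simps power2_eq_square power3_eq_cube)
  also have "of_real kp = - (u * u * w)" using assms(3) by simp
  also have "of_real (a * b + a * c + b * c) = x + (u * u + u * w + u * w)" using assms(2) by simp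
  also have "u ^ 3 + of_real sg * u\<^sup>2 + (x + (u * u + u * w + u * w)) * u + - (u * u * w) = x * u"
    unfolding w by (simp add: algebra_simps power2_eq_square power3_eq_cube)
  finally have p: "(u + of_real a) * (u + of_real b) * (u + of_real c) = x * u" .
  have "u / (u + of_real a) + u / (u + of_real b) + u / (u + of_real c) = x * u / ((u + of_real a) * (u + of_real b) * (u + of_real c))"
    using nz(2)[of a] nz(2)[of b] nz(2)[of c] unfolding x by (simp add: divide_simps) (simp add: algebra_simps)
  also have "\<dots> = 1" using nz unfolding p[symmetric] by simp
  finally have "Im (u / (u + of_real a) + u / (u + of_real b) + u / (u + of_real c)) = 0" by simp
  hence "Im u * (a / (cmod (u + of_real a))\<^sup>2 + b / (cmod (u + of_real b))\<^sup>2 + c / (cmod (u + of_real c))\<^sup>2) = 0"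
    by (simp only: plus_complex.simps Im_quot) (simp add: algebra_simps)
  moreover have "a / (cmod (u + of_real a))\<^sup>2 + b / (cmod (u + of_real b))\<^sup>2 + c / (cmod (u + of_real c))\<^sup>2 > 0"
    using pos nz(2) by (intro add_pos_pos divide_pos_pos) auto
  ultimately show False using Im by simp
qed

text \<open>Roots, or their conjugates in the upper half-plane, are logarithms of \<open>x\<close>
  or \<open>cnj x\<close>. The range of \<open>Im (Lf u)\<close> leaves three heights, below 0,
  between 0 and pi, and above pi; injectivity allows one root for each, and the heights order the
  moduli.\<close>

lemma roots_lower:
  assumes R: "roots x u1 u2 u3" and x: "Im x < 0"
  shows "Im u1 > 0" "Lf u1 = Ln x" "Im u2 < 0" "Lf (cnj u2) = cnj (Ln x)" "Im u3 > 0" "Lf u3 = Ln x + 2 * of_real pi * \<i>"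
    "cmod u1 < cmod u2" "cmod u2 < cmod u3"
proof -
  have x0: "x \<noteq> 0" using x by auto
  note nz = roots_nonzero[OF R]
  have ae: "Af u1 = x" "Af u2 = x" "Af u3 = x" using roots_Af_iff[OF R] nz by auto
  have t: "- pi < Im (Ln x)" "Im (Ln x) < 0"
    using Im_Ln_lower[OF x] mpi_less_Im_Ln[OF x0] Im_Ln_pos_le[OF x0] x Im_Ln_le_pi[OF x0] by auto
  have nonreal: "Im u \<noteq> 0" if "Af u = x" for u
  proof
    assume "Im u = 0"
    hence "cnj u = u" by (simp add: complex_eq_iff)
    hence "Af u = cnj (Af u)" using Af_cnj[of u] by simp
    hence "Im (Af u) = 0" by (metis Reals_cnj_iff complex_is_Real_iff)
    thus False using that x by simp
  qed
  \<comment> \<open>The range of length \<open>3 * pi\<close> leaves only two of the branches over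
    \<open>Ln x\<close>.\<close>
  have up: "Lf u = Ln x \<or> Lf u = Ln x + 2 * of_real pi * \<i>" if "Af u = x" "Im u > 0" for u
  proof -
    have "exp (Lf u) = exp (Ln x)" using exp_Lf[OF that(2)] that(1) x0 by simp
    then obtain n :: int where n: "Lf u = Ln x + (of_int (2 * n) * of_real pi) * \<i>" unfolding exp_eq by auto
    have "Im (Lf u) = Im (Ln x) + 2 * of_int n * pi" unfolding n by simp
    hence "2 * of_int n * pi > - pi" "2 * of_int n * pi < 3 * pi" using Im_Lf_range[OF that(2)] t by linarith+
    hence "real_of_int (2 * n) * pi > real_of_int (-1) * pi" "real_of_int (2 * n) * pi < real_of_int 3 * pi" by simp_all
    hence "real_of_int (2 * n) > real_of_int (-1)" "real_of_int (2 * n) < real_of_int 3" by (simp_all only: mult_less_cancel_right_pos[OF pi_gt_zero])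
    hence "n = 0 \<or> n = 1" by linarith
    thus ?thesis using n by auto
  qed
  have low: "Lf (cnj u) = cnj (Ln x)" if "Af u = x" "Im u < 0" for u
  proof -
    have u: "Im (cnj u) > 0" using that by simp
    have "exp (Lf (cnj u)) = exp (cnj (Ln x))" using exp_Lf[OF u] that(1) x0 by (simp add: Af_cnj flip: exp_cnj)
    then obtain n :: int where n: "Lf (cnj u) = cnj (Ln x) + (of_int (2 * n) * of_real pi) * \<i>" unfolding exp_eq by auto
    have "Im (Lf (cnj u)) = - Im (Ln x) + 2 * of_int n * pi" unfolding n by simp
    hence "2 * of_int n * pi > - 2 * pi" "2 * of_int n * pi < 2 * pi" using Im_Lf_range[OF u] t by linarith+
    hence "real_of_int n * pi > real_of_int (-1) * pi" "real_of_int n * pi < real_of_int 1 * pi" by (simp_all add: mult.commute)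
    hence "real_of_int n > real_of_int (-1)" "real_of_int n < real_of_int 1" by (simp_all only: mult_less_cancel_right_pos[OF pi_gt_zero])
    hence "n = 0" by linarith
    thus ?thesis using n by simp
  qed
  \<comment> \<open>Labels a root by its height. Labels are injective on roots and increase with the
    modulus, so the three distinct roots carry 1, 2, 3 in order.\<close>
  define k :: "complex \<Rightarrow> nat" where "k u = (if Im u < 0 then 2 else if Lf u = Ln x then 1 else 3)" for u
  have k1: "Im u > 0 \<and> Lf u = Ln x" if "Af u = x" "k u = 1" for u
    using that nonreal[OF that(1)] by (auto simp: k_def split: if_splits)
  have k2: "Im u < 0 \<and> Lf (cnj u) = cnj (Ln x)" if "Af u = x" "k u = 2" for u
    using that low by (auto simp: k_def split: if_splits)
  have k3: "Im u > 0 \<and> Lf u = Ln x + 2 * of_real pi * \<i>" if "Af u = x" "k u = 3" for u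
    using that nonreal[OF that(1)] up[OF that(1)] by (auto simp: k_def split: if_splits)
  have k123: "k u = 1 \<or> k u = 2 \<or> k u = 3" for u by (simp add: k_def)
  have kinj: "u = w" if "Af u = x" "Af w = x" "k u = k w" for u w
    using k123[of u]
  proof (elim disjE)
    assume ku: "k u = 1"
    hence kw: "k w = 1" using that(3) by simp
    show ?thesis using k1[OF that(1) ku] k1[OF that(2) kw] Lf_inj[of u w] by simp
  next
    assume ku: "k u = 2"
    hence kw: "k w = 2" using that(3) by simp
    have "cnj u = cnj w" using k2[OF that(1) ku] k2[OF that(2) kw] Lf_inj[of "cnj u" "cnj w"] by simp
    thus ?thesis by simp
  next
    assume ku: "k u = 3"
    hence kw: "k w = 3" using that(3) by simp
    show ?thesis using k3[OF that(1) ku] k3[OF that(2) kw] Lf_inj[of u w] by simp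
  qed
  have kmono: "cmod u < cmod w" if K: "Af u = x" "Af w = x" "k u < k w" for u w
  proof -
    consider "k u = 1" "k w = 2" | "k u = 1" "k w = 3" | "k u = 2" "k w = 3"
      using K(3) k123[of u] k123[of w] by auto
    thus ?thesis
    proof cases
      case 1
      have "cmod u < cmod (cnj w)" using k1[OF that(1) 1(1)] k2[OF that(2) 1(2)] t Lf_cmod_less[of u "cnj w"] by simp
      thus ?thesis by simp
    next
      case 2
      show ?thesis using k1[OF that(1) 2(1)] k3[OF that(2) 2(2)] t Lf_cmod_less[of u w] by simp
    next
      case 3
      have "cmod (cnj u) < cmod w" using k2[OF that(1) 3(1)] k3[OF that(2) 3(2)] t Lf_cmod_less[of "cnj u" w] by simp
      thus ?thesis by simp
    qed
  qed
  have R': "u1 + u2 + u3 = - of_real sg" "u1 * u2 + u1 * u3 + u2 * u3 = of_real (a * b + a * c + b * c) - x"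
    "u1 * u2 * u3 = - of_real kp" using R by (auto simp: roots_def cubic_roots_def)
  have d12: "u1 \<noteq> u2"
    using double_root_real[of u1 u3 x] R' nonreal[OF ae(1)] by (auto simp: algebra_simps)
  have d23: "u2 \<noteq> u3"
    using double_root_real[of u2 u1 x] R' nonreal[OF ae(2)] by (auto simp: algebra_simps)
  have le: "cmod u1 \<le> cmod u2" "cmod u2 \<le> cmod u3" using roots_le[OF R] by auto
  have "k u1 < k u2" using kinj[OF ae(1,2)] d12 kmono[OF ae(2,1)] le by (meson linorder_neqE_nat not_le)
  moreover have "k u2 < k u3" using kinj[OF ae(2,3)] d23 kmono[OF ae(3,2)] le by (meson linorder_neqE_nat not_le)
  ultimately have k: "k u1 = 1" "k u2 = 2" "k u3 = 3" using k123[of u1] k123[of u2] k123[of u3] by auto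
  show "Im u1 > 0" "Lf u1 = Ln x" "Im u2 < 0" "Lf (cnj u2) = cnj (Ln x)" "Im u3 > 0" "Lf u3 = Ln x + 2 * of_real pi * \<i>"
    using k1[OF ae(1) k(1)] k2[OF ae(2) k(2)] k3[OF ae(3) k(3)] by auto
  show "cmod u1 < cmod u2" "cmod u2 < cmod u3" using kmono[OF ae(1,2)] kmono[OF ae(2,3)] k by auto
qed

end

lemma real_pair:
  fixes y y' :: complex
  assumes s: "y + y' = of_real S" and p: "y * y' = of_real P" and P: "P > 0"
  shows "S\<^sup>2 < 4 * P \<Longrightarrow> Im y \<noteq> 0 \<and> y' = cnj y \<and> (cmod y)\<^sup>2 = P \<and> (cmod y')\<^sup>2 = P \<and> Re y = S / 2"
    and "S\<^sup>2 \<ge> 4 * P \<Longrightarrow> Im y = 0 \<and> Im y' = 0 \<and> Re y + Re y' = S \<and> Re y * Re y' = P"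
proof -
  have s': "Re y + Re y' = S" "Im y' = - Im y" using s by (auto simp: complex_eq_iff)
  have p': "Re y * Re y' - Im y * Im y' = P" "Re y * Im y' + Im y * Re y' = 0" using p by (auto simp: complex_eq_iff)
  have "Im y * (Re y' - Re y) = 0" using p'(2) s'(2) by (simp add: algebra_simps)
  hence dis: "Im y = 0 \<or> Re y' = Re y" by auto
  have disc: "S\<^sup>2 - 4 * P = (Re y - Re y')\<^sup>2 + 4 * Im y * Im y'" unfolding p'(1)[symmetric] s'(1)[symmetric]
    by (simp add: power2_eq_square algebra_simps)
  { assume lt: "S\<^sup>2 < 4 * P"
    have ny: "Im y \<noteq> 0"
    proof
      assume "Im y = 0"
      hence "S\<^sup>2 - 4 * P \<ge> 0" unfolding disc using s'(2) by simp
      thus False using lt by simp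
    qed
    hence e: "Re y' = Re y" using dis by simp
    hence c: "y' = cnj y" using s'(2) by (simp add: complex_eq_iff)
    moreover have "(cmod y)\<^sup>2 = P" unfolding cmod_power2 using p'(1) e s'(2) by (simp add: power2_eq_square)
    ultimately show "Im y \<noteq> 0 \<and> y' = cnj y \<and> (cmod y)\<^sup>2 = P \<and> (cmod y')\<^sup>2 = P \<and> Re y = S / 2"
      using ny e s'(1) by simp }
  { assume ge: "S\<^sup>2 \<ge> 4 * P"
    have "Im y = 0"
    proof (rule ccontr)
      assume n: "Im y \<noteq> 0"
      hence "S\<^sup>2 - 4 * P = - 4 * (Im y)\<^sup>2" unfolding disc using dis s'(2) by (simp add: power2_eq_square)
      moreover have "(Im y)\<^sup>2 > 0" using n by simp
      ultimately show False using ge by linarith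
    qed
    thus "Im y = 0 \<and> Im y' = 0 \<and> Re y + Re y' = S \<and> Re y * Re y' = P" using s' p' by simp }
qed

section \<open>The distinguished real root and the angle of the other two\<close>

context three_shifts
begin

definition AR :: "real \<Rightarrow> real" where "AR m = (m - a) * (m - b) * (m - c) / m"
definition dAR :: "real \<Rightarrow> real" where "dAR m = 2 * m - sg + kp / m\<^sup>2"
text \<open>With \<open>- m\<close> a root, Vieta gives sum \<open>m - sg\<close> and product
  \<open>kp / m\<close> for the other two; this is half their sum over the square root of their
  product.\<close>

definition CC :: "real \<Rightarrow> real" where "CC m = (m - sg) * sqrt m / (2 * sqrt kp)"
definition dCC :: "real \<Rightarrow> real" where "dCC m = (3 * m - sg) / (4 * sqrt kp * sqrt m)"
text \<open>Two intervals on which \<open>AR\<close> is monotone: \<open>(0, a)\<close> maps onto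
  the negative and \<open>(c, \<infinity>)\<close> onto the positive axis.\<close>

definition Dm :: "real set" where "Dm = {m. 0 < m \<and> (m < a \<or> c < m)}"

lemma Dm_pos: "m \<in> Dm \<Longrightarrow> 0 < m" by (simp add: Dm_def)

lemma Af_AR: "m \<noteq> 0 \<Longrightarrow> Af (of_real (- m)) = of_real (AR m)"
proof -
  assume m: "m \<noteq> 0"
  have "AR m = (- m + a) * (- m + b) * (- m + c) / (- m)" using m by (simp add: AR_def field_simps)
  thus ?thesis by (simp only: Af_def of_real_divide of_real_mult of_real_add)
qed

lemma DERIV_AR: "m \<noteq> 0 \<Longrightarrow> DERIV AR m :> dAR m"
proof -
  assume m: "m \<noteq> 0"
  have eq: "AR u = u\<^sup>2 - sg * u + (a * b + a * c + b * c) - kp / u" if "u \<noteq> 0" for u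
    using that by (simp add: AR_def sg_def kp_def field_simps power2_eq_square)
  have "DERIV (\<lambda>u. u\<^sup>2 - sg * u + (a * b + a * c + b * c) - kp / u) m :> dAR m"
    unfolding dAR_def using m by (auto intro!: derivative_eq_intros simp: power2_eq_square)
  moreover have "\<forall>\<^sub>F u in nhds m. u \<in> - {0}" using m by (intro eventually_nhds_in_open) auto
  hence "\<forall>\<^sub>F u in nhds m. AR u = u\<^sup>2 - sg * u + (a * b + a * c + b * c) - kp / u"
    by eventually_elim (use eq in auto)
  ultimately show ?thesis by (subst DERIV_cong_ev[OF refl _ refl]) auto
qed

lemma dAR_pos: "m \<in> Dm \<Longrightarrow> dAR m > 0"
proof -
  assume m: "m \<in> Dm"
  hence m0: "m > 0" by (rule Dm_pos)
  \<comment> \<open>On \<open>Dm\<close> the three differences have a common sign, so each product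
    of two of them is positive in this decomposition.\<close>
  have "m\<^sup>2 * dAR m = a * ((m - b) * (m - c)) + m * ((m - a) * (m - c)) + m * ((m - a) * (m - b))"
    using m0 by (simp add: dAR_def sg_def kp_def field_simps power2_eq_square)
  moreover have "(m - b) * (m - c) > 0" "(m - a) * (m - c) > 0" "(m - a) * (m - b) > 0"
    using m ab bc by (auto simp: Dm_def zero_less_mult_iff)
  ultimately have "m\<^sup>2 * dAR m > 0" using m0 pos by (simp add: add_pos_pos)
  thus ?thesis using m0 by (simp add: zero_less_mult_iff)
qed

lemma AR_sign: "m \<in> Dm \<Longrightarrow> (AR m > 0 \<longleftrightarrow> c < m)" "m \<in> Dm \<Longrightarrow> (AR m < 0 \<longleftrightarrow> m < a)"
proof -
  have 1: "AR m > 0" if "c < m" for m using that ab bc pos unfolding AR_def by (intro divide_pos_pos mult_pos_pos) auto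
  have 2: "AR m < 0" if "0 < m" "m < a" for m
  proof -
    have "(m - a) * (m - b) * (m - c) < 0" using that ab bc by (intro mult_pos_neg mult_neg_neg) auto
    thus ?thesis using that unfolding AR_def by (simp add: divide_neg_pos)
  qed
  show "m \<in> Dm \<Longrightarrow> (AR m > 0 \<longleftrightarrow> c < m)" "m \<in> Dm \<Longrightarrow> (AR m < 0 \<longleftrightarrow> m < a)"
    using 1[of m] 2[of m] ab bc by (auto simp: Dm_def)
qed

lemma AR_mono:
  assumes "m < m'" and D: "{m..m'} \<subseteq> Dm"
  shows "AR m < AR m'"
proof (rule DERIV_pos_imp_increasing[OF assms(1)])
  fix u assume "m \<le> u" "u \<le> m'"
  hence u: "u \<in> Dm" using D by auto
  show "\<exists>y. DERIV AR u :> y \<and> y > 0" using DERIV_AR[of u] dAR_pos[OF u] Dm_pos[OF u] by auto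
qed

lemma AR_less_iff:
  assumes "m \<in> Dm" "m' \<in> Dm" "AR m > 0 \<longleftrightarrow> AR m' > 0"
  shows "AR m < AR m' \<longleftrightarrow> m < m'"
proof -
  have *: "AR m < AR m'" if "m < m'" "m \<in> Dm" "m' \<in> Dm" "AR m > 0 \<longleftrightarrow> AR m' > 0" for m m'
  proof (rule AR_mono[OF that(1)])
    show "{m..m'} \<subseteq> Dm" using that ab bc AR_sign[OF that(2)] AR_sign[OF that(3)] by (auto simp: Dm_def)
  qed
  show ?thesis using *[of m m'] *[of m' m] assms by (cases m m' rule: linorder_cases) auto
qed

lemma AR_inj: "m \<in> Dm \<Longrightarrow> m' \<in> Dm \<Longrightarrow> AR m = AR m' \<Longrightarrow> m = m'"
  using AR_less_iff[of m m'] AR_less_iff[of m' m] by (metis less_irrefl linorder_neqE)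

lemma isCont_AR: "m \<noteq> 0 \<Longrightarrow> isCont AR m" using DERIV_AR by (rule DERIV_isCont)

lemma AR_surj: "x \<noteq> 0 \<Longrightarrow> \<exists>m\<in>Dm. AR m = x"
proof -
  assume x: "x \<noteq> 0"
  show ?thesis
  proof (cases "x > 0")
    case True
    \<comment> \<open>From \<open>M \<ge> 2 * c\<close> every factor is at least
      \<open>M / 2\<close>, so \<open>AR M \<ge> M * M / 8\<close>, and this exceeds
      \<open>x\<close> as \<open>M\<close> is at least 8 and at least \<open>x\<close>.\<close>
    define M where "M = 8 + 2 * c + x"
    have M: "M \<ge> 2 * c" "M > 8" "M \<ge> x" using True pos by (auto simp: M_def)
    have "(M / 2) * (M / 2) * (M / 2) \<le> (M - a) * (M - b) * (M - c)"
      using M ab bc pos by (intro mult_mono mult_nonneg_nonneg) auto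
    hence "(M / 2) * (M / 2) * (M / 2) / M \<le> AR M" unfolding AR_def using M by (intro divide_right_mono) auto
    moreover have "(M / 2) * (M / 2) * (M / 2) / M = M * M / 8" using M by simp
    moreover have "8 * x \<le> M * M" using M True by (intro mult_mono) auto
    ultimately have "x \<le> AR M" by linarith
    moreover have "AR c = 0" by (simp add: AR_def)
    ultimately obtain m where m: "c \<le> m" "m \<le> M" "AR m = x"
      using IVT[of AR c x M] isCont_AR pos M True by (smt (verit))
    hence "m \<noteq> c" using True \<open>AR c = 0\<close> by auto
    thus ?thesis using m pos by (intro bexI[of _ m]) (auto simp: Dm_def)
  next
    case False
    hence xn: "x < 0" using x by simp
    \<comment> \<open>From \<open>M \<le> a / 2\<close> every factor is at least half its value at
      0, so \<open>- AR M \<ge> kp / (8 * M)\<close>, and the second bound makes this at least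
      \<open>- x\<close>.\<close>
    define M where "M = min (a / 2) (kp / (8 * (- x)))"
    have M: "M > 0" "M \<le> a / 2" "M \<le> kp / (8 * (- x))" using xn pos by (auto simp: M_def divide_pos_neg)
    have "a / 2 * (b / 2) * (c / 2) \<le> (a - M) * (b - M) * (c - M)"
      using M ab bc pos by (intro mult_mono mult_nonneg_nonneg) auto
    hence "kp / 8 / M \<le> (a - M) * (b - M) * (c - M) / M" using M by (intro divide_right_mono) (auto simp: kp_def)
    moreover have "- x \<le> kp / 8 / M" using M xn by (simp add: field_simps)
    moreover have "(a - M) * (b - M) * (c - M) = - ((M - a) * (M - b) * (M - c))" by (simp add: algebra_simps)
    hence "(a - M) * (b - M) * (c - M) / M = - AR M" by (simp add: AR_def)
    ultimately have "AR M \<le> x" by linarith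
    moreover have "AR a = 0" by (simp add: AR_def)
    ultimately obtain m where m: "M \<le> m" "m \<le> a" "AR m = x"
      using IVT[of AR M x a] isCont_AR pos M xn by (smt (verit) field_sum_of_halves)
    hence "m \<noteq> a" using xn \<open>AR a = 0\<close> by auto
    thus ?thesis using m M by (intro bexI[of _ m]) (auto simp: Dm_def)
  qed
qed

text \<open>Unspecified at \<open>x = 0\<close>, since \<open>AR\<close> has no zero in
  \<open>Dm\<close>; near 0 the values approach \<open>c\<close> from one side and \<open>a\<close>
  from the other.\<close>

definition mp :: "real \<Rightarrow> real" where "mp x = (THE m. m \<in> Dm \<and> AR m = x)"

lemma mp_AR: "m \<in> Dm \<Longrightarrow> mp (AR m) = m"
  unfolding mp_def by (rule the_equality) (auto intro: AR_inj)

lemma mp: assumes "x \<noteq> 0" shows "mp x \<in> Dm" "AR (mp x) = x"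
proof -
  obtain m where "m \<in> Dm" "AR m = x" using AR_surj[OF assms] by blast
  thus "mp x \<in> Dm" "AR (mp x) = x" using mp_AR by auto
qed

lemma mp_pos: "x > 0 \<Longrightarrow> mp x > c" "x < 0 \<Longrightarrow> 0 < mp x \<and> mp x < a"
  using AR_sign[OF mp(1), of x] mp(2)[of x] Dm_pos[OF mp(1), of x] by auto

lemma mp_less: "x \<noteq> 0 \<Longrightarrow> y \<noteq> 0 \<Longrightarrow> x > 0 \<longleftrightarrow> y > 0 \<Longrightarrow> mp x < mp y \<longleftrightarrow> x < y"
  using AR_less_iff[OF mp(1) mp(1), of x y] mp(2) by auto

lemma open_Dm: "open Dm"
proof -
  have "Dm = {0<..<a} \<union> {c<..}" using ab bc pos by (auto simp: Dm_def)
  thus ?thesis by auto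
qed

lemma isCont_mp: "x \<noteq> 0 \<Longrightarrow> isCont mp x"
proof -
  assume x: "x \<noteq> 0"
  obtain e where e: "e > 0" "cball (mp x) e \<subseteq> Dm" using open_Dm mp(1)[OF x] open_contains_cball by blast
  have "isCont mp (AR (mp x))"
  proof (rule isCont_inverse_function2[of "mp x - e" "mp x" "mp x + e"])
    fix z assume "mp x - e \<le> z" "z \<le> mp x + e"
    hence z: "z \<in> Dm" using e by (auto simp: dist_real_def)
    show "mp (AR z) = z" by (rule mp_AR[OF z])
    show "isCont AR z" using isCont_AR Dm_pos[OF z] by auto
  qed (use e in auto)
  thus ?thesis using mp(2)[OF x] by simp
qed

lemma DERIV_mp: assumes x: "x \<noteq> 0" shows "DERIV mp x :> inverse (dAR (mp x))"
proof -
  obtain l u where lu: "l < x" "x < u" "\<forall>y. l < y \<and> y < u \<longrightarrow> y \<noteq> 0"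
    using x by (cases "x > 0") (auto intro: that[of 0 "x + 1"] that[of "x - 1" 0])
  show ?thesis
    by (rule DERIV_inverse_function[of AR, OF DERIV_AR _ lu(1,2)])
      (use lu mp dAR_pos[OF mp(1)[OF x]] Dm_pos[OF mp(1)[OF x]] isCont_mp x in auto)
qed

lemma CC_sq: "m > 0 \<Longrightarrow> (CC m)\<^sup>2 = (m - sg)\<^sup>2 / (4 * (kp / m))"
  unfolding CC_def power_mult_distrib power_divide using pos by simp

lemma CC_abs_less: "m > 0 \<Longrightarrow> \<bar>CC m\<bar> < 1 \<longleftrightarrow> (m - sg)\<^sup>2 < 4 * (kp / m)"
proof -
  assume m: "m > 0"
  have "\<bar>CC m\<bar> < 1 \<longleftrightarrow> (CC m)\<^sup>2 < 1" by (simp add: abs_square_less_1)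
  also have "\<dots> \<longleftrightarrow> (m - sg)\<^sup>2 < 4 * (kp / m)" unfolding CC_sq[OF m] using m pos by (subst divide_less_eq_1_pos) auto
  finally show ?thesis .
qed

lemma CC_alt: "m > 0 \<Longrightarrow> CC m = (m - sg) / (2 * sqrt (kp / m))"
  using pos by (simp add: CC_def real_sqrt_divide)

lemma DERIV_CC: "m > 0 \<Longrightarrow> DERIV CC m :> dCC m"
proof -
  assume m: "m > 0"
  have "DERIV (\<lambda>u. (u - sg) * sqrt u / (2 * sqrt kp)) m :> (1 * sqrt m + inverse (sqrt m) / 2 * (m - sg)) / (2 * sqrt kp)"
    using m by (intro DERIV_cdivide DERIV_mult DERIV_real_sqrt) (auto intro!: derivative_eq_intros)
  moreover have "(1 * sqrt m + inverse (sqrt m) / 2 * (m - sg)) / (2 * sqrt kp) = dCC m"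
  proof -
    have "sqrt m * sqrt m = m" using m by simp
    hence "1 * sqrt m + inverse (sqrt m) / 2 * (m - sg) = (3 * m - sg) / (2 * sqrt m)"
      using m by (simp add: field_simps)
    thus ?thesis using m pos by (simp add: dCC_def)
  qed
  ultimately show ?thesis unfolding CC_def[abs_def] by simp
qed

text \<open>When the other two roots are not real they are \<open>sqrt (kp / m) * cis (\<plusminus> \<theta>)\<close> with \<open>cos \<theta> = CC m\<close>; clamping
  makes \<open>\<theta>\<close> constant where they are real.\<close>

definition clamp :: "real \<Rightarrow> real" where "clamp t = max (-1) (min 1 t)"

definition Th :: "real \<Rightarrow> real" where "Th x = arccos (clamp (CC (mp x)))"

lemma clamp_range: "-1 \<le> clamp t" "clamp t \<le> 1" by (auto simp: clamp_def)

lemma Th_range: "0 \<le> Th x" "Th x \<le> pi" unfolding Th_def using clamp_range by (auto intro: arccos_lbound arccos_ubound)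

text \<open>The real root is \<open>- mp x\<close>; it is the largest root for \<open>x > 0\<close> and the smallest one for \<open>x < 0\<close>.\<close>

lemma root_pair:
  assumes R: "roots (of_real x) u1 u2 u3" and x: "x \<noteq> 0"
  obtains y y' where "y + y' = of_real (mp x - sg)" "y * y' = of_real (kp / mp x)"
    "x > 0 \<Longrightarrow> u3 = of_real (- mp x) \<and> u1 = y \<and> u2 = y' \<and> cmod u2 < mp x"
    "x < 0 \<Longrightarrow> u1 = of_real (- mp x) \<and> u2 = y \<and> u3 = y' \<and> mp x < cmod u2"
proof -
  let ?m = "mp x"
  have m: "?m \<in> Dm" "AR ?m = x" "?m > 0" using mp[OF x] Dm_pos by auto
  have dm: "dAR ?m > 0" by (rule dAR_pos[OF m(1)])
  have Rs: "u1 + u2 + u3 = - of_real sg" "u1 * u2 * u3 = - of_real kp" using roots_sum[OF R] roots_prod[OF R] .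
  have "Af (of_real (- ?m)) = of_real x" using Af_AR[of ?m] m by simp
  hence mem: "of_real (- ?m) \<in> {u1, u2, u3}" using roots_Af_iff[OF R, of "of_real (- ?m)"] m(3) by auto
  \<comment> \<open>A conjugate pair is compared through its product \<open>kp / ?m\<close>, using
    that \<open>?m\<close> exceeds, or stays below, all three shifts. Real roots are located by the
    position of their negatives relative to \<open>Dm\<close>.\<close>
  have others: "y \<in> {u1, u2, u3} \<Longrightarrow> (x > 0 \<longrightarrow> cmod y < ?m) \<and> (x < 0 \<longrightarrow> ?m < cmod y)"
    if yy: "y + y' = of_real (?m - sg)" "y * y' = of_real (kp / ?m)" for y y'
  proof -
    assume ymem: "y \<in> {u1, u2, u3}"
    have y0: "y \<noteq> 0" using roots_nonzero[OF R] ymem by auto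
    have Ay: "Af y = of_real x" using roots_Af_iff[OF R y0] ymem by auto
    have P: "kp / ?m > 0" using pos m by simp
    show ?thesis
    proof (cases "(?m - sg)\<^sup>2 < 4 * (kp / ?m)")
      case True
      have cy: "(cmod y)\<^sup>2 = kp / ?m" using real_pair(1)[OF yy P True] by simp
      have "(cmod y)\<^sup>2 < ?m\<^sup>2" if "x > 0"
      proof -
        have "a < ?m" "b < ?m" "c < ?m" using mp_pos(1)[OF that] ab bc by auto
        hence "kp < ?m * ?m * ?m" unfolding kp_def using pos by (intro mult_strict_mono mult_pos_pos) auto
        thus ?thesis unfolding cy using m by (simp add: field_simps power2_eq_square)
      qed
      moreover have "?m\<^sup>2 < (cmod y)\<^sup>2" if "x < 0"
      proof -
        have "?m < a" "?m < b" "?m < c" using mp_pos(2)[OF that] ab bc by auto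
        hence "?m * ?m * ?m < kp" unfolding kp_def using m pos by (intro mult_strict_mono mult_pos_pos) auto
        thus ?thesis unfolding cy using m by (simp add: field_simps power2_eq_square)
      qed
      ultimately show ?thesis using m by (auto intro: power2_less_imp_less)
    next
      case False
      hence r: "Im y = 0" "Im y' = 0" "Re y + Re y' = ?m - sg" "Re y * Re y' = kp / ?m"
        using real_pair(2)[OF yy P] by auto
      have y_real: "y = of_real (Re y)" using r by (simp add: complex_eq_iff)
      have same: "(Re y > 0 \<and> Re y' > 0) \<or> (Re y < 0 \<and> Re y' < 0)" using P unfolding r(4)[symmetric] zero_less_mult_iff .
      show ?thesis
      proof (cases "Re y > 0")
        case True
        have "Re y < ?m - sg" using same True r(3) by auto
        hence lt: "Re y < ?m" and big: "?m > sg" using pos True by auto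
        have "x > 0"
        proof (rule ccontr)
          assume "\<not> x > 0"
          hence "?m < a" using mp_pos(2)[of x] x by auto
          thus False using big ab bc pos by (simp add: sg_def)
        qed
        thus ?thesis using lt True by (subst y_real, subst norm_of_real) auto
      next
        case False
        define t where "t = - Re y"
        have t: "t > 0" "y = of_real (- t)" using False same y_real by (auto simp: t_def)
        have "of_real (AR t) = (of_real x :: complex)" using Ay Af_AR[of t] t by simp
        hence ARt: "AR t = x" using of_real_eq_iff by blast
        \<comment> \<open>Equality would make \<open>- ?m\<close> a double root, hence a critical
          point of \<open>AR\<close>.\<close>
        have ne: "t \<noteq> ?m"
        proof
          assume tm: "t = ?m"
          hence "Re y = - ?m" by (simp add: t_def)
          hence "?m * Re y' = - (kp / ?m)" using r(4) by simp
          hence "Re y' = - kp / ?m\<^sup>2" using m(3) by (simp add: field_simps power2_eq_square)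
          hence "dAR ?m = 0" using r(3) tm by (simp add: dAR_def t_def)
          thus False using dm by simp
        qed
        \<comment> \<open>Another solution of \<open>AR t = x\<close> must lie in
          \<open>[a, c]\<close>, between the two intervals of \<open>Dm\<close>.\<close>
        have nd: "t \<notin> Dm" using AR_inj[OF _ m(1), of t] ARt m(2) ne by auto
        have "cmod y = t" unfolding t(2) using t(1) by simp
        thus ?thesis using nd t(1) mp_pos[of x] ab bc by (auto simp: Dm_def)
      qed
    qed
  qed
  have rel: "u + w = of_real (?m - sg) \<and> u * w = of_real (kp / ?m)"
    if "u + w + of_real (- ?m) = - of_real sg" "u * w * of_real (- ?m) = - of_real kp" for u w :: complex
    using that m(3) by (auto simp: field_simps of_real_diff eq_neg_iff_add_eq_0)
  have nm: "cmod (of_real (- ?m)) = ?m" using m(3) by simp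
  have le: "cmod u1 \<le> cmod u2" "cmod u2 \<le> cmod u3" using roots_le[OF R] by auto
  consider "u1 = of_real (- ?m)" | "u2 = of_real (- ?m)" | "u3 = of_real (- ?m)" using mem by auto
  then consider (A) "x > 0" "u3 = of_real (- ?m)" | (B) "x < 0" "u1 = of_real (- ?m)"
  proof cases
    case 1
    have "u2 + u3 = of_real (?m - sg) \<and> u2 * u3 = of_real (kp / ?m)" using Rs 1 by (intro rel) (auto simp: algebra_simps)
    hence "x > 0 \<longrightarrow> cmod u2 < ?m" using others[of u2 u3] by auto
    thus ?thesis using that 1 le nm x by (metis linorder_neqE not_le)
  next
    case 2
    have "u1 + u3 = of_real (?m - sg) \<and> u1 * u3 = of_real (kp / ?m)" using Rs 2 by (intro rel) (auto simp: algebra_simps)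
    hence "(x < 0 \<longrightarrow> ?m < cmod u1)" using others[of u1 u3] by auto
    moreover have "u3 + u1 = of_real (?m - sg) \<and> u3 * u1 = of_real (kp / ?m)" using Rs 2 by (intro rel) (auto simp: algebra_simps)
    hence "(x > 0 \<longrightarrow> cmod u3 < ?m)" using others[of u3 u1] by auto
    ultimately show ?thesis using that 2 le nm x by (metis linorder_neqE not_le)
  next
    case 3
    have "u2 + u1 = of_real (?m - sg) \<and> u2 * u1 = of_real (kp / ?m)" using Rs 3 by (intro rel) (auto simp: algebra_simps)
    hence "(x < 0 \<longrightarrow> ?m < cmod u2)" using others[of u2 u1] by auto
    moreover have "u1 + u2 = of_real (?m - sg) \<and> u1 * u2 = of_real (kp / ?m)" using Rs 3 by (intro rel) (auto simp: algebra_simps)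
    hence "x < 0 \<longrightarrow> ?m < cmod u1" using others[of u1 u2] by auto
    ultimately show ?thesis
    proof (cases "x > 0")
      case False
      hence "x < 0" using x by simp
      moreover obtain t where "AR t = x" by (metis m(2))
      show ?thesis
      proof -
        have "cmod u1 * cmod u2 * cmod u3 = kp" by (rule roots_cmod_prod[OF R])
        have "?m < cmod u1" "?m < cmod u2" using \<open>x < 0\<close> \<open>x < 0 \<longrightarrow> ?m < cmod u2\<close> \<open>x < 0 \<longrightarrow> ?m < cmod u1\<close> by auto
        thus ?thesis using 3 nm le by simp
      qed
    qed (use that 3 in auto)
  qed
  thus ?thesis
  proof cases
    case A
    have r: "u1 + u2 = of_real (?m - sg) \<and> u1 * u2 = of_real (kp / ?m)" using Rs A by (intro rel) (auto simp: algebra_simps)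
    have "u2 + u1 = of_real (?m - sg) \<and> u2 * u1 = of_real (kp / ?m)" using r by (simp add: algebra_simps)
    hence "cmod u2 < ?m" using others[of u2 u1] A by auto
    thus ?thesis using that[of u1 u2] r A by auto
  next
    case B
    have r: "u2 + u3 = of_real (?m - sg) \<and> u2 * u3 = of_real (kp / ?m)" using Rs B by (intro rel) (auto simp: algebra_simps)
    hence "?m < cmod u2" using others[of u2 u3] B by auto
    thus ?thesis using that[of u2 u3] r B by auto
  qed
qed

text \<open>A real pair with positive product has argument 0 or pi according to the sign of its sum,
  which is also the sign of \<open>CC m\<close>; clamping gives the matching cosine.\<close>

lemma pair_angle:
  assumes yy: "y + y' = of_real (m - sg)" "y * y' = of_real (kp / m)" and m: "m > 0" and y: "Im y \<ge> 0"
  shows "Im (Ln y) = arccos (clamp (CC m))"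
proof -
  have P: "kp / m > 0" using pos m by simp
  have y0: "y \<noteq> 0" using yy(2) P by auto
  show ?thesis
  proof (cases "(m - sg)\<^sup>2 < 4 * (kp / m)")
    case True
    have cy: "(cmod y)\<^sup>2 = kp / m" "Re y = (m - sg) / 2" using real_pair(1)[OF yy P True] by auto
    have sq: "cmod y = sqrt (kp / m)" unfolding cy(1)[symmetric] by simp
    have "Re y / cmod y = CC m" unfolding CC_alt[OF m] sq cy(2) by simp
    moreover have "clamp (CC m) = CC m" using CC_abs_less[OF m] True by (auto simp: clamp_def)
    ultimately show ?thesis using Im_Ln_upper[OF y0 y] by simp
  next
    case False
    hence r: "Im y = 0" "Im y' = 0" "Re y + Re y' = m - sg" "Re y * Re y' = kp / m"
      using real_pair(2)[OF yy P] by auto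
    have same: "(Re y > 0 \<and> Re y' > 0) \<or> (Re y < 0 \<and> Re y' < 0)" using P unfolding r(4)[symmetric] zero_less_mult_iff .
    have big: "\<bar>CC m\<bar> \<ge> 1" using CC_abs_less[OF m] False by auto
    have cy: "cmod y = \<bar>Re y\<bar>" using r by (simp add: cmod_eq_Re)
    show ?thesis
    proof (cases "Re y > 0")
      case True
      hence "m - sg > 0" using same r(3) by auto
      hence "CC m > 0" unfolding CC_alt[OF m] using P by simp
      hence "clamp (CC m) = 1" using big by (auto simp: clamp_def)
      moreover have "Re y / cmod y = 1" unfolding cy using True by simp
      ultimately show ?thesis using Im_Ln_upper[OF y0 y] by (simp only:)
    next
      case F: False
      hence "m - sg < 0" using same r(3) by auto
      hence "CC m < 0" unfolding CC_alt[OF m] using P by (simp add: divide_neg_pos)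
      hence "clamp (CC m) = -1" using big by (auto simp: clamp_def)
      moreover have "Re y / cmod y = -1" unfolding cy using F same by auto
      ultimately show ?thesis using Im_Ln_upper[OF y0 y] by (simp only:)
    qed
  qed
qed

end

section \<open>The two measures at a fixed parameter\<close>

lemma measurable_continuous_except_0:
  fixes f :: "real \<Rightarrow> real"
  assumes "\<And>x. x \<noteq> 0 \<Longrightarrow> isCont f x"
  shows "f \<in> borel_measurable borel"
proof -
  have "continuous_on (- {0}) f" using assms by (intro continuous_at_imp_continuous_on) auto
  hence "(\<lambda>x. indicator (- {0}) x *\<^sub>R f x) \<in> borel_measurable borel"
    by (intro borel_measurable_continuous_on_indicator) auto
  moreover have "(\<lambda>x. indicator {0::real} x * f 0) \<in> borel_measurable borel"
    by (intro borel_measurable_times borel_measurable_indicator borel_closed) auto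
  ultimately have "(\<lambda>x. indicator (- {0}) x *\<^sub>R f x + indicator {0} x * f 0) \<in> borel_measurable borel" by measurable
  moreover have "(\<lambda>x. indicator (- {0}) x *\<^sub>R f x + indicator {0} x * f 0) = f" by (auto simp: fun_eq_iff indicator_def)
  ultimately show ?thesis by simp
qed

lemma half_le_sin:
  fixes t :: real
  assumes "0 \<le> t" "t \<le> pi / 3"
  shows "t / 2 \<le> sin t"
proof -
  have "(\<lambda>t. sin t - t / 2) 0 \<le> (\<lambda>t. sin t - t / 2) t"
  proof (rule DERIV_nonneg_imp_nondecreasing[OF assms(1)])
    fix u assume u: "0 \<le> u" "u \<le> t"
    have "cos (pi / 3) \<le> cos u" using u assms by (intro cos_monotone_0_pi_le) auto
    hence "cos u - 1 / 2 \<ge> 0" by (simp add: cos_60)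
    moreover have "DERIV (\<lambda>t. sin t - t / 2) u :> cos u - 1 / 2" by (auto intro!: derivative_eq_intros)
    ultimately show "\<exists>y. DERIV (\<lambda>t. sin t - t / 2) u :> y \<and> 0 \<le> y" by blast
  qed
  thus ?thesis by simp
qed

text \<open>Linear control of how far the angle exceeds pi/2; for \<open>u \<ge> 1 / 2\<close> it is
  trivial because the left side is at most 1/2. It gives the decay of the second measure at
  infinity.\<close>

lemma arccos_neg_le:
  assumes "0 \<le> u" "u \<le> 1"
  shows "arccos (- u) / pi - 1 / 2 \<le> u"
proof (cases "u < 1 / 2")
  case False
  have "arccos (- u) / pi \<le> 1" using arccos_ubound[of "- u"] assms by simp
  thus ?thesis using False by linarith
next
  case True
  define t where "t = arccos (- u) - pi / 2"
  have s: "sin t = u" unfolding t_def using assms by (simp add: sin_diff)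
  have "arccos (- u) \<le> arccos (- (1 / 2))" using assms True by (intro arccos_le_arccos) auto
  also have "arccos (- (1 / 2)) = pi - arccos (1 / 2)" by (rule arccos_minus) auto
  also have "arccos (1 / 2) = pi / 3" by (rule arccos_unique) (auto simp: cos_60)
  finally have t1: "t \<le> pi / 6" by (simp add: t_def)
  have "arccos 0 \<le> arccos (- u)" using assms by (intro arccos_le_arccos) auto
  hence t0: "0 \<le> t" by (simp add: t_def)
  have "t \<le> 2 * u" using half_le_sin[OF t0] t1 s pi_gt_zero by linarith
  also have "2 * u \<le> pi * u" using assms pi_gt3 by (intro mult_right_mono) auto
  finally have "t / pi \<le> u" using pi_gt_zero by (simp add: divide_le_eq mult.commute)
  thus ?thesis by (simp add: t_def diff_divide_distrib)
qed

section \<open>The density and its distribution function\<close>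

context three_shifts
begin

text \<open>The absolute value of the derivative of \<open>Th\<close>, divided by pi: arc cosine,
  then \<open>CC\<close>, then \<open>mp\<close> with derivative \<open>1 / dAR\<close>.\<close>

definition rho :: "real \<Rightarrow> real" where
  "rho x = (if x \<noteq> 0 \<and> \<bar>CC (mp x)\<bar> < 1 then \<bar>dCC (mp x)\<bar> / (pi * sqrt (1 - (CC (mp x))\<^sup>2) * dAR (mp x)) else 0)"

lemma mp_nz_pos: "x \<noteq> 0 \<Longrightarrow> mp x > 0" using Dm_pos[OF mp(1)] .

lemma isCont_CCmp: "x \<noteq> 0 \<Longrightarrow> isCont (\<lambda>x. CC (mp x)) x"
  using isCont_o2[OF isCont_mp DERIV_isCont[OF DERIV_CC[OF mp_nz_pos]]] .

lemma measurable_mp [measurable]: "mp \<in> borel_measurable borel"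
  by (rule measurable_continuous_except_0[OF isCont_mp])

lemma measurable_rho [measurable]: "rho \<in> borel_measurable borel"
  unfolding rho_def[abs_def] CC_def dCC_def dAR_def by measurable

lemma rho_nonneg: "rho x \<ge> 0"
proof (cases "x \<noteq> 0 \<and> \<bar>CC (mp x)\<bar> < 1")
  case True
  hence "(CC (mp x))\<^sup>2 < 1" by (simp add: abs_square_less_1)
  thus ?thesis using True dAR_pos[OF mp(1), of x] unfolding rho_def by (auto intro!: divide_nonneg_pos mult_pos_pos)
qed (auto simp: rho_def)

lemma Th_eq_pi: "CC (mp x) \<le> -1 \<Longrightarrow> Th x = pi"
  and Th_eq_0: "CC (mp x) \<ge> 1 \<Longrightarrow> Th x = 0"
proof -
  assume "CC (mp x) \<le> -1"
  hence "clamp (CC (mp x)) = -1" by (simp add: clamp_def)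
  thus "Th x = pi" by (simp add: Th_def)
next
  assume "CC (mp x) \<ge> 1"
  hence "clamp (CC (mp x)) = 1" by (simp add: clamp_def)
  thus "Th x = 0" by (simp add: Th_def)
qed

lemma isCont_Th: "x \<noteq> 0 \<Longrightarrow> isCont Th x"
proof -
  assume x: "x \<noteq> 0"
  have "continuous_on (- {0}) (\<lambda>x. arccos (clamp (CC (mp x))))"
    using clamp_range isCont_CCmp unfolding clamp_def
    by (intro continuous_on_arccos continuous_intros continuous_at_imp_continuous_on) auto
  hence "continuous_on (- {0}) Th" unfolding Th_def[abs_def] .
  thus ?thesis using x continuous_on_eq_continuous_at[of "- {0}" Th] by auto
qed

text \<open>The sign comes from \<open>3 * m - sg\<close>, positive for \<open>m > c\<close> and
  negative for \<open>m < a\<close>; so the angle is nonincreasing on the positive axis and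
  nondecreasing on the negative one.\<close>

lemma DERIV_Th:
  assumes x: "x \<noteq> 0" and C: "\<bar>CC (mp x)\<bar> \<noteq> 1"
  shows "DERIV Th x :> - sgn x * pi * rho x"
proof -
  have cont: "((\<lambda>x. CC (mp x)) \<longlongrightarrow> CC (mp x)) (nhds x)"
    using isCont_CCmp[OF x] unfolding isCont_def by (rule tendsto_at_iff_tendsto_nhds[THEN iffD1])
  consider "\<bar>CC (mp x)\<bar> < 1" | "CC (mp x) > 1" | "CC (mp x) < -1" using C by linarith
  thus ?thesis
  proof cases
    case 1
    have "\<forall>\<^sub>F y in nhds x. CC (mp y) < 1" "\<forall>\<^sub>F y in nhds x. -1 < CC (mp y)"
      using order_tendstoD[OF cont] 1 by auto
    hence ev: "\<forall>\<^sub>F y in nhds x. Th y = arccos (CC (mp y))"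
      by eventually_elim (simp add: Th_def clamp_def)
    have m: "mp x > 0" by (rule mp_nz_pos[OF x])
    have s1: "(CC (mp x))\<^sup>2 < 1" using 1 by (simp add: abs_square_less_1)
    have D: "DERIV (\<lambda>y. arccos (CC (mp y))) x :> inverse (- sqrt (1 - (CC (mp x))\<^sup>2)) * (dCC (mp x) * inverse (dAR (mp x)))"
      by (rule DERIV_chain2[OF DERIV_arccos DERIV_chain2[OF DERIV_CC[OF m] DERIV_mp[OF x]]]) (use 1 in auto)
    have "sgn x * \<bar>dCC (mp x)\<bar> = dCC (mp x)"
    proof (cases "x > 0")
      case True
      hence "3 * mp x - sg > 0" using mp_pos(1)[OF True] ab bc by (simp add: sg_def)
      hence "dCC (mp x) > 0" using m pos by (simp add: dCC_def)
      thus ?thesis using True by simp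
    next
      case False
      hence xn: "x < 0" using x by simp
      hence "3 * mp x - sg < 0" using mp_pos(2)[OF xn] ab bc by (simp add: sg_def)
      hence "dCC (mp x) < 0" using m pos by (simp add: dCC_def divide_neg_pos)
      thus ?thesis using xn by simp
    qed
    hence "inverse (- sqrt (1 - (CC (mp x))\<^sup>2)) * (dCC (mp x) * inverse (dAR (mp x)))
       = inverse (- sqrt (1 - (CC (mp x))\<^sup>2)) * (sgn x * \<bar>dCC (mp x)\<bar> * inverse (dAR (mp x)))" by simp
    also have "\<dots> = - sgn x * pi * rho x"
      using x 1 s1 by (simp add: rho_def field_simps)
    finally show ?thesis using D DERIV_cong_ev[OF refl ev refl] by simp
  next
    case 2
    have "\<forall>\<^sub>F y in nhds x. 1 < CC (mp y)" using order_tendstoD[OF cont] 2 by auto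
    hence ev: "\<forall>\<^sub>F y in nhds x. Th y = arccos 1"
      by eventually_elim (simp add: Th_def clamp_def)
    have "DERIV (\<lambda>y. arccos 1) x :> - sgn x * pi * rho x" using 2 by (simp add: rho_def)
    thus ?thesis using DERIV_cong_ev[OF refl ev refl] by simp
  next
    case 3
    have "\<forall>\<^sub>F y in nhds x. CC (mp y) < -1" using order_tendstoD[OF cont] 3 by auto
    hence ev: "\<forall>\<^sub>F y in nhds x. Th y = arccos (-1)"
      by eventually_elim (simp add: Th_def clamp_def)
    have "DERIV (\<lambda>y. arccos (-1)) x :> - sgn x * pi * rho x" using 3 by (simp add: rho_def)
    thus ?thesis using DERIV_cong_ev[OF refl ev refl] by simp
  qed
qed

text \<open>\<open>\<bar>CC m\<bar> = 1\<close> is the cubic equation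
  \<open>m * (m - sg)\<^sup>2 = 4 * kp\<close>.\<close>

lemma finite_exceptional: "finite {x. x \<noteq> 0 \<and> \<bar>CC (mp x)\<bar> = 1}"
proof -
  let ?p = "[: - 4 * kp, sg\<^sup>2, - 2 * sg, 1 :]"
  have "finite {m. poly ?p m = 0}" by (rule poly_roots_finite) simp
  moreover have "{x. x \<noteq> 0 \<and> \<bar>CC (mp x)\<bar> = 1} \<subseteq> AR ` {m. poly ?p m = 0}"
  proof
    fix x assume x: "x \<in> {x. x \<noteq> 0 \<and> \<bar>CC (mp x)\<bar> = 1}"
    hence m: "mp x > 0" "AR (mp x) = x" using mp_nz_pos mp(2) by auto
    have "(CC (mp x))\<^sup>2 = 1" using x by (simp add: abs_square_eq_1)
    hence "(mp x - sg)\<^sup>2 = 4 * (kp / mp x)" unfolding CC_sq[OF m(1)] using pos m by (simp add: divide_eq_1_iff)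
    hence "poly ?p (mp x) = 0" using m by (simp add: field_simps power2_eq_square)
    thus "x \<in> AR ` {m. poly ?p m = 0}" using m by (intro image_eqI[of _ _ "mp x"]) auto
  qed
  ultimately show ?thesis by (meson finite_imageI finite_subset)
qed

text \<open>At edges of the support \<open>Th\<close> may fail to be differentiable and
  \<open>rho\<close> may be unbounded nearby; there are finitely many such points and
  \<open>Th\<close> is continuous across them, so the fundamental theorem survives.\<close>

lemma nn_integral_rho:
  assumes "t \<le> T" "0 < t \<or> T < 0"
  shows "(\<integral>\<^sup>+x. ennreal (rho x) * indicator {t..T} x \<partial>lborel) = ennreal (sgn t * (Th t - Th T) / pi)"
proof -
  have nz: "x \<noteq> 0 \<and> sgn x = sgn t" if "x \<in> {t..T}" for x using that assms by (auto simp: sgn_if)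
  have "((\<lambda>x. rho x) has_integral (- sgn t * Th T / pi - (- sgn t * Th t / pi))) {t..T}"
  proof (rule fundamental_theorem_of_calculus_interior_strong[OF finite_exceptional])
    show "t \<le> T" by fact
    show "continuous_on {t..T} (\<lambda>x. - sgn t * Th x / pi)"
      using isCont_Th nz by (intro continuous_intros continuous_at_imp_continuous_on) auto
    fix x assume x: "x \<in> {t<..<T} - {x. x \<noteq> 0 \<and> \<bar>CC (mp x)\<bar> = 1}"
    hence "x \<noteq> 0" "sgn x = sgn t" using nz[of x] by auto
    hence "DERIV (\<lambda>x. - sgn t * Th x / pi) x :> - sgn t * (- sgn x * pi * rho x) / pi"
      using x by (intro DERIV_cdivide DERIV_cmult DERIV_Th) auto
    moreover have "- sgn t * (- sgn x * pi * rho x) / pi = rho x"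
      using \<open>sgn x = sgn t\<close> \<open>x \<noteq> 0\<close> by (auto simp: sgn_if split: if_splits)
    ultimately show "((\<lambda>x. - sgn t * Th x / pi) has_vector_derivative rho x) (at x)"
      by (simp only: has_real_derivative_iff_has_vector_derivative)
  qed
  hence "(rho has_integral (sgn t * (Th t - Th T) / pi)) {t..T}"
    by (simp add: diff_divide_distrib right_diff_distrib)
  thus ?thesis by (intro nn_integral_has_integral_lebesgue') (use rho_nonneg in auto)
qed

text \<open>At \<open>x = 0\<close> the roots are \<open>- a\<close>, \<open>- b\<close>,
  \<open>- c\<close>; the strict arithmetic-geometric inequality for two distinct shifts puts the
  cosine below -1.\<close>

lemma CC_c: "CC c < -1" and CC_a: "CC a < -1"
proof -
  have *: "(c' - sg) * sqrt c' / (2 * sqrt kp) < -1" if "0 < c'" "0 < u" "0 < w" "u \<noteq> w" "sg = c' + u + w" "kp = c' * u * w" for c' u w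
  proof -
    have "0 < (sqrt u - sqrt w)\<^sup>2" using that by simp
    also have "\<dots> = u + w - 2 * (sqrt u * sqrt w)" using that by (simp add: power2_diff)
    finally have "2 * (sqrt u * sqrt w) < u + w" by simp
    hence "2 * (sqrt u * sqrt w) * sqrt c' < (u + w) * sqrt c'" using that by (intro mult_strict_right_mono) auto
    hence "2 * sqrt kp < (u + w) * sqrt c'" using that by (simp add: real_sqrt_mult mult_ac)
    moreover have "kp > 0" using pos by simp
    ultimately show ?thesis using that(5) by (simp add: divide_less_eq algebra_simps)
  qed
  show "CC c < -1" unfolding CC_def by (rule *[of c a b]) (use pos ab in \<open>auto simp: sg_def kp_def\<close>)
  show "CC a < -1" unfolding CC_def by (rule *[of a b c]) (use pos bc in \<open>auto simp: sg_def kp_def\<close>)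
qed

text \<open>Near \<open>c\<close> and near \<open>a\<close> the cosine stays below -1, and
  monotonicity of \<open>mp\<close> transports this to small \<open>x\<close>. At a fixed parameter
  both supports keep away from 0.\<close>

lemma CC_le_near_0: "\<exists>d>0. \<forall>x. x \<noteq> 0 \<and> \<bar>x\<bar> \<le> d \<longrightarrow> CC (mp x) \<le> -1"
proof -
  have c1: "\<exists>e>0. \<forall>u. \<bar>u - m\<bar> < e \<longrightarrow> CC u < -1" if "m > 0" "CC m < -1" for m
  proof -
    have "(CC \<longlongrightarrow> CC m) (nhds m)" using DERIV_isCont[OF DERIV_CC[OF that(1)]]
      unfolding isCont_def by (rule tendsto_at_iff_tendsto_nhds[THEN iffD1])
    from order_tendstoD(2)[OF this that(2)] show ?thesis by (auto simp: eventually_nhds_metric dist_real_def)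
  qed
  obtain e1 where e1: "e1 > 0" "\<And>u. \<bar>u - c\<bar> < e1 \<Longrightarrow> CC u < -1" using c1[OF pos(3) CC_c] by blast
  obtain e2 where e2: "e2 > 0" "\<And>u. \<bar>u - a\<bar> < e2 \<Longrightarrow> CC u < -1" using c1[OF pos(1) CC_a] by blast
  define m1 where "m1 = c + e1 / 2"
  define m2 where "m2 = max (a / 2) (a - e2 / 2)"
  have m1: "m1 \<in> Dm" "AR m1 > 0" using e1 pos AR_sign[of m1] by (auto simp: m1_def Dm_def)
  have m2: "m2 \<in> Dm" "AR m2 < 0" using e2 pos AR_sign[of m2] by (auto simp: m2_def Dm_def max_def)
  define d where "d = min (AR m1) (- AR m2)"
  have "CC (mp x) \<le> -1" if x: "x \<noteq> 0" "\<bar>x\<bar> \<le> d" for x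
  proof (cases "x > 0")
    case True
    hence "mp x \<le> mp (AR m1)" using mp_less[of "AR m1" x] m1 x by (auto simp: d_def not_less[symmetric])
    hence "mp x \<le> m1" "mp x > c" using mp_AR[OF m1(1)] mp_pos(1)[OF True] by auto
    hence "\<bar>mp x - c\<bar> < e1" using e1(1) by (auto simp: m1_def)
    thus ?thesis using e1(2) by force
  next
    case False
    hence xn: "x < 0" using x by simp
    hence "mp (AR m2) \<le> mp x" using mp_less[of x "AR m2"] m2 x by (auto simp: d_def not_less[symmetric])
    hence "m2 \<le> mp x" "mp x < a" using mp_AR[OF m2(1)] mp_pos(2)[OF xn] by auto
    hence "\<bar>mp x - a\<bar> < e2" using e2(1) by (auto simp: m2_def)
    thus ?thesis using e2(2) by force
  qed
  moreover have "d > 0" using m1 m2 by (auto simp: d_def)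
  ultimately show ?thesis by blast
qed

lemma CC_ge_large: "\<exists>X>0. \<forall>x\<ge>X. CC (mp x) \<ge> 1"
proof -
  \<comment> \<open>Chosen so that \<open>m \<ge> M\<close> gives
    \<open>m - sg \<ge> 2 * sqrt kp\<close> and \<open>sqrt m \<ge> 1\<close>.\<close>
  define M where "M = sg + 2 * sqrt kp + 1"
  have "sqrt kp > 0" using pos by simp
  hence M: "M \<ge> 1" "M > c" using pos unfolding M_def sg_def by linarith+
  have MD: "M \<in> Dm" "AR M > 0" using M pos AR_sign[of M] by (auto simp: Dm_def)
  have "CC (mp x) \<ge> 1" if "x \<ge> AR M" for x
  proof -
    have "mp (AR M) \<le> mp x" using mp_less[of x "AR M"] that MD by (auto simp: not_less[symmetric])
    hence m: "mp x \<ge> M" using mp_AR[OF MD(1)] by simp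
    have "mp x \<ge> 1" "2 * sqrt kp \<le> mp x - sg" "0 \<le> mp x - sg"
      using m M \<open>sqrt kp > 0\<close> pos unfolding M_def by linarith+
    hence "2 * sqrt kp * 1 \<le> (mp x - sg) * sqrt (mp x)"
      by (intro mult_mono) auto
    thus ?thesis using pos by (simp add: CC_def)
  qed
  thus ?thesis using MD by blast
qed

definition m1 :: "real measure" where "m1 = density lborel (\<lambda>x. ennreal (rho x) * indicator {0<..} x)"
definition m2 :: "real measure" where "m2 = density lborel (\<lambda>x. ennreal (rho x) * indicator {..<0} x)"

lemma emeasure_m1:
  assumes "A \<in> sets borel"
  shows "emeasure m1 A = (\<integral>\<^sup>+x. ennreal (rho x) * indicator (A \<inter> {0<..}) x \<partial>lborel)"
  unfolding m1_def using assms by (subst emeasure_density) (auto intro!: nn_integral_cong simp: indicator_def)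

lemma emeasure_m2:
  assumes "A \<in> sets borel"
  shows "emeasure m2 A = (\<integral>\<^sup>+x. ennreal (rho x) * indicator (A \<inter> {..<0}) x \<partial>lborel)"
  unfolding m2_def using assms by (subst emeasure_density) (auto intro!: nn_integral_cong simp: indicator_def)

lemma sets_m12 [simp, measurable_cong]: "sets m1 = sets borel" "sets m2 = sets borel"
  by (simp_all add: m1_def m2_def)

text \<open>\<open>Th\<close> falls from pi just right of 0 to 0 for large \<open>x\<close>; the
  cut-offs \<open>t'\<close> and \<open>T\<close> are placed where the density vanishes.\<close>

lemma emeasure_m1_greaterThan:
  "emeasure m1 {t<..} = ennreal ((if t \<le> 0 then pi else Th t) / pi)"
proof -
  obtain d where d: "d > 0" "\<And>x. x \<noteq> 0 \<Longrightarrow> \<bar>x\<bar> \<le> d \<Longrightarrow> CC (mp x) \<le> -1" using CC_le_near_0 by blast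
  obtain X where X: "X > 0" "\<And>x. x \<ge> X \<Longrightarrow> CC (mp x) \<ge> 1" using CC_ge_large by blast
  define t' where "t' = (if t \<le> 0 then d else t)"
  define T where "T = max X t'"
  have t': "0 < t'" "t' \<le> T" using d by (auto simp: t'_def T_def)
  have ThT: "Th T = 0" using X(2)[of T] by (intro Th_eq_0) (simp add: T_def)
  have Tht: "Th t' = (if t \<le> 0 then pi else Th t)" using d(2)[of d] d(1) by (auto simp: t'_def Th_eq_pi)
  have r1: "rho x = 0" if "x \<ge> X" for x using X(2)[OF that] by (simp add: rho_def)
  have r2: "rho x = 0" if "0 < x" "x \<le> d" for x using d(2)[of x] that by (simp add: rho_def)
  have "emeasure m1 {t<..} = (\<integral>\<^sup>+x. ennreal (rho x) * indicator ({t<..} \<inter> {0<..}) x \<partial>lborel)"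
    by (rule emeasure_m1) auto
  also have "\<dots> = (\<integral>\<^sup>+x. ennreal (rho x) * indicator {t'..T} x \<partial>lborel)"
  proof (rule nn_integral_cong_AE)
    have "AE x in lborel. x \<noteq> t'" by (rule AE_lborel_singleton)
    thus "AE x in lborel. ennreal (rho x) * indicator ({t<..} \<inter> {0<..}) x = ennreal (rho x) * indicator {t'..T} x"
    proof eventually_elim
      case (elim x)
      show ?case using elim r1[of x] r2[of x] d(1) by (auto simp: indicator_def t'_def T_def split: if_splits)
    qed
  qed
  also have "\<dots> = ennreal (Th t' / pi)" using nn_integral_rho[of t' T] t' ThT by simp
  finally show ?thesis by (simp add: Tht)
qed

lemma emeasure_m2_greaterThan:
  "emeasure m2 {t<..} = ennreal ((if t \<ge> 0 then 0 else pi - Th t) / pi)"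
proof (cases "t \<ge> 0")
  case True
  hence "{t<..} \<inter> {..<0} = {}" by auto
  thus ?thesis using True by (subst emeasure_m2) auto
next
  case False
  obtain d where d: "d > 0" "\<And>x. x \<noteq> 0 \<Longrightarrow> \<bar>x\<bar> \<le> d \<Longrightarrow> CC (mp x) \<le> -1" using CC_le_near_0 by blast
  define T where "T = max t (- d)"
  have T: "t \<le> T" "T < 0" using d False by (auto simp: T_def)
  have ThT: "Th T = (if t \<le> - d then pi else Th t)" using d(2)[of "- d"] d(1) by (auto simp: T_def Th_eq_pi max_def)
  have Tht: "t > - d \<Longrightarrow> Th t = pi" using d(2)[of t] False by (intro Th_eq_pi) auto
  have r2: "rho x = 0" if "x < 0" "x \<ge> - d" for x using d(2)[of x] that by (simp add: rho_def)
  have "emeasure m2 {t<..} = (\<integral>\<^sup>+x. ennreal (rho x) * indicator ({t<..} \<inter> {..<0}) x \<partial>lborel)"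
    by (rule emeasure_m2) auto
  also have "\<dots> = (\<integral>\<^sup>+x. ennreal (rho x) * indicator {t..T} x \<partial>lborel)"
  proof (rule nn_integral_cong_AE)
    have "AE x in lborel. x \<noteq> t" by (rule AE_lborel_singleton)
    thus "AE x in lborel. ennreal (rho x) * indicator ({t<..} \<inter> {..<0}) x = ennreal (rho x) * indicator {t..T} x"
    proof eventually_elim
      case (elim x)
      show ?case using elim r2[of x] T False d(1) by (auto simp: indicator_def T_def max_def split: if_splits)
    qed
  qed
  also have "\<dots> = ennreal (- (Th t - Th T) / pi)" using nn_integral_rho[of t T] T False by (simp add: sgn_if)
  finally show ?thesis using ThT Tht False by (cases "t \<le> - d") auto
qed

lemma mp_le_neg: "x < 0 \<Longrightarrow> mp x \<le> kp / (- x)"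
proof -
  assume x: "x < 0"
  have m: "0 < mp x" "mp x < a" "AR (mp x) = x" using mp_pos(2)[OF x] mp(2)[of x] x by auto
  have "(a - mp x) * (b - mp x) * (c - mp x) \<le> a * b * c"
    using m ab bc pos by (intro mult_mono mult_nonneg_nonneg) auto
  moreover have "(a - mp x) * (b - mp x) * (c - mp x) = - x * mp x"
    using m by (simp add: AR_def field_simps)
  ultimately show ?thesis using x by (simp add: kp_def field_simps)
qed

text \<open>At minus infinity \<open>mp x\<close> is at most \<open>kp / (- x)\<close>, so the
  cosine tends to 0 from below like the inverse square root. This limit pi/2 gives the second
  measure its mass 1/2.\<close>

lemma Th_tail: "x < 0 \<Longrightarrow> Th x / pi - 1 / 2 \<le> sg / (2 * sqrt (- x))" "x < 0 \<Longrightarrow> Th x / pi \<ge> 1 / 2"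
proof -
  assume x: "x < 0"
  have m: "0 < mp x" "mp x < a" using mp_pos(2)[OF x] by auto
  have neg: "CC (mp x) \<le> 0" using m ab bc pos by (auto simp: CC_def sg_def divide_nonpos_pos mult_nonpos_nonneg)
  define u where "u = - clamp (CC (mp x))"
  have u: "0 \<le> u" "u \<le> 1" using neg clamp_range[of "CC (mp x)"] by (auto simp: u_def clamp_def)
  have "u \<le> - CC (mp x)" using neg by (auto simp: u_def clamp_def)
  also have "\<dots> = (sg - mp x) * sqrt (mp x) / (2 * sqrt kp)" by (simp add: CC_def minus_divide_left algebra_simps)
  also have "\<dots> \<le> sg * sqrt (kp / (- x)) / (2 * sqrt kp)"
    using m pos mp_le_neg[OF x] x ab bc by (intro divide_right_mono mult_mono real_sqrt_le_mono) (auto simp: sg_def)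
  also have "\<dots> = sg / (2 * sqrt (- x))" unfolding real_sqrt_divide[of kp "- x"] using pos by simp
  finally have le: "u \<le> sg / (2 * sqrt (- x))" .
  have "Th x / pi - 1 / 2 \<le> u" unfolding Th_def using arccos_neg_le[OF u] by (simp add: u_def)
  thus "Th x / pi - 1 / 2 \<le> sg / (2 * sqrt (- x))" using le by linarith
  have "arccos 0 \<le> arccos (clamp (CC (mp x)))" using u by (intro arccos_le_arccos) (auto simp: u_def)
  thus "Th x / pi \<ge> 1 / 2" by (simp add: Th_def le_divide_eq)
qed

lemma emeasure_m1_UNIV: "emeasure m1 UNIV = 1"
proof -
  have "emeasure m1 UNIV = (\<integral>\<^sup>+x. ennreal (rho x) * indicator (UNIV \<inter> {0<..}) x \<partial>lborel)" by (rule emeasure_m1) auto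
  also have "\<dots> = emeasure m1 {0<..}" by (subst emeasure_m1) auto
  finally show ?thesis unfolding emeasure_m1_greaterThan by simp
qed

lemma emeasure_m2_UNIV: "emeasure m2 UNIV = ennreal (1 / 2)"
proof -
  have lim: "(\<lambda>n. emeasure m2 {- (1 + real n)<..}) \<longlonglongrightarrow> emeasure m2 (\<Union>n. {- (1 + real n)<..})"
    by (rule Lim_emeasure_incseq) (auto simp: incseq_def)
  have un: "(\<Union>n. {- (1 + real n)<..}) = UNIV"
  proof -
    have "\<exists>n. - (1 + real n) < x" for x
    proof -
      obtain n where "- x < real n" using reals_Archimedean2 by blast
      thus ?thesis by (intro exI[of _ n]) linarith
    qed
    thus ?thesis by auto
  qed
  have "(\<lambda>n. sg / (2 * sqrt (1 + real n))) \<longlonglongrightarrow> 0" by real_asymp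
  hence "(\<lambda>n. Th (- (1 + real n)) / pi - 1 / 2) \<longlonglongrightarrow> 0"
  proof (rule Lim_null_comparison[rotated], intro always_eventually allI)
    fix n
    have "- (1 + real n) < 0" by simp
    from Th_tail[OF this] show "norm (Th (- (1 + real n)) / pi - 1 / 2) \<le> sg / (2 * sqrt (1 + real n))"
      by (simp add: add.commute[of 1])
  qed
  hence "(\<lambda>n. 1 / 2 - (Th (- (1 + real n)) / pi - 1 / 2)) \<longlonglongrightarrow> 1 / 2 - 0" by (intro tendsto_intros)
  hence "(\<lambda>n. (pi - Th (- (1 + real n))) / pi) \<longlonglongrightarrow> 1 / 2" by (simp add: diff_divide_distrib)
  hence "(\<lambda>n. ennreal ((pi - Th (- (1 + real n))) / pi)) \<longlonglongrightarrow> ennreal (1 / 2)" by (rule tendsto_ennrealI)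
  moreover have "(\<lambda>n. emeasure m2 {- (1 + real n)<..}) = (\<lambda>n. ennreal ((pi - Th (- (1 + real n))) / pi))"
    unfolding emeasure_m2_greaterThan by (auto simp: fun_eq_iff)
  ultimately show ?thesis using LIMSEQ_unique[OF lim] un by simp
qed

lemma finite_m1: "finite_borel_measure m1"
  using emeasure_m1_UNIV by (auto simp: finite_borel_measure_def finite_borel_measure_axioms_def m1_def intro!: finite_measureI)

lemma finite_m2: "finite_borel_measure m2"
  using emeasure_m2_UNIV by (auto simp: finite_borel_measure_def finite_borel_measure_axioms_def m2_def intro!: finite_measureI)

lemma measure_m12: "measure m1 UNIV = 1" "measure m2 UNIV = 1 / 2"
  unfolding Sigma_Algebra.measure_def emeasure_m1_UNIV emeasure_m2_UNIV by (simp, subst enn2real_ennreal, auto)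

lemma AE_m1: "AE x in m1. 0 < x" and AE_m2: "AE x in m2. x < 0"
  unfolding m1_def m2_def by (subst AE_density; auto simp: indicator_def)+

lemma AE_m12_neq: "AE y in m1. y \<noteq> x" "AE y in m2. y \<noteq> x"
  using AE_lborel_singleton[of x] unfolding m1_def m2_def by (subst AE_density; auto)+

lemma measure_m1_greaterThan: "measure m1 {t<..} = (if t \<le> 0 then pi else Th t) / pi"
  unfolding Sigma_Algebra.measure_def emeasure_m1_greaterThan using Th_range by (subst enn2real_ennreal) auto

lemma measure_m2_greaterThan: "measure m2 {t<..} = (if t \<ge> 0 then 0 else pi - Th t) / pi"
  unfolding Sigma_Algebra.measure_def emeasure_m2_greaterThan using Th_range by (subst enn2real_ennreal) auto

lemma log_int_m1: "log_int m1"
proof -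
  interpret M: finite_borel_measure m1 by (rule finite_m1)
  obtain X where X: "X > 0" "\<And>x. x \<ge> X \<Longrightarrow> CC (mp x) \<ge> 1" using CC_ge_large by blast
  have "AE x in m1. x < X"
  proof -
    have "rho x = 0" if "x \<ge> X" for x using X(2)[OF that] by (simp add: rho_def)
    thus ?thesis unfolding m1_def by (subst AE_density, measurable, intro AE_I2) (force simp: not_less[symmetric])
  qed
  hence "AE x in m1. norm (ln (1 + \<bar>x\<bar>)) \<le> ln (1 + X)"
    using AE_m1 by eventually_elim (auto simp: ln_ge_zero)
  thus ?thesis unfolding log_int_def by (intro M.integrable_const_bound) auto
qed

text \<open>Layer cake with \<open>ln (1 + |y|)\<close> as the integral of
  \<open>1 / (1 + t)\<close>: the tail of order \<open>1 / sqrt t\<close> leaves an integrable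
  \<open>1 / (sqrt t * t)\<close> for \<open>t \<ge> 1\<close>.\<close>

lemma log_int_m2: "log_int m2"
proof -
  interpret M: finite_borel_measure m2 by (rule finite_m2)
  interpret P: pair_sigma_finite m2 "lborel::real measure" ..
  let ?f = "\<lambda>y t. ennreal (1 / (1 + t)) * indicator {0..} t * indicator {y. y < - t} y"
  have "(\<integral>\<^sup>+y. ennreal (norm (ln (1 + \<bar>y\<bar>))) \<partial>m2) = (\<integral>\<^sup>+y. (\<integral>\<^sup>+t. ?f y t \<partial>lborel) \<partial>m2)"
  proof (rule nn_integral_cong_AE)
    show "AE y in m2. ennreal (norm (ln (1 + \<bar>y\<bar>))) = (\<integral>\<^sup>+t. ?f y t \<partial>lborel)"
      using AE_m2
    proof eventually_elim
      case (elim y)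
      have "(\<integral>\<^sup>+t. ennreal (1 / (1 + t)) * indicator {0..-y} t \<partial>lborel) = ennreal (ln (1 + (-y)) - ln (1 + 0))"
        by (rule nn_integral_FTC_Icc) (use elim in \<open>auto intro!: derivative_eq_intros simp: inverse_eq_divide\<close>)
      also have "(\<integral>\<^sup>+t. ennreal (1 / (1 + t)) * indicator {0..-y} t \<partial>lborel) = (\<integral>\<^sup>+t. ?f y t \<partial>lborel)"
      proof (rule nn_integral_cong_AE)
        have "AE t in lborel. t \<noteq> - y" by (rule AE_lborel_singleton)
        thus "AE t in lborel. ennreal (1 / (1 + t)) * indicator {0..-y} t = ?f y t"
          by eventually_elim (auto simp: indicator_def)
      qed
      finally show ?case using elim by (simp add: ln_ge_zero)
    qed
  qed
  also have "\<dots> = (\<integral>\<^sup>+t. (\<integral>\<^sup>+y. ?f y t \<partial>m2) \<partial>lborel)"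
    by (rule P.Fubini'[symmetric]) (simp add: case_prod_unfold)
  also have "\<dots> = (\<integral>\<^sup>+t. ennreal (1 / (1 + t)) * indicator {0..} t * emeasure m2 {..<- t} \<partial>lborel)"
    by (intro nn_integral_cong) (simp add: nn_integral_cmult lessThan_def)
  also have "\<dots> \<le> (\<integral>\<^sup>+t. ennreal 1 * indicator {0..1} t + ennreal (sg / 2 * (1 / (sqrt t * t))) * indicator {1..} t \<partial>lborel)"
  proof (rule nn_integral_mono)
    fix t :: real
    show "ennreal (1 / (1 + t)) * indicator {0..} t * emeasure m2 {..<- t}
      \<le> ennreal 1 * indicator {0..1} t + ennreal (sg / 2 * (1 / (sqrt t * t))) * indicator {1..} t"
    proof (cases "t < 0")
      case True
      thus ?thesis by simp
    next
      case False
      have ms: "measure m2 {..<- t} = 1 / 2 - measure m2 {- t..}"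
      proof -
        have "measure m2 (UNIV - {- t..}) = measure m2 UNIV - measure m2 {- t..}"
          by (intro M.finite_measure_Diff) auto
        moreover have "UNIV - {- t..} = {..<- t}" by auto
        ultimately show ?thesis by (simp add: measure_m12)
      qed
      have "measure m2 {..<- t} \<le> measure m2 UNIV" by (intro M.finite_measure_mono) auto
      hence h: "measure m2 {..<- t} \<le> 1 / 2" by (simp add: measure_m12)
      show ?thesis
      proof (cases "t \<le> 1")
        case True
        have "1 / (1 + t) * measure m2 {..<- t} \<le> 1 * 1" using False h by (intro mult_mono) auto
        hence "ennreal (1 / (1 + t)) * emeasure m2 {..<- t} \<le> ennreal 1"
          using False unfolding M.emeasure_eq_measure by (subst ennreal_mult[symmetric]) (auto intro: ennreal_leI)
        thus ?thesis using False True by (auto simp: add_increasing2)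
      next
        case gt: False
        have "measure m2 {- t<..} \<le> measure m2 {- t..}" by (intro M.finite_measure_mono) auto
        hence "measure m2 {..<- t} \<le> Th (- t) / pi - 1 / 2"
          unfolding ms using gt by (simp add: measure_m2_greaterThan diff_divide_distrib)
        also have "\<dots> \<le> sg / (2 * sqrt t)" using Th_tail(1)[of "- t"] gt by simp
        finally have "1 / (1 + t) * measure m2 {..<- t} \<le> 1 / t * (sg / (2 * sqrt t))"
          using gt pos by (intro mult_mono divide_left_mono) auto
        hence "1 / (1 + t) * measure m2 {..<- t} \<le> sg / 2 * (1 / (sqrt t * t))" by (simp add: mult_ac)
        hence "ennreal (1 / (1 + t)) * emeasure m2 {..<- t} \<le> ennreal (sg / 2 * (1 / (sqrt t * t)))"
          using gt unfolding M.emeasure_eq_measure by (subst ennreal_mult[symmetric]) (auto intro: ennreal_leI)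
        thus ?thesis using gt by simp
      qed
    qed
  qed
  also have "\<dots> = (\<integral>\<^sup>+t. ennreal 1 * indicator {0..1} (t::real) \<partial>lborel) + (\<integral>\<^sup>+t. ennreal (sg / 2 * (1 / (sqrt t * t))) * indicator {1..} t \<partial>lborel)"
    by (rule nn_integral_add) auto
  also have "(\<integral>\<^sup>+t. ennreal (sg / 2 * (1 / (sqrt t * t))) * indicator {1..} t \<partial>lborel) = ennreal (0 - (- sg * inverse (sqrt 1)))"
  proof (rule nn_integral_FTC_atLeast)
    fix t :: real assume t: "1 \<le> t"
    have "DERIV (\<lambda>t. inverse (sqrt t)) t :> - (inverse (sqrt t) * (inverse (sqrt t) / 2) * inverse (sqrt t))"
      by (rule DERIV_inverse'[OF DERIV_real_sqrt]) (use t in auto)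
    hence D: "DERIV (\<lambda>t. - sg * inverse (sqrt t)) t :> - sg * - (inverse (sqrt t) * (inverse (sqrt t) / 2) * inverse (sqrt t))"
      by (rule DERIV_cmult)
    have r: "- sg * - (inverse r * (inverse r / 2) * inverse r) = sg / 2 * (1 / (r * (r * r)))" if "r > 0" for r :: real
      using that by (simp add: field_simps)
    have "sqrt t > 0" "sqrt t * sqrt t = t" using t by auto
    from r[OF this(1), unfolded this(2)]
    have "- sg * - (inverse (sqrt t) * (inverse (sqrt t) / 2) * inverse (sqrt t)) = sg / 2 * (1 / (sqrt t * t))" .
    with D show "DERIV (\<lambda>t. - sg * inverse (sqrt t)) t :> sg / 2 * (1 / (sqrt t * t))" by (simp only:)
    show "0 \<le> sg / 2 * (1 / (sqrt t * t))" using t pos by simp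
  next
    show "((\<lambda>t. - sg * inverse (sqrt t)) \<longlongrightarrow> 0) at_top"
      by (rule tendsto_mult_right_zero[OF tendsto_inverse_0_at_top[OF sqrt_at_top]])
  qed auto
  also have "(\<integral>\<^sup>+t. ennreal 1 * indicator {0..1} (t::real) \<partial>lborel) + ennreal (0 - (- sg * inverse (sqrt 1))) < \<infinity>" by simp
  finally show ?thesis by (simp add: log_int_def integrable_iff_bounded)
qed

end

section \<open>Their logarithmic potentials\<close>

text \<open>Maximum principle for the harmonic function \<open>Im h\<close> on an open set that may
  be unbounded and whose boundary need not carry values of \<open>h\<close>, so boundary behaviour
  is stated along sequences.\<close>

lemma Im_zero_of_boundary:
  assumes op: "open W" and hol: "h holomorphic_on W"
    and fin: "\<And>v p. (\<And>n. v n \<in> W) \<Longrightarrow> v \<longlonglongrightarrow> p \<Longrightarrow> p \<notin> W \<Longrightarrow> (\<lambda>n. Im (h (v n))) \<longlonglongrightarrow> 0"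
    and inf: "\<And>v. (\<And>n. v n \<in> W) \<Longrightarrow> filterlim (\<lambda>n. cmod (v n)) at_top sequentially \<Longrightarrow> (\<lambda>n. Im (h (v n))) \<longlonglongrightarrow> 0"
    and w: "w \<in> W"
  shows "Im (h w) = 0"
proof -
  have *: "Im (g w) \<le> 0"
    if hol: "g holomorphic_on W"
    and fin: "\<And>v p. (\<And>n. v n \<in> W) \<Longrightarrow> v \<longlonglongrightarrow> p \<Longrightarrow> p \<notin> W \<Longrightarrow> (\<lambda>n. Im (g (v n))) \<longlonglongrightarrow> 0"
    and inf: "\<And>v. (\<And>n. v n \<in> W) \<Longrightarrow> filterlim (\<lambda>n. cmod (v n)) at_top sequentially \<Longrightarrow> (\<lambda>n. Im (g (v n))) \<longlonglongrightarrow> 0"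
    for g
  proof (rule ccontr)
    assume "\<not> Im (g w) \<le> 0"
    define e where "e = Im (g w) / 2"
    have e: "e > 0" "Im (g w) > e" using \<open>\<not> Im (g w) \<le> 0\<close> by (auto simp: e_def)
    \<comment> \<open>The boundary hypotheses keep this superlevel set bounded with closure inside
      \<open>W\<close>; on its frontier the imaginary part is at most \<open>e\<close>, hence also
      inside.\<close>
    define S where "S = {v \<in> W. Im (g v) > e}"
    have no: False if "\<And>n. v n \<in> S" "(\<lambda>n. Im (g (v n))) \<longlonglongrightarrow> 0" for v
    proof -
      have "e \<le> 0" by (rule LIMSEQ_le_const[OF that(2)]) (use that(1) in \<open>auto simp: S_def intro: less_imp_le\<close>)
      thus False using e by simp
    qed
    have "bounded S"
    proof (rule ccontr)
      assume "\<not> bounded S"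
      hence "\<forall>n::nat. \<exists>v\<in>S. cmod v > real n" unfolding bounded_iff by (meson not_le)
      then obtain v where v: "\<And>n. v n \<in> S" "\<And>n::nat. cmod (v n) > real n" by metis
      have "filterlim (\<lambda>n. cmod (v n)) at_top sequentially"
        by (rule filterlim_at_top_mono[OF filterlim_real_sequentially], intro always_eventually allI less_imp_le) (rule v(2))
      hence "(\<lambda>n. Im (g (v n))) \<longlonglongrightarrow> 0" using v(1) by (intro inf) (auto simp: S_def)
      thus False using no v(1) by blast
    qed
    have cl: "closure S \<subseteq> W"
    proof
      fix p assume "p \<in> closure S"
      then obtain v where v: "\<And>n. v n \<in> S" "v \<longlonglongrightarrow> p" unfolding closure_sequential by blast
      show "p \<in> W"
      proof (rule ccontr)
        assume "p \<notin> W"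
        hence "(\<lambda>n. Im (g (v n))) \<longlonglongrightarrow> 0" using v by (intro fin) (auto simp: S_def)
        thus False using no v(1) by blast
      qed
    qed
    have contg: "continuous_on W g" using hol by (rule holomorphic_on_imp_continuous_on)
    have opS: "open S"
    proof -
      have "continuous_on W (\<lambda>v. Im (g v))" using contg by (intro continuous_intros)
      hence "open ((\<lambda>v. Im (g v)) -` {e<..} \<inter> W)" using op by (intro continuous_on_open_vimage[THEN iffD1, rule_format]) auto
      moreover have "(\<lambda>v. Im (g v)) -` {e<..} \<inter> W = S" by (auto simp: S_def)
      ultimately show ?thesis by simp
    qed
    have "Re ((\<lambda>v. - \<i> * g v) w) \<le> e"
    proof (rule maximum_real_frontier[of "\<lambda>v. - \<i> * g v" S e w])
      have "S \<subseteq> W" by (auto simp: S_def)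
      thus "(\<lambda>v. - \<i> * g v) holomorphic_on interior S" using hol opS
        by (auto simp: interior_open intro!: holomorphic_intros elim: holomorphic_on_subset)
      show "continuous_on (closure S) (\<lambda>v. - \<i> * g v)"
        using continuous_on_subset[OF contg cl] by (intro continuous_intros)
      show "w \<in> S" using w e by (simp add: S_def)
      fix z assume "z \<in> frontier S"
      hence "z \<in> closure S" "z \<notin> S" using opS by (auto simp: frontier_def interior_open)
      thus "Re (- \<i> * g z) \<le> e" using cl by (auto simp: S_def)
    qed fact
    thus False using e by simp
  qed
  have "Im (h w) \<le> 0" by (rule *[OF hol fin inf])
  moreover have "Im (- h w) \<le> 0"
  proof (rule *[of "\<lambda>v. - h v"])
    show "(\<lambda>v. - h v) holomorphic_on W" using hol by (intro holomorphic_intros)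
    fix v :: "nat \<Rightarrow> complex" assume v: "\<And>n. v n \<in> W"
    { fix p assume "v \<longlonglongrightarrow> p" "p \<notin> W"
      from tendsto_minus[OF fin[OF v this]] show "(\<lambda>n. Im (- h (v n))) \<longlonglongrightarrow> 0" by simp }
    { assume "filterlim (\<lambda>n. cmod (v n)) at_top sequentially"
      from tendsto_minus[OF inf[OF v this]] show "(\<lambda>n. Im (- h (v n))) \<longlonglongrightarrow> 0" by simp }
  qed
  ultimately show ?thesis by simp
qed

text \<open>A real-valued holomorphic function has derivative 0. Constancy is claimed along a
  segment, which avoids establishing that \<open>W\<close> is connected.\<close>

lemma constant_on_ray:
  assumes op: "open W" and hol: "h holomorphic_on W" and Im0: "\<And>w. w \<in> W \<Longrightarrow> Im (h w) = 0"
    and ray: "\<And>t. s \<le> t \<Longrightarrow> t \<le> u \<Longrightarrow> of_real t * v \<in> W" and st: "s \<le> u"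
  shows "h (of_real s * v) = h (of_real u * v)"
proof -
  have d0: "(h has_field_derivative 0) (at w)" if w: "w \<in> W" for w
  proof -
    obtain D where D: "(h has_field_derivative D) (at w)"
      using hol op w by (meson holomorphic_on_open)
    have Ime: "Im (D * e) = 0" for e
    proof -
      have lin: "((\<lambda>z. w + z * e) has_field_derivative e) (at (of_real 0))" by (auto intro!: derivative_eq_intros)
      have D': "(h has_field_derivative D) (at (w + of_real 0 * e))" using D by simp
      have "((\<lambda>z. h (w + z * e)) has_field_derivative D * e) (at (of_real 0))" by (rule DERIV_chain2[OF D' lin])
      from has_vector_derivative_real_field[OF this]
      have "((\<lambda>t. Im (h (w + of_real t * e))) has_vector_derivative Im (D * e)) (at 0)"
        by (rule bounded_linear.has_vector_derivative[OF bounded_linear_Im])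
      hence 1: "DERIV (\<lambda>t. Im (h (w + of_real t * e))) 0 :> Im (D * e)"
        by (simp add: has_real_derivative_iff_has_vector_derivative)
      have "((\<lambda>t::real. w + of_real t * e) \<longlongrightarrow> w + of_real 0 * e) (nhds 0)"
        by (intro tendsto_intros filterlim_ident)
      hence "\<forall>\<^sub>F t in nhds (0::real). w + of_real t * e \<in> W" using op w by (intro topological_tendstoD) auto
      hence ev: "\<forall>\<^sub>F t in nhds (0::real). Im (h (w + of_real t * e)) = 0" by eventually_elim (rule Im0)
      have "DERIV (\<lambda>t::real. 0 :: real) 0 :> Im (D * e)" using 1 DERIV_cong_ev[OF refl ev refl] by simp
      thus ?thesis using DERIV_unique[OF _ DERIV_const] by blast
    qed
    have "D = 0" using Ime[of 1] Ime[of \<i>] by (simp add: complex_eq_iff)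
    thus ?thesis using D by simp
  qed
  have "\<exists>c. \<forall>t\<in>{s..u}. h (of_real t * v) = c"
  proof (rule has_derivative_zero_constant)
    show "convex {s..u}" by simp
    fix t assume t: "t \<in> {s..u}"
    have lin: "((\<lambda>z. z * v) has_field_derivative v) (at (of_real t))" by (auto intro!: derivative_eq_intros)
    have "((\<lambda>z. h (z * v)) has_field_derivative 0 * v) (at (of_real t))"
      by (rule DERIV_chain2[OF d0 lin]) (use ray t in auto)
    from has_vector_derivative_real_field[OF this] have "((\<lambda>t. h (of_real t * v)) has_vector_derivative 0) (at t)" by simp
    thus "((\<lambda>t. h (of_real t * v)) has_derivative (\<lambda>_. 0)) (at t within {s..u})"
      by (simp add: has_vector_derivative_def has_derivative_at_withinI)
  qed
  thus ?thesis using st by auto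
qed

text \<open>Its real part is the logarithmic potential; its imaginary part just below the axis
  records the mass to the right of the point.\<close>

definition Gc :: "real measure \<Rightarrow> complex \<Rightarrow> complex" where
  "Gc M w = (\<integral>y. Ln (w - of_real y) \<partial>M)"

lemma norm_minus_of_real_bounds:
  fixes w :: complex and y :: real
  assumes "Im w \<noteq> 0"
  shows "\<bar>Im w\<bar> \<le> cmod (w - of_real y)" "cmod (w - of_real y) \<le> (1 + cmod w) * (1 + \<bar>y\<bar>)" "w - of_real y \<noteq> 0"
proof -
  show 1: "\<bar>Im w\<bar> \<le> cmod (w - of_real y)" using abs_Im_le_cmod[of "w - of_real y"] by simp
  show "w - of_real y \<noteq> 0" using 1 assms by auto
  have "cmod (w - of_real y) \<le> cmod w + \<bar>y\<bar>" using norm_triangle_ineq4[of w "of_real y"] by simp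
  also have "\<dots> \<le> (1 + cmod w) * (1 + \<bar>y\<bar>)" by (simp add: algebra_simps)
  finally show "cmod (w - of_real y) \<le> (1 + cmod w) * (1 + \<bar>y\<bar>)" .
qed

lemma ln_norm_minus_bound:
  fixes w :: complex and y :: real
  assumes "Im w \<noteq> 0"
  shows "\<bar>ln (cmod (w - of_real y))\<bar> \<le> \<bar>ln \<bar>Im w\<bar>\<bar> + ln (1 + cmod w) + ln (1 + \<bar>y\<bar>)"
proof -
  note b = norm_minus_of_real_bounds[OF assms, of y]
  have "ln \<bar>Im w\<bar> \<le> ln (cmod (w - of_real y))" using b assms by (subst ln_le_cancel_iff) auto
  moreover have "ln (cmod (w - of_real y)) \<le> ln ((1 + cmod w) * (1 + \<bar>y\<bar>))"
    using b by (subst ln_le_cancel_iff) (auto intro!: mult_pos_pos add_pos_nonneg)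
  moreover have "ln ((1 + cmod w) * (1 + \<bar>y\<bar>)) = ln (1 + cmod w) + ln (1 + \<bar>y\<bar>)"
    by (rule ln_mult_pos) (auto intro!: add_pos_nonneg)
  moreover have "0 \<le> ln (1 + cmod w)" "0 \<le> ln (1 + \<bar>y\<bar>)" by (auto intro: ln_ge_zero)
  ultimately show ?thesis by linarith
qed

lemma norm_Ln_le: "w \<noteq> 0 \<Longrightarrow> cmod (Ln w) \<le> \<bar>ln (cmod w)\<bar> + pi"
  using cmod_le[of "Ln w"] Im_Ln_le_pi[of w] mpi_less_Im_Ln[of w] by simp

section \<open>Complex logarithmic potentials of finite measures\<close>

context finite_borel_measure
begin

lemma measurable_Ln_shift: "(\<lambda>y. Ln (w - of_real y)) \<in> borel_measurable M"
  by (subst measurable_cong_sets[OF M_is_borel refl]) measurable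

lemma integrable_Ln_shift:
  assumes "log_int M" "Im w \<noteq> 0"
  shows "integrable M (\<lambda>y. Ln (w - of_real y))"
proof (rule Bochner_Integration.integrable_bound)
  show "integrable M (\<lambda>y. (\<bar>ln \<bar>Im w\<bar>\<bar> + ln (1 + cmod w) + pi) + ln (1 + \<bar>y\<bar>))"
    using assms(1) by (intro Bochner_Integration.integrable_add) (auto simp: log_int_def)
  show "AE y in M. norm (Ln (w - of_real y)) \<le> norm ((\<bar>ln \<bar>Im w\<bar>\<bar> + ln (1 + cmod w) + pi) + ln (1 + \<bar>y\<bar>))"
  proof (rule AE_I2)
    fix y :: real
    have "cmod (Ln (w - of_real y)) \<le> \<bar>ln (cmod (w - of_real y))\<bar> + pi"
      using norm_minus_of_real_bounds(3)[OF assms(2)] by (rule norm_Ln_le)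
    also have "\<dots> \<le> (\<bar>ln \<bar>Im w\<bar>\<bar> + ln (1 + cmod w) + pi) + ln (1 + \<bar>y\<bar>)"
      using ln_norm_minus_bound[OF assms(2), of y] by simp
    finally show "norm (Ln (w - of_real y)) \<le> norm ((\<bar>ln \<bar>Im w\<bar>\<bar> + ln (1 + cmod w) + pi) + ln (1 + \<bar>y\<bar>))"
      unfolding real_norm_def by (rule order.trans[OF _ abs_ge_self])
  qed
qed (rule measurable_Ln_shift)

lemma Gc_has_field_derivative:
  assumes li: "log_int M" and w: "Im w < 0"
  shows "(Gc M has_field_derivative (\<integral>y. 1 / (w - of_real y) \<partial>M)) (at w)"
  unfolding DERIV_def
proof (subst tendsto_at_iff_sequentially, intro allI impI)
  fix X :: "nat \<Rightarrow> complex" assume X: "\<forall>i. X i \<in> UNIV - {0}" "X \<longlonglongrightarrow> 0"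
  \<comment> \<open>Half the distance of \<open>w\<close> from the real axis: the disc of this
    radius keeps distance \<open>e\<close> from all \<open>y\<close>, so difference quotients of the
    logarithm are bounded by \<open>1 / e\<close> uniformly in \<open>y\<close>.\<close>
  define e where "e = - Im w / 2"
  have e: "e > 0" using w by (simp add: e_def)
  obtain N where N: "\<And>n. n \<ge> N \<Longrightarrow> cmod (X n) < e" using X(2) e unfolding lim_sequentially by auto
  define Y where "Y n = X (n + N)" for n
  have Y: "Y n \<noteq> 0" "cmod (Y n) < e" for n using X(1) N by (auto simp: Y_def)
  have Y0: "Y \<longlonglongrightarrow> 0" unfolding Y_def using X(2) by (rule LIMSEQ_ignore_initial_segment)
  have Imw: "Im (w + k) < 0" "- Im (w + k) \<ge> e" if "cmod k < e" for k
    using abs_Im_le_cmod[of k] that w by (auto simp: e_def)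
  have dLn: "((\<lambda>z. Ln (z - of_real y)) has_field_derivative 1 / (z - of_real y)) (at z)" if "Im z < 0" for z y
    using that by (auto intro!: derivative_eq_intros simp: complex_nonpos_Reals_iff inverse_eq_divide)
  have bound: "cmod ((Ln (w + k - of_real y) - Ln (w - of_real y)) / k) \<le> 1 / e" if k: "cmod k < e" "k \<noteq> 0" for k y
  proof -
    have "cmod (Ln (w + k - of_real y) - Ln (w - of_real y)) \<le> (1 / e) * cmod (w + k - w)"
    proof (rule field_differentiable_bound[of "ball w e" "\<lambda>z. Ln (z - of_real y)" "\<lambda>z. 1 / (z - of_real y)"])
      fix z assume "z \<in> ball w e"
      hence k: "cmod (z - w) < e" by (simp add: dist_norm norm_minus_commute)
      have z: "Im z < 0" "- Im z \<ge> e" using Imw[OF k] by auto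
      show "((\<lambda>z. Ln (z - of_real y)) has_field_derivative 1 / (z - of_real y)) (at z within ball w e)"
        by (rule has_field_derivative_at_within[OF dLn[OF z(1)]])
      have "e \<le> cmod (z - of_real y)" using norm_minus_of_real_bounds(1)[of z y] z by auto
      thus "cmod (1 / (z - of_real y)) \<le> 1 / e" using e by (simp add: norm_divide frac_le)
    qed (use k e in \<open>auto simp: dist_norm\<close>)
    thus ?thesis using k by (simp add: norm_divide field_simps)
  qed
  have "(\<lambda>n. \<integral>y. (Ln (w + Y n - of_real y) - Ln (w - of_real y)) / Y n \<partial>M) \<longlonglongrightarrow> (\<integral>y. 1 / (w - of_real y) \<partial>M)"
  proof (rule integral_dominated_convergence[where w = "\<lambda>_. 1 / e"])
    show "(\<lambda>y. 1 / (w - of_real y)) \<in> borel_measurable M"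
      by (subst measurable_cong_sets[OF M_is_borel refl]) measurable
    show "(\<lambda>y. (Ln (w + Y n - of_real y) - Ln (w - of_real y)) / Y n) \<in> borel_measurable M" for n
      by (subst measurable_cong_sets[OF M_is_borel refl]) measurable
    show "AE y in M. (\<lambda>n. (Ln (w + Y n - of_real y) - Ln (w - of_real y)) / Y n) \<longlonglongrightarrow> 1 / (w - of_real y)"
    proof (rule AE_I2)
      fix y
      have "((\<lambda>k. (Ln (w + k - of_real y) - Ln (w - of_real y)) / k) \<longlongrightarrow> 1 / (w - of_real y)) (at 0)"
        using dLn[OF w, of y] by (simp add: DERIV_def)
      thus "(\<lambda>n. (Ln (w + Y n - of_real y) - Ln (w - of_real y)) / Y n) \<longlonglongrightarrow> 1 / (w - of_real y)"
        unfolding tendsto_at_iff_sequentially using Y(1) Y0 by (auto simp: o_def)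
    qed
    show "AE y in M. norm ((Ln (w + Y n - of_real y) - Ln (w - of_real y)) / Y n) \<le> 1 / e" for n
      using bound[OF Y(2) Y(1)] by (intro AE_I2)
  qed auto
  moreover have "(\<integral>y. (Ln (w + Y n - of_real y) - Ln (w - of_real y)) / Y n \<partial>M) = (Gc M (w + Y n) - Gc M w) / Y n" for n
  proof -
    have i: "integrable M (\<lambda>y. Ln (w + Y n - of_real y))" "integrable M (\<lambda>y. Ln (w - of_real y))"
      using integrable_Ln_shift[OF li] Imw[OF Y(2)[of n]] w by auto
    show ?thesis unfolding Gc_def using i by simp
  qed
  ultimately have "(\<lambda>n. (Gc M (w + Y n) - Gc M w) / Y n) \<longlonglongrightarrow> (\<integral>y. 1 / (w - of_real y) \<partial>M)" by (simp only:)
  hence "(\<lambda>n. (\<lambda>h. (Gc M (w + h) - Gc M w) / h) (X (n + N))) \<longlonglongrightarrow> (\<integral>y. 1 / (w - of_real y) \<partial>M)" by (simp add: Y_def)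
  from LIMSEQ_offset[OF this] show "((\<lambda>h. (Gc M (w + h) - Gc M w) / h) \<circ> X) \<longlonglongrightarrow> (\<integral>y. 1 / (w - of_real y) \<partial>M)"
    by (simp add: o_def)
qed

lemma Im_Gc: "log_int M \<Longrightarrow> Im w \<noteq> 0 \<Longrightarrow> Im (Gc M w) = (\<integral>y. Im (Ln (w - of_real y)) \<partial>M)"
  and Re_Gc: "log_int M \<Longrightarrow> Im w \<noteq> 0 \<Longrightarrow> Re (Gc M w) = (\<integral>y. ln (cmod (w - of_real y)) \<partial>M)"
proof -
  assume a: "log_int M" "Im w \<noteq> 0"
  note i = integrable_Ln_shift[OF a]
  show "Im (Gc M w) = (\<integral>y. Im (Ln (w - of_real y)) \<partial>M)" unfolding Gc_def using integral_Im[OF i] by simp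
  have "Re (Gc M w) = (\<integral>y. Re (Ln (w - of_real y)) \<partial>M)" unfolding Gc_def using integral_Re[OF i] by simp
  thus "Re (Gc M w) = (\<integral>y. ln (cmod (w - of_real y)) \<partial>M)" using norm_minus_of_real_bounds(3)[OF a(2)] by simp
qed

lemma Im_Ln_abs_le: "w \<noteq> 0 \<Longrightarrow> \<bar>Im (Ln w)\<bar> \<le> pi"
  using Im_Ln_le_pi[of w] mpi_less_Im_Ln[of w] by simp

text \<open>From below, the argument of \<open>w - y\<close> tends to \<open>- pi\<close> for
  \<open>y > x\<close> and to 0 for \<open>y < x\<close>; dominated convergence needs no more as
  \<open>x\<close> carries no mass.\<close>

lemma Im_Gc_boundary:
  assumes li: "log_int M" and w: "\<And>n. Im (w n) < 0" and lim: "w \<longlonglongrightarrow> of_real x" and at: "AE y in M. y \<noteq> x"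
  shows "(\<lambda>n. Im (Gc M (w n))) \<longlonglongrightarrow> - pi * measure M {x<..}"
proof -
  have "(\<lambda>n. \<integral>y. Im (Ln (w n - of_real y)) \<partial>M) \<longlonglongrightarrow> (\<integral>y. - pi * indicator {x<..} y \<partial>M)"
  proof (rule integral_dominated_convergence[where w = "\<lambda>_. pi"])
    show "(\<lambda>y. Im (Ln (w n - of_real y))) \<in> borel_measurable M" for n
      by (subst measurable_cong_sets[OF M_is_borel refl]) measurable
    show "AE y in M. (\<lambda>n. Im (Ln (w n - of_real y))) \<longlonglongrightarrow> - pi * indicator {x<..} y"
      using at
    proof eventually_elim
      case (elim y)
      have "(\<lambda>n. Re (w n - of_real y) / cmod (w n - of_real y)) \<longlonglongrightarrow> Re (of_real x - of_real y) / cmod (of_real x - of_real y)"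
        using elim by (intro tendsto_intros lim) auto
      moreover have "cmod (of_real x - of_real y) = \<bar>x - y\<bar>" by (metis norm_of_real of_real_diff)
      ultimately have l: "(\<lambda>n. Re (w n - of_real y) / cmod (w n - of_real y)) \<longlonglongrightarrow> sgn (x - y)"
        by (simp only: real_sgn_eq minus_complex.simps Re_complex_of_real)
      have "(\<lambda>n. - arccos (Re (w n - of_real y) / cmod (w n - of_real y))) \<longlonglongrightarrow> - arccos (sgn (x - y))"
      proof (intro tendsto_minus continuous_on_tendsto_compose[OF continuous_on_arccos' l])
        show "sgn (x - y) \<in> {-1..1}" by (auto simp: sgn_real_def)
        show "\<forall>\<^sub>F n in sequentially. Re (w n - of_real y) / cmod (w n - of_real y) \<in> {-1..1}"
        proof (intro always_eventually allI)
          fix n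
          show "Re (w n - of_real y) / cmod (w n - of_real y) \<in> {-1..1}"
            using abs_Re_le_cmod[of "w n - of_real y"] norm_minus_of_real_bounds(3)[of "w n" y] w[of n]
            by (auto simp: field_simps abs_le_iff)
        qed
      qed
      moreover have "Im (Ln (w n - of_real y)) = - arccos (Re (w n - of_real y) / cmod (w n - of_real y))" for n
        using w[of n] by (intro Im_Ln_lower) simp
      moreover have "- arccos (sgn (x - y)) = - pi * indicator {x<..} y" using elim by (auto simp: sgn_real_def indicator_def)
      ultimately show ?case by simp
    qed
    show "AE y in M. norm (Im (Ln (w n - of_real y))) \<le> pi" for n
      using w[of n] norm_minus_of_real_bounds(3)[of "w n"] by (intro AE_I2) (simp add: Im_Ln_abs_le)
  qed auto
  moreover have "{x<..} \<in> sets M" by auto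
  ultimately show ?thesis using Im_Gc[OF li] w by (simp add: less_imp_neq)
qed

lemma ratio_tendsto_1:
  assumes "filterlim (\<lambda>n. cmod (w n)) at_top sequentially"
  shows "(\<lambda>n. (w n - of_real y) / w n) \<longlonglongrightarrow> 1"
proof -
  have wi: "filterlim w at_infinity sequentially" using assms by (simp add: filterlim_norm_at_top_imp_at_infinity)
  have "(\<lambda>n. 1 - of_real y / w n) \<longlonglongrightarrow> 1 - 0" by (intro tendsto_intros tendsto_divide_0[OF tendsto_const wi])
  moreover have "\<forall>\<^sub>F n in sequentially. 1 - of_real y / w n = (w n - of_real y) / w n"
  proof -
    have "\<forall>\<^sub>F n in sequentially. cmod (w n) > 0" using assms unfolding filterlim_at_top_dense by blast
    thus ?thesis by eventually_elim (simp add: diff_divide_distrib)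
  qed
  ultimately show ?thesis by (simp add: tendsto_cong)
qed

text \<open>Both \<open>w - y\<close> and \<open>w\<close> lie in the lower half-plane, so the
  difference of their logarithms is the principal logarithm of a quotient tending to 1. Arguments
  are bounded, hence every direction of approach is covered.\<close>

lemma Im_Gc_infinity:
  assumes li: "log_int M" and w: "\<And>n. Im (w n) < 0" and lim: "filterlim (\<lambda>n. cmod (w n)) at_top sequentially"
  shows "(\<lambda>n. Im (Gc M (w n)) - measure M UNIV * Im (Ln (w n))) \<longlonglongrightarrow> 0"
proof -
  have w0: "w n \<noteq> 0" "w n - of_real y \<noteq> 0" for n y using w[of n] norm_minus_of_real_bounds(3)[of "w n" y] by auto
  have "(\<lambda>n. \<integral>y. Im (Ln (w n - of_real y)) - Im (Ln (w n)) \<partial>M) \<longlonglongrightarrow> (\<integral>y. 0 \<partial>M)"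
  proof (rule integral_dominated_convergence[where w = "\<lambda>_. 2 * pi"])
    show "(\<lambda>y. Im (Ln (w n - of_real y)) - Im (Ln (w n))) \<in> borel_measurable M" for n
      by (subst measurable_cong_sets[OF M_is_borel refl]) measurable
    show "AE y in M. norm (Im (Ln (w n - of_real y)) - Im (Ln (w n))) \<le> 2 * pi" for n
    proof (rule AE_I2)
      fix y
      show "norm (Im (Ln (w n - of_real y)) - Im (Ln (w n))) \<le> 2 * pi"
        using Im_Ln_abs_le[OF w0(1)[of n]] Im_Ln_abs_le[OF w0(2)[of n y]] unfolding real_norm_def by linarith
    qed
    show "AE y in M. (\<lambda>n. Im (Ln (w n - of_real y)) - Im (Ln (w n))) \<longlonglongrightarrow> 0"
    proof (rule AE_I2)
      fix y
      have "Ln ((w n - of_real y) / w n) = Ln (w n - of_real y) - Ln (w n)" for n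
      proof -
        have neg: "- pi < Im (Ln z) \<and> Im (Ln z) < 0" if "Im z < 0" for z
          using that Im_Ln_lower[OF that] mpi_less_Im_Ln[of z] Im_Ln_pos_le[of z] Im_Ln_le_pi[of z] by force
        have "- pi < Im (Ln (w n)) \<and> Im (Ln (w n)) < 0" "- pi < Im (Ln (w n - of_real y)) \<and> Im (Ln (w n - of_real y)) < 0"
          using neg w[of n] by auto
        hence "Ln (exp (Ln (w n - of_real y) - Ln (w n))) = Ln (w n - of_real y) - Ln (w n)"
          by (intro Ln_exp) auto
        thus ?thesis using w0 by (simp add: exp_diff)
      qed
      moreover have "(\<lambda>n. Im (Ln ((w n - of_real y) / w n))) \<longlonglongrightarrow> Im (Ln 1)"
        by (intro tendsto_intros ratio_tendsto_1 lim) (auto simp: complex_nonpos_Reals_iff)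
      ultimately show "(\<lambda>n. Im (Ln (w n - of_real y)) - Im (Ln (w n))) \<longlonglongrightarrow> 0" by simp
    qed
  qed auto
  moreover have "(\<integral>y. Im (Ln (w n - of_real y)) - Im (Ln (w n)) \<partial>M) = Im (Gc M (w n)) - measure M UNIV * Im (Ln (w n))" for n
  proof -
    have Imw: "Im (w n) \<noteq> 0" using w[of n] by simp
    have "integrable M (\<lambda>y. Im (Ln (w n - of_real y)))" using integrable_Im[OF integrable_Ln_shift[OF li Imw]] .
    thus ?thesis by (simp add: Im_Gc[OF li Imw])
  qed
  ultimately show ?thesis by simp
qed

text \<open>The real part could be disturbed near the axis; in the sector
  \<open>- Im w \<ge> d * cmod w\<close> the ratio of \<open>|w - y|\<close> to \<open>|w|\<close>
  stays above \<open>d\<close>, which supplies a dominating function.\<close>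

lemma Re_Gc_infinity:
  assumes li: "log_int M" and w: "\<And>n. Im (w n) < 0" and lim: "filterlim (\<lambda>n. cmod (w n)) at_top sequentially"
    and d: "d > 0" and dir: "\<And>n. - Im (w n) \<ge> d * cmod (w n)" and big: "\<And>n. cmod (w n) \<ge> 1"
  shows "(\<lambda>n. Re (Gc M (w n)) - measure M UNIV * ln (cmod (w n))) \<longlonglongrightarrow> 0"
proof -
  have w0: "w n \<noteq> 0" "w n - of_real y \<noteq> 0" for n y using w[of n] norm_minus_of_real_bounds(3)[of "w n" y] by auto
  have q: "ln (cmod (w n - of_real y)) - ln (cmod (w n)) = ln (cmod ((w n - of_real y) / w n))" for n y
    using w0[of n] w0(2)[of n y] by (simp add: norm_divide ln_div)
  have "(\<lambda>n. \<integral>y. ln (cmod (w n - of_real y)) - ln (cmod (w n)) \<partial>M) \<longlonglongrightarrow> (\<integral>y. 0 \<partial>M)"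
  proof (rule integral_dominated_convergence[where w = "\<lambda>y. \<bar>ln d\<bar> + ln (1 + \<bar>y\<bar>)"])
    show "(\<lambda>y. ln (cmod (w n - of_real y)) - ln (cmod (w n))) \<in> borel_measurable M" for n
      by (subst measurable_cong_sets[OF M_is_borel refl]) measurable
    show "integrable M (\<lambda>y. \<bar>ln d\<bar> + ln (1 + \<bar>y\<bar>))"
      using li by (intro Bochner_Integration.integrable_add) (auto simp: log_int_def)
    show "AE y in M. norm (ln (cmod (w n - of_real y)) - ln (cmod (w n))) \<le> \<bar>ln d\<bar> + ln (1 + \<bar>y\<bar>)" for n
    proof (rule AE_I2)
      fix y :: real
      let ?q = "cmod (w n - of_real y) / cmod (w n)"
      have "d * cmod (w n) \<le> cmod (w n - of_real y)"
        using norm_minus_of_real_bounds(1)[of "w n" y] w[of n] dir[of n] by auto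
      hence 1: "d \<le> ?q" using w0(1)[of n] by (simp add: le_divide_eq)
      have "cmod (w n - of_real y) \<le> cmod (w n) + \<bar>y\<bar>" using norm_triangle_ineq4[of "w n" "of_real y"] by simp
      also have "\<dots> \<le> (1 + \<bar>y\<bar>) * cmod (w n)"
        using mult_left_mono[OF big[of n], of "\<bar>y\<bar>"] by (simp add: algebra_simps)
      finally have 2: "?q \<le> 1 + \<bar>y\<bar>" using w0(1)[of n] by (simp add: divide_le_eq)
      have "ln d \<le> ln ?q" using 1 d by (subst ln_le_cancel_iff) auto
      moreover have "ln ?q \<le> ln (1 + \<bar>y\<bar>)" using 1 2 d by (subst ln_le_cancel_iff) auto
      moreover have "0 \<le> ln (1 + \<bar>y\<bar>)" by (simp add: ln_ge_zero)
      ultimately show "norm (ln (cmod (w n - of_real y)) - ln (cmod (w n))) \<le> \<bar>ln d\<bar> + ln (1 + \<bar>y\<bar>)"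
        unfolding q norm_divide real_norm_def by linarith
    qed
    show "AE y in M. (\<lambda>n. ln (cmod (w n - of_real y)) - ln (cmod (w n))) \<longlonglongrightarrow> 0"
    proof (rule AE_I2)
      fix y
      have "(\<lambda>n. ln (cmod ((w n - of_real y) / w n))) \<longlonglongrightarrow> ln (cmod 1)"
        by (intro tendsto_intros ratio_tendsto_1 lim) auto
      thus "(\<lambda>n. ln (cmod (w n - of_real y)) - ln (cmod (w n))) \<longlonglongrightarrow> 0" unfolding q by simp
    qed
  qed auto
  moreover have "(\<integral>y. ln (cmod (w n - of_real y)) - ln (cmod (w n)) \<partial>M) = Re (Gc M (w n)) - measure M UNIV * ln (cmod (w n))" for n
  proof -
    have Imw: "Im (w n) \<noteq> 0" using w[of n] by simp
    have "integrable M (\<lambda>y. Re (Ln (w n - of_real y)))" using integrable_Re[OF integrable_Ln_shift[OF li Imw]] .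
    hence "integrable M (\<lambda>y. ln (cmod (w n - of_real y)))" using w0(2)[of n] by simp
    thus ?thesis by (simp add: Re_Gc[OF li Imw])
  qed
  ultimately show ?thesis by simp
qed

text \<open>Descending vertically to \<open>x\<close> makes the kernels decrease, so monotone
  convergence yields integrability at \<open>x\<close> itself together with the value.\<close>

lemma potential_of_vertical_limit:
  assumes li: "log_int M" and at: "AE y in M. y \<noteq> x"
    and lim: "(\<lambda>n. Re (Gc M (of_real x - \<i> * of_real (1 / real (Suc n))))) \<longlonglongrightarrow> L"
  shows "log_potential M x = ereal L"
proof -
  let ?e = "\<lambda>n. 1 / real (Suc n)"
  have k: "ln (cmod (of_real x - \<i> * of_real (?e n) - of_real y)) = ker (?e n) x y" for n y
  proof -
    have "cmod (of_real x - \<i> * of_real (?e n) - of_real y) = sqrt ((x - y)\<^sup>2 + (?e n)\<^sup>2)"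
      by (simp add: cmod_def)
    moreover have "(x - y)\<^sup>2 + (?e n)\<^sup>2 > 0" by (intro add_nonneg_pos) auto
    ultimately show ?thesis by (simp add: ker_def ln_sqrt)
  qed
  have Imx: "Im (of_real x - \<i> * of_real (?e n)) \<noteq> 0" for n by simp
  have Rek: "Re (Gc M (of_real x - \<i> * of_real (?e n))) = (\<integral>y. ker (?e n) x y \<partial>M)" for n
    using Re_Gc[OF li Imx[of n]] unfolding k .
  have ik: "integrable M (\<lambda>y. ker (?e n) x y)" for n
  proof -
    have "integrable M (\<lambda>y. Re (Ln (of_real x - \<i> * of_real (?e n) - of_real y)))"
      using integrable_Re[OF integrable_Ln_shift[OF li Imx]] .
    moreover have "Re (Ln (of_real x - \<i> * of_real (?e n) - of_real y)) = ker (?e n) x y" for y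
      using norm_minus_of_real_bounds(3)[OF Imx[of n], of y] k[of n y] by simp
    ultimately show ?thesis by simp
  qed
  have e0: "?e \<longlonglongrightarrow> 0" using LIMSEQ_inverse_real_of_nat by (simp add: inverse_eq_divide)
  have mono: "AE y in M. mono (\<lambda>n. - ker (?e n) x y)"
    using at
  proof eventually_elim
    case (elim y)
    show ?case
    proof (rule monoI)
      fix i j :: nat assume "i \<le> j"
      hence "?e j \<le> ?e i" by (simp add: frac_le)
      thus "- ker (?e i) x y \<le> - ker (?e j) x y" using ker_mono[of "?e j" "?e i" x y] elim by simp
    qed
  qed
  have limk: "AE y in M. (\<lambda>n. - ker (?e n) x y) \<longlonglongrightarrow> - ln \<bar>x - y\<bar>"
    using at
  proof eventually_elim
    case (elim y)
    have "(\<lambda>n. - ker (?e n) x y) \<longlonglongrightarrow> - ker 0 x y"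
      unfolding ker_def by (intro tendsto_intros e0) (use elim in auto)
    thus ?case by (simp add: ker_0)
  qed
  have "(\<lambda>n. - (\<integral>y. ker (?e n) x y \<partial>M)) \<longlonglongrightarrow> - L" using tendsto_minus[OF lim] unfolding Rek .
  hence limI: "(\<lambda>n. \<integral>y. - ker (?e n) x y \<partial>M) \<longlonglongrightarrow> - L" by simp
  have m: "(\<lambda>y. - ln \<bar>x - y\<bar>) \<in> borel_measurable M"
    by (subst measurable_cong_sets[OF M_is_borel refl]) measurable
  have "integrable M (\<lambda>y. - ln \<bar>x - y\<bar>)" "(\<integral>y. - ln \<bar>x - y\<bar> \<partial>M) = - L"
    using integrable_monotone_convergence[OF Bochner_Integration.integrable_minus[OF ik] mono limk limI m]
      integral_monotone_convergence[OF Bochner_Integration.integrable_minus[OF ik] mono limk limI m] by auto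
  hence i: "integrable M (\<lambda>y. ln \<bar>x - y\<bar>)" "(\<integral>y. ln \<bar>x - y\<bar> \<partial>M) = L" by auto
  have "(\<integral>\<^sup>+y. kap x y \<partial>M) = (\<integral>\<^sup>+y. ennreal (- ln \<bar>x - y\<bar>) \<partial>M)"
    by (rule nn_integral_cong_AE) (use at in eventually_elim, simp add: kap_def log_dist_def)
  also have "\<dots> < \<infinity>" using i(1) by (simp add: real_integrable_def top.not_eq_extremum)
  finally have "(\<integral>\<^sup>+y. kap x y \<partial>M) < \<infinity>" .
  thus ?thesis by (cases rule: potential_cases[OF li, of x]) (use i in auto)
qed

end

section \<open>Boundary angles and the identification of the two potentials\<close>

context three_shifts
begin

lemma root_pair_ex:
  assumes "roots (of_real x) u1 u2 u3" "x \<noteq> 0"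
  shows "\<exists>y y'. y + y' = of_real (mp x - sg) \<and> y * y' = of_real (kp / mp x)
    \<and> (x > 0 \<longrightarrow> u3 = of_real (- mp x) \<and> u1 = y \<and> u2 = y' \<and> cmod u2 < mp x)
    \<and> (x < 0 \<longrightarrow> u1 = of_real (- mp x) \<and> u2 = y \<and> u3 = y' \<and> mp x < cmod u2)"
  by (rule root_pair[OF assms]) blast

lemma exp_Lf_polar: "Im v > 0 \<Longrightarrow> Im (Af v) = exp (Re (Lf v)) * sin (Im (Lf v))"
  by (subst exp_Lf[symmetric]) (simp_all add: Im_exp)

text \<open>The cube root of \<open>kp\<close> is the geometric mean of the three moduli: if the
  real root lies below it, the conjugate pair lies above, and conversely.\<close>

lemma cmod_cube_less:
  assumes "cmod p ^ 2 = kp / m" "m > 0"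
  shows "m ^ 3 < kp \<Longrightarrow> cmod p ^ 3 > kp" "m ^ 3 > kp \<Longrightarrow> cmod p ^ 3 < kp"
proof -
  have e: "(cmod p ^ 3)\<^sup>2 = kp ^ 3 / m ^ 3"
  proof -
    have "(cmod p ^ 3)\<^sup>2 = (cmod p ^ 2) ^ 3" by (simp add: power_mult[symmetric])
    thus ?thesis by (simp add: assms(1) power_divide)
  qed
  { assume "m ^ 3 < kp"
    hence "kp\<^sup>2 < kp ^ 3 / m ^ 3" using assms pos by (simp add: field_simps power2_eq_square power3_eq_cube)
    hence "kp\<^sup>2 < (cmod p ^ 3)\<^sup>2" unfolding e .
    thus "cmod p ^ 3 > kp" by (rule power2_less_imp_less) simp }
  { assume "m ^ 3 > kp"
    hence "kp ^ 3 / m ^ 3 < kp\<^sup>2" using assms pos by (simp add: field_simps power2_eq_square power3_eq_cube)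
    hence "(cmod p ^ 3)\<^sup>2 < kp\<^sup>2" unfolding e .
    thus "cmod p ^ 3 < kp" by (rule power2_less_imp_less) (use pos in simp) }
qed

lemma cube_bounds: "c < m \<Longrightarrow> kp < m ^ 3" "0 < m \<Longrightarrow> m < a \<Longrightarrow> m ^ 3 < kp"
proof -
  assume "c < m"
  hence "a < m" "b < m" using ab bc by auto
  thus "kp < m ^ 3" unfolding kp_def power3_eq_cube using pos \<open>c < m\<close> by (intro mult_strict_mono mult_pos_pos) auto
next
  assume "0 < m" "m < a"
  thus "m ^ 3 < kp" unfolding kp_def power3_eq_cube using pos ab bc by (intro mult_strict_mono mult_pos_pos) auto
qed

lemma Im_Ln_neg_real: "t > 0 \<Longrightarrow> Im (Ln (of_real (- t))) = pi"
  by (subst Im_Ln_upper) auto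

text \<open>A limit of smallest or largest roots need not be identifiable by its rank, but
  comparison with the geometric mean of the moduli is a closed condition and suffices to find its
  argument.\<close>

lemma boundary_angle:
  assumes R: "roots (of_real x) u1 u2 u3" and p: "p \<noteq> 0" "Im p \<ge> 0" "Af p = of_real x"
  shows "cmod p ^ 3 \<le> kp \<Longrightarrow> Im (Ln p) = (if x \<le> 0 then pi else Th x)"
    and "cmod p ^ 3 \<ge> kp \<Longrightarrow> Re p \<le> 0 \<Longrightarrow> Im (Ln p) = (if x \<ge> 0 then pi else Th x)"
proof -
  have mem: "p = u1 \<or> p = u2 \<or> p = u3" using roots_Af_iff[OF R p(1)] p(3) by simp
  have zero: "Im (Ln p) = pi" if "x = 0"
  proof -
    have "(p + of_real a) * (p + of_real b) * (p + of_real c) = 0" using p that by (simp add: Af_def)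
    hence "p = of_real (- a) \<or> p = of_real (- b) \<or> p = of_real (- c)" by (auto simp: add_eq_0_iff2)
    thus ?thesis using Im_Ln_neg_real pos by blast
  qed
  { assume small: "cmod p ^ 3 \<le> kp"
    show "Im (Ln p) = (if x \<le> 0 then pi else Th x)"
    proof (cases "x = 0")
      case True thus ?thesis using zero by simp
    next
      case x: False
      have m: "mp x > 0" by (rule mp_nz_pos[OF x])
      obtain y y' where yy: "y + y' = of_real (mp x - sg)" "y * y' = of_real (kp / mp x)"
        "x > 0 \<longrightarrow> u3 = of_real (- mp x) \<and> u1 = y \<and> u2 = y' \<and> cmod u2 < mp x"
        "x < 0 \<longrightarrow> u1 = of_real (- mp x) \<and> u2 = y \<and> u3 = y' \<and> mp x < cmod u2"
        using root_pair_ex[OF R x] by blast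
      have yy': "y' + y = of_real (mp x - sg)" "y' * y = of_real (kp / mp x)" using yy by (simp_all add: ac_simps)
      have pr: "Im (Ln p) = Th x" if "p = y \<or> p = y'"
        unfolding Th_def using pair_angle[OF yy(1,2) m] pair_angle[OF yy' m] that p(2) by blast
      show ?thesis
      proof (cases "x > 0")
        case True
        have "p \<noteq> u3"
        proof
          assume "p = u3"
          hence "cmod p = mp x" using yy(3)[rule_format, OF True] m by simp
          thus False using small cube_bounds(1)[OF mp_pos(1)[OF True]] by simp
        qed
        thus ?thesis using True mem yy(3) pr by auto
      next
        case False
        hence xn: "x < 0" using x by simp
        have ma: "0 < mp x" "mp x < a" using mp_pos(2)[OF xn] by auto
        show ?thesis
        proof (cases "p = u1")
          case True
          thus ?thesis using yy(4)[rule_format, OF xn] Im_Ln_neg_real[OF m] xn by simp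
        next
          case F: False
          hence py: "p = y \<or> p = y'" using mem yy(4)[rule_format, OF xn] by auto
          \<comment> \<open>A nonreal pair would have modulus above the geometric mean, against
            \<open>small\<close>; so the pair is real, and a negative cosine leaves only the angle
            pi.\<close>
          have "CC (mp x) \<le> -1"
          proof (rule ccontr)
            assume "\<not> CC (mp x) \<le> -1"
            moreover have "CC (mp x) < 0" using ma ab bc pos by (auto simp: CC_def sg_def intro!: divide_neg_pos mult_neg_pos)
            ultimately have "\<bar>CC (mp x)\<bar> < 1" by auto
            hence "(mp x - sg)\<^sup>2 < 4 * (kp / mp x)" using CC_abs_less[OF m] by simp
            from real_pair(1)[OF yy(1,2) _ this] py have "cmod p ^ 2 = kp / mp x" using pos m by auto
            from cmod_cube_less(1)[OF this m cube_bounds(2)[OF ma]] show False using small by simp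
          qed
          thus ?thesis using pr[OF py] Th_eq_pi xn by simp
        qed
      qed
    qed }
  { assume large: "cmod p ^ 3 \<ge> kp" and Rep: "Re p \<le> 0"
    show "Im (Ln p) = (if x \<ge> 0 then pi else Th x)"
    proof (cases "x = 0")
      case True thus ?thesis using zero by simp
    next
      case x: False
      have m: "mp x > 0" by (rule mp_nz_pos[OF x])
      obtain y y' where yy: "y + y' = of_real (mp x - sg)" "y * y' = of_real (kp / mp x)"
        "x > 0 \<longrightarrow> u3 = of_real (- mp x) \<and> u1 = y \<and> u2 = y' \<and> cmod u2 < mp x"
        "x < 0 \<longrightarrow> u1 = of_real (- mp x) \<and> u2 = y \<and> u3 = y' \<and> mp x < cmod u2"
        using root_pair_ex[OF R x] by blast
      have yy': "y' + y = of_real (mp x - sg)" "y' * y = of_real (kp / mp x)" using yy by (simp_all add: ac_simps)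
      have pr: "Im (Ln p) = Th x" if "p = y \<or> p = y'"
        unfolding Th_def using pair_angle[OF yy(1,2) m] pair_angle[OF yy' m] that p(2) by blast
      show ?thesis
      proof (cases "x > 0")
        case False
        hence xn: "x < 0" using x by simp
        have ma: "0 < mp x" "mp x < a" using mp_pos(2)[OF xn] by auto
        have "p \<noteq> u1"
        proof
          assume "p = u1"
          hence "cmod p = mp x" using yy(4)[rule_format, OF xn] m by simp
          thus False using large cube_bounds(2)[OF ma] by simp
        qed
        thus ?thesis using xn mem yy(4) pr by auto
      next
        case True
        show ?thesis
        proof (cases "p = u3")
          case p3: True
          thus ?thesis using yy(3)[rule_format, OF True] Im_Ln_neg_real[OF m] True by simp
        next
          case F: False
          hence py: "p = y \<or> p = y'" using mem yy(3)[rule_format, OF True] by auto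
          have P: "kp / mp x > 0" using pos m by simp
          have "\<not> (mp x - sg)\<^sup>2 < 4 * (kp / mp x)"
          proof
            assume "(mp x - sg)\<^sup>2 < 4 * (kp / mp x)"
            from real_pair(1)[OF yy(1,2) P this] py have "cmod p ^ 2 = kp / mp x" by auto
            from cmod_cube_less(2)[OF this m cube_bounds(1)[OF mp_pos(1)[OF True]]] show False using large by simp
          qed
          hence "Im p = 0" using real_pair(2)[OF yy(1,2) P] py by auto
          \<comment> \<open>For large positive \<open>x\<close> the real pair may be positive;
            \<open>Re p \<le> 0\<close> is what rules this out.\<close>
          hence "p = of_real (- (- Re p))" "- Re p > 0" using p(1) Rep by (auto simp: complex_eq_iff)
          thus ?thesis using Im_Ln_neg_real[of "- Re p"] True by simp
        qed
      qed
    qed }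
qed

text \<open>For \<open>x\<close> in the lower half-plane the smallest root has
  \<open>Im (Lf v)\<close> equal to the argument of \<open>x\<close>, and the largest root has it
  larger by \<open>2 * pi\<close>; these are the resulting ranges.\<close>

definition "Om1 = {v. Im v > 0 \<and> Im (Lf v) < 0}"
definition "Om3 = {v. Im v > 0 \<and> Im (Lf v) > pi}"

lemma Lf_continuous: "continuous_on {v. Im v > 0} Lf"
  using has_field_derivative_Lf by (intro continuous_at_imp_continuous_on) (auto intro: DERIV_isCont)

lemma open_Om: "open Om1" "open Om3"
proof -
  have c: "continuous_on {v. Im v > 0} (\<lambda>v. Im (Lf v))" using Lf_continuous by (intro continuous_intros)
  have o: "open {v. Im v > 0}" by (rule open_halfspace_Im_gt)
  have "Om1 = (\<lambda>v. Im (Lf v)) -` {..<0} \<inter> {v. Im v > 0}" "Om3 = (\<lambda>v. Im (Lf v)) -` {pi<..} \<inter> {v. Im v > 0}"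
    by (auto simp: Om1_def Om3_def)
  thus "open Om1" "open Om3" using c o by (auto intro: continuous_on_open_vimage[THEN iffD1, rule_format])
qed

lemma Om1_D:
  assumes "v \<in> Om1"
  shows "Im v > 0" "Im (Af v) < 0" "Ln (Af v) = Lf v"
proof -
  show v: "Im v > 0" using assms by (simp add: Om1_def)
  have L: "- pi < Im (Lf v)" "Im (Lf v) < 0" using assms Im_Lf_range[OF v] by (auto simp: Om1_def)
  show "Im (Af v) < 0" unfolding exp_Lf_polar[OF v] using L sin_gt_zero[of "- Im (Lf v)"] by (simp add: mult_pos_neg)
  show "Ln (Af v) = Lf v" unfolding exp_Lf[OF v, symmetric] using L by (intro Ln_exp) auto
qed

lemma Om3_D:
  assumes "v \<in> Om3"
  shows "Im v > 0" "Re v < 0" "Im (Af v) < 0" "Ln (Af v) = Lf v - 2 * of_real pi * \<i>"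
proof -
  show v: "Im v > 0" using assms by (simp add: Om3_def)
  have L: "pi < Im (Lf v)" "Im (Lf v) < 2 * pi" "Im (Lf v) < 2 * Im (Ln v)" using assms Im_Lf_range[OF v] by (auto simp: Om3_def)
  have "pi / 2 < Im (Ln v)" using L by simp
  thus "Re v < 0" using Re_Ln_pos_le[of v] v by force
  have s: "sin (Im (Lf v)) < 0" using L sin_lt_zero by blast
  show "Im (Af v) < 0" unfolding exp_Lf_polar[OF v] using s by (simp add: mult_pos_neg)
  have "Af v = exp (Lf v - 2 * of_real pi * \<i>)" unfolding exp_Lf[OF v, symmetric] by (simp add: exp_diff)
  moreover have "Ln (exp (Lf v - 2 * of_real pi * \<i>)) = Lf v - 2 * of_real pi * \<i>" using L by (intro Ln_exp) auto
  ultimately show "Ln (Af v) = Lf v - 2 * of_real pi * \<i>" by simp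
qed

text \<open>Injectivity of \<open>Lf\<close> identifies \<open>v\<close> as the smallest root, whose
  modulus is at most the geometric mean. The cube inequality is the form that survives
  limits.\<close>

lemma Om1_root:
  assumes "v \<in> Om1" "roots (Af v) u1 u2 u3"
  shows "v = u1" "cmod v ^ 3 \<le> kp"
proof -
  note D = Om1_D[OF assms(1)]
  note L = roots_lower[OF assms(2) D(2)]
  show v: "v = u1" using Lf_inj[OF D(1) L(1)] L(2) D(3) by simp
  have "cmod v ^ 3 \<le> cmod u1 * cmod u2 * cmod u3"
    unfolding power3_eq_cube v using roots_le[OF assms(2)] by (intro mult_mono) auto
  thus "cmod v ^ 3 \<le> kp" using roots_cmod_prod[OF assms(2)] by simp
qed

lemma Om3_root:
  assumes "v \<in> Om3" "roots (Af v) u1 u2 u3"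
  shows "v = u3" "cmod v ^ 3 \<ge> kp"
proof -
  note D = Om3_D[OF assms(1)]
  note L = roots_lower[OF assms(2) D(3)]
  show v: "v = u3" using Lf_inj[OF D(1) L(5)] L(6) D(4) by simp
  have "cmod u1 * cmod u2 * cmod u3 \<le> cmod v ^ 3"
    unfolding power3_eq_cube v using roots_le[OF assms(2)] by (intro mult_mono) auto
  thus "cmod v ^ 3 \<ge> kp" using roots_cmod_prod[OF assms(2)] by simp
qed

lemma Af_tendsto: "(v \<longlongrightarrow> p) F \<Longrightarrow> p \<noteq> 0 \<Longrightarrow> ((\<lambda>n. Af (v n)) \<longlongrightarrow> Af p) F"
  unfolding Af_def by (intro tendsto_intros) auto

lemma Af_holomorphic: "0 \<notin> S \<Longrightarrow> Af holomorphic_on S"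
  unfolding Af_def[abs_def] by (intro holomorphic_intros) auto

lemma Gc_Af_holomorphic:
  assumes "finite_borel_measure M" "log_int M" "open S" "\<And>v. v \<in> S \<Longrightarrow> Im v > 0 \<and> Im (Af v) < 0"
  shows "(\<lambda>v. Gc M (Af v)) holomorphic_on S"
proof -
  have "Gc M holomorphic_on {w. Im w < 0}"
    using finite_borel_measure.Gc_has_field_derivative[OF assms(1,2)]
    by (subst holomorphic_on_open) (auto simp: open_halfspace_Im_lt)
  moreover have "Af holomorphic_on S" using assms(4) by (intro Af_holomorphic) force
  ultimately have "(Gc M \<circ> Af) holomorphic_on S" using assms(4) by (intro holomorphic_on_compose_gen) auto
  thus ?thesis by (simp add: o_def)
qed

lemma Im_Ln_tendsto_upper:
  assumes v: "\<And>n. Im (v n) > 0" and lim: "v \<longlonglongrightarrow> p" and p: "p \<noteq> 0"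
  shows "(\<lambda>n. Im (Ln (v n))) \<longlonglongrightarrow> Im (Ln p)" "Im p \<ge> 0"
proof -
  show Imp: "Im p \<ge> 0"
    by (rule LIMSEQ_le_const[OF tendsto_Im[OF lim]]) (use v in \<open>auto intro: less_imp_le\<close>)
  have l: "(\<lambda>n. Re (v n) / cmod (v n)) \<longlonglongrightarrow> Re p / cmod p" using p by (intro tendsto_intros lim) auto
  have r: "Re z / cmod z \<in> {-1..1}" if "z \<noteq> 0" for z
    using that abs_Re_le_cmod[of z] by (auto simp: field_simps abs_le_iff)
  have vn: "v n \<noteq> 0" for n using v[of n] by auto
  have "(\<lambda>n. arccos (Re (v n) / cmod (v n))) \<longlonglongrightarrow> arccos (Re p / cmod p)"
    by (rule continuous_on_tendsto_compose[OF continuous_on_arccos' l]) (use r p vn in \<open>auto intro!: always_eventually\<close>)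
  moreover have "Im (Ln (v n)) = arccos (Re (v n) / cmod (v n))" for n
    using v[of n] vn[of n] by (intro Im_Ln_upper) auto
  ultimately show "(\<lambda>n. Im (Ln (v n))) \<longlonglongrightarrow> Im (Ln p)" using Im_Ln_upper[OF p Imp] by simp
qed

lemma Lf_tendsto:
  assumes "v \<longlonglongrightarrow> p" "Im p > 0"
  shows "(\<lambda>n. Im (Lf (v n))) \<longlonglongrightarrow> Im (Lf p)"
  by (intro tendsto_Im isCont_tendsto_compose[OF DERIV_isCont[OF has_field_derivative_Lf[OF assms(2)]] assms(1)])

text \<open>A boundary point is either real or lies on a level of \<open>Im (Lf p)\<close> equal to
  0 or pi; in both cases \<open>Af p\<close> is real.\<close>

lemma Af_real_limit:
  assumes v: "\<And>n. v n \<in> Om1 \<or> v n \<in> Om3" and lim: "v \<longlonglongrightarrow> p" and p: "p \<noteq> 0"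
    and ev: "(\<forall>n. v n \<in> Om1) \<and> p \<notin> Om1 \<or> (\<forall>n. v n \<in> Om3) \<and> p \<notin> Om3"
  shows "Af p = of_real (Re (Af p))" "Im p \<ge> 0"
proof -
  have vp: "Im (v n) > 0" for n using v[of n] by (auto simp: Om1_def Om3_def)
  show Imp: "Im p \<ge> 0" by (rule Im_Ln_tendsto_upper(2)[OF vp lim p])
  have "Im (Af p) = 0"
  proof (cases "Im p = 0")
    case True
    hence "cnj p = p" by (simp add: complex_eq_iff)
    hence "cnj (Af p) = Af p" using Af_cnj[of p] by simp
    thus ?thesis by (metis Reals_cnj_iff complex_is_Real_iff)
  next
    case False
    hence ip: "Im p > 0" using Imp by simp
    have l: "(\<lambda>n. Im (Lf (v n))) \<longlonglongrightarrow> Im (Lf p)" by (rule Lf_tendsto[OF lim ip])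
    from ev have "Im (Lf p) = 0 \<or> Im (Lf p) = pi"
    proof
      assume a: "(\<forall>n. v n \<in> Om1) \<and> p \<notin> Om1"
      have "Im (Lf p) \<le> 0" by (rule LIMSEQ_le_const2[OF l]) (use a in \<open>auto simp: Om1_def intro: less_imp_le\<close>)
      moreover have "Im (Lf p) \<ge> 0" using a ip by (auto simp: Om1_def)
      ultimately show ?thesis by simp
    next
      assume a: "(\<forall>n. v n \<in> Om3) \<and> p \<notin> Om3"
      have "Im (Lf p) \<ge> pi" by (rule LIMSEQ_le_const[OF l]) (use a in \<open>auto simp: Om3_def intro: less_imp_le\<close>)
      moreover have "Im (Lf p) \<le> pi" using a ip by (auto simp: Om3_def)
      ultimately show ?thesis by simp
    qed
    thus ?thesis unfolding exp_Lf_polar[OF ip] by auto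
  qed
  thus "Af p = of_real (Re (Af p))" by (simp add: complex_eq_iff)
qed

lemma Af_at_0:
  assumes "v \<longlonglongrightarrow> 0" "\<And>n. v n \<noteq> 0"
  shows "filterlim (\<lambda>n. cmod (Af (v n))) at_top sequentially" "(\<lambda>n. Af (v n) * v n) \<longlonglongrightarrow> of_real kp"
proof -
  have e: "Af (v n) * v n = (v n + of_real a) * (v n + of_real b) * (v n + of_real c)" for n
    using assms(2)[of n] by (simp add: Af_def)
  have "(\<lambda>n. (v n + of_real a) * (v n + of_real b) * (v n + of_real c)) \<longlonglongrightarrow> (0 + of_real a) * (0 + of_real b) * (0 + of_real c)"
    by (intro tendsto_intros assms)
  thus l: "(\<lambda>n. Af (v n) * v n) \<longlonglongrightarrow> of_real kp" unfolding e by (simp add: kp_def)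
  have "filterlim (\<lambda>n. cmod (Af (v n) * v n) / cmod (v n)) at_top sequentially"
  proof (rule LIM_at_top_divide)
    show "(\<lambda>n. cmod (Af (v n) * v n)) \<longlonglongrightarrow> kp" using tendsto_norm[OF l] pos by simp
    show "(\<lambda>n. cmod (v n)) \<longlonglongrightarrow> 0" using tendsto_norm[OF assms(1)] by simp
  qed (use assms pos in auto)
  thus "filterlim (\<lambda>n. cmod (Af (v n))) at_top sequentially" using assms(2) by (simp add: norm_mult)
qed

end

lemma (in finite_borel_measure) Re_Gc_infinity_dir:
  assumes li: "log_int M" and w: "\<And>n. Im (w n) < 0" and lim: "filterlim (\<lambda>n. cmod (w n)) at_top sequentially"
    and dir: "(\<lambda>n. Im (w n) / cmod (w n)) \<longlonglongrightarrow> - d" and d: "d > 0"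
  shows "(\<lambda>n. Re (Gc M (w n)) - measure M UNIV * ln (cmod (w n))) \<longlonglongrightarrow> 0"
proof -
  have e1: "\<forall>\<^sub>F n in sequentially. Im (w n) / cmod (w n) < - d / 2" using order_tendstoD(2)[OF dir, of "- d / 2"] d by simp
  have e2: "\<forall>\<^sub>F n in sequentially. cmod (w n) \<ge> 1" using lim unfolding filterlim_at_top by blast
  obtain N where N: "\<And>n. n \<ge> N \<Longrightarrow> Im (w n) / cmod (w n) < - d / 2 \<and> cmod (w n) \<ge> 1"
    using eventually_conj[OF e1 e2] unfolding eventually_sequentially by blast
  have "(\<lambda>n. Re (Gc M (w (n + N))) - measure M UNIV * ln (cmod (w (n + N)))) \<longlonglongrightarrow> 0"
  proof (rule Re_Gc_infinity[OF li w])
    show "filterlim (\<lambda>n. cmod (w (n + N))) at_top sequentially"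
      using filterlim_compose[OF lim filterlim_add_const_nat_at_top[of N]] by simp
    show "d / 2 > 0" using d by simp
    fix n
    have "Im (w (n + N)) / cmod (w (n + N)) < - d / 2" "cmod (w (n + N)) \<ge> 1" using N[of "n + N"] by auto
    moreover from this have "Im (w (n + N)) < - d / 2 * cmod (w (n + N))" by (subst (asm) pos_divide_less_eq) auto
    ultimately show "d / 2 * cmod (w (n + N)) \<le> - Im (w (n + N))" "cmod (w (n + N)) \<ge> 1" by auto
  qed
  thus ?thesis by (rule LIMSEQ_offset)
qed

context three_shifts
begin

text \<open>Once \<open>h\<close> is constant on the ray from \<open>v\<close> towards 0, its value
  is read off in the limit: there \<open>Af u * u\<close> tends to \<open>kp\<close> and the
  potential behaves like \<open>ln (cmod (Af u))\<close>, the mass being 1.\<close>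

lemma potential_Om1:
  assumes R: "\<And>x. \<exists>u1 u2 u3. roots x u1 u2 u3" and v: "v \<in> Om1"
  shows "Re (Gc m1 (Af v)) = ln kp - ln (cmod v)"
proof -
  interpret M: finite_borel_measure m1 by (rule finite_m1)
  note li = log_int_m1
  define h where "h v = of_real (ln kp) - Ln v - Gc m1 (Af v)" for v
  have "(\<lambda>v. Gc m1 (Af v)) holomorphic_on Om1"
    using Om1_D by (intro Gc_Af_holomorphic finite_m1 li open_Om) auto
  moreover have "Ln holomorphic_on Om1"
    by (rule holomorphic_on_Ln) (auto simp: Om1_def complex_nonpos_Reals_iff)
  ultimately have hol: "h holomorphic_on Om1" unfolding h_def[abs_def] by (intro holomorphic_on_diff holomorphic_on_const)
  have Imh: "Im (h v) = - Im (Ln v) - Im (Gc m1 (Af v))" for v by (simp add: h_def)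
  have Im0: "Im (h v) = 0" if "v \<in> Om1" for v
  proof (rule Im_zero_of_boundary[OF open_Om(1) hol _ _ that])
    fix v :: "nat \<Rightarrow> complex" assume v: "\<And>n. v n \<in> Om1"
    note D = Om1_D[OF v]
    have v0: "v n \<noteq> 0" for n using D(1)[of n] by auto
    have cube: "cmod (v n) ^ 3 \<le> kp" for n using R[of "Af (v n)"] Om1_root(2)[OF v] by blast
    { fix p assume lim: "v \<longlonglongrightarrow> p" and p: "p \<notin> Om1"
      have cp: "cmod p ^ 3 \<le> kp"
        by (rule LIMSEQ_le_const2[OF tendsto_power[OF tendsto_norm[OF lim]]]) (use cube in auto)
      show "(\<lambda>n. Im (h (v n))) \<longlonglongrightarrow> 0"
      proof (cases "p = 0")
        case True
        \<comment> \<open>At 0 the logarithms of \<open>Af v\<close> and \<open>v\<close> are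
          singular, but their imaginary parts combine to those of \<open>v + a\<close>,
          \<open>v + b\<close>, \<open>v + c\<close>, which tend to 0.\<close>
        have l0: "v \<longlonglongrightarrow> 0" using lim True by simp
        have A: "(\<lambda>n. Im (Gc m1 (Af (v n))) - measure m1 UNIV * Im (Ln (Af (v n)))) \<longlonglongrightarrow> 0"
          by (rule M.Im_Gc_infinity[OF li D(2) Af_at_0(1)[OF l0 v0]])
        have "(\<lambda>n. Im (Ln (v n + of_real a)) + Im (Ln (v n + of_real b)) + Im (Ln (v n + of_real c))) \<longlonglongrightarrow>
          Im (Ln (0 + of_real a)) + Im (Ln (0 + of_real b)) + Im (Ln (0 + of_real c))"
          using pos by (intro tendsto_intros l0) (auto simp: complex_nonpos_Reals_iff)
        hence B: "(\<lambda>n. Im (Ln (v n + of_real a)) + Im (Ln (v n + of_real b)) + Im (Ln (v n + of_real c))) \<longlonglongrightarrow> 0"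
          using pos by (simp add: Ln_of_real)
        have "Im (h (v n)) = - (Im (Gc m1 (Af (v n))) - measure m1 UNIV * Im (Ln (Af (v n))))
           - (Im (Ln (v n + of_real a)) + Im (Ln (v n + of_real b)) + Im (Ln (v n + of_real c)))" for n
          unfolding Imh D(3) measure_m12 by (simp add: Lf_def)
        moreover have "(\<lambda>n. - (Im (Gc m1 (Af (v n))) - measure m1 UNIV * Im (Ln (Af (v n))))
           - (Im (Ln (v n + of_real a)) + Im (Ln (v n + of_real b)) + Im (Ln (v n + of_real c)))) \<longlonglongrightarrow> - 0 - 0"
          by (intro tendsto_intros A B)
        ultimately show ?thesis by simp
      next
        case p0: False
        define x where "x = Re (Af p)"
        have Ap: "Af p = of_real x" "Im p \<ge> 0" using Af_real_limit[OF _ lim p0] v p by (auto simp: x_def)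
        obtain u1 u2 u3 where "roots (of_real x) u1 u2 u3" using R by blast
        note ang = boundary_angle(1)[OF this p0 Ap(2,1) cp]
        have "(\<lambda>n. Im (Gc m1 (Af (v n)))) \<longlonglongrightarrow> - pi * measure m1 {x<..}"
          using Af_tendsto[OF lim p0] Ap(1) AE_m12_neq(1) by (intro M.Im_Gc_boundary[OF li D(2)]) auto
        hence "(\<lambda>n. Im (h (v n))) \<longlonglongrightarrow> - Im (Ln p) - - pi * measure m1 {x<..}"
          unfolding Imh by (intro tendsto_intros Im_Ln_tendsto_upper(1)[OF D(1) lim p0])
        moreover have "- Im (Ln p) - - pi * measure m1 {x<..} = 0"
          unfolding ang measure_m1_greaterThan by simp
        ultimately show ?thesis by simp
      qed }
    { assume "filterlim (\<lambda>n. cmod (v n)) at_top sequentially"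
      hence "\<forall>\<^sub>F n in sequentially. cmod (v n) > 1 + kp" unfolding filterlim_at_top_dense by blast
      then obtain n where n: "cmod (v n) > 1 + kp" unfolding eventually_sequentially by blast
      have "cmod (v n) ^ 1 \<le> cmod (v n) ^ 3" using n pos by (intro power_increasing) auto
      \<comment> \<open>The region is bounded by the cube inequality, so the case of infinity is
        vacuous.\<close>
      hence False using n cube[of n] pos by simp
      thus "(\<lambda>n. Im (h (v n))) \<longlonglongrightarrow> 0" .. }
  qed
  define t where "t n = 1 / real (Suc n)" for n
  have t: "0 < t n" "t n \<le> 1" for n by (auto simp: t_def)
  have t0: "t \<longlonglongrightarrow> 0" unfolding t_def using LIMSEQ_inverse_real_of_nat by (simp add: inverse_eq_divide)
  have ray: "of_real s * v \<in> Om1" if "0 < s" "s \<le> 1" for s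
  proof (cases "s = 1")
    case False
    thus ?thesis using Im_Lf_scale[of v s] v that by (auto simp: Om1_def)
  qed (use v in simp)
  have Imv: "Im v > 0" using v by (simp add: Om1_def)
  hence v0: "v \<noteq> 0" by auto
  have hc: "h (of_real (t n) * v) = h v" for n
  proof -
    have "h (of_real (t n) * v) = h (of_real 1 * v)"
    proof (rule constant_on_ray[OF open_Om(1) hol Im0 _ t(2)])
      fix s assume "t n \<le> s" "s \<le> 1"
      thus "of_real s * v \<in> Om1" using t(1)[of n] by (intro ray) auto
    qed
    thus ?thesis by simp
  qed
  let ?u = "\<lambda>n. of_real (t n) * v"
  have u: "?u n \<in> Om1" "?u n \<noteq> 0" for n using ray[OF t] t(1)[of n] v0 by auto
  have ul: "?u \<longlonglongrightarrow> 0" using tendsto_mult[OF tendsto_of_real[OF t0] tendsto_const[of v]] by simp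
  note A0 = Af_at_0[OF ul u(2)]
  \<comment> \<open>Along the ray \<open>Af\<close> has asymptotically the direction of
    \<open>1 / v\<close>, so it stays in a sector of the lower half-plane, as the real part
    requires.\<close>
  have dir: "(\<lambda>n. Im (Af (?u n)) / cmod (Af (?u n))) \<longlonglongrightarrow> - (Im v / cmod v)"
  proof -
    have "(\<lambda>n. Im ((Af (?u n) * ?u n) / v) / (cmod (Af (?u n) * ?u n) / cmod v)) \<longlonglongrightarrow> Im (of_real kp / v) / (cmod (of_real kp) / cmod v)"
      using v0 pos by (intro tendsto_intros A0(2)) auto
    moreover have "Im ((Af (?u n) * ?u n) / v) / (cmod (Af (?u n) * ?u n) / cmod v) = Im (Af (?u n)) / cmod (Af (?u n))" for n
    proof -
      have "(Af (?u n) * ?u n) / v = of_real (t n) * Af (?u n)" using v0 by simp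
      thus ?thesis using v0 t(1)[of n] by (simp add: norm_mult)
    qed
    moreover have "Im (of_real kp / v) / (cmod (of_real kp) / cmod v) = - (Im v / cmod v)"
    proof -
      have "Im (of_real kp / v) = - (kp * Im v) / (cmod v)\<^sup>2" by (simp add: Im_divide cmod_power2)
      thus ?thesis using v0 pos by (simp add: power2_eq_square)
    qed
    ultimately show ?thesis by (simp only:)
  qed
  have A: "(\<lambda>n. Re (Gc m1 (Af (?u n))) - measure m1 UNIV * ln (cmod (Af (?u n)))) \<longlonglongrightarrow> 0"
    using Imv v0 by (intro M.Re_Gc_infinity_dir[OF li Om1_D(2)[OF u(1)] A0(1) dir]) auto
  have B: "(\<lambda>n. ln kp - ln (cmod (Af (?u n) * ?u n))) \<longlonglongrightarrow> ln kp - ln (cmod (of_real kp))"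
    using pos by (intro tendsto_intros A0(2)) auto
  have "Re (h v) = (ln kp - ln (cmod (Af (?u n) * ?u n))) - (Re (Gc m1 (Af (?u n))) - measure m1 UNIV * ln (cmod (Af (?u n))))" for n
  proof -
    have nz: "Af (?u n) \<noteq> 0" using Om1_D(2)[OF u(1)[of n]] by auto
    have "Re (h (?u n)) = ln kp - ln (cmod (?u n)) - Re (Gc m1 (Af (?u n)))"
      unfolding h_def using u(2)[of n] by simp
    hence "Re (h v) = ln kp - ln (cmod (?u n)) - Re (Gc m1 (Af (?u n)))" by (simp only: hc)
    moreover have "ln (cmod (Af (?u n) * ?u n)) = ln (cmod (Af (?u n))) + ln (cmod (?u n))"
      unfolding norm_mult[of "Af (?u n)"] using nz u(2)[of n] by (intro ln_mult_pos) auto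
    ultimately show ?thesis by (simp add: measure_m12)
  qed
  hence "(\<lambda>n::nat. Re (h v)) \<longlonglongrightarrow> (ln kp - ln (cmod (of_real kp))) - 0" using tendsto_diff[OF B A] by simp
  hence "Re (h v) = 0" using pos LIMSEQ_unique[OF tendsto_const] by fastforce
  thus ?thesis using v0 by (simp add: h_def)
qed

lemma Af_at_infinity:
  assumes "filterlim (\<lambda>n. cmod (v n)) at_top sequentially" "\<And>n. v n \<noteq> 0"
  shows "filterlim (\<lambda>n. cmod (Af (v n))) at_top sequentially" "(\<lambda>n. Af (v n) / (v n)\<^sup>2) \<longlonglongrightarrow> 1"
proof -
  interpret M: finite_borel_measure m2 by (rule finite_m2)
  have e: "((v n - of_real (- a)) / v n) * ((v n - of_real (- b)) / v n) * ((v n - of_real (- c)) / v n) = Af (v n) / (v n)\<^sup>2" for n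
    using assms(2)[of n] by (simp add: Af_def power2_eq_square)
  have "(\<lambda>n. ((v n - of_real (- a)) / v n) * ((v n - of_real (- b)) / v n) * ((v n - of_real (- c)) / v n)) \<longlonglongrightarrow> 1 * 1 * 1"
    by (intro tendsto_mult M.ratio_tendsto_1 assms)
  thus l: "(\<lambda>n. Af (v n) / (v n)\<^sup>2) \<longlonglongrightarrow> 1" unfolding e by simp
  have "filterlim (\<lambda>n. cmod (Af (v n) / (v n)\<^sup>2) * (cmod (v n))\<^sup>2) at_top sequentially"
    using tendsto_norm[OF l] by (intro filterlim_tendsto_pos_mult_at_top[where c = 1] filterlim_pow_at_top assms) auto
  thus "filterlim (\<lambda>n. cmod (Af (v n))) at_top sequentially" using assms(2) by (simp add: norm_divide norm_power)
qed

lemma Im_Ln_shift_infinity: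
  assumes v: "\<And>n. Im (v n) > 0" and inf: "filterlim (\<lambda>n. cmod (v n)) at_top sequentially" and t: "t > 0"
  shows "(\<lambda>n. Im (Ln (v n)) - Im (Ln (v n + of_real t))) \<longlonglongrightarrow> 0"
proof -
  interpret M: finite_borel_measure m2 by (rule finite_m2)
  have "Ln ((v n - of_real (- t)) / v n) = Ln (v n + of_real t) - Ln (v n)" for n
  proof -
    have "Im (v n + of_real t) > 0" "v n \<noteq> 0" "v n + of_real t \<noteq> 0" using v[of n] by (auto simp: complex_eq_iff)
    hence "Ln (exp (Ln (v n + of_real t) - Ln (v n))) = Ln (v n + of_real t) - Ln (v n)"
      using Im_Ln_strip[OF v[of n]] Im_Ln_strip[of "v n + of_real t"] by (intro Ln_exp) auto
    thus ?thesis using \<open>v n \<noteq> 0\<close> \<open>v n + of_real t \<noteq> 0\<close> by (simp add: exp_diff)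
  qed
  moreover have "(\<lambda>n. - Im (Ln ((v n - of_real (- t)) / v n))) \<longlonglongrightarrow> - Im (Ln 1)"
    by (intro tendsto_intros M.ratio_tendsto_1 inf) (auto simp: complex_nonpos_Reals_iff)
  ultimately show ?thesis by simp
qed

lemma potential_Om3:
  assumes R: "\<And>x. \<exists>u1 u2 u3. roots x u1 u2 u3" and v: "v \<in> Om3"
  shows "Re (Gc m2 (Af v)) = ln (cmod v)"
proof -
  interpret M: finite_borel_measure m2 by (rule finite_m2)
  note li = log_int_m2
  \<comment> \<open>The shift by pi is half the \<open>2 * pi\<close> between \<open>Lf v\<close>
    and \<open>Ln (Af v)\<close>, the mass being 1/2; since \<open>Af v\<close> grows like the
    square of \<open>v\<close>, mass 1/2 also matches a single \<open>Ln v\<close>.\<close>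
  define h where "h v = Ln v - of_real pi * \<i> - Gc m2 (Af v)" for v
  have "(\<lambda>v. Gc m2 (Af v)) holomorphic_on Om3"
    using Om3_D by (intro Gc_Af_holomorphic finite_m2 li open_Om) auto
  moreover have "Ln holomorphic_on Om3"
    by (rule holomorphic_on_Ln) (auto simp: Om3_def complex_nonpos_Reals_iff)
  ultimately have hol: "h holomorphic_on Om3" unfolding h_def[abs_def] by (intro holomorphic_on_diff holomorphic_on_const)
  have Imh: "Im (h v) = Im (Ln v) - pi - Im (Gc m2 (Af v))" for v by (simp add: h_def)
  have Im0: "Im (h v) = 0" if "v \<in> Om3" for v
  proof (rule Im_zero_of_boundary[OF open_Om(2) hol _ _ that])
    fix v :: "nat \<Rightarrow> complex" assume v: "\<And>n. v n \<in> Om3"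
    note D = Om3_D[OF v]
    have v0: "v n \<noteq> 0" for n using D(1)[of n] by auto
    have cube: "cmod (v n) ^ 3 \<ge> kp" for n using R[of "Af (v n)"] Om3_root(2)[OF v] by blast
    { fix p assume lim: "v \<longlonglongrightarrow> p" and p: "p \<notin> Om3"
      have cp: "cmod p ^ 3 \<ge> kp"
        by (rule LIMSEQ_le_const[OF tendsto_power[OF tendsto_norm[OF lim]]]) (use cube in auto)
      hence p0: "p \<noteq> 0" using pos by auto
      have Rep: "Re p \<le> 0" by (rule LIMSEQ_le_const2[OF tendsto_Re[OF lim]]) (use D(2) in \<open>auto intro: less_imp_le\<close>)
      define x where "x = Re (Af p)"
      have Ap: "Af p = of_real x" "Im p \<ge> 0" using Af_real_limit[OF _ lim p0] v p by (auto simp: x_def)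
      obtain u1 u2 u3 where "roots (of_real x) u1 u2 u3" using R by blast
      note ang = boundary_angle(2)[OF this p0 Ap(2,1) cp Rep]
      have "(\<lambda>n. Im (Gc m2 (Af (v n)))) \<longlonglongrightarrow> - pi * measure m2 {x<..}"
        using Af_tendsto[OF lim p0] Ap(1) AE_m12_neq(2) by (intro M.Im_Gc_boundary[OF li D(3)]) auto
      hence "(\<lambda>n. Im (h (v n))) \<longlonglongrightarrow> Im (Ln p) - pi - - pi * measure m2 {x<..}"
        unfolding Imh by (intro tendsto_intros Im_Ln_tendsto_upper(1)[OF D(1) lim p0])
      moreover have "Im (Ln p) - pi - - pi * measure m2 {x<..} = 0"
        unfolding ang measure_m2_greaterThan by simp
      ultimately show "(\<lambda>n. Im (h (v n))) \<longlonglongrightarrow> 0" by simp }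
    { assume inf: "filterlim (\<lambda>n. cmod (v n)) at_top sequentially"
      have A: "(\<lambda>n. Im (Gc m2 (Af (v n))) - measure m2 UNIV * Im (Ln (Af (v n)))) \<longlonglongrightarrow> 0"
        by (rule M.Im_Gc_infinity[OF li D(3) Af_at_infinity(1)[OF inf v0]])
      let ?s = "\<lambda>t n. Im (Ln (v n)) - Im (Ln (v n + of_real t))"
      have B: "(\<lambda>n. (?s a n + ?s b n + ?s c n) / 2) \<longlonglongrightarrow> (0 + 0 + 0) / 2"
        by (intro tendsto_intros Im_Ln_shift_infinity[OF D(1) inf] pos) auto
      have "Im (h (v n)) = (?s a n + ?s b n + ?s c n) / 2 - (Im (Gc m2 (Af (v n))) - measure m2 UNIV * Im (Ln (Af (v n))))" for n
        unfolding Imh D(4) measure_m12 by (simp add: Lf_def field_simps)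
      thus "(\<lambda>n. Im (h (v n))) \<longlonglongrightarrow> 0" using tendsto_diff[OF B A] by simp }
  qed
  define t where "t n = real (Suc n)" for n
  have t: "1 \<le> t n" for n by (auto simp: t_def)
  have ti: "filterlim t at_top sequentially" unfolding t_def
    using filterlim_compose[OF filterlim_real_sequentially filterlim_Suc] by simp
  have Imv: "Im v > 0" "Re v < 0" using Om3_D[OF v] by auto
  hence v0: "v \<noteq> 0" by auto
  have ray: "of_real s * v \<in> Om3" if "1 \<le> s" for s
  proof (cases "s = 1")
    case False
    have "Im (of_real s * v) > 0" using Imv that by simp
    from Im_Lf_scale[OF this, of "1 / s"] show ?thesis using v that False by (auto simp: Om3_def)
  qed (use v in simp)
  have hc: "h (of_real (t n) * v) = h v" for n
  proof -
    have "h (of_real 1 * v) = h (of_real (t n) * v)"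
      by (rule constant_on_ray[OF open_Om(2) hol Im0 _ t]) (auto intro: ray)
    thus ?thesis by simp
  qed
  let ?u = "\<lambda>n. of_real (t n) * v"
  have u: "?u n \<in> Om3" "?u n \<noteq> 0" for n using ray[OF t] t[of n] v0 by auto
  have ul: "filterlim (\<lambda>n. cmod (?u n)) at_top sequentially"
  proof -
    have "filterlim (\<lambda>n. cmod v * t n) at_top sequentially"
      using v0 by (intro filterlim_tendsto_pos_mult_at_top[OF tendsto_const _ ti]) auto
    moreover have "cmod (?u n) = cmod v * t n" for n using t[of n] by (simp add: norm_mult mult.commute)
    ultimately show ?thesis by simp
  qed
  note A0 = Af_at_infinity[OF ul u(2)]
  \<comment> \<open>\<open>Af\<close> has asymptotically the direction of the square of
    \<open>v\<close>, which lies in the lower half-plane since \<open>v\<close> is in the open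
    second quadrant.\<close>
  define d where "d = - Im (v\<^sup>2) / (cmod v)\<^sup>2"
  have "Im (v\<^sup>2) < 0" using Imv by (simp add: power2_eq_square mult_neg_pos mult_pos_neg)
  hence dpos: "d > 0" using v0 unfolding d_def by (intro divide_pos_pos) auto
  have dir: "(\<lambda>n. Im (Af (?u n)) / cmod (Af (?u n))) \<longlonglongrightarrow> - d"
  proof -
    have "(\<lambda>n. Im ((Af (?u n) / (?u n)\<^sup>2) * v\<^sup>2) / (cmod (Af (?u n) / (?u n)\<^sup>2) * (cmod v)\<^sup>2)) \<longlonglongrightarrow> Im (1 * v\<^sup>2) / (cmod 1 * (cmod v)\<^sup>2)"
      using v0 by (intro tendsto_intros A0(2)) auto
    moreover have "Im ((Af (?u n) / (?u n)\<^sup>2) * v\<^sup>2) / (cmod (Af (?u n) / (?u n)\<^sup>2) * (cmod v)\<^sup>2) = Im (Af (?u n)) / cmod (Af (?u n))" for n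
    proof -
      have tn: "t n > 0" using t[of n] by simp
      have "(Af (?u n) / (?u n)\<^sup>2) * v\<^sup>2 = Af (?u n) / of_real ((t n)\<^sup>2)" using v0 by (simp add: power_mult_distrib)
      moreover have "cmod (Af (?u n) / (?u n)\<^sup>2) * (cmod v)\<^sup>2 = cmod (Af (?u n)) / (t n)\<^sup>2"
        using v0 tn by (simp add: norm_divide norm_power norm_mult power_mult_distrib)
      ultimately show ?thesis using tn by (simp only: Im_divide_of_real) simp
    qed
    moreover have "Im (1 * v\<^sup>2) / (cmod 1 * (cmod v)\<^sup>2) = - d" by (simp add: d_def)
    ultimately show ?thesis by (simp only:)
  qed
  have A: "(\<lambda>n. Re (Gc m2 (Af (?u n))) - measure m2 UNIV * ln (cmod (Af (?u n)))) \<longlonglongrightarrow> 0"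
    by (rule M.Re_Gc_infinity_dir[OF li Om3_D(3)[OF u(1)] A0(1) dir dpos])
  have B: "(\<lambda>n. - (ln (cmod (Af (?u n) / (?u n)\<^sup>2)) / 2)) \<longlonglongrightarrow> - (ln (cmod 1) / 2)"
    by (intro tendsto_intros A0(2)) auto
  have "Re (h v) = - (ln (cmod (Af (?u n) / (?u n)\<^sup>2)) / 2) - (Re (Gc m2 (Af (?u n))) - measure m2 UNIV * ln (cmod (Af (?u n))))" for n
  proof -
    have nz: "Af (?u n) \<noteq> 0" using Om3_D(3)[OF u(1)[of n]] by auto
    have "Re (h (?u n)) = ln (cmod (?u n)) - Re (Gc m2 (Af (?u n)))"
      unfolding h_def using u(2)[of n] by simp
    hence "Re (h v) = ln (cmod (?u n)) - Re (Gc m2 (Af (?u n)))" by (simp only: hc)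
    moreover have "ln (cmod (Af (?u n) / (?u n)\<^sup>2)) = ln (cmod (Af (?u n))) - 2 * ln (cmod (?u n))"
    proof -
      have "ln (cmod (Af (?u n)) / (cmod (?u n))\<^sup>2) = ln (cmod (Af (?u n))) - ln ((cmod (?u n))\<^sup>2)"
        using nz u(2)[of n] by (intro ln_divide_pos) auto
      also have "ln ((cmod (?u n))\<^sup>2) = 2 * ln (cmod (?u n))" using u(2)[of n] by (subst ln_realpow) auto
      finally show ?thesis by (simp only: norm_divide norm_power)
    qed
    ultimately show ?thesis unfolding measure_m12 by linarith
  qed
  hence "(\<lambda>n::nat. Re (h v)) \<longlonglongrightarrow> - (ln (cmod 1) / 2) - 0" using tendsto_diff[OF B A] by simp
  hence "(\<lambda>n::nat. Re (h v)) \<longlonglongrightarrow> 0" by simp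
  hence "Re (h v) = 0" by (rule LIMSEQ_unique[OF tendsto_const])
  thus ?thesis using v0 by (simp add: h_def)
qed

text \<open>The formulas at the roots for \<open>x - \<i> / n\<close> pass to the real point: the
  potential by monotone convergence, the right sides because moduli of ordered roots are
  continuous.\<close>

lemma log_potential_m12:
  assumes R: "\<And>x. \<exists>u1 u2 u3. roots x u1 u2 u3" and r: "roots (of_real x) u1 u2 u3"
  shows "log_potential m1 x = ereal (ln kp - ln (cmod u1))" "log_potential m2 x = ereal (ln (cmod u3))"
proof -
  interpret M1: finite_borel_measure m1 by (rule finite_m1)
  interpret M2: finite_borel_measure m2 by (rule finite_m2)
  define w where "w n = of_real x - \<i> * of_real (1 / real (Suc n))" for n
  have Imw: "Im (w n) < 0" for n by (simp add: w_def)
  have "\<forall>n. \<exists>u1 u2 u3. roots (w n) u1 u2 u3" using R by blast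
  then obtain w1 w2 w3 where W: "\<And>n. roots (w n) (w1 n) (w2 n) (w3 n)" by metis
  note nzW = roots_nonzero[OF W]
  have wl: "w \<longlonglongrightarrow> of_real x"
  proof -
    have "(\<lambda>n. 1 / real (Suc n)) \<longlonglongrightarrow> 0" using LIMSEQ_inverse_real_of_nat by (simp add: inverse_eq_divide)
    hence "w \<longlonglongrightarrow> of_real x - \<i> * of_real 0" unfolding w_def by (intro tendsto_intros)
    thus ?thesis by simp
  qed
  have lim: "(\<lambda>n. cmod (w1 n)) \<longlonglongrightarrow> cmod u1" "(\<lambda>n. cmod (w3 n)) \<longlonglongrightarrow> cmod u3"
    using cubic_roots_tendsto(1)[OF tendsto_const tendsto_diff[OF tendsto_const wl] tendsto_const W[unfolded roots_def] r[unfolded roots_def]]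
      cubic_roots_tendsto(3)[OF tendsto_const tendsto_diff[OF tendsto_const wl] tendsto_const W[unfolded roots_def] r[unfolded roots_def]]
    by auto
  have nz: "u1 \<noteq> 0" "u3 \<noteq> 0" using roots_nonzero[OF r] by auto
  have L: "- pi < Im (Ln (w n))" "Im (Ln (w n)) < 0" for n
    using Im_Ln_lower[OF Imw] mpi_less_Im_Ln[of "w n"] Im_Ln_pos_le[of "w n"] Im_Ln_le_pi[of "w n"] Imw[of n] by force+
  have o1: "w1 n \<in> Om1" "Af (w1 n) = w n" for n
    using roots_lower(1,2)[OF W Imw, of n] L[of n] roots_Af_iff[OF W[of n]] nzW[of n] by (auto simp: Om1_def)
  have o3: "w3 n \<in> Om3" "Af (w3 n) = w n" for n
    using roots_lower(5,6)[OF W Imw, of n] L[of n] roots_Af_iff[OF W[of n]] nzW[of n] by (auto simp: Om3_def)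
  have "(\<lambda>n. ln kp - ln (cmod (w1 n))) \<longlonglongrightarrow> ln kp - ln (cmod u1)" using nz by (intro tendsto_intros lim) auto
  moreover have "Re (Gc m1 (w n)) = ln kp - ln (cmod (w1 n))" for n using potential_Om1[OF R o1(1)[of n]] o1(2) by simp
  ultimately have "(\<lambda>n. Re (Gc m1 (w n))) \<longlonglongrightarrow> ln kp - ln (cmod u1)" by simp
  thus "log_potential m1 x = ereal (ln kp - ln (cmod u1))"
    unfolding w_def by (rule M1.potential_of_vertical_limit[OF log_int_m1 AE_m12_neq(1)])
  have "(\<lambda>n. ln (cmod (w3 n))) \<longlonglongrightarrow> ln (cmod u3)" using nz by (intro tendsto_intros lim) auto
  moreover have "Re (Gc m2 (w n)) = ln (cmod (w3 n))" for n using potential_Om3[OF R o3(1)[of n]] o3(2) by simp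
  ultimately have "(\<lambda>n. Re (Gc m2 (w n))) \<longlonglongrightarrow> ln (cmod u3)" by simp
  thus "log_potential m2 x = ereal (ln (cmod u3))"
    unfolding w_def by (rule M2.potential_of_vertical_limit[OF log_int_m2 AE_m12_neq(2)])
qed

end

section \<open>Boundary values of the solutions\<close>

text \<open>Stated without measurability, since the integrand in \<open>mu\<close> is built from
  \<open>Lim\<close> and vector derivatives and is known only almost everywhere.\<close>

lemma density_cong_AE':
  assumes "AE x in M. f x = g x"
  shows "density M f = density M g"
  unfolding density_def
  by (intro arg_cong[where f = "measure_of (space M) (sets M)"] ext nn_integral_cong_AE)
    (use assms in eventually_elim, simp)

locale ordered_roots =
  fixes p q :: real and z :: "nat \<Rightarrow> complex \<Rightarrow> real \<Rightarrow> complex"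
  assumes p: "p > 0" and q: "q > 0" and z: "ordered_solutions p q z"
begin

definition kappa :: "real \<Rightarrow> real" where "kappa s = s * (s + p) * (s + p + q)"

definition vv :: "nat \<Rightarrow> complex \<Rightarrow> real \<Rightarrow> complex" where
  "vv j x s = of_real (kappa s) / z j x s"

lemma three_shifts: "s > 0 \<Longrightarrow> three_shifts s (s + p) (s + p + q)"
  using p q by unfold_locales auto

lemma kappa_pos: "s > 0 \<Longrightarrow> kappa s > 0"
  using p q by (simp add: kappa_def)

lemma z_nonzero: "s > 0 \<Longrightarrow> z 1 x s \<noteq> 0 \<and> z 2 x s \<noteq> 0 \<and> z 3 x s \<noteq> 0"
  using z unfolding ordered_solutions_def by (smt (verit) norm_le_zero_iff)

text \<open>With \<open>w = kappa s / v\<close> the equation \<open>A_symbol p q s w = x\<close> becomes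
  \<open>(v + s) (v + s + p) (v + s + p + q) = x v\<close>, and the order of the moduli is reversed.\<close>

lemma roots_vv:
  assumes s: "s > 0"
  shows "three_shifts.roots s (s + p) (s + p + q) x (vv 1 x s) (vv 2 x s) (vv 3 x s)"
proof -
  interpret T: three_shifts s "s + p" "s + p + q" by (rule three_shifts[OF s])
  let ?a = "s * (s + p)" and ?b = "s * (s + p + q)" and ?c = "(s + p) * (s + p + q)"
  let ?z1 = "z 1 x s" and ?z2 = "z 2 x s" and ?z3 = "z 3 x s"
  have id: "\<And>w. w \<noteq> 0 \<Longrightarrow> A_symbol p q s w - x = (w - ?z1) * (w - ?z2) * (w - ?z3) / w\<^sup>2"
    and ord: "cmod ?z1 \<ge> cmod ?z2" "cmod ?z2 \<ge> cmod ?z3" "cmod ?z3 > 0"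
    using z s unfolding ordered_solutions_def by blast+
  have nz: "?z1 \<noteq> 0" "?z2 \<noteq> 0" "?z3 \<noteq> 0" using z_nonzero[OF s] by auto
  have poly: "(w + of_real ?a) * (w + of_real ?b) * (w + of_real ?c) - x * w\<^sup>2 = (w - ?z1) * (w - ?z2) * (w - ?z3)" if "w \<noteq> 0" for w
    using id[OF that] that unfolding A_symbol_def by (simp add: field_simps)
  define A where "A = of_real ?a + of_real ?b + of_real ?c - x + (?z1 + ?z2 + ?z3)"
  define B where "B = of_real ?a * of_real ?b + of_real ?a * of_real ?c + of_real ?b * of_real ?c - (?z1 * ?z2 + ?z1 * ?z3 + ?z2 * ?z3)"
  define C where "C = of_real ?a * of_real ?b * of_real ?c + ?z1 * ?z2 * ?z3"
  have lin: "A * w\<^sup>2 + B * w + C = 0" if "w \<noteq> 0" for w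
    using poly[OF that] unfolding A_def B_def C_def by (simp add: algebra_simps power2_eq_square)
  \<comment> \<open>The factorization is given only for nonzero arguments, so the coefficients are
    extracted from the values at 1, -1 and 2.\<close>
  have l1: "A + B + C = 0" using lin[of 1] by simp
  have l2: "A - B + C = 0" using lin[of "-1"] by simp
  have l3: "A * 4 + B * 2 + C = 0" using lin[of 2] by simp
  have B0: "B = 0"
  proof -
    have "2 * B = (A + B + C) - (A - B + C)" by (simp add: algebra_simps)
    thus ?thesis using l1 l2 by simp
  qed
  have A0: "A = 0"
  proof -
    have "3 * A = (A * 4 + B * 2 + C) - (A + B + C) - B" by (simp add: algebra_simps)
    also have "\<dots> = 0" unfolding l1 l3 by (simp add: B0)
    finally show ?thesis by simp
  qed
  have C0: "C = 0" using l1 A0 B0 by simp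
  let ?k = "of_real (kappa s) :: complex"
  have k0: "?k \<noteq> 0" using kappa_pos[OF s] by simp
  have prod: "?z1 * ?z2 * ?z3 = - (?k * ?k)"
    using C0 unfolding C_def kappa_def by (simp add: eq_neg_iff_add_eq_0 algebra_simps)
  have pairs: "?z1 * ?z2 + ?z1 * ?z3 + ?z2 * ?z3 = ?k * of_real T.sg"
    using B0 unfolding B_def kappa_def T.sg_def by (simp add: algebra_simps)
  have sum: "?z1 + ?z2 + ?z3 = x - of_real (s * (s + p) + s * (s + p + q) + (s + p) * (s + p + q))"
    using A0 unfolding A_def by (simp add: algebra_simps eq_neg_iff_add_eq_0 add_eq_0_iff2)
  have kk: "T.kp = kappa s" by (simp add: T.kp_def kappa_def)
  show ?thesis
    unfolding T.roots_def cubic_roots_def vv_def kk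
  proof (intro conjI)
    have "?k / ?z1 + ?k / ?z2 + ?k / ?z3 = ?k * (?z1 * ?z2 + ?z1 * ?z3 + ?z2 * ?z3) / (?z1 * ?z2 * ?z3)"
      using nz by (simp add: field_simps)
    also have "\<dots> = - of_real T.sg" unfolding prod pairs using k0 by simp
    finally show "?k / ?z1 + ?k / ?z2 + ?k / ?z3 = - of_real T.sg" .
    have "?k / ?z1 * (?k / ?z2) + ?k / ?z1 * (?k / ?z3) + ?k / ?z2 * (?k / ?z3) = ?k * ?k * (?z1 + ?z2 + ?z3) / (?z1 * ?z2 * ?z3)"
      using nz by (simp add: field_simps)
    also have "\<dots> = of_real (s * (s + p) + s * (s + p + q) + (s + p) * (s + p + q)) - x"
      unfolding prod sum using k0 by simp
    finally show "?k / ?z1 * (?k / ?z2) + ?k / ?z1 * (?k / ?z3) + ?k / ?z2 * (?k / ?z3)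
       = of_real (s * (s + p) + s * (s + p + q) + (s + p) * (s + p + q)) - x" .
    have "?k / ?z1 * (?k / ?z2) * (?k / ?z3) = ?k * ?k * ?k / (?z1 * ?z2 * ?z3)" using nz by simp
    also have "\<dots> = - ?k" unfolding prod using k0 by simp
    finally show "?k / ?z1 * (?k / ?z2) * (?k / ?z3) = - ?k" .
    show "cmod (?k / ?z1) \<le> cmod (?k / ?z2)" "cmod (?k / ?z2) \<le> cmod (?k / ?z3)"
      using ord nz kappa_pos[OF s] by (auto simp: norm_divide intro!: divide_left_mono mult_pos_pos)
  qed
qed

lemma vv_nonzero: "s > 0 \<Longrightarrow> vv 1 x s \<noteq> 0 \<and> vv 2 x s \<noteq> 0 \<and> vv 3 x s \<noteq> 0"
  using z_nonzero[of s x] kappa_pos[of s] by (simp add: vv_def)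

lemma z_eq: "s > 0 \<Longrightarrow> j \<in> {1, 2, 3} \<Longrightarrow> z j x s = of_real (kappa s) / vv j x s"
  using z_nonzero[of s x] kappa_pos[of s] by (auto simp: vv_def)

text \<open>Continuity jointly in \<open>x\<close> and \<open>s\<close>, from which measurability in
  both variables will follow; it concerns moduli because single roots may jump at ties.\<close>

lemma cmod_vv_tendsto:
  assumes s: "\<And>n. S n > 0" "s > 0" and lim: "X \<longlonglongrightarrow> x" "S \<longlonglongrightarrow> s" and j: "j \<in> {1, 2, 3}"
  shows "(\<lambda>n. cmod (vv j (X n) (S n))) \<longlonglongrightarrow> cmod (vv j x s)"
proof -
  have R: "cubic_roots (- of_real (s + (s + p) + (s + p + q))) (of_real (s * (s + p) + s * (s + p + q) + (s + p) * (s + p + q)) - x)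
     (- of_real (s * (s + p) * (s + p + q))) (vv 1 x s) (vv 2 x s) (vv 3 x s)" if "s > 0" for x s
  proof -
    interpret T: three_shifts s "s + p" "s + p + q" by (rule three_shifts[OF that])
    show ?thesis using roots_vv[OF that, of x] unfolding T.roots_def T.sg_def T.kp_def .
  qed
  have e1: "(\<lambda>n. - complex_of_real (S n + (S n + p) + (S n + p + q))) \<longlonglongrightarrow> - of_real (s + (s + p) + (s + p + q))"
    by (intro tendsto_intros lim)
  have e2: "(\<lambda>n. of_real (S n * (S n + p) + S n * (S n + p + q) + (S n + p) * (S n + p + q)) - X n)
     \<longlonglongrightarrow> of_real (s * (s + p) + s * (s + p + q) + (s + p) * (s + p + q)) - x"
    by (intro tendsto_intros lim)
  have e3: "(\<lambda>n. - complex_of_real (S n * (S n + p) * (S n + p + q))) \<longlonglongrightarrow> - of_real (s * (s + p) * (s + p + q))"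
    by (intro tendsto_intros lim)
  show ?thesis using cubic_roots_tendsto[OF e1 e2 e3 R[OF s(1)] R[OF s(2)]] j by auto
qed

lemma cmod_vv_tendsto_within:
  assumes s: "s > 0" and j: "j \<in> {1, 2, 3}"
  shows "((\<lambda>w. cmod (vv j w s)) \<longlongrightarrow> cmod (vv j x s)) (at x within S)"
proof (subst tendsto_at_iff_sequentially, intro allI impI)
  fix X assume "\<forall>i. X i \<in> S - {x}" "X \<longlonglongrightarrow> x"
  thus "((\<lambda>w. cmod (vv j w s)) \<circ> X) \<longlonglongrightarrow> cmod (vv j x s)"
    unfolding o_def by (intro cmod_vv_tendsto s tendsto_const j)
qed

end

section \<open>Limits of a root at a point of the support\<close>

context three_shifts
begin

text \<open>A root \<open>u\<close> at \<open>w\<close> satisfies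
  \<open>(u - v) * (u - v') * (u + m) = (w - x) * u\<close>. Staying away from \<open>v\<close> by
  position and from \<open>- m\<close> by modulus, it must approach \<open>v'\<close>.\<close>

lemma root_tendsto:
  assumes fac: "\<And>X. (X + of_real a) * (X + of_real b) * (X + of_real c) - x * X = (X - v) * (X - v') * (X + of_real m)"
    and m: "m > 0"
    and u: "\<forall>\<^sub>F w in F. (u w + of_real a) * (u w + of_real b) * (u w + of_real c) = w * u w"
    and d: "d > 0" "\<forall>\<^sub>F w in F. d \<le> cmod (u w - v)"
    and lim: "((\<lambda>w. cmod (u w)) \<longlongrightarrow> r) F" "r \<noteq> m" and F: "((\<lambda>w. w) \<longlongrightarrow> x) F"
  shows "(u \<longlongrightarrow> v') F"
proof -
  define e where "e = \<bar>r - m\<bar> / 2"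
  have e: "e > 0" using lim(2) by (simp add: e_def)
  have ev: "\<forall>\<^sub>F w in F. \<bar>cmod (u w) - r\<bar> < e"
    using tendstoD[OF lim(1) e] by (simp add: dist_real_def)
  have "((\<lambda>w. u w - v') \<longlongrightarrow> 0) F"
  proof (rule Lim_null_comparison)
    show "\<forall>\<^sub>F w in F. norm (u w - v') \<le> cmod (w - x) * cmod (u w) / (d * e)"
      using u d(2) ev
    proof eventually_elim
      case (elim w)
      have "e \<le> \<bar>cmod (u w) - m\<bar>" using elim(3) unfolding e_def by (simp add: abs_if split: if_splits)
      also have "\<dots> \<le> cmod (u w + of_real m)"
        using norm_triangle_ineq3[of "u w" "- of_real m"] m by simp
      finally have 1: "e \<le> cmod (u w + of_real m)" .
      have "(u w - v) * (u w - v') * (u w + of_real m) = (w - x) * u w"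
        unfolding fac[symmetric] elim(1) by (simp add: algebra_simps)
      hence "cmod (u w - v) * cmod (u w - v') * cmod (u w + of_real m) = cmod (w - x) * cmod (u w)"
        by (metis norm_mult)
      moreover have "(d * e) * cmod (u w - v') \<le> cmod (u w - v) * cmod (u w + of_real m) * cmod (u w - v')"
        using elim(2) 1 d e by (intro mult_right_mono mult_mono) auto
      ultimately have "(d * e) * cmod (u w - v') \<le> cmod (w - x) * cmod (u w)" by (simp add: mult_ac)
      thus ?case using d e by (simp add: field_simps)
    qed
    have "((\<lambda>w. cmod (w - x) * cmod (u w) / (d * e)) \<longlongrightarrow> cmod (x - x) * r / (d * e)) F"
      using d e by (intro tendsto_intros lim F) auto
    thus "((\<lambda>w. cmod (w - x) * cmod (u w) / (d * e)) \<longlongrightarrow> 0) F" by simp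
  qed
  thus ?thesis by (simp add: LIM_zero_iff)
qed

definition vup :: "real \<Rightarrow> complex" where "vup x = of_real (sqrt (kp / mp x)) * cis (Th x)"

lemma interior_roots:
  assumes R: "roots (of_real x) u1 u2 u3" and x: "x \<noteq> 0" and C: "\<bar>CC (mp x)\<bar> < 1"
  shows "\<And>X. (X + of_real a) * (X + of_real b) * (X + of_real c) - of_real x * X = (X - vup x) * (X - cnj (vup x)) * (X + of_real (mp x))"
    and "Im (vup x) > 0" "cmod (vup x) = sqrt (kp / mp x)"
    and "x > 0 \<Longrightarrow> cmod u1 = sqrt (kp / mp x) \<and> cmod u2 = sqrt (kp / mp x) \<and> sqrt (kp / mp x) < mp x"
    and "x < 0 \<Longrightarrow> cmod u2 = sqrt (kp / mp x) \<and> cmod u3 = sqrt (kp / mp x) \<and> mp x < sqrt (kp / mp x)"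
proof -
  have m: "mp x > 0" by (rule mp_nz_pos[OF x])
  have P: "kp / mp x > 0" using pos m by simp
  obtain y y' where yy: "y + y' = of_real (mp x - sg)" "y * y' = of_real (kp / mp x)"
    "x > 0 \<longrightarrow> u3 = of_real (- mp x) \<and> u1 = y \<and> u2 = y' \<and> cmod u2 < mp x"
    "x < 0 \<longrightarrow> u1 = of_real (- mp x) \<and> u2 = y \<and> u3 = y' \<and> mp x < cmod u2"
    using root_pair_ex[OF R x] by blast
  have disc: "(mp x - sg)\<^sup>2 < 4 * (kp / mp x)" using CC_abs_less[OF m] C by simp
  note rp = real_pair(1)[OF yy(1,2) P disc]
  have cy: "cmod y = sqrt (kp / mp x)" "cmod y' = sqrt (kp / mp x)"
    using rp by (auto simp: real_sqrt_unique)
  show cv: "cmod (vup x) = sqrt (kp / mp x)" using P by (simp add: vup_def norm_mult)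
  have cl: "clamp (CC (mp x)) = CC (mp x)" using C by (auto simp: clamp_def)
  have cosT: "cos (Th x) = CC (mp x)" unfolding Th_def cl using C by (intro cos_arccos) auto
  have T: "0 < Th x" "Th x < pi" unfolding Th_def cl using arccos_lt_bounded[of "CC (mp x)"] C by auto
  show Iv: "Im (vup x) > 0" using P T sin_gt_zero by (simp add: vup_def)
  have Rv: "Re (vup x) = (mp x - sg) / 2"
  proof -
    have "sqrt (kp / mp x) > 0" by (rule real_sqrt_gt_zero[OF P])
    hence "sqrt (kp / mp x) \<noteq> 0" by linarith
    thus ?thesis unfolding vup_def using cosT CC_alt[OF m] by simp
  qed
  have vs: "vup x + cnj (vup x) = of_real (mp x - sg)" using Rv by (simp add: complex_eq_iff)
  have vp: "vup x * cnj (vup x) = of_real (kp / mp x)"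
    unfolding complex_norm_square[symmetric] cv using P by (simp flip: of_real_power)
  have fp: "(X - y) * (X - y') = (X - vup x) * (X - cnj (vup x))" for X
  proof -
    have "(X - y) * (X - y') = X * X - (y + y') * X + y * y'" by (simp add: algebra_simps)
    also have "\<dots> = X * X - (vup x + cnj (vup x)) * X + vup x * cnj (vup x)" unfolding vs vp yy(1,2) ..
    also have "\<dots> = (X - vup x) * (X - cnj (vup x))" by (simp add: algebra_simps)
    finally show ?thesis .
  qed
  show "(X + of_real a) * (X + of_real b) * (X + of_real c) - of_real x * X = (X - vup x) * (X - cnj (vup x)) * (X + of_real (mp x))" for X
    unfolding roots_factor[OF R] fp[symmetric] using yy(3,4) x by (cases "x > 0") auto
  show "x > 0 \<Longrightarrow> cmod u1 = sqrt (kp / mp x) \<and> cmod u2 = sqrt (kp / mp x) \<and> sqrt (kp / mp x) < mp x"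
    using yy(3) cy by auto
  show "x < 0 \<Longrightarrow> cmod u2 = sqrt (kp / mp x) \<and> cmod u3 = sqrt (kp / mp x) \<and> mp x < sqrt (kp / mp x)"
    using yy(4) cy by auto
qed

lemma exterior_roots:
  assumes R: "roots (of_real x) u1 u2 u3" and x: "x \<noteq> 0" and C: "\<bar>CC (mp x)\<bar> > 1"
  shows "cmod u1 \<noteq> cmod u2" "cmod u2 \<noteq> cmod u3"
proof -
  have m: "mp x > 0" by (rule mp_nz_pos[OF x])
  have P: "kp / mp x > 0" using pos m by simp
  obtain y y' where yy: "y + y' = of_real (mp x - sg)" "y * y' = of_real (kp / mp x)"
    "x > 0 \<longrightarrow> u3 = of_real (- mp x) \<and> u1 = y \<and> u2 = y' \<and> cmod u2 < mp x"
    "x < 0 \<longrightarrow> u1 = of_real (- mp x) \<and> u2 = y \<and> u3 = y' \<and> mp x < cmod u2"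
    using root_pair_ex[OF R x] by blast
  have "(CC (mp x))\<^sup>2 > 1" using C by (simp add: abs_square_le_1 not_le[symmetric])
  hence disc: "(mp x - sg)\<^sup>2 > 4 * (kp / mp x)"
    unfolding CC_sq[OF m] using P less_divide_eq_1_pos[of "4 * (kp / mp x)"] by simp
  have r: "Im y = 0" "Im y' = 0" "Re y + Re y' = mp x - sg" "Re y * Re y' = kp / mp x"
    using real_pair(2)[OF yy(1,2) P] disc by auto
  have "cmod y \<noteq> cmod y'"
  proof
    assume "cmod y = cmod y'"
    hence "\<bar>Re y\<bar> = \<bar>Re y'\<bar>" using r by (simp add: cmod_eq_Re)
    moreover have "Re y * Re y' > 0" using r(4) P by simp
    ultimately have e: "Re y = Re y'" by (auto simp: zero_less_mult_iff abs_if split: if_splits)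
    have "(mp x - sg)\<^sup>2 = 4 * (kp / mp x)" unfolding r(3)[symmetric] r(4)[symmetric] e by (simp add: power2_eq_square)
    thus False using disc by simp
  qed
  moreover have "cmod (of_real (- mp x)) = mp x" using m by simp
  ultimately show "cmod u1 \<noteq> cmod u2" "cmod u2 \<noteq> cmod u3" using yy(3,4) x by (cases "x > 0"; auto)+
qed

lemma mp_strict:
  assumes R: "roots (of_real x) u1 u2 u3"
  shows "x > 0 \<Longrightarrow> cmod u2 < cmod u3 \<and> cmod u3 = mp x" "x < 0 \<Longrightarrow> cmod u1 < cmod u2 \<and> cmod u1 = mp x"
proof -
  { assume x: "x > 0"
    hence "mp x > 0" using mp_nz_pos[of x] by simp
    thus "cmod u2 < cmod u3 \<and> cmod u3 = mp x" using root_pair_ex[OF R, of] x by auto }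
  { assume x: "x < 0"
    hence "mp x > 0" using mp_nz_pos[of x] by simp
    thus "cmod u1 < cmod u2 \<and> cmod u1 = mp x" using root_pair_ex[OF R, of] x by auto }
qed

text \<open>Polar form of \<open>kp / v\<close> for the conjugate pair, with \<open>e = 1\<close> or
  \<open>e = -1\<close> selecting the member.\<close>

definition Zc :: "real \<Rightarrow> real \<Rightarrow> complex" where "Zc e x = of_real (sqrt (kp * mp x)) * cis (e * Th x)"

lemma Zc_vup: "x \<noteq> 0 \<Longrightarrow> of_real kp / vup x = Zc (-1) x" "x \<noteq> 0 \<Longrightarrow> of_real kp / cnj (vup x) = Zc 1 x"
proof -
  assume x: "x \<noteq> 0"
  have m: "mp x > 0" by (rule mp_nz_pos[OF x])
  have r: "kp / sqrt (kp / mp x) = sqrt (kp * mp x)"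
  proof -
    have "sqrt (kp * mp x) * sqrt (kp / mp x) = sqrt (kp * kp)" using m by (simp flip: real_sqrt_mult)
    hence "sqrt (kp * mp x) * sqrt (kp / mp x) = kp" using pos by simp
    thus ?thesis using pos m by (simp add: divide_eq_eq)
  qed
  have q: "of_real kp / (of_real (sqrt (kp / mp x)) * cis t) = of_real (sqrt (kp * mp x)) * cis (- t)" for t
    unfolding r[symmetric] of_real_divide by (simp add: divide_inverse cis_inverse mult_ac)
  show "of_real kp / vup x = Zc (-1) x" unfolding vup_def Zc_def q by simp
  show "of_real kp / cnj (vup x) = Zc 1 x" using q[of "- Th x"] unfolding vup_def Zc_def by (simp add: cis_cnj)
qed

text \<open>The logarithmic derivative has a real part \<open>D\<close> common to both signs of
  \<open>e\<close>, which cancels in the jump.\<close>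

lemma Zc_derivative:
  assumes x: "x \<noteq> 0" and C: "\<bar>CC (mp x)\<bar> < 1"
  shows "\<exists>D. \<forall>e. (Zc e has_vector_derivative Zc e x * (of_real D + \<i> * of_real (e * (- sgn x * pi * rho x)))) (at x)"
proof -
  have m: "mp x > 0" by (rule mp_nz_pos[OF x])
  let ?r = "\<lambda>x. sqrt (kp * mp x)" and ?T = "- sgn x * pi * rho x"
  define r' where "r' = inverse (?r x) / 2 * (kp * inverse (dAR (mp x)))"
  have dr: "DERIV ?r x :> r'" unfolding r'_def
    by (rule DERIV_chain2[OF DERIV_real_sqrt DERIV_cmult[OF DERIV_mp[OF x]]]) (use pos m in simp)
  have dT: "DERIV Th x :> ?T" by (rule DERIV_Th[OF x]) (use C in simp)
  have rx: "?r x > 0" using pos m by simp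
  show ?thesis
  proof (intro exI[of _ "r' / ?r x"] allI)
    fix e
    have d1: "((\<lambda>t. complex_of_real (?r t)) has_vector_derivative of_real r') (at x)"
      using dr by (intro has_vector_derivative_of_real) (simp add: has_real_derivative_iff_has_vector_derivative)
    have d2: "((\<lambda>t. cis (e * Th t)) has_vector_derivative (e * ?T) *\<^sub>R (\<i> * cis (e * Th x))) (at x)"
    proof -
      have c: "(cis has_vector_derivative \<i> * cis u) (at u)" for u
      proof -
        have "((\<lambda>w. exp (\<i> * w)) has_field_derivative exp (\<i> * of_real u) * \<i>) (at (of_real u))"
          by (auto intro!: derivative_eq_intros)
        from has_vector_derivative_real_field[OF this, of UNIV]
        have "((\<lambda>t. exp (\<i> * of_real t)) has_vector_derivative \<i> * exp (\<i> * of_real u)) (at u)" by (simp only: mult.commute)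
        moreover have "cis = (\<lambda>t. exp (\<i> * of_real t))" by (simp add: fun_eq_iff cis_conv_exp)
        ultimately have "(cis has_vector_derivative \<i> * exp (\<i> * of_real u)) (at u)" by simp
        thus ?thesis by (simp only: cis_conv_exp)
      qed
      have "((\<lambda>t. e * Th t) has_vector_derivative e * ?T) (at x)"
        using DERIV_cmult[OF dT, of e] by (simp add: has_real_derivative_iff_has_vector_derivative)
      from vector_diff_chain_at[OF this c] show ?thesis by (simp add: o_def)
    qed
    have "(Zc e has_vector_derivative (of_real (?r x) * ((e * ?T) *\<^sub>R (\<i> * cis (e * Th x))) + of_real r' * cis (e * Th x))) (at x)"
      unfolding Zc_def[abs_def] by (rule has_vector_derivative_mult[OF d1 d2])
    moreover have "of_real (?r x) * ((e * ?T) *\<^sub>R (\<i> * cis (e * Th x))) + of_real r' * cis (e * Th x)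
       = Zc e x * (of_real (r' / ?r x) + \<i> * of_real (e * ?T))"
      unfolding Zc_def scaleR_conv_of_real using rx pos m by (simp add: algebra_simps)
    ultimately show "(Zc e has_vector_derivative Zc e x * (of_real (r' / ?r x) + \<i> * of_real (e * ?T))) (at x)" by simp
  qed
qed

end

lemma half_plane_limit_nontrivial:
  "at (complex_of_real x) within {w. Im w > 0} \<noteq> bot" "at (complex_of_real x) within {w. Im w < 0} \<noteq> bot"
proof -
  have "complex_of_real x islimpt {w. Im w > 0}"
    unfolding islimpt_approachable
  proof (intro allI impI)
    fix e :: real assume "e > 0"
    thus "\<exists>x'\<in>{w. Im w > 0}. x' \<noteq> complex_of_real x \<and> dist x' (of_real x) < e"
      by (intro bexI[of _ "Complex x (e / 2)"]) (auto simp: complex_eq_iff dist_norm cmod_def)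
  qed
  thus "at (complex_of_real x) within {w. Im w > 0} \<noteq> bot" by (simp add: trivial_limit_within)
  have "complex_of_real x islimpt {w. Im w < 0}"
    unfolding islimpt_approachable
  proof (intro allI impI)
    fix e :: real assume "e > 0"
    thus "\<exists>x'\<in>{w. Im w < 0}. x' \<noteq> complex_of_real x \<and> dist x' (of_real x) < e"
      by (intro bexI[of _ "Complex x (- (e / 2))"]) (auto simp: complex_eq_iff dist_norm cmod_def)
  qed
  thus "at (complex_of_real x) within {w. Im w < 0} \<noteq> bot" by (simp add: trivial_limit_within)
qed

section \<open>The jump of the logarithmic derivative\<close>

context ordered_roots
begin

text \<open>Off the axis the sign of \<open>Im (vv j w s)\<close> is known and keeps the root away
  from one member of the pair; the modulus keeps it away from the real root.\<close>

lemma z_boundary_values: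
  assumes s: "s > 0"
  defines "T \<equiv> three_shifts.mp s (s + p) (s + p + q)"
  assumes x: "x \<noteq> 0" and C: "\<bar>three_shifts.CC s (s + p) (s + p + q) (T x)\<bar> < 1"
    and j: "j = 1 \<and> x > 0 \<and> e = 1 \<or> j = 2 \<and> x < 0 \<and> e = -1"
  shows "z_plus z j x s = three_shifts.Zc s (s + p) (s + p + q) e x"
    and "z_minus z j x s = three_shifts.Zc s (s + p) (s + p + q) (- e) x"
proof -
  interpret T: three_shifts s "s + p" "s + p + q" by (rule three_shifts[OF s])
  note C' = C[unfolded T_def]
  note R = roots_vv[OF s]
  note I = T.interior_roots[OF R x C']
  have kk: "T.kp = kappa s" by (simp add: T.kp_def kappa_def)
  have m: "T.mp x > 0" by (rule T.mp_nz_pos[OF x])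
  have vnz: "T.vup x \<noteq> 0" "cnj (T.vup x) \<noteq> 0" using I(2) by auto
  define r where "r = sqrt (T.kp / T.mp x)"
  have r: "r \<noteq> T.mp x" "cmod (vv j (of_real x) s) = r" using I(4,5) j unfolding r_def by auto
  have j3: "j \<in> {1, 2, 3}" using j by auto
  have eq: "(vv j w s + of_real s) * (vv j w s + of_real (s + p)) * (vv j w s + of_real (s + p + q)) = w * vv j w s" for w
    using T.roots_factor[OF R[of w], of "vv j w s"] j by auto
  have up: "((\<lambda>w. vv j w s) \<longlongrightarrow> T.vup x) (at (of_real x) within S)" if "\<And>w. w \<in> S \<Longrightarrow> Im (vv j w s) > 0" for S
  proof (rule T.root_tendsto[where v = "cnj (T.vup x)", OF _ m _ I(2) _ cmod_vv_tendsto_within[OF s j3] _ tendsto_ident_at])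
    show "(X + of_real s) * (X + of_real (s + p)) * (X + of_real (s + p + q)) - of_real x * X
       = (X - cnj (T.vup x)) * (X - T.vup x) * (X + of_real (T.mp x))" for X
      using I(1)[of X] by (simp only: mult_ac)
    show "\<forall>\<^sub>F w in at (of_real x) within S. (vv j w s + of_real s) * (vv j w s + of_real (s + p)) * (vv j w s + of_real (s + p + q)) = w * vv j w s"
      by (simp only: eq) simp
    show "\<forall>\<^sub>F w in at (of_real x) within S. Im (T.vup x) \<le> cmod (vv j w s - cnj (T.vup x))"
      unfolding eventually_at_filter
    proof (intro always_eventually allI impI)
      fix w assume "w \<in> S"
      thus "Im (T.vup x) \<le> cmod (vv j w s - cnj (T.vup x))"
        using that[of w] abs_Im_le_cmod[of "vv j w s - cnj (T.vup x)"] by simp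
    qed
    show "cmod (vv j (of_real x) s) \<noteq> T.mp x" using r by simp
  qed
  have down: "((\<lambda>w. vv j w s) \<longlongrightarrow> cnj (T.vup x)) (at (of_real x) within S)" if "\<And>w. w \<in> S \<Longrightarrow> Im (vv j w s) < 0" for S
  proof (rule T.root_tendsto[where v = "T.vup x", OF I(1) m _ I(2) _ cmod_vv_tendsto_within[OF s j3] _ tendsto_ident_at])
    show "\<forall>\<^sub>F w in at (of_real x) within S. (vv j w s + of_real s) * (vv j w s + of_real (s + p)) * (vv j w s + of_real (s + p + q)) = w * vv j w s"
      by (simp only: eq) simp
    show "\<forall>\<^sub>F w in at (of_real x) within S. Im (T.vup x) \<le> cmod (vv j w s - T.vup x)"
      unfolding eventually_at_filter
    proof (intro always_eventually allI impI)
      fix w assume "w \<in> S"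
      thus "Im (T.vup x) \<le> cmod (vv j w s - T.vup x)"
        using that[of w] abs_Im_le_cmod[of "vv j w s - T.vup x"] by simp
    qed
    show "cmod (vv j (of_real x) s) \<noteq> T.mp x" using r by simp
  qed
  have zv: "z j w s = of_real T.kp / vv j w s" for w unfolding kk using z_eq[OF s j3] by simp
  have lower: "Im (vv 1 w s) > 0" "Im (vv 2 w s) < 0" if "Im w < 0" for w
    using T.roots_lower(1,3)[OF R that] by auto
  \<comment> \<open>Conjugation preserves the ordering and carries the upper half-plane to the lower
    one.\<close>
  have upper: "Im (vv 1 w s) < 0" "Im (vv 2 w s) > 0" if "Im w > 0" for w
    using T.roots_lower(1,3)[OF T.roots_cnj[OF R[of w]]] that by auto
  have "((\<lambda>w. z j w s) \<longlongrightarrow> T.Zc e x) (at (of_real x) within {w. Im w > 0})"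
    using j
  proof
    assume j: "j = 1 \<and> x > 0 \<and> e = 1"
    show ?thesis unfolding zv using j T.Zc_vup(2)[OF x] tendsto_divide[OF tendsto_const[of "of_real T.kp"] down vnz(2), of "{w. Im w > 0}"] upper(1) by auto
  next
    assume j: "j = 2 \<and> x < 0 \<and> e = -1"
    show ?thesis unfolding zv using j T.Zc_vup(1)[OF x] tendsto_divide[OF tendsto_const[of "of_real T.kp"] up vnz(1), of "{w. Im w > 0}"] upper(2) by auto
  qed
  thus "z_plus z j x s = T.Zc e x"
    unfolding z_plus_def by (intro tendsto_Lim half_plane_limit_nontrivial)
  have "((\<lambda>w. z j w s) \<longlongrightarrow> T.Zc (- e) x) (at (of_real x) within {w. Im w < 0})"
    using j
  proof
    assume j: "j = 1 \<and> x > 0 \<and> e = 1"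
    show ?thesis unfolding zv using j T.Zc_vup(1)[OF x] tendsto_divide[OF tendsto_const[of "of_real T.kp"] up vnz(1), of "{w. Im w < 0}"] lower(1) by auto
  next
    assume j: "j = 2 \<and> x < 0 \<and> e = -1"
    show ?thesis unfolding zv using j T.Zc_vup(2)[OF x] tendsto_divide[OF tendsto_const[of "of_real T.kp"] down vnz(2), of "{w. Im w < 0}"] lower(2) by auto
  qed
  thus "z_minus z j x s = T.Zc (- e) x"
    unfolding z_minus_def by (intro tendsto_Lim half_plane_limit_nontrivial)
qed

lemma jump_density:
  fixes e :: real
  assumes s: "s > 0"
  defines "T \<equiv> three_shifts.mp s (s + p) (s + p + q)"
  assumes x: "x \<noteq> 0" and C: "\<bar>three_shifts.CC s (s + p) (s + p + q) (T x)\<bar> < 1"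
    and j: "j = 1 \<and> x > 0 \<and> e = 1 \<or> j = 2 \<and> x < 0 \<and> e = -1"
  shows "Re (1 / (2 * of_real pi * \<i>) *
       (vector_derivative (\<lambda>t. z_minus z j t s) (at x) / z_minus z j x s
        - vector_derivative (\<lambda>t. z_plus z j t s) (at x) / z_plus z j x s)) = three_shifts.rho s (s + p) (s + p + q) x"
proof -
  interpret T: three_shifts s "s + p" "s + p + q" by (rule three_shifts[OF s])
  note C' = C[unfolded T_def]
  have lim: "((\<lambda>x. \<bar>T.CC (T.mp x)\<bar>) \<longlongrightarrow> \<bar>T.CC (T.mp x)\<bar>) (nhds x)"
    using tendsto_rabs[OF T.isCont_CCmp[OF x, unfolded isCont_def]] by (rule tendsto_at_iff_tendsto_nhds[THEN iffD1])
  have "((\<lambda>y. e * y) \<longlongrightarrow> e * x) (nhds x)" by (intro tendsto_intros filterlim_ident)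
  from order_tendstoD(1)[OF this, of 0] j have "\<forall>\<^sub>F y in nhds x. e * y > 0" by auto
  with order_tendstoD(2)[OF lim C'] have ev: "\<forall>\<^sub>F y in nhds x. z_plus z j y s = T.Zc e y \<and> z_minus z j y s = T.Zc (- e) y"
  proof eventually_elim
    case (elim y)
    have "y \<noteq> 0" "j = 1 \<and> y > 0 \<and> e = 1 \<or> j = 2 \<and> y < 0 \<and> e = -1" using elim(2) j by auto
    thus ?case using z_boundary_values[OF s, of y j e] elim(1) by blast
  qed
  obtain D where D: "\<And>e. (T.Zc e has_vector_derivative T.Zc e x * (of_real D + \<i> * of_real (e * (- sgn x * pi * T.rho x)))) (at x)"
    using T.Zc_derivative[OF x C'] by blast
  have nz: "T.Zc e x \<noteq> 0" for e
    using T.mp_nz_pos[OF x] T.pos unfolding T.Zc_def by simp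
  have vp: "vector_derivative (\<lambda>t. z_plus z j t s) (at x) = T.Zc e x * (of_real D + \<i> * of_real (e * (- sgn x * pi * T.rho x)))"
    unfolding vector_derivative_at[OF D, symmetric]
    by (rule vector_derivative_cong_eq) (use ev in \<open>auto elim!: eventually_mono\<close>)
  have vm: "vector_derivative (\<lambda>t. z_minus z j t s) (at x) = T.Zc (- e) x * (of_real D + \<i> * of_real (- e * (- sgn x * pi * T.rho x)))"
    unfolding vector_derivative_at[OF D, symmetric]
    by (rule vector_derivative_cong_eq) (use ev in \<open>auto elim!: eventually_mono\<close>)
  have pm: "z_plus z j x s = T.Zc e x" "z_minus z j x s = T.Zc (- e) x"
    using z_boundary_values[OF s x C[unfolded T_def] j] by auto
  have es: "e * sgn x = 1" using j by auto
  \<comment> \<open>The real parts cancel and the angular parts add; \<open>e * sgn x = 1\<close>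
    makes the jump positive for both \<open>j\<close>.\<close>
  have "vector_derivative (\<lambda>t. z_minus z j t s) (at x) / z_minus z j x s
        - vector_derivative (\<lambda>t. z_plus z j t s) (at x) / z_plus z j x s = 2 * of_real pi * \<i> * of_real ((e * sgn x) * T.rho x)"
    unfolding vp vm pm nonzero_mult_div_cancel_left[OF nz] by (simp add: algebra_simps)
  also have "1 / (2 * of_real pi * \<i>) * \<dots> = of_real (T.rho x)" unfolding es by simp
  finally show ?thesis by simp
qed

text \<open>Off a finite set, \<open>jump_density\<close> applies inside the support; elsewhere the
  moduli differ, and on the half-line concerned \<open>rho\<close> vanishes too.\<close>

lemma mu_eq:
  assumes s: "s > 0"
  shows "mu z 1 s = three_shifts.m1 s (s + p) (s + p + q)" "mu z 2 s = three_shifts.m2 s (s + p) (s + p + q)"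
proof -
  interpret T: three_shifts s "s + p" "s + p + q" by (rule three_shifts[OF s])
  have kp0: "kappa s > 0" by (rule kappa_pos[OF s])
  have cz: "cmod (z j x s) = kappa s / cmod (vv j x s)" if "j \<in> {1,2,3}" for j x
    using kp0 by (simp add: z_eq[OF s that] norm_divide)
  have vp: "cmod (vv 1 x s) > 0" "cmod (vv 2 x s) > 0" "cmod (vv 3 x s) > 0" for x using vv_nonzero[OF s] by auto
  have G1: "of_real x \<in> Gamma z 1 s \<longleftrightarrow> cmod (vv 1 (of_real x) s) = cmod (vv 2 (of_real x) s)" for x
    unfolding Gamma_def using cz[of 1 "of_real x"] cz[of 2 "of_real x"] vp[of "of_real x"] kp0 by (auto simp: numeral_2_eq_2)
  have G2: "of_real x \<in> Gamma z 2 s \<longleftrightarrow> cmod (vv 2 (of_real x) s) = cmod (vv 3 (of_real x) s)" for x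
    unfolding Gamma_def using cz[of 2 "of_real x"] cz[of 3 "of_real x"] vp[of "of_real x"] kp0 by (auto simp: numeral_3_eq_3 numeral_2_eq_2)
  note R = roots_vv[OF s]
  have "finite ({0} \<union> {x. x \<noteq> 0 \<and> \<bar>T.CC (T.mp x)\<bar> = 1})" using T.finite_exceptional by simp
  hence "{0} \<union> {x. x \<noteq> 0 \<and> \<bar>T.CC (T.mp x)\<bar> = 1} \<in> null_sets lborel" by (rule finite_imp_null_set_lborel)
  from AE_not_in[OF this] have ae: "AE x in lborel. x \<noteq> 0 \<and> \<bar>T.CC (T.mp x)\<bar> \<noteq> 1" by eventually_elim auto
  show "mu z 1 s = T.m1" unfolding mu_def T.m1_def
  proof (rule density_cong_AE')
    show "AE x in lborel. ennreal (Re (1 / (2 * of_real pi * \<i>) *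
       (vector_derivative (\<lambda>t. z_minus z 1 t s) (at x) / z_minus z 1 x s
        - vector_derivative (\<lambda>t. z_plus z 1 t s) (at x) / z_plus z 1 x s))) * indicator {x. complex_of_real x \<in> Gamma z 1 s} x
       = ennreal (T.rho x) * indicator {0<..} x"
      using ae
    proof eventually_elim
      case (elim x)
      consider "x < 0" | "x > 0" "\<bar>T.CC (T.mp x)\<bar> > 1" | "x > 0" "\<bar>T.CC (T.mp x)\<bar> < 1" using elim by linarith
      thus ?case
      proof cases
        case 1
        thus ?thesis using T.mp_strict(2)[OF R[of "of_real x"] 1] G1[of x] by simp
      next
        case 2
        thus ?thesis using T.exterior_roots(1)[OF R[of "of_real x"] _ 2(2)] G1[of x] by (simp add: T.rho_def)
      next
        case 3
        thus ?thesis using T.interior_roots(4)[OF R[of "of_real x"] _ 3(2)] G1[of x] jump_density[OF s, of x 1 1] by simp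
      qed
    qed
  qed
  show "mu z 2 s = T.m2" unfolding mu_def T.m2_def
  proof (rule density_cong_AE')
    show "AE x in lborel. ennreal (Re (1 / (2 * of_real pi * \<i>) *
       (vector_derivative (\<lambda>t. z_minus z 2 t s) (at x) / z_minus z 2 x s
        - vector_derivative (\<lambda>t. z_plus z 2 t s) (at x) / z_plus z 2 x s))) * indicator {x. complex_of_real x \<in> Gamma z 2 s} x
       = ennreal (T.rho x) * indicator {..<0} x"
      using ae
    proof eventually_elim
      case (elim x)
      consider "x > 0" | "x < 0" "\<bar>T.CC (T.mp x)\<bar> > 1" | "x < 0" "\<bar>T.CC (T.mp x)\<bar> < 1" using elim by linarith
      thus ?case
      proof cases
        case 1
        thus ?thesis using T.mp_strict(1)[OF R[of "of_real x"] 1] G2[of x] by simp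
      next
        case 2
        thus ?thesis using T.exterior_roots(2)[OF R[of "of_real x"] _ 2(2)] G2[of x] by (simp add: T.rho_def)
      next
        case 3
        thus ?thesis using T.interior_roots(5)[OF R[of "of_real x"] _ 3(2)] G2[of x] jump_density[OF s, of x 2 "-1"] by simp
      qed
    qed
  qed
qed

end

section \<open>Averages over the parameter\<close>

context
  fixes h :: "real \<Rightarrow> real \<Rightarrow> ennreal" and M :: "real \<Rightarrow> real measure" and c \<xi> :: real and N :: "real measure"
  assumes h [measurable]: "(\<lambda>(x, s). h x s) \<in> borel_measurable (borel \<Otimes>\<^sub>M borel)"
    and M: "\<And>s. s \<in> {0<..\<xi>} \<Longrightarrow> M s = density lborel (\<lambda>x. h x s)" and c: "c > 0"
  defines "N \<equiv> measure_of UNIV (sets borel) (\<lambda>B. ennreal c * (\<integral>\<^sup>+s\<in>{0<..\<xi>}. emeasure (M s) B \<partial>lborel))"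
begin

text \<open>Tonelli identifies the averaged set function with the measure of a density; in
  particular it is countably additive, so \<open>measure_of\<close> really takes these
  values.\<close>

lemma average_eq_density: "N = density lborel (\<lambda>x. ennreal c * (\<integral>\<^sup>+s\<in>{0<..\<xi>}. h x s \<partial>lborel))" (is "_ = ?D")
proof -
  have "N = measure_of UNIV (sets borel) (emeasure ?D)" unfolding N_def
  proof (rule measure_of_eq)
    fix B :: "real set" assume "B \<in> sigma_sets UNIV (sets borel)"
    hence B [measurable]: "B \<in> sets borel" using sets.sigma_sets_eq[of "borel :: real measure"] by simp
    have "emeasure ?D B = (\<integral>\<^sup>+x. (\<integral>\<^sup>+s. ennreal c * (h x s * indicator {0<..\<xi>} s * indicator B x) \<partial>lborel) \<partial>lborel)"
    proof -
      have "(\<integral>\<^sup>+s. ennreal c * (h x s * indicator {0<..\<xi>} s * indicator B x) \<partial>lborel)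
         = ennreal c * (\<integral>\<^sup>+s\<in>{0<..\<xi>}. h x s \<partial>lborel) * indicator B x" for x
        by (subst nn_integral_cmult, measurable, subst nn_integral_multc, measurable) (simp add: mult.assoc)
      thus ?thesis by (simp add: emeasure_density)
    qed
    also have "\<dots> = (\<integral>\<^sup>+s. (\<integral>\<^sup>+x. ennreal c * (h x s * indicator {0<..\<xi>} s * indicator B x) \<partial>lborel) \<partial>lborel)"
      by (rule lborel_pair.Fubini') measurable
    also have "\<dots> = (\<integral>\<^sup>+s. ennreal c * (emeasure (M s) B * indicator {0<..\<xi>} s) \<partial>lborel)"
    proof (rule nn_integral_cong)
      fix s
      show "(\<integral>\<^sup>+x. ennreal c * (h x s * indicator {0<..\<xi>} s * indicator B x) \<partial>lborel) = ennreal c * (emeasure (M s) B * indicator {0<..\<xi>} s)"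
      proof (cases "s \<in> {0<..\<xi>}")
        case True
        thus ?thesis unfolding M[OF True] by (subst emeasure_density) (auto simp: nn_integral_cmult)
      qed simp
    qed
    also have "\<dots> = ennreal c * (\<integral>\<^sup>+s\<in>{0<..\<xi>}. emeasure (M s) B \<partial>lborel)"
    proof -
      have "(\<lambda>s. emeasure (M s) B * indicator {0<..\<xi>} s) = (\<lambda>s. (\<integral>\<^sup>+x. h x s * indicator B x \<partial>lborel) * indicator {0<..\<xi>} s)"
      proof
        fix s show "emeasure (M s) B * indicator {0<..\<xi>} s = (\<integral>\<^sup>+x. h x s * indicator B x \<partial>lborel) * indicator {0<..\<xi>} s"
          by (cases "s \<in> {0<..\<xi>}") (use M in \<open>auto simp: emeasure_density\<close>)
      qed
      moreover have "(\<lambda>s. (\<integral>\<^sup>+x. h x s * indicator B x \<partial>lborel) * indicator {0<..\<xi>} s) \<in> borel_measurable lborel" by measurable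
      ultimately show ?thesis by (simp add: nn_integral_cmult)
    qed
    finally show "ennreal c * (\<integral>\<^sup>+s\<in>{0<..\<xi>}. emeasure (M s) B \<partial>lborel) = emeasure ?D B" ..
  qed simp
  also have "\<dots> = ?D" using measure_of_of_measure[of ?D] by simp
  finally show ?thesis .
qed

lemma nn_integral_average:
  assumes [measurable]: "f \<in> borel_measurable borel"
  shows "(\<integral>\<^sup>+x. f x \<partial>N) = ennreal c * (\<integral>\<^sup>+s\<in>{0<..\<xi>}. (\<integral>\<^sup>+x. h x s * f x \<partial>lborel) \<partial>lborel)"
proof -
  have "(\<integral>\<^sup>+x. f x \<partial>N) = (\<integral>\<^sup>+x. (\<integral>\<^sup>+s. ennreal c * (h x s * f x * indicator {0<..\<xi>} s) \<partial>lborel) \<partial>lborel)"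
    unfolding average_eq_density
    by (subst nn_integral_density) (auto simp: nn_integral_cmult nn_integral_multc[symmetric] mult_ac intro!: nn_integral_cong)
  also have "\<dots> = (\<integral>\<^sup>+s. (\<integral>\<^sup>+x. ennreal c * (h x s * f x * indicator {0<..\<xi>} s) \<partial>lborel) \<partial>lborel)"
    by (rule lborel_pair.Fubini') measurable
  also have "\<dots> = ennreal c * (\<integral>\<^sup>+s\<in>{0<..\<xi>}. (\<integral>\<^sup>+x. h x s * f x \<partial>lborel) \<partial>lborel)"
    by (simp add: nn_integral_cmult nn_integral_multc)
  finally show ?thesis .
qed

text \<open>Interchanging the two integrations is safe for the positive and negative parts
  separately; what has to be shown is that neither average is infinite.\<close>

lemma log_potential_average:
  assumes fin: "finite_borel_measure N" and L: "log_int N"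
    and U: "\<And>s. s \<in> {0<..\<xi>} \<Longrightarrow> log_potential (M s) x = ereal (U s)"
    and Ui: "set_integrable lborel {0<..\<xi>} U"
  shows "log_potential N x = ereal (c * (LINT s:{0<..\<xi>}|lborel. U s))"
proof -
  define P where "P s = (\<integral>\<^sup>+y. h y s * e2ennreal (log_dist x y) \<partial>lborel)" for s
  define Q where "Q s = (\<integral>\<^sup>+y. h y s * e2ennreal (- log_dist x y) \<partial>lborel)" for s
  have [measurable]: "P \<in> borel_measurable borel" "Q \<in> borel_measurable borel" unfolding P_def[abs_def] Q_def[abs_def] by measurable
  have [measurable_cong]: "sets N = sets borel" unfolding average_eq_density by simp
  have PN: "(\<integral>\<^sup>+y. e2ennreal (log_dist x y) \<partial>N) = ennreal c * (\<integral>\<^sup>+s\<in>{0<..\<xi>}. P s \<partial>lborel)"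
    unfolding P_def by (rule nn_integral_average) measurable
  have QN: "(\<integral>\<^sup>+y. e2ennreal (- log_dist x y) \<partial>N) = ennreal c * (\<integral>\<^sup>+s\<in>{0<..\<xi>}. Q s \<partial>lborel)"
    unfolding Q_def by (rule nn_integral_average) measurable
  have Us: "P s = ennreal (enn2real (P s)) \<and> Q s = ennreal (enn2real (Q s)) \<and> U s = enn2real (P s) - enn2real (Q s)" if "s \<in> {0<..\<xi>}" for s
  proof -
    have "(\<integral>\<^sup>+y. e2ennreal (log_dist x y) \<partial>M s) = P s" "(\<integral>\<^sup>+y. e2ennreal (- log_dist x y) \<partial>M s) = Q s"
      unfolding M[OF that] P_def Q_def by (subst nn_integral_density; measurable)+
    hence "enn2ereal (P s) - enn2ereal (Q s) = ereal (U s)" using U[OF that] unfolding log_potential_def eintegral_def by simp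
    thus ?thesis by (cases "P s"; cases "Q s") (auto simp: enn2ereal_ennreal)
  qed
  have "(\<integral>\<^sup>+y. e2ennreal (log_dist x y) \<partial>N) < \<infinity>"
    by (rule finite_borel_measure.pos_part_finite[OF fin L])
  hence Pf: "(\<integral>\<^sup>+s\<in>{0<..\<xi>}. P s \<partial>lborel) < \<infinity>" unfolding PN using c by (auto simp: ennreal_mult_less_top)
  have P': "(\<integral>\<^sup>+s\<in>{0<..\<xi>}. P s \<partial>lborel) = (\<integral>\<^sup>+s. ennreal (indicator {0<..\<xi>} s * enn2real (P s)) \<partial>lborel)"
    by (rule nn_integral_cong) (use Us in \<open>auto simp: indicator_def\<close>)
  have Q': "(\<integral>\<^sup>+s\<in>{0<..\<xi>}. Q s \<partial>lborel) = (\<integral>\<^sup>+s. ennreal (indicator {0<..\<xi>} s * enn2real (Q s)) \<partial>lborel)"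
    by (rule nn_integral_cong) (use Us in \<open>auto simp: indicator_def\<close>)
  have iP: "integrable lborel (\<lambda>s. indicator {0<..\<xi>} s * enn2real (P s))"
    using Pf unfolding P' by (subst integrable_iff_bounded) auto
  \<comment> \<open>The moment of \<open>N\<close> makes the average of \<open>P\<close> finite, and
    subtracting the integrable \<open>U\<close> gives the same for \<open>Q\<close>.\<close>
  have "integrable lborel (\<lambda>s. indicator {0<..\<xi>} s * enn2real (P s) - indicator {0<..\<xi>} s *\<^sub>R U s)"
    using Ui unfolding set_integrable_def by (intro Bochner_Integration.integrable_diff iP)
  moreover have eqQ: "indicator {0<..\<xi>} s * enn2real (P s) - indicator {0<..\<xi>} s *\<^sub>R U s = indicator {0<..\<xi>} s * enn2real (Q s)" for s
    using Us by (auto simp: indicator_def)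
  ultimately have iQ: "integrable lborel (\<lambda>s. indicator {0<..\<xi>} s * enn2real (Q s))" by simp
  have IU: "(LINT s:{0<..\<xi>}|lborel. U s) = (\<integral>s. indicator {0<..\<xi>} s * enn2real (P s) \<partial>lborel) - (\<integral>s. indicator {0<..\<xi>} s * enn2real (Q s) \<partial>lborel)"
  proof -
    have "indicator {0<..\<xi>} s *\<^sub>R U s = indicator {0<..\<xi>} s * enn2real (P s) - indicator {0<..\<xi>} s * enn2real (Q s)" for s
      using eqQ[of s] by linarith
    thus ?thesis unfolding set_lebesgue_integral_def by (simp only: Bochner_Integration.integral_diff[OF iP iQ])
  qed
  have "log_potential N x = enn2ereal (ennreal c * ennreal (\<integral>s. indicator {0<..\<xi>} s * enn2real (P s) \<partial>lborel))
      - enn2ereal (ennreal c * ennreal (\<integral>s. indicator {0<..\<xi>} s * enn2real (Q s) \<partial>lborel))"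
    unfolding log_potential_def eintegral_def PN QN P' Q'
    by (subst (1 2) nn_integral_eq_integral) (auto intro!: iP iQ)
  also have "\<dots> = ereal (c * (\<integral>s. indicator {0<..\<xi>} s * enn2real (P s) \<partial>lborel) - c * (\<integral>s. indicator {0<..\<xi>} s * enn2real (Q s) \<partial>lborel))"
    using c by (simp add: ennreal_mult[symmetric] enn2ereal_ennreal)
  finally show ?thesis unfolding IU by (simp add: algebra_simps)
qed

end

section \<open>Measurability and integrability in the parameter\<close>

context ordered_roots
begin

text \<open>Cut off to 0 for \<open>s \<le> 0\<close>, where the roots are unspecified, so that it
  is Borel on the whole plane.\<close>

definition cv :: "nat \<Rightarrow> real \<Rightarrow> real \<Rightarrow> real" where
  "cv j x s = indicator {0<..} s *\<^sub>R cmod (vv j (of_real x) s)"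

lemma measurable_cv: "j \<in> {1, 2, 3} \<Longrightarrow> (\<lambda>w. cv j (fst w) (snd w)) \<in> borel_measurable (borel \<Otimes>\<^sub>M borel)"
proof -
  assume j: "j \<in> {1, 2, 3}"
  have "continuous_on (UNIV \<times> {0<..}) (\<lambda>w. cmod (vv j (of_real (fst w)) (snd w)))"
    unfolding continuous_on_sequentially
  proof (intro allI ballI impI)
    fix X :: "nat \<Rightarrow> real \<times> real" and w
    assume w: "w \<in> UNIV \<times> {0<..}" and X: "(\<forall>n. X n \<in> UNIV \<times> {0<..}) \<and> X \<longlonglongrightarrow> w"
    show "((\<lambda>w. cmod (vv j (of_real (fst w)) (snd w))) \<circ> X) \<longlonglongrightarrow> cmod (vv j (of_real (fst w)) (snd w))"
      unfolding o_def
    proof (rule cmod_vv_tendsto)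
      show "snd (X n) > 0" for n using X by (auto simp: mem_Times_iff)
      show "snd w > 0" using w by (auto simp: mem_Times_iff)
      show "(\<lambda>n. complex_of_real (fst (X n))) \<longlonglongrightarrow> of_real (fst w)" "(\<lambda>n. snd (X n)) \<longlonglongrightarrow> snd w"
        using X by (auto intro!: tendsto_intros)
      show "j \<in> {1, 2, 3}" by (rule j)
    qed
  qed
  hence "(\<lambda>w. indicator (UNIV \<times> {0<..}) w *\<^sub>R cmod (vv j (of_real (fst w)) (snd w))) \<in> borel_measurable borel"
    by (intro borel_measurable_continuous_on_indicator) (auto intro!: borel_open open_Times)
  moreover have "(\<lambda>w. indicator (UNIV \<times> {0<..}) w *\<^sub>R cmod (vv j (of_real (fst w)) (snd w))) = (\<lambda>w :: real \<times> real. cv j (fst w) (snd w))"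
    by (auto simp: cv_def fun_eq_iff indicator_def)
  ultimately show ?thesis by (simp add: borel_prod)
qed

lemma cv_eq: "s > 0 \<Longrightarrow> cv j x s = cmod (vv j (of_real x) s)" by (simp add: cv_def)

lemma measurable_cv' [measurable (raw)]:
  assumes "j \<in> {1, 2, 3}" "f \<in> borel_measurable M" "g \<in> borel_measurable M"
  shows "(\<lambda>w. cv j (f w) (g w)) \<in> borel_measurable M"
  using measurable_compose[OF measurable_Pair[OF assms(2,3)] measurable_cv[OF assms(1)]] by simp

definition mu_dens :: "nat \<Rightarrow> real \<Rightarrow> real \<Rightarrow> ennreal" where
  "mu_dens j x s = (if s > 0 then ennreal (three_shifts.rho s (s + p) (s + p + q) x) * indicator (if j = 1 then {0<..} else {..<0}) x else 0)"

lemma mu_eq_density: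
  assumes "s > 0" "j \<in> {1, 2}"
  shows "mu z j s = density lborel (\<lambda>x. mu_dens j x s)"
proof -
  interpret T: three_shifts s "s + p" "s + p + q" by (rule three_shifts[OF assms(1)])
  show ?thesis using assms mu_eq[OF assms(1)] by (auto simp: mu_dens_def T.m1_def T.m2_def)
qed

text \<open>\<open>mp\<close> is given by a description operator at each parameter; it is replaced
  by \<open>cv 3\<close> or \<open>cv 1\<close>, the modulus of the distinguished real root, which
  is jointly measurable.\<close>

lemma measurable_mu_dens [measurable]: "(\<lambda>(x, s). mu_dens j x s) \<in> borel_measurable (borel \<Otimes>\<^sub>M borel)"
proof -
  define m where "m x s = (if x > 0 then cv 3 x s else cv 1 x s)" for x s
  define C where "C x s = (m x s - (s + (s + p) + (s + p + q))) * sqrt (m x s) / (2 * sqrt (s * (s + p) * (s + p + q)))" for x s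
  define C' where "C' x s = (3 * m x s - (s + (s + p) + (s + p + q))) / (4 * sqrt (s * (s + p) * (s + p + q)) * sqrt (m x s))" for x s
  define A' where "A' x s = 2 * m x s - (s + (s + p) + (s + p + q)) + s * (s + p) * (s + p + q) / (m x s)\<^sup>2" for x s
  have [measurable]: "(\<lambda>w. m (fst w) (snd w)) \<in> borel_measurable (borel \<Otimes>\<^sub>M borel)" unfolding m_def by measurable
  have eq: "mu_dens j x s = (if s > 0 then ennreal (if x \<noteq> 0 \<and> \<bar>C x s\<bar> < 1 then \<bar>C' x s\<bar> / (pi * sqrt (1 - (C x s)\<^sup>2) * A' x s) else 0)
      * indicator (if j = 1 then {0<..} else {..<0}) x else 0)" for x s
  proof (cases "s > 0 \<and> x \<noteq> 0")
    case True
    hence s: "s > 0" and x: "x \<noteq> 0" by auto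
    interpret T: three_shifts s "s + p" "s + p + q" by (rule three_shifts[OF s])
    have mm: "T.mp x = m x s"
      using T.mp_strict[OF roots_vv[OF s, of "of_real x"]] x s by (auto simp: m_def cv_eq not_less)
    have "T.CC (m x s) = C x s" "T.dCC (m x s) = C' x s" "T.dAR (m x s) = A' x s"
      by (simp_all add: T.CC_def T.dCC_def T.dAR_def T.sg_def T.kp_def C_def C'_def A'_def)
    thus ?thesis using s by (simp add: mu_dens_def T.rho_def mm)
  next
    case False
    thus ?thesis by (auto simp: mu_dens_def)
  qed
  have [measurable]: "(\<lambda>w. C (fst w) (snd w)) \<in> borel_measurable (borel \<Otimes>\<^sub>M borel)" "(\<lambda>w. C' (fst w) (snd w)) \<in> borel_measurable (borel \<Otimes>\<^sub>M borel)"
    "(\<lambda>w. A' (fst w) (snd w)) \<in> borel_measurable (borel \<Otimes>\<^sub>M borel)"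
    unfolding C_def C'_def A'_def by measurable
  have [measurable]: "(if j = 1 then {0<..} else {..<0::real}) \<in> sets borel" by simp
  show ?thesis unfolding case_prod_unfold eq by measurable
qed

definition log_pot :: "nat \<Rightarrow> real \<Rightarrow> real \<Rightarrow> real" where
  "log_pot j x s = (if j = 1 then ln (kappa s) - ln (cv 1 x s) else ln (cv 3 x s))"

lemma log_potential_mu:
  assumes s: "s > 0" and j: "j \<in> {1, 2}"
  shows "log_potential (mu z j s) x = ereal (log_pot j x s)"
proof -
  interpret T: three_shifts s "s + p" "s + p + q" by (rule three_shifts[OF s])
  have "\<exists>u1 u2 u3. T.roots x u1 u2 u3" for x using roots_vv[OF s, of x] by blast
  note * = T.log_potential_m12[OF this roots_vv[OF s, of "of_real x"]]
  show ?thesis using j * mu_eq[OF s] s by (auto simp: log_pot_def cv_eq T.kp_def kappa_def)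
qed

lemma cv_facts:
  assumes s: "s > 0"
  shows "cv 1 x s > 0" "cv 1 x s \<le> cv 2 x s" "cv 2 x s \<le> cv 3 x s" "cv 1 x s * cv 2 x s * cv 3 x s = kappa s"
    "ln (cv 1 x s) + ln (cv 2 x s) + ln (cv 3 x s) = ln (kappa s)"
proof -
  interpret T: three_shifts s "s + p" "s + p + q" by (rule three_shifts[OF s])
  note R = roots_vv[OF s, of "of_real x"]
  show 1: "cv 1 x s > 0" "cv 1 x s \<le> cv 2 x s" "cv 2 x s \<le> cv 3 x s" "cv 1 x s * cv 2 x s * cv 3 x s = kappa s"
    using T.roots_nonzero[OF R] T.roots_le[OF R] T.roots_cmod_prod[OF R] by (auto simp: cv_eq[OF s] T.kp_def kappa_def)
  have "cv 2 x s > 0" "cv 3 x s > 0" using 1 by linarith+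
  thus "ln (cv 1 x s) + ln (cv 2 x s) + ln (cv 3 x s) = ln (kappa s)"
    unfolding 1(4)[symmetric] using 1(1) by (simp add: ln_mult_pos)
qed

text \<open>The smallest modulus is at most, and the largest at least, the geometric mean of all
  three. The bound is uniform in \<open>x\<close>, which later gives potentials bounded
  below.\<close>

lemma log_pot_lower:
  assumes s: "s > 0" and j: "j \<in> {1, 2}"
  shows "log_pot j x s \<ge> - \<bar>ln (kappa s)\<bar>"
proof -
  note f = cv_facts[OF s, of x]
  have "ln (cv 1 x s) \<le> ln (cv 2 x s)" "ln (cv 2 x s) \<le> ln (cv 3 x s)" using f by (auto intro!: ln_mono)
  thus ?thesis using f(5) j by (auto simp: log_pot_def)
qed

text \<open>For fixed \<open>x\<close> the coefficients of the cubic are bounded for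
  \<open>0 \<le> s \<le> \<xi>\<close>, hence so are the roots; for \<open>j = 1\<close> the
  potential is the sum of two such logarithms.\<close>

lemma log_pot_upper:
  assumes xi: "0 < \<xi>"
  shows "\<exists>C. \<forall>s\<in>{0<..\<xi>}. \<forall>j\<in>{1, 2}. log_pot j x s \<le> C"
proof -
  define B where "B s = 1 + cmod (- of_real (s + (s + p) + (s + p + q))) + cmod (of_real (s * (s + p) + s * (s + p + q) + (s + p) * (s + p + q)) - of_real x)
     + cmod (- of_real (s * (s + p) * (s + p + q)))" for s
  have "continuous_on {0..\<xi>} B" unfolding B_def by (intro continuous_intros)
  hence "bounded (B ` {0..\<xi>})" by (intro compact_imp_bounded compact_continuous_image) auto
  then obtain K where K: "\<And>s. s \<in> {0..\<xi>} \<Longrightarrow> \<bar>B s\<bar> \<le> K" unfolding bounded_iff by force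
  have "log_pot j x s \<le> 2 * \<bar>ln K\<bar>" if s: "s \<in> {0<..\<xi>}" and j: "j \<in> {1, 2}" for j s
  proof -
    have s0: "s > 0" using s by simp
    interpret T: three_shifts s "s + p" "s + p + q" by (rule three_shifts[OF s0])
    note f = cv_facts[OF s0, of x]
    have "cv 3 x s \<le> B s"
      using cubic_roots_bound(3)[OF roots_vv[OF s0, of "of_real x", unfolded T.roots_def T.sg_def T.kp_def]]
      unfolding B_def cv_eq[OF s0] .
    also have "\<dots> \<le> K" using K[of s] s by auto
    finally have "ln (cv 3 x s) \<le> ln K" "ln (cv 2 x s) \<le> ln K" using f by (auto intro!: ln_mono)
    thus ?thesis using f(5) j by (auto simp: log_pot_def)
  qed
  thus ?thesis by blast
qed

lemma measurable_log_pot [measurable]: "(\<lambda>s. log_pot j x s) \<in> borel_measurable borel"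
  unfolding log_pot_def kappa_def by measurable

text \<open>Only the factor \<open>s\<close> degenerates at 0; there
  \<open>ln (1 / sqrt s) \<le> 1 / sqrt s - 1\<close> provides an integrable majorant.\<close>

lemma ln_kappa_bound:
  assumes s: "s \<in> {0<..\<xi>}"
  shows "\<bar>ln (kappa s)\<bar> \<le> 2 / sqrt s + (\<xi> + \<bar>ln p\<bar> + \<bar>ln (\<xi> + p)\<bar> + \<bar>ln (p + q)\<bar> + \<bar>ln (\<xi> + p + q)\<bar>)"
proof -
  have s0: "s > 0" "s \<le> \<xi>" using s by auto
  have "ln (kappa s) = ln s + ln (s + p) + ln (s + p + q)"
    unfolding kappa_def using s0 p q by (simp add: ln_mult_pos)
  moreover have "\<bar>ln (s + p)\<bar> \<le> \<bar>ln p\<bar> + \<bar>ln (\<xi> + p)\<bar>"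
    using ln_mono[of p "s + p"] ln_mono[of "s + p" "\<xi> + p"] s0 p by linarith
  moreover have "\<bar>ln (s + p + q)\<bar> \<le> \<bar>ln (p + q)\<bar> + \<bar>ln (\<xi> + p + q)\<bar>"
    using ln_mono[of "p + q" "s + p + q"] ln_mono[of "s + p + q" "\<xi> + p + q"] s0 p q by linarith
  moreover have "\<bar>ln s\<bar> \<le> 2 / sqrt s + \<xi>"
  proof -
    have "ln s \<le> s" using ln_le_minus_one[of s] s0 by linarith
    moreover have "- ln s = 2 * ln (1 / sqrt s)" using s0 by (simp add: ln_div ln_sqrt)
    moreover have "ln (1 / sqrt s) \<le> 1 / sqrt s - 1" using s0 by (intro ln_le_minus_one) simp
    moreover have "2 * (1 / sqrt s) = 2 / sqrt s" "2 / sqrt s \<ge> 0" using s0 by auto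
    ultimately show ?thesis using s0 by linarith
  qed
  ultimately show ?thesis by linarith
qed

lemma integrable_inverse_sqrt: "\<xi> > 0 \<Longrightarrow> set_integrable lborel {0<..\<xi>} (\<lambda>s. 2 / sqrt s)"
proof -
  assume xi: "\<xi> > 0"
  have "((\<lambda>s. 2 / sqrt s) has_integral (4 * sqrt \<xi> - 4 * sqrt 0)) {0..\<xi>}"
  proof (rule fundamental_theorem_of_calculus_interior)
    show "continuous_on {0..\<xi>} (\<lambda>s. 4 * sqrt s)" by (intro continuous_intros)
    fix s assume "s \<in> {0<..<\<xi>}"
    hence s: "s > 0" by simp
    have e: "4 * (inverse (sqrt s) / 2) = 2 / sqrt s" using s by (simp add: field_simps)
    have "DERIV (\<lambda>s. 4 * sqrt s) s :> 2 / sqrt s"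
      by (rule DERIV_cong[OF DERIV_cmult[OF DERIV_real_sqrt[OF s]] e])
    thus "((\<lambda>s. 4 * sqrt s) has_vector_derivative 2 / sqrt s) (at s)"
      by (rule has_real_derivative_iff_has_vector_derivative[THEN iffD1])
  next
    show "0 \<le> \<xi>" using xi by linarith
  qed
  hence I: "(\<integral>\<^sup>+s\<in>{0..\<xi>}. ennreal (2 / sqrt s) \<partial>lborel) = ennreal (4 * sqrt \<xi> - 4 * sqrt 0)"
    by (rule nn_integral_has_integral_lebesgue'[rotated]) simp
  have m: "(\<lambda>s. indicator {0<..\<xi>} s *\<^sub>R (2 / sqrt s)) \<in> borel_measurable lborel" by measurable
  have "(\<integral>\<^sup>+s. ennreal (norm (indicator {0<..\<xi>} s *\<^sub>R (2 / sqrt s))) \<partial>lborel) \<le> (\<integral>\<^sup>+s\<in>{0..\<xi>}. ennreal (2 / sqrt s) \<partial>lborel)"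
  proof (rule nn_integral_mono)
    fix s show "ennreal (norm (indicator {0<..\<xi>} s *\<^sub>R (2 / sqrt s))) \<le> ennreal (2 / sqrt s) * indicator {0..\<xi>} s"
      by (cases "s \<in> {0<..\<xi>}") auto
  qed
  hence "(\<integral>\<^sup>+s. ennreal (norm (indicator {0<..\<xi>} s *\<^sub>R (2 / sqrt s))) \<partial>lborel) < \<infinity>"
    unfolding I by (rule le_less_trans) simp
  with m show ?thesis unfolding set_integrable_def integrable_iff_bounded by (rule conjI)
qed

lemma integrable_dominated:
  assumes "\<xi> > 0" and [measurable]: "f \<in> borel_measurable borel" and "\<And>s. s \<in> {0<..\<xi>} \<Longrightarrow> \<bar>f s\<bar> \<le> \<bar>ln (kappa s)\<bar> + C"
  shows "set_integrable lborel {0<..\<xi>} (f :: real \<Rightarrow> real)"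
proof -
  define D where "D = \<xi> + \<bar>ln p\<bar> + \<bar>ln (\<xi> + p)\<bar> + \<bar>ln (p + q)\<bar> + \<bar>ln (\<xi> + p + q)\<bar> + C"
  have "set_integrable lborel {0<..\<xi>} (\<lambda>s. 2 / sqrt s + D)"
    by (intro set_integral_add integrable_inverse_sqrt assms(1))
      (use assms(1) in \<open>auto simp: set_integrable_def intro!: integrable_real_indicator\<close>)
  thus ?thesis
  proof (rule set_integrable_bound)
    show "set_borel_measurable lborel {0<..\<xi>} f" unfolding set_borel_measurable_def by measurable
    show "AE s in lborel. s \<in> {0<..\<xi>} \<longrightarrow> norm (f s) \<le> norm (2 / sqrt s + D)"
    proof (intro AE_I2 impI)
      fix s assume s: "s \<in> {0<..\<xi>}"
      show "norm (f s) \<le> norm (2 / sqrt s + D)" using assms(3)[OF s] ln_kappa_bound[OF s] unfolding D_def real_norm_def by linarith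
    qed
  qed
qed

lemma integrable_log_pot: "\<xi> > 0 \<Longrightarrow> j \<in> {1, 2} \<Longrightarrow> set_integrable lborel {0<..\<xi>} (log_pot j x)"
proof -
  assume a: "\<xi> > 0" "j \<in> {1, 2}"
  obtain C where C: "\<And>s. s \<in> {0<..\<xi>} \<Longrightarrow> log_pot j x s \<le> C" using log_pot_upper[OF a(1), of x] a(2) by blast
  show ?thesis
  proof (rule integrable_dominated[OF a(1) measurable_log_pot])
    fix s assume s: "s \<in> {0<..\<xi>}"
    show "\<bar>log_pot j x s\<bar> \<le> \<bar>ln (kappa s)\<bar> + \<bar>C\<bar>" using C[OF s] log_pot_lower[of s j x] a(2) s by auto
  qed
qed

lemma integrable_ln_kappa: "\<xi> > 0 \<Longrightarrow> set_integrable lborel {0<..\<xi>} (\<lambda>s. ln (kappa s))"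
  by (rule integrable_dominated[where C = 0]) (auto simp: kappa_def)

end

section \<open>Growth of the supports, and the averaged measures\<close>

context ordered_roots
begin

text \<open>With \<open>X = v + s' - s\<close>, a real root \<open>v\<close> at \<open>s'\<close> makes the cubic at \<open>s\<close> equal to \<open>- y (s' - s)\<close> at \<open>X\<close>.  Its
  only real root at \<open>s\<close> is \<open>- mp y\<close>, so \<open>X\<close> lies on the side of it that identifies \<open>v\<close> with \<open>- mp y\<close> at \<open>s'\<close>.\<close>

lemma modulus_tie_persists:
  assumes s: "0 < s" "s < s'" and j: "j \<in> {1, 2}" and d: "mu_dens j y s \<noteq> 0"
  shows "cv j y s' = cv (j + 1) y s'"
proof (rule ccontr)
  assume ne: "cv j y s' \<noteq> cv (j + 1) y s'"
  have s0: "s' > 0" using s by simp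
  interpret T: three_shifts s "s + p" "s + p + q" by (rule three_shifts[OF s(1)])
  interpret T': three_shifts s' "s' + p" "s' + p + q" by (rule three_shifts[OF s0])
  have rho: "T.rho y \<noteq> 0" and side: "y \<in> (if j = 1 then {0<..} else {..<0})"
    using d s(1) by (auto simp: mu_dens_def indicator_def split: if_splits)
  have y: "y \<noteq> 0" and C: "\<bar>T.CC (T.mp y)\<bar> < 1" using rho by (auto simp: T.rho_def split: if_splits)
  note I = T.interior_roots[OF roots_vv[OF s(1)] y C]
  let ?v = "vv j (of_real y) s'"
  note R' = roots_vv[OF s0, of "of_real y"]
  have eq: "(?v + of_real s') * (?v + of_real (s' + p)) * (?v + of_real (s' + p + q)) = of_real y * ?v"
    using T'.roots_factor[OF R', of ?v] j by auto
  have strict: "cmod (vv 1 (of_real y) s') \<le> cmod (vv 2 (of_real y) s')" "cmod (vv 2 (of_real y) s') \<le> cmod (vv 3 (of_real y) s')"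
    using T'.roots_le[OF R'] by auto
  have ne': "cmod ?v \<noteq> cmod (vv (j + 1) (of_real y) s')" using ne by (simp add: cv_eq s0)
  have "Im ?v = 0"
  proof -
    have "(cnj ?v + of_real s') * (cnj ?v + of_real (s' + p)) * (cnj ?v + of_real (s' + p + q)) - of_real y * cnj ?v = 0"
      using arg_cong[OF eq, of cnj] by simp
    hence "cnj ?v = vv 1 (of_real y) s' \<or> cnj ?v = vv 2 (of_real y) s' \<or> cnj ?v = vv 3 (of_real y) s'"
      unfolding T'.roots_factor[OF R'] by auto
    moreover have A: "cmod (vv i (of_real y) s') = cmod ?v" if "cnj ?v = vv i (of_real y) s'" for i
      using that by (metis complex_mod_cnj)
    moreover have "y < 0 \<Longrightarrow> cmod (vv 1 (of_real y) s') < cmod (vv 2 (of_real y) s')" using T'.mp_strict(2)[OF R'] by blast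
    \<comment> \<open>The conjugate is a root of the same modulus. Were it a different one, there
      would be a tie with the neighbour \<open>j + 1\<close>, or for \<open>j = 2\<close> with the
      strictly smaller root.\<close>
    ultimately have "cnj ?v = ?v"
      using ne' strict j side A[of 1] A[of 2] A[of 3] by (auto simp: numeral_2_eq_2 numeral_3_eq_3 split: if_splits)
    thus ?thesis by (simp add: complex_eq_iff)
  qed
  then obtain v where v: "?v = of_real v" by (metis complex_is_Real_iff Reals_cases)
  define X where "X = v + s' - s"
  have eqv: "(v + s') * (v + (s' + p)) * (v + (s' + p + q)) = y * v"
    using eq unfolding v by (simp flip: of_real_add of_real_mult)
  have "(of_real X - T.vup y) * (of_real X - cnj (T.vup y)) = complex_of_real ((cmod (of_real X - T.vup y))\<^sup>2)"
    using complex_norm_square[of "of_real X - T.vup y"] by simp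
  with I(1)[of "of_real X"] have "complex_of_real ((X + s) * (X + (s + p)) * (X + (s + p + q)) - y * X)
     = of_real ((cmod (of_real X - T.vup y))\<^sup>2 * (X + T.mp y))" by simp
  hence "(X + s) * (X + (s + p)) * (X + (s + p + q)) - y * X = (cmod (of_real X - T.vup y))\<^sup>2 * (X + T.mp y)"
    by (simp only: of_real_eq_iff)
  moreover have "(X + s) * (X + (s + p)) * (X + (s + p + q)) = y * v" unfolding eqv[symmetric] X_def by (simp add: algebra_simps)
  ultimately have key: "- (y * (s' - s)) = (cmod (of_real X - T.vup y))\<^sup>2 * (X + T.mp y)"
    unfolding X_def by (simp add: algebra_simps)
  have pos: "(cmod (of_real X - T.vup y))\<^sup>2 > 0"
  proof -
    have "Im (of_real X - T.vup y) \<noteq> 0" using I(2) by simp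
    hence "of_real X - T.vup y \<noteq> 0" by (metis zero_complex.sel(2))
    thus ?thesis by simp
  qed
  have AR: "T'.AR (- v) = y" if "v < 0"
    using eqv that unfolding T'.AR_def by (simp add: field_simps)
  have cv: "cmod ?v = - v" if "v < 0" unfolding v using that by simp
  show False
  proof (cases "y > 0")
    case True
    hence j1: "j = 1" using side by (auto split: if_splits)
    have "y * (s' - s) > 0" using True s by simp
    hence "X + T.mp y < 0" using key pos by (metis mult_nonneg_nonneg less_imp_le neg_less_0_iff_less not_le)
    \<comment> \<open>So \<open>- v\<close> lies in \<open>Dm\<close> at \<open>s'\<close> and
      \<open>v\<close> is the real root of largest modulus, which the root with index 1 cannot
      be.\<close>
    hence vl: "v < - (s' + p + q)" using T.mp_pos(1)[OF True] unfolding X_def by linarith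
    hence v0: "v < 0" using s0 p q by linarith
    have "- v \<in> T'.Dm" using vl v0 by (auto simp: T'.Dm_def)
    hence "T'.mp y = - v" using T'.mp_AR[of "- v"] AR[OF v0] by simp
    thus False using T'.mp_strict(1)[OF R' True] strict cv[OF v0] j1 by simp
  next
    case False
    hence yn: "y < 0" using y by simp
    hence j2: "j = 2" using side j by (auto split: if_splits)
    have "y * (s' - s) < 0" using yn s by (intro mult_neg_pos) auto
    hence "X + T.mp y > 0" using key pos by (metis neg_0_less_iff_less zero_less_mult_pos)
    \<comment> \<open>So \<open>- v\<close> lies in \<open>Dm\<close> at \<open>s'\<close> and
      \<open>v\<close> is the real root of smallest modulus, strictly below the root with index
      2.\<close>
    hence vl: "v > - s'" using T.mp_pos(2)[OF yn] unfolding X_def by linarith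
    have v0: "v < 0"
    proof (rule ccontr)
      assume "\<not> v < 0"
      hence "y * v \<le> 0" "(v + s') * (v + (s' + p)) * (v + (s' + p + q)) > 0"
        using yn s0 p q by (auto intro!: mult_pos_pos mult_nonpos_nonneg)
      thus False using eqv by linarith
    qed
    have "- v \<in> T'.Dm" using vl v0 by (auto simp: T'.Dm_def)
    hence "T'.mp y = - v" using T'.mp_AR[of "- v"] AR[OF v0] by simp
    thus False using T'.mp_strict(2)[OF R' yn] cv[OF v0] j2 by simp
  qed
qed

lemma continuous_on_cv: "s > 0 \<Longrightarrow> j \<in> {1, 2, 3} \<Longrightarrow> continuous_on UNIV (\<lambda>x. cv j x s)"
  unfolding continuous_on_sequentially
proof (intro allI ballI impI)
  fix X :: "nat \<Rightarrow> real" and x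
  assume s: "s > 0" and j: "j \<in> {1, 2, 3}" and X: "(\<forall>n. X n \<in> UNIV) \<and> X \<longlonglongrightarrow> x"
  show "((\<lambda>x. cv j x s) \<circ> X) \<longlonglongrightarrow> cv j x s"
    unfolding o_def cv_eq[OF s] using X
    by (intro cmod_vv_tendsto[where S = "\<lambda>_. s"] s j tendsto_const tendsto_of_real) auto
qed

context
  fixes \<xi> :: real and j :: nat
  assumes xi: "\<xi> > 0" and j: "j \<in> {1, 2}"
begin

lemma nu_eq_density: "nu z \<xi> j = density lborel (\<lambda>x. ennreal (1 / \<xi>) * (\<integral>\<^sup>+s\<in>{0<..\<xi>}. mu_dens j x s \<partial>lborel))"
  unfolding nu_def by (rule average_eq_density) (use xi j mu_eq_density in auto)

lemma sets_nu: "sets (nu z \<xi> j) = sets borel" unfolding nu_eq_density by simp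

lemma nn_integral_nu:
  "f \<in> borel_measurable borel \<Longrightarrow>
    (\<integral>\<^sup>+x. f x \<partial>nu z \<xi> j) = ennreal (1 / \<xi>) * (\<integral>\<^sup>+s\<in>{0<..\<xi>}. (\<integral>\<^sup>+x. mu_dens j x s * f x \<partial>lborel) \<partial>lborel)"
  unfolding nu_def by (rule nn_integral_average) (use xi j mu_eq_density in auto)

lemma emeasure_nu:
  assumes "A \<in> sets borel"
  shows "emeasure (nu z \<xi> j) A = ennreal (1 / \<xi>) * (\<integral>\<^sup>+s\<in>{0<..\<xi>}. (\<integral>\<^sup>+x. mu_dens j x s * indicator A x \<partial>lborel) \<partial>lborel)"
  using nn_integral_nu[of "indicator A"] assms by (simp add: sets_nu)

lemma emeasure_nu_eq_0:
  assumes "A \<in> sets borel" "\<And>s x. s \<in> {0<..\<xi>} \<Longrightarrow> x \<in> A \<Longrightarrow> mu_dens j x s = 0"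
  shows "emeasure (nu z \<xi> j) A = 0"
proof -
  have "(\<integral>\<^sup>+x. mu_dens j x s * indicator A x \<partial>lborel) * indicator {0<..\<xi>} s = 0" for s
  proof (cases "s \<in> {0<..\<xi>}")
    case True
    hence "mu_dens j x s * indicator A x = 0" for x using assms(2)[OF True, of x] by (cases "x \<in> A") auto
    hence "(\<lambda>x. mu_dens j x s * indicator A x) = (\<lambda>x. 0)" by (intro ext)
    thus ?thesis by (simp only: nn_integral_const mult_zero_left)
  qed simp
  thus ?thesis unfolding emeasure_nu[OF assms(1)] by (simp only: nn_integral_const mult_zero_left mult_zero_right)
qed

lemma nn_integral_mu_dens:
  assumes s: "s > 0" and [measurable]: "f \<in> borel_measurable borel"
  shows "(\<integral>\<^sup>+x. mu_dens j x s * f x \<partial>lborel) = (\<integral>\<^sup>+x. f x \<partial>mu z j s)"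
  unfolding mu_eq_density[OF s j] by (subst nn_integral_density; measurable)

lemma emeasure_nu_UNIV: "emeasure (nu z \<xi> j) UNIV = ennreal (if j = 1 then 1 else 1 / 2)"
proof -
  have "(\<integral>\<^sup>+s\<in>{0<..\<xi>}. (\<integral>\<^sup>+x. mu_dens j x s * indicator UNIV x \<partial>lborel) \<partial>lborel)
     = (\<integral>\<^sup>+s\<in>{0<..\<xi>}. ennreal (if j = 1 then 1 else 1 / 2) \<partial>lborel)"
  proof (rule nn_integral_cong)
    fix s
    show "(\<integral>\<^sup>+x. mu_dens j x s * indicator UNIV x \<partial>lborel) * indicator {0<..\<xi>} s
       = ennreal (if j = 1 then 1 else 1 / 2) * indicator {0<..\<xi>} s"
    proof (cases "s \<in> {0<..\<xi>}")
      case True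
      hence s: "s > 0" by simp
      interpret T: three_shifts s "s + p" "s + p + q" by (rule three_shifts[OF s])
      have "emeasure (mu z j s) UNIV = ennreal (if j = 1 then 1 else 1 / 2)"
        using j mu_eq[OF s] T.emeasure_m1_UNIV T.emeasure_m2_UNIV by auto
      moreover have "(\<integral>\<^sup>+x. mu_dens j x s * indicator UNIV x \<partial>lborel) = emeasure (mu z j s) UNIV"
        using nn_integral_mu_dens[OF s, of "indicator UNIV"] by (simp add: mu_eq_density[OF s j])
      ultimately show ?thesis by simp
    qed simp
  qed
  also have "\<dots> = ennreal (if j = 1 then 1 else 1 / 2) * ennreal \<xi>"
    using xi by (subst nn_integral_cmult) auto
  finally show ?thesis using xi by (subst emeasure_nu) (auto simp: ennreal_mult[symmetric])
qed

lemma finite_nu: "finite_borel_measure (nu z \<xi> j)"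
  using emeasure_nu_UNIV sets_eq_imp_space_eq[OF sets_nu]
  by (auto simp: finite_borel_measure_def finite_borel_measure_axioms_def sets_nu intro!: finite_measureI)

lemma log_int_nu: "log_int (nu z \<xi> j)"
proof -
  \<comment> \<open>From the opposite side of 0 the distance to \<open>y\<close> is exactly
    \<open>1 + |y|\<close>, so the logarithmic moment of each measure is its potential at
    \<open>x0\<close>, already known in closed form.\<close>
  define x0 :: real where "x0 = (if j = 1 then -1 else 1)"
  have L: "(\<integral>\<^sup>+y. mu_dens j y s * ennreal (ln (1 + \<bar>y\<bar>)) \<partial>lborel) = ennreal (log_pot j x0 s)" if s: "s > 0" for s
  proof -
    have ld: "log_dist x0 y = ereal (ln (1 + \<bar>y\<bar>)) \<and> ln (1 + \<bar>y\<bar>) \<ge> 0" if "mu_dens j y s \<noteq> 0" for y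
      using that j unfolding mu_dens_def x0_def log_dist_def by (auto simp: indicator_def algebra_simps split: if_splits)
    have "(\<integral>\<^sup>+y. e2ennreal (log_dist x0 y) \<partial>mu z j s) = (\<integral>\<^sup>+y. mu_dens j y s * ennreal (ln (1 + \<bar>y\<bar>)) \<partial>lborel)"
    proof (subst nn_integral_mu_dens[OF s, symmetric], measurable, intro nn_integral_cong)
      fix y show "mu_dens j y s * e2ennreal (log_dist x0 y) = mu_dens j y s * ennreal (ln (1 + \<bar>y\<bar>))"
        using ld[of y] by (cases "mu_dens j y s = 0") auto
    qed
    moreover have "(\<integral>\<^sup>+y. e2ennreal (- log_dist x0 y) \<partial>mu z j s) = (\<integral>\<^sup>+y. 0 \<partial>(lborel :: real measure))"
    proof (subst nn_integral_mu_dens[OF s, symmetric], measurable, intro nn_integral_cong)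
      fix y show "mu_dens j y s * e2ennreal (- log_dist x0 y) = 0"
        using ld[of y] by (cases "mu_dens j y s = 0") (auto simp: ennreal_neg)
    qed
    ultimately have "enn2ereal (\<integral>\<^sup>+y. mu_dens j y s * ennreal (ln (1 + \<bar>y\<bar>)) \<partial>lborel) = ereal (log_pot j x0 s)"
      using log_potential_mu[OF s j, of x0] by (simp add: log_potential_def eintegral_def zero_ennreal.rep_eq)
    thus ?thesis by (metis e2ennreal_enn2ereal e2ennreal_ereal)
  qed
  have "(\<integral>\<^sup>+y. ennreal (norm (ln (1 + \<bar>y\<bar>))) \<partial>nu z \<xi> j) = ennreal (1 / \<xi>) * (\<integral>\<^sup>+s\<in>{0<..\<xi>}. ennreal (log_pot j x0 s) \<partial>lborel)"
  proof -
    have "(\<integral>\<^sup>+y. mu_dens j y s * ennreal (ln (1 + \<bar>y\<bar>)) \<partial>lborel) * indicator {0<..\<xi>} s = ennreal (log_pot j x0 s) * indicator {0<..\<xi>} s" for s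
      by (cases "s \<in> {0<..\<xi>}") (use L in auto)
    thus ?thesis by (subst nn_integral_nu) auto
  qed
  also have "\<dots> < \<infinity>"
  proof -
    have "(\<integral>\<^sup>+s\<in>{0<..\<xi>}. ennreal (log_pot j x0 s) \<partial>lborel) \<le> (\<integral>\<^sup>+s. ennreal (norm (indicator {0<..\<xi>} s *\<^sub>R log_pot j x0 s)) \<partial>lborel)"
      by (intro nn_integral_mono) (auto simp: indicator_def intro: ennreal_leI)
    also have "\<dots> < \<infinity>" using integrable_log_pot[OF xi j, of x0] unfolding set_integrable_def integrable_iff_bounded by blast
    finally show ?thesis by (simp add: ennreal_mult_less_top)
  qed
  finally show ?thesis unfolding log_int_def integrable_iff_bounded by (simp add: measurable_cong_sets[OF sets_nu refl])
qed

lemma log_potential_nu: "log_potential (nu z \<xi> j) x = ereal (1 / \<xi> * (LINT s:{0<..\<xi>}|lborel. log_pot j x s))"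
  unfolding nu_def
proof (rule log_potential_average)
  show "(\<lambda>(x, s). mu_dens j x s) \<in> borel_measurable (borel \<Otimes>\<^sub>M borel)" by measurable
  show "mu z j s = density lborel (\<lambda>x. mu_dens j x s)" if "s \<in> {0<..\<xi>}" for s using mu_eq_density j that by auto
  show "log_potential (mu z j s) x = ereal (log_pot j x s)" if "s \<in> {0<..\<xi>}" for s using log_potential_mu j that by auto
qed (use xi finite_nu log_int_nu integrable_log_pot[OF xi j] in \<open>auto simp: nu_def\<close>)

text \<open>The bound is independent of \<open>x\<close> and of \<open>j\<close>, as the uniqueness
  theorem requires.\<close>

lemma log_potential_nu_ge: "log_potential (nu z \<xi> j) x \<ge> ereal (- (1 / \<xi> * (LINT s:{0<..\<xi>}|lborel. \<bar>ln (kappa s)\<bar>)))"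
proof -
  have i: "set_integrable lborel {0<..\<xi>} (\<lambda>s. \<bar>ln (kappa s)\<bar>)"
    by (rule integrable_dominated[where C = 0]) (auto simp: xi kappa_def)
  have "(LINT s:{0<..\<xi>}|lborel. - \<bar>ln (kappa s)\<bar>) \<le> (LINT s:{0<..\<xi>}|lborel. log_pot j x s)"
  proof (intro set_integral_mono integrable_log_pot xi j)
    show "set_integrable lborel {0<..\<xi>} (\<lambda>s. - \<bar>ln (kappa s)\<bar>)"
      by (rule integrable_dominated[where C = 0]) (auto simp: xi kappa_def)
    show "- \<bar>ln (kappa s)\<bar> \<le> log_pot j x s" if "s \<in> {0<..\<xi>}" for s using log_pot_lower[OF _ j] that by auto
  qed
  hence "- (LINT s:{0<..\<xi>}|lborel. \<bar>ln (kappa s)\<bar>) \<le> (LINT s:{0<..\<xi>}|lborel. log_pot j x s)"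
    unfolding set_integral_uminus[OF i] .
  hence "1 / \<xi> * - (LINT s:{0<..\<xi>}|lborel. \<bar>ln (kappa s)\<bar>) \<le> 1 / \<xi> * (LINT s:{0<..\<xi>}|lborel. log_pot j x s)"
    using xi by (intro mult_left_mono) auto
  thus ?thesis unfolding log_potential_nu by (simp add: algebra_simps)
qed

end

end

section \<open>The variational conditions\<close>

context ordered_roots
begin

definition gap :: "nat \<Rightarrow> real \<Rightarrow> real \<Rightarrow> real" where "gap j x s = ln (cv (j + 1) x s) - ln (cv j x s)"

lemma measurable_gap: "j \<in> {1, 2} \<Longrightarrow> (\<lambda>w. gap j (fst w) (snd w)) \<in> borel_measurable (borel \<Otimes>\<^sub>M borel)"
  unfolding gap_def by measurable auto

lemma measurable_gap' [measurable (raw)]: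
  assumes "j \<in> {1, 2}" "f \<in> borel_measurable M" "g \<in> borel_measurable M"
  shows "(\<lambda>w. gap j (f w) (g w)) \<in> borel_measurable M"
  using measurable_compose[OF measurable_Pair[OF assms(2,3)] measurable_gap[OF assms(1)]] by simp

lemma potential_V_eq:
  assumes j: "j \<in> {1, 2}"
  shows "potential_V z j x = (\<integral>\<^sup>+s\<in>{0<..}. ennreal (gap j x s) \<partial>lborel)"
  unfolding potential_V_def
proof (rule nn_integral_cong)
  fix s
  show "ennreal (ln (cmod (z j (of_real x) s / z (j + 1) (of_real x) s))) * indicator {0<..} s = ennreal (gap j x s) * indicator {0<..} s"
  proof (cases "s > 0")
    case True
    have v: "cv j x s > 0" "cv (j + 1) x s > 0" using cv_facts(1-3)[OF True, of x] j by (auto simp: numeral_2_eq_2 numeral_3_eq_3)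
    have k: "kappa s > 0" by (rule kappa_pos[OF True])
    have "j \<in> {1, 2, 3}" "j + 1 \<in> {1, 2, 3}" using j by auto
    hence "cmod (z j (of_real x) s / z (j + 1) (of_real x) s) = cv (j + 1) x s / cv j x s"
      using k by (simp add: z_eq[OF True] norm_divide cv_eq[OF True])
    thus ?thesis using v by (simp add: gap_def ln_divide_pos)
  qed simp
qed

lemma measurable_potential_V: "j \<in> {1, 2} \<Longrightarrow> potential_V z j \<in> borel_measurable borel"
proof -
  assume j: "j \<in> {1, 2}"
  have "potential_V z j = (\<lambda>x. \<integral>\<^sup>+s\<in>{0<..}. ennreal (gap j x s) \<partial>lborel)"
    using potential_V_eq[OF j] by (rule ext)
  moreover have "(\<lambda>x. \<integral>\<^sup>+s\<in>{0<..}. ennreal (gap j x s) \<partial>lborel) \<in> borel_measurable borel"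
    using j by measurable
  ultimately show ?thesis by (simp only:)
qed

lemma gap_nonneg: "s > 0 \<Longrightarrow> j \<in> {1, 2} \<Longrightarrow> gap j x s \<ge> 0"
  using cv_facts(1-3)[of s x] by (auto simp: gap_def numeral_2_eq_2 numeral_3_eq_3 intro!: ln_mono)

text \<open>Eliminates the middle modulus by \<open>ln v_1 + ln v_2 + ln v_3 = ln kappa\<close>. The
  term \<open>ln (kappa s)\<close> survives only for \<open>j = 1\<close>; this is the origin of
  \<open>l\<close> in the first condition and of 0 in the second.\<close>

lemma gap_eq_log_pot: "s > 0 \<Longrightarrow> gap 1 x s = 2 * log_pot 1 x s - log_pot 2 x s - ln (kappa s)" "s > 0 \<Longrightarrow> gap 2 x s = 2 * log_pot 2 x s - log_pot 1 x s"
  using cv_facts(5)[of s x] by (auto simp: gap_def log_pot_def numeral_2_eq_2 numeral_3_eq_3)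

lemma variational_function_eq:
  fixes a b l w :: real and V W :: ennreal
  assumes xi: "\<xi> > 0" and V: "V = ennreal w + W" and w: "w = 2 * a - b - l" "w \<ge> 0"
  shows "2 * ereal (1 / \<xi> * a) - ereal (1 / \<xi> * b) - ereal (1 / \<xi>) * enn2ereal V = ereal (1 / \<xi> * l) - ereal (1 / \<xi>) * enn2ereal W"
proof (cases W)
  case (real r)
  hence "V = ennreal (w + r)" unfolding V using w(2) by simp
  thus ?thesis using real w xi by (simp add: enn2ereal_ennreal field_simps)
next
  case top
  thus ?thesis unfolding V using xi by simp
qed

lemma potential_V_split:
  assumes xi: "\<xi> > 0" and j: "j \<in> {1, 2}" and i: "set_integrable lborel {0<..\<xi>} (gap j x)"
  shows "potential_V z j x = ennreal (LINT s:{0<..\<xi>}|lborel. gap j x s) + (\<integral>\<^sup>+s\<in>{\<xi><..}. ennreal (gap j x s) \<partial>lborel)"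
    "(LINT s:{0<..\<xi>}|lborel. gap j x s) \<ge> 0"
proof -
  have un: "{0<..} = {0<..\<xi>} \<union> {\<xi><..}" using xi by auto
  have m: "(\<lambda>s. ennreal (gap j x s)) \<in> borel_measurable lborel" using j by measurable
  have "potential_V z j x = (\<integral>\<^sup>+s\<in>{0<..\<xi>}. ennreal (gap j x s) \<partial>lborel) + (\<integral>\<^sup>+s\<in>{\<xi><..}. ennreal (gap j x s) \<partial>lborel)"
    unfolding potential_V_eq[OF j] un using m by (intro nn_integral_disjoint_pair) auto
  moreover have "(\<integral>\<^sup>+s\<in>{0<..\<xi>}. ennreal (gap j x s) \<partial>lborel) = (\<integral>\<^sup>+s. ennreal (indicator {0<..\<xi>} s *\<^sub>R gap j x s) \<partial>lborel)"
    by (intro nn_integral_cong) (auto simp: indicator_def)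
  moreover have "\<dots> = ennreal (LINT s:{0<..\<xi>}|lborel. gap j x s)"
    unfolding set_lebesgue_integral_def
    by (rule nn_integral_eq_integral) (use i gap_nonneg j in \<open>auto simp: set_integrable_def indicator_def\<close>)
  ultimately show "potential_V z j x = ennreal (LINT s:{0<..\<xi>}|lborel. gap j x s) + (\<integral>\<^sup>+s\<in>{\<xi><..}. ennreal (gap j x s) \<partial>lborel)" by simp
  show "(LINT s:{0<..\<xi>}|lborel. gap j x s) \<ge> 0"
    unfolding set_lebesgue_integral_def by (rule integral_nonneg_AE) (use gap_nonneg j in \<open>auto simp: indicator_def\<close>)
qed

text \<open>Integrates the pointwise identity over \<open>s \<le> \<xi>\<close>, where everything is
  integrable. The part beyond \<open>\<xi>\<close> stays in \<open>ennreal\<close>, since it may be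
  infinite.\<close>

lemma variational_functions:
  assumes xi: "\<xi> > 0"
  defines "l \<equiv> 1 / \<xi> * (LINT s:{0<..\<xi>}|lborel. ln (kappa s))"
  shows "2 * log_potential (nu z \<xi> 1) x - log_potential (nu z \<xi> 2) x - ereal (1 / \<xi>) * enn2ereal (potential_V z 1 x)
      = ereal l - ereal (1 / \<xi>) * enn2ereal (\<integral>\<^sup>+s\<in>{\<xi><..}. ennreal (gap 1 x s) \<partial>lborel)" (is ?A)
    and "2 * log_potential (nu z \<xi> 2) x - log_potential (nu z \<xi> 1) x - ereal (1 / \<xi>) * enn2ereal (potential_V z 2 x)
      = ereal 0 - ereal (1 / \<xi>) * enn2ereal (\<integral>\<^sup>+s\<in>{\<xi><..}. ennreal (gap 2 x s) \<partial>lborel)" (is ?B)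
proof -
  have j: "1 \<in> {1, 2 :: nat}" "2 \<in> {1, 2 :: nat}" by auto
  note iU = integrable_log_pot[OF xi j(1), of x] integrable_log_pot[OF xi j(2), of x] and ik = integrable_ln_kappa[OF xi]
  have i2: "set_integrable lborel {0<..\<xi>} (\<lambda>s. 2 * log_pot k x s)" if "k \<in> {1, 2}" for k
    by (rule set_integrable_mult_right) (rule integrable_log_pot[OF xi that])
  have c1: "indicator {0<..\<xi>} s *\<^sub>R gap 1 x s = indicator {0<..\<xi>} s *\<^sub>R (2 * log_pot 1 x s - log_pot 2 x s - ln (kappa s))" for s
    using gap_eq_log_pot(1)[of s x] by (auto simp: indicator_def)
  have c2: "indicator {0<..\<xi>} s *\<^sub>R gap 2 x s = indicator {0<..\<xi>} s *\<^sub>R (2 * log_pot 2 x s - log_pot 1 x s)" for s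
    using gap_eq_log_pot(2)[of s x] by (auto simp: indicator_def)
  have g1: "set_integrable lborel {0<..\<xi>} (gap 1 x)"
    using set_integral_diff(1)[OF set_integral_diff(1)[OF i2[OF j(1)] iU(2)] ik] unfolding set_integrable_def c1 .
  have g2: "set_integrable lborel {0<..\<xi>} (gap 2 x)"
    using set_integral_diff(1)[OF i2[OF j(2)] iU(1)] unfolding set_integrable_def c2 .
  have G1: "(LINT s:{0<..\<xi>}|lborel. gap 1 x s) = 2 * (LINT s:{0<..\<xi>}|lborel. log_pot 1 x s) - (LINT s:{0<..\<xi>}|lborel. log_pot 2 x s) - (LINT s:{0<..\<xi>}|lborel. ln (kappa s))"
  proof -
    have "(LINT s:{0<..\<xi>}|lborel. gap 1 x s) = (LINT s:{0<..\<xi>}|lborel. 2 * log_pot 1 x s - log_pot 2 x s - ln (kappa s))"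
      unfolding set_lebesgue_integral_def c1 ..
    also have "\<dots> = (LINT s:{0<..\<xi>}|lborel. 2 * log_pot 1 x s - log_pot 2 x s) - (LINT s:{0<..\<xi>}|lborel. ln (kappa s))"
      by (rule set_integral_diff(2)[OF set_integral_diff(1)[OF i2[OF j(1)] iU(2)] ik])
    also have "(LINT s:{0<..\<xi>}|lborel. 2 * log_pot 1 x s - log_pot 2 x s) = (LINT s:{0<..\<xi>}|lborel. 2 * log_pot 1 x s) - (LINT s:{0<..\<xi>}|lborel. log_pot 2 x s)"
      by (rule set_integral_diff(2)[OF i2[OF j(1)] iU(2)])
    finally show ?thesis by simp
  qed
  have G2: "(LINT s:{0<..\<xi>}|lborel. gap 2 x s) = 2 * (LINT s:{0<..\<xi>}|lborel. log_pot 2 x s) - (LINT s:{0<..\<xi>}|lborel. log_pot 1 x s) - 0"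
  proof -
    have "(LINT s:{0<..\<xi>}|lborel. gap 2 x s) = (LINT s:{0<..\<xi>}|lborel. 2 * log_pot 2 x s - log_pot 1 x s)"
      unfolding set_lebesgue_integral_def c2 ..
    also have "\<dots> = (LINT s:{0<..\<xi>}|lborel. 2 * log_pot 2 x s) - (LINT s:{0<..\<xi>}|lborel. log_pot 1 x s)"
      by (rule set_integral_diff(2)[OF i2[OF j(2)] iU(1)])
    finally show ?thesis by simp
  qed
  note V1 = potential_V_split[OF xi j(1) g1] and V2 = potential_V_split[OF xi j(2) g2]
  show ?A unfolding log_potential_nu[OF xi j(1)] log_potential_nu[OF xi j(2)] l_def
    by (rule variational_function_eq[OF xi V1(1) G1 V1(2)])
  show ?B using variational_function_eq[OF xi V2(1) G2 V2(2)]
    unfolding log_potential_nu[OF xi j(1)] log_potential_nu[OF xi j(2)] by (simp only: mult_zero_right)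
qed

text \<open>Persistence of ties speaks of points with nonzero density. For \<open>s > \<xi>\<close>
  the points without a tie at \<open>s\<close> form an open set, which is therefore null for
  \<open>nu z \<xi> j\<close> and misses the support.\<close>

lemma gap_zero_on_supp:
  assumes xi: "\<xi> > 0" and j: "j \<in> {1, 2}" and x: "x \<in> supp (nu z \<xi> j)"
  shows "(\<integral>\<^sup>+s\<in>{\<xi><..}. ennreal (gap j x s) \<partial>lborel) = 0"
proof -
  have "gap j x s = 0" if s: "s > \<xi>" for s
  proof (rule ccontr)
    assume g: "gap j x s \<noteq> 0"
    have s0: "s > 0" using s xi by simp
    let ?U = "{y. cv j y s \<noteq> cv (j + 1) y s}"
    have "open ?U"
      using j by (intro open_Collect_neq continuous_on_cv s0) auto
    moreover have "x \<in> ?U" using g by (auto simp: gap_def)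
    moreover have "emeasure (nu z \<xi> j) ?U = 0"
    proof (rule emeasure_nu_eq_0[OF xi j])
      show "?U \<in> sets borel" using \<open>open ?U\<close> by simp
      fix s' y assume "s' \<in> {0<..\<xi>}" "y \<in> ?U"
      thus "mu_dens j y s' = 0" using modulus_tie_persists[of s' s j y] s j by auto
    qed
    ultimately show False using x unfolding supp_def by auto
  qed
  hence "ennreal (gap j x s) * indicator {\<xi><..} s = 0" for s by (auto simp: indicator_def)
  thus ?thesis by (simp only: nn_integral_const mult_zero_left)
qed

lemma admissible_nu:
  assumes xi: "\<xi> > 0"
  shows "admissible (nu z \<xi> 1, nu z \<xi> 2)"
proof -
  have j: "1 \<in> {1, 2 :: nat}" "2 \<in> {1, 2 :: nat}" by auto
  have z1: "emeasure (nu z \<xi> 1) {..<0} = 0"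
    by (rule emeasure_nu_eq_0[OF xi j(1)]) (auto simp: mu_dens_def)
  have z2: "emeasure (nu z \<xi> 2) {0<..} = 0"
    by (rule emeasure_nu_eq_0[OF xi j(2)]) (auto simp: mu_dens_def)
  have "supp (nu z \<xi> 1) \<subseteq> {0..}"
  proof
    fix x assume x: "x \<in> supp (nu z \<xi> 1)"
    show "x \<in> {0..}"
    proof (rule ccontr)
      assume "x \<notin> {0..}"
      hence "open {..<0::real} \<and> x \<in> {..<0}" by auto
      with x z1 show False unfolding supp_def by (metis (no_types, lifting) mem_Collect_eq less_irrefl)
    qed
  qed
  moreover have "supp (nu z \<xi> 2) \<subseteq> {..0}"
  proof
    fix x assume x: "x \<in> supp (nu z \<xi> 2)"
    show "x \<in> {..0}"
    proof (rule ccontr)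
      assume "x \<notin> {..0}"
      hence "open {0::real<..} \<and> x \<in> {0<..}" by auto
      with x z2 show False unfolding supp_def by (metis (no_types, lifting) mem_Collect_eq less_irrefl)
    qed
  qed
  ultimately show ?thesis
    using sets_nu[OF xi j(1)] sets_nu[OF xi j(2)] emeasure_nu_UNIV[OF xi j(1)] emeasure_nu_UNIV[OF xi j(2)]
    by (simp add: admissible_def)
qed

lemma variational_conditions_nu:
  assumes xi: "\<xi> > 0"
  shows "variational_conditions z \<xi> (1 / \<xi> * (LINT s:{0<..\<xi>}|lborel. ln (kappa s))) (nu z \<xi> 1, nu z \<xi> 2)"
proof -
  have j: "1 \<in> {1, 2 :: nat}" "2 \<in> {1, 2 :: nat}" by auto
  have le: "ereal l - ereal (1 / \<xi>) * enn2ereal W \<le> ereal l" for l and W :: ennreal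
    using xi by (cases W) (auto simp: enn2ereal_ennreal)
  have eq: "ereal l - ereal (1 / \<xi>) * enn2ereal 0 = ereal l" for l by (simp add: zero_ennreal.rep_eq)
  show ?thesis
    unfolding variational_conditions_def Let_def case_prod_conv variational_functions[OF xi]
  proof (intro conjI ballI allI impI)
    fix x
    show "x \<in> supp (nu z \<xi> 1) \<Longrightarrow> ereal (1 / \<xi> * (LINT s:{0<..\<xi>}|lborel. ln (kappa s)))
        - ereal (1 / \<xi>) * enn2ereal (\<integral>\<^sup>+s\<in>{\<xi><..}. ennreal (gap 1 x s) \<partial>lborel) = ereal (1 / \<xi> * (LINT s:{0<..\<xi>}|lborel. ln (kappa s)))"
      by (simp only: gap_zero_on_supp[OF xi j(1)] eq)
    show "x \<in> supp (nu z \<xi> 2) \<Longrightarrow> ereal 0 - ereal (1 / \<xi>) * enn2ereal (\<integral>\<^sup>+s\<in>{\<xi><..}. ennreal (gap 2 x s) \<partial>lborel) = 0"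
      by (simp only: gap_zero_on_supp[OF xi j(2)] eq zero_ereal_def)
    show "ereal 0 - ereal (1 / \<xi>) * enn2ereal (\<integral>\<^sup>+s\<in>{\<xi><..}. ennreal (gap 2 x s) \<partial>lborel) \<le> 0"
      unfolding zero_ereal_def by (rule le)
  qed (rule le)
qed

end

theorem theorem2p4:
  fixes p q \<xi> :: real and z :: "nat \<Rightarrow> complex \<Rightarrow> real \<Rightarrow> complex"
  assumes "p > 0" and "q > 0" and "\<xi> > 0"
    and "ordered_solutions p q z"
  shows "(\<forall>\<nu>. is_arg_min (energy z \<xi>) admissible \<nu> \<longleftrightarrow> \<nu> = (nu z \<xi> 1, nu z \<xi> 2)) \<and>
         (\<forall>\<nu>. admissible \<nu> \<longrightarrow>
            ((\<exists>l. variational_conditions z \<xi> l \<nu>) \<longleftrightarrow> \<nu> = (nu z \<xi> 1, nu z \<xi> 2)))"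
proof -
  interpret ordered_roots p q z using assms by unfold_locales
  note xi = \<open>\<xi> > 0\<close>
  have j: "1 \<in> {1, 2 :: nat}" "2 \<in> {1, 2 :: nat}" by auto
  note * = equilibrium_unique[OF xi measurable_potential_V[OF j(1)] measurable_potential_V[OF j(2)] admissible_nu[OF xi]
      log_int_nu[OF xi j(1)] log_int_nu[OF xi j(2)] log_potential_nu_ge[OF xi j(1)] log_potential_nu_ge[OF xi j(2)]
      variational_conditions_nu[OF xi]]
  show ?thesis using * by blast
qed

end
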